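(* Let $\nu\ge0$ and let $\Xi_0\in L^\infty(\mathbb{T}^2)$ have zero spatial average. Consider, for $\epsilon>0$, the Navier-Stokes ($\nu>0$) or Euler ($\nu=0$) system $$\begin{cases}d\Xi^\epsilon_t+(v^\epsilon_t+u^\epsilon_t)\cdot\nabla\Xi^\epsilon_t\,dt=\nu\Delta\Xi^\epsilon_t\,dt+q^\epsilon_t\,dt,\\ d\xi^\epsilon_t+(v^\epsilon_t+u^\epsilon_t)\cdot\nabla\xi^\epsilon_t\,dt=-\epsilon^{-1}\xi^\epsilon_t\,dt+\epsilon^{-1}\sum_{k\in\mathbb{N}}\varsigma_k\,dW^k_t,\\ v^\epsilon_t=-\nabla^\perp(-\Delta)^{-1}\Xi^\epsilon_t,\qquad u^\epsilon_t=-\nabla^\perp(-\Delta)^{-1}\xi^\epsilon_t,\end{cases}$$ and the limiting large-scale dynamics $$\begin{cases}d\Xi_t+v_t\cdot\nabla\Xi_t\,dt+\sum_{k\in\mathbb{N}}\sigma_k\cdot\nabla\Xi_t\circ dW^k_t=\nu\Delta\Xi_t\,dt+q_t\,dt,\\ v_t=-\nabla^\perp(-\Delta)^{-1}\Xi_t,\end{cases}$$ with $\Xi^\epsilon|_{t=0}=\Xi|_{t=0}=\Xi_0$, $\xi^\epsilon|_{t=0}=0$. Assume: (i) there is $\ell\ge1$ such that $\varsigma_k\in W^{\ell,\infty}(\mathbb{T}^2)$ has zero mean for every $k\in\mathbb{N}$ and $\sum_{k}\|\varsigma_k\|_{W^{\ell,\infty}(\mathbb{T}^2)}<\infty$; (ii)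 $\sum_{k}((K\ast\varsigma_k)\cdot\nabla\varsigma_k)(x)=0$ for every $x\in\mathbb{T}^2$; (iii) $q^\epsilon,q:[0,T]\times\mathbb{T}^2\to\mathbb{R}$ belong to $L^1([0,T],L^\infty(\mathbb{T}^2))$ and, for a constant $C$ independent of $\epsilon>0$, $\int_0^T\|q^\epsilon_s\|_{L^\infty(\mathbb{T}^2)}ds\le C$ and $\int_0^T\|q_s\|_{L^\infty(\mathbb{T}^2)}ds\le C$; (iv) $q^\epsilon-q\to0$ in $L^1([0,T],L^\infty(\mathbb{T}^2))$ as $\epsilon\to0$; (v) there is a constant $C$ such that $|q(t,x)-q(t,y)|\le C\gamma(|x-y|)$ for almost every $t\in[0,T]$ and almost every $x,y\in\mathbb{T}^2$; (vi) $q^\epsilon_t$ and $q_t$ have zero spatial average for almost every $t\in[0,T]$. Then the velocity fields $v^\epsilon,v$ satisfy all of the following: (1) $v^\epsilon,v:\Omega\times[0,T]\times\mathbb{T}^2\to\mathbb{R}^2$, and for every $t\in[0,T]$ their restrictions to $\Omega\times[0,t]\times\mathbb{T}^2$ are $\mathcal{F}_t\otimes\mathcal{B}_{[0,t]}\otimes\mathcal{B}_{\mathbb{T}^2}$-measurable; (2) there are a constant $C$ and a $\mathbb{P}$-negligible set $\mathcal{N}\subset\Omega$ such that for every $\omega\in\mathcal{N}^c$, $\epsilon>0$, $t\in[0,T]$: $\mathrm{div}\,v^\epsilon(\omega,t,\cdot)=\mathrm{div}\,v(\omega,t,\cdot)=0$, and for all $x,y\in\mathbb{T}^2$, $|v^\epsilon(\omega,t,x)|\le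 C$, $|v^\epsilon(\omega,t,x)-v^\epsilon(\omega,t,y)|\le C\gamma(|x-y|)$, $|v(\omega,t,x)|\le C$, $|v(\omega,t,x)-v(\omega,t,y)|\le C\gamma(|x-y|)$; (3) there are a constant $C$, a $\mathbb{P}$-negligible set $\mathcal{N}\subset\Omega$ and numbers $c_\epsilon\in\mathbb{R}$ with $c_\epsilon\to0$ as $\epsilon\to0$ such that for every $\omega\in\mathcal{N}^c$, $\epsilon>0$, $t\in[0,T]$: $$\|v^\epsilon(\omega,t,\cdot)-v(\omega,t,\cdot)\|_{L^1(\mathbb{T}^2,\mathbb{R}^2)}\le C\gamma\Big(\tilde{\mathbb{E}}\big[\|\phi^\epsilon_t-\phi_t\|_{L^1(\mathbb{T}^2,\mathbb{T}^2)}\big]\Big)+C\int_0^t\gamma\Big(\tilde{\mathbb{E}}\big[\|\phi^\epsilon_s-\phi_s\|_{L^1(\mathbb{T}^2,\mathbb{T}^2)}\big]\Big)ds+c_\epsilon,$$ where $\phi^\epsilon$ and $\phi$ are the characteristics associated with $v^\epsilon+u^\epsilon$ and with the limiting dynamics, i.e. the solutions of $$\phi^\epsilon_t(x)=x+\int_0^tv^\epsilon_s(\phi^\epsilon_s(x))ds+\int_0^tu^\epsilon_s(\phi^\epsilon_s(x))ds+\sqrt{2\nu}\,w_t,$$ $$\phi_t(x)=x+\int_0^tv_s(\phi_s(x))ds+\sum_{k\in\mathbb{N}}\int_0^t\sigma_k(\phi_s(x))\circ dW^k_s+\sqrt{2\nu}\,w_t.$$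
   Context: Fix $T>0$. $\mathbb{T}^2=\mathbb{R}^2/(2\pi\mathbb{Z}^2)$, and $|x-y|$ is the geodesic distance between $x,y\in\mathbb{T}^2$; $\mathcal{B}$ denotes Borel sigma-fields. $(\Omega,(\mathcal{F}_t)_{t\in[0,T]},\mathbb{P})$ is a filtered probability space carrying a family $(W^k)_{k\in\mathbb{N}}$ of i.i.d. real standard Wiener processes; $(\tilde\Omega,(\tilde{\mathcal{F}}_t),\tilde{\mathbb{P}})$ is an auxiliary filtered probability space carrying a standard $\mathbb{R}^2$-valued Wiener process $w$; $\tilde{\mathbb{E}}$ is the expectation with respect to $\tilde{\mathbb{P}}$. A set is negligible if it is measurable with probability zero. For $\phi:\mathbb{T}^2\to\mathbb{T}^2$ measurable, $\|\phi\|_{L^1(\mathbb{T}^2,\mathbb{T}^2)}:=\int_{\mathbb{T}^2}|\phi(x)|dx$ (so $\|\phi-\phi'\|_{L^1(\mathbb{T}^2,\mathbb{T}^2)}$ is the integral of the geodesic distance between $\phi(x)$ and $\phi'(x)$). $\gamma:[0,\infty)\to\mathbb{R}$ is $\gamma(r)=r(1-\log r)$ for $0<r<1/e$, $\gamma(r)=r+1/e$ for $r\ge1/e$, and $\gamma(0)=0$. $K=-\nabla^\perp G=(\partial_2G,-\partial_1G)$ is the Biot-Savart kernel, $G$ being the zero-mean Green function of the Laplace operator on $\mathbb{T}^2$, so that $K\ast\xi=-\nabla^\perp(-\Delta)^{-1}\xi$ is the zero-mean divergence-free field with curl $\xi$ for zero-mean $\xi$. Put $\sigma_k=K\ast\varsigma_k$.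 A measurable map $\phi:\Omega\times\tilde\Omega\times[0,T]\times\mathbb{T}^2\to\mathbb{T}^2$ is a stochastic flow of measure-preserving homeomorphisms if there are negligible $\mathcal{N}\subset\Omega$, $\tilde{\mathcal{N}}\subset\tilde\Omega$ such that: for all $\omega\in\mathcal{N}^c,\tilde\omega\in\tilde{\mathcal{N}}^c,t\in[0,T]$ the map $\phi(\omega,\tilde\omega,t,\cdot)$ is a homeomorphism of $\mathbb{T}^2$ preserving Lebesgue measure; and for all $\tilde\omega\in\tilde{\mathcal{N}}^c$, $x\in\mathbb{T}^2$ the process $\phi(\cdot,\tilde\omega,\cdot,x)$ is $(\mathcal{F}_t)$-progressively measurable. It is inviscid if, outside negligible sets, it does not depend on $\tilde\omega$. Equations for flows are required to hold for all $\omega,\tilde\omega$ outside negligible sets and all $t\in[0,T],x\in\mathbb{T}^2$; the Stratonovich integral against $W^k$ is taken on $\Omega$ for fixed $\tilde\omega$. Notion of solution. The second equation of the system is understood in the Lagrangian sense: $\xi^\epsilon:\Omega\times[0,T]\to L^\infty(\mathbb{T}^2)$ is weakly $(\mathcal{F}_t)$-progressively measurable, the equation $\psi^\epsilon_t(x)=x+\int_0^tv^\epsilon_s(\psi^\epsilon_s(x))ds+\int_0^tu^\epsilon_s(\psi^\epsilon_s(x))ds$ with $u^\epsilon=K\ast\xi^\epsilon$ has a unique inviscid stochastic flow of measure-preserving homeomorphisms $\psi^\epsilon$ as solution, and $\xi^\epsilon_t(\psi^\epsilon_t(x))=\epsilon^{-1}\sum_k\int_0^te^{-\epsilon^{-1}(t-s)}\varsigma_k(\psi^\epsilon_s(x))dW^k_s$.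 The large-scale equations are understood in the generalized sense: $\Xi^\epsilon,\Xi:\Omega\times[0,T]\times\mathbb{T}^2\to\mathbb{R}$ are measurable, $v^\epsilon=K\ast\Xi^\epsilon$, $v=K\ast\Xi$, and for every $t\in[0,T]$, as equalities in $L^\infty(\Omega\times\mathbb{T}^2)$, $$\Xi^\epsilon_t=\tilde{\mathbb{E}}\left[\Xi_0\circ(\phi^\epsilon_t)^{-1}+\int_0^tq^\epsilon_s\circ\phi^\epsilon_s\circ(\phi^\epsilon_t)^{-1}ds\right],\qquad \Xi_t=\tilde{\mathbb{E}}\left[\Xi_0\circ(\phi_t)^{-1}+\int_0^tq_s\circ\phi_s\circ(\phi_t)^{-1}ds\right],$$ where $\phi^\epsilon$, $\phi$ are the stochastic flows of measure-preserving homeomorphisms solving the equations of characteristics displayed in the claim. Such solutions are assumed to be given.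
   Formalization: F_0 is assumed to contain all P-negligible sets, and (1)-(3) are claimed for modifications of v^ε, v (at each t almost surely equal, same characteristics), or for v^ε, v themselves if the exceptional sets can be chosen independent of t and ε. *)

theory Defs
  imports "HOL-Probability.Probability"
begin

section \<open>The flat torus\<close>

definition torus_lattice :: "(real \<times> real) set" where
  "torus_lattice = (*\<^sub>R) (2 * pi) ` (\<int> \<times> \<int>)"

lemma torus_lattice_zero: "0 \<in> torus_lattice"
  unfolding torus_lattice_def by (rule image_eqI[where x = 0]) (auto simp: zero_prod_def)

lemma torus_lattice_diff: "x \<in> torus_lattice \<Longrightarrow> y \<in> torus_lattice \<Longrightarrow> x - y \<in> torus_lattice"
  unfolding torus_lattice_def
proof (elim imageE)
  fix a b :: "real \<times> real"
  assume "x = (2 * pi) *\<^sub>R a" "y = (2 * pi) *\<^sub>R b" "a \<in> \<int> \<times> \<int>" "b \<in> \<int> \<times> \<int>"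
  then have "x - y = (2 * pi) *\<^sub>R (a - b)" "a - b \<in> \<int> \<times> \<int>"
    by (auto simp: scaleR_diff_right mem_Times_iff)
  then show "x - y \<in> (*\<^sub>R) (2 * pi) ` (\<int> \<times> \<int>)" by (rule image_eqI)
qed

lemma torus_lattice_uminus: "x \<in> torus_lattice \<Longrightarrow> - x \<in> torus_lattice"
  using torus_lattice_diff[OF torus_lattice_zero] by simp

lemma torus_lattice_add: "x \<in> torus_lattice \<Longrightarrow> y \<in> torus_lattice \<Longrightarrow> x + y \<in> torus_lattice"
  using torus_lattice_diff[OF _ torus_lattice_uminus] by fastforce

lemma closed_torus_lattice: "closed torus_lattice"
  unfolding torus_lattice_def by (intro closed_scaling closed_Times closed_Ints)

quotient_type torus = "real \<times> real" / "\<lambda>x y. x - y \<in> torus_lattice"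
  morphisms rep_torus to_torus
proof (intro equivpI reflpI sympI transpI)
  show "x - x \<in> torus_lattice" for x using torus_lattice_zero by simp
  show "y - x \<in> torus_lattice" if "x - y \<in> torus_lattice" for x y
    using torus_lattice_uminus[OF that] by simp
  show "x - z \<in> torus_lattice" if "x - y \<in> torus_lattice" "y - z \<in> torus_lattice" for x y z
    using torus_lattice_add[OF that] by simp
qed

instantiation torus :: ab_group_add
begin

lift_definition zero_torus :: torus is 0 .

lift_definition plus_torus :: "torus \<Rightarrow> torus \<Rightarrow> torus" is "(+)"
  by (drule (1) torus_lattice_add) (simp add: algebra_simps)

lift_definition uminus_torus :: "torus \<Rightarrow> torus" is uminus
  by (drule torus_lattice_uminus) (simp add: algebra_simps)

lift_definition minus_torus :: "torus \<Rightarrow> torus \<Rightarrow> torus" is "(-)"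
  by (drule (1) torus_lattice_diff) (simp add: algebra_simps)

instance
  by standard (transfer; simp add: torus_lattice_zero algebra_simps)+

end

lemma infdist_torus_lattice_add:
  "infdist (x + y) torus_lattice \<le> infdist x torus_lattice + infdist y torus_lattice"
proof -
  have ne: "torus_lattice \<noteq> {}" using torus_lattice_zero by blast
  obtain a where a: "a \<in> torus_lattice" "infdist x torus_lattice = dist x a"
    using infdist_attains_inf[OF closed_torus_lattice ne] by blast
  obtain b where b: "b \<in> torus_lattice" "infdist y torus_lattice = dist y b"
    using infdist_attains_inf[OF closed_torus_lattice ne] by blast
  have "infdist (x + y) torus_lattice \<le> dist (x + y) (a + b)"
    by (rule infdist_le[OF torus_lattice_add[OF a(1) b(1)]])
  also have "\<dots> \<le> dist x a + dist y b" by (rule dist_triangle_add)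
  finally show ?thesis using a b by simp
qed

lemma infdist_torus_lattice_mono:
  assumes "x - y \<in> torus_lattice"
  shows "infdist x torus_lattice \<le> infdist y torus_lattice"
  using infdist_torus_lattice_add[of "x - y" y] assms by simp

lemma infdist_torus_lattice_cong:
  assumes "x - y \<in> torus_lattice"
  shows "infdist x torus_lattice = infdist y torus_lattice"
  using assms infdist_torus_lattice_mono[OF assms]
    infdist_torus_lattice_mono[of y x] torus_lattice_uminus[OF assms] by simp

lemma infdist_torus_lattice_uminus: "infdist (- x) torus_lattice = infdist x torus_lattice"
proof -
  have le: "infdist (- z) torus_lattice \<le> infdist z torus_lattice" for z
  proof -
    obtain a where a: "a \<in> torus_lattice" "infdist z torus_lattice = dist z a"
      using infdist_attains_inf[OF closed_torus_lattice] torus_lattice_zero by blast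
    have "dist (- z) (- a) = dist z a" by (simp add: dist_norm norm_minus_commute)
    then show ?thesis using infdist_le[OF torus_lattice_uminus[OF a(1)], of "- z"] a by simp
  qed
  show ?thesis using le[of x] le[of "- x"] by simp
qed

text \<open>The distance of the classes of \<^term>\<open>x\<close> and \<^term>\<open>y\<close> is the least Euclidean distance of
  representatives, that is, the geodesic distance of the flat torus.\<close>

instantiation torus :: metric_space
begin

lift_definition dist_torus :: "torus \<Rightarrow> torus \<Rightarrow> real" is "\<lambda>x y. infdist (x - y) torus_lattice"
  by (rule infdist_torus_lattice_cong, drule (1) torus_lattice_diff) (simp add: algebra_simps)

definition uniformity_torus :: "(torus \<times> torus) filter" where
  "uniformity_torus = (INF e\<in>{0<..}. principal {(x, y). dist x y < e})"

definition open_torus :: "torus set \<Rightarrow> bool" where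
  "open_torus U = (\<forall>x\<in>U. \<forall>\<^sub>F (x', y) in uniformity. x' = x \<longrightarrow> y \<in> U)"

instance
proof
  show "dist x y = 0 \<longleftrightarrow> x = y" for x y :: torus
    by transfer (use in_closed_iff_infdist_zero[OF closed_torus_lattice] torus_lattice_zero in blast)
  show "dist x y \<le> dist x z + dist y z" for x y z :: torus
  proof transfer
    fix x y z :: "real \<times> real"
    show "infdist (x - y) torus_lattice
        \<le> infdist (x - z) torus_lattice + infdist (y - z) torus_lattice"
      using infdist_torus_lattice_add[of "x - z" "z - y"]
        infdist_torus_lattice_uminus[of "y - z"] by simp
  qed
qed (simp_all add: uniformity_torus_def open_torus_def)

end

text \<open>Lebesgue measure, of total mass \<open>4 \<pi>\<^sup>2\<close> (not normalised).\<close>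

definition torus_lebesgue :: "torus measure" where
  "torus_lebesgue = distr (restrict_space lborel ({0..<2 * pi} \<times> {0..<2 * pi})) borel to_torus"


section \<open>Function spaces on the torus\<close>

definition Linf_norm :: "(torus \<Rightarrow> real) \<Rightarrow> ennreal" where
  "Linf_norm f = esssup torus_lebesgue (\<lambda>x. ennreal \<bar>f x\<bar>)"

definition Linf :: "(torus \<Rightarrow> real) set" where
  "Linf = {f \<in> borel_measurable borel. Linf_norm f < \<infinity>}"

definition zero_mean :: "(torus \<Rightarrow> real) \<Rightarrow> bool" where
  "zero_mean f \<longleftrightarrow> integrable torus_lebesgue f \<and> (\<integral>x. f x \<partial>torus_lebesgue) = 0"

definition pd1 :: "(torus \<Rightarrow> real) \<Rightarrow> torus \<Rightarrow> real" where
  "pd1 f x = deriv (\<lambda>h. f (x + to_torus (h, 0))) 0"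

definition pd2 :: "(torus \<Rightarrow> real) \<Rightarrow> torus \<Rightarrow> real" where
  "pd2 f x = deriv (\<lambda>h. f (x + to_torus (0, h))) 0"

primrec C_class :: "nat \<Rightarrow> (torus \<Rightarrow> real) \<Rightarrow> bool" where
  "C_class 0 f \<longleftrightarrow> continuous_on UNIV f"
| "C_class (Suc n) f \<longleftrightarrow> continuous_on UNIV f \<and>
     (\<forall>x. (\<lambda>h. f (x + to_torus (h, 0))) field_differentiable at 0 \<and>
          (\<lambda>h. f (x + to_torus (0, h))) field_differentiable at 0) \<and>
     C_class n (pd1 f) \<and> C_class n (pd2 f)"

definition smooth :: "(torus \<Rightarrow> real) \<Rightarrow> bool" where
  "smooth f \<longleftrightarrow> (\<forall>n. C_class n f)"

text \<open>\<open>g\<close> is the distributional derivative \<open>\<partial>\<^sub>1\<^sup>a \<partial>\<^sub>2\<^sup>b f\<close>.\<close>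

definition has_weak_deriv :: "(torus \<Rightarrow> real) \<Rightarrow> nat \<Rightarrow> nat \<Rightarrow> (torus \<Rightarrow> real) \<Rightarrow> bool" where
  "has_weak_deriv f a b g \<longleftrightarrow> (\<forall>\<theta>. smooth \<theta> \<longrightarrow>
     (\<integral>x. f x * (pd1 ^^ a) ((pd2 ^^ b) \<theta>) x \<partial>torus_lebesgue)
       = (- 1) ^ (a + b) * (\<integral>x. g x * \<theta> x \<partial>torus_lebesgue))"

definition weak_deriv :: "(torus \<Rightarrow> real) \<Rightarrow> nat \<Rightarrow> nat \<Rightarrow> torus \<Rightarrow> real" where
  "weak_deriv f a b = (SOME g. g \<in> Linf \<and> has_weak_deriv f a b g)"

definition sobolev_inf :: "nat \<Rightarrow> (torus \<Rightarrow> real) set" where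
  "sobolev_inf l = {f \<in> Linf. \<forall>a b. a + b \<le> l \<longrightarrow> (\<exists>g \<in> Linf. has_weak_deriv f a b g)}"

definition sobolev_inf_norm :: "nat \<Rightarrow> (torus \<Rightarrow> real) \<Rightarrow> ennreal" where
  "sobolev_inf_norm l f = (\<Sum>(a, b) \<in> {(a, b). a + b \<le> l}. Linf_norm (weak_deriv f a b))"

text \<open>Distributional sense, since the velocity fields are only log-Lipschitz.\<close>

definition div_free :: "(torus \<Rightarrow> real \<times> real) \<Rightarrow> bool" where
  "div_free b \<longleftrightarrow> integrable torus_lebesgue b \<and>
     (\<forall>\<theta>. smooth \<theta> \<longrightarrow> (\<integral>x. b x \<bullet> (pd1 \<theta> x, pd2 \<theta> x) \<partial>torus_lebesgue) = 0)"

text \<open>\<open>- \<Delta> G = \<delta>\<^sub>0 - 1 / (4 \<pi>\<^sup>2)\<close> in the sense of distributions; of the representatives of \<open>G\<close>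
  the one that is continuous off the pole is taken. The sign is the one for which
  \<open>G * \<xi> = (-\<Delta>)\<^sup>-\<^sup>1 \<xi>\<close>.\<close>

definition green_function :: "(torus \<Rightarrow> real) \<Rightarrow> bool" where
  "green_function G \<longleftrightarrow> zero_mean G \<and> continuous_on (- {0}) G \<and>
     (\<forall>\<theta>. smooth \<theta> \<longrightarrow>
        (\<integral>x. G x * (- (pd1 (pd1 \<theta>) x + pd2 (pd2 \<theta>) x)) \<partial>torus_lebesgue)
          = \<theta> 0 - (\<integral>x. \<theta> x \<partial>torus_lebesgue) / (4 * pi\<^sup>2))"

text \<open>The value at \<open>0\<close> is unspecified and irrelevant for convolutions.\<close>

definition biot_savart_kernel :: "(torus \<Rightarrow> real) \<Rightarrow> torus \<Rightarrow> real \<times> real" where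
  "biot_savart_kernel G x = (pd2 G x, - pd1 G x)"

definition biot_savart :: "(torus \<Rightarrow> real) \<Rightarrow> (torus \<Rightarrow> real) \<Rightarrow> torus \<Rightarrow> real \<times> real" where
  "biot_savart G \<xi> x = (\<integral>y. \<xi> y *\<^sub>R biot_savart_kernel G (x - y) \<partial>torus_lebesgue)"

definition velocity ::
  "(torus \<Rightarrow> real) \<Rightarrow> ('w \<Rightarrow> real \<Rightarrow> torus \<Rightarrow> real) \<Rightarrow> 'w \<Rightarrow> real \<Rightarrow> torus \<Rightarrow> real \<times> real" where
  "velocity G \<Xi> \<omega> t = biot_savart G (\<Xi> \<omega> t)"

definition log_modulus :: "real \<Rightarrow> real" where
  "log_modulus r = (if r \<le> 0 then 0
     else if r < 1 / exp 1 then r * (1 - ln r) else r + 1 / exp 1)"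


section \<open>Processes\<close>

definition filtered_prob_space :: "'w measure \<Rightarrow> (real \<Rightarrow> 'w measure) \<Rightarrow> real \<Rightarrow> bool" where
  "filtered_prob_space P F T \<longleftrightarrow> prob_space P \<and> (\<forall>t\<in>{0..T}. subalgebra P (F t)) \<and>
     (\<forall>s\<in>{0..T}. \<forall>t\<in>{0..T}. s \<le> t \<longrightarrow> sets (F s) \<subseteq> sets (F t))"

definition progressive ::
  "(real \<Rightarrow> 'w measure) \<Rightarrow> real \<Rightarrow> ('w \<Rightarrow> real \<Rightarrow> 'b::topological_space) \<Rightarrow> bool" where
  "progressive F T X \<longleftrightarrow> (\<forall>t\<in>{0..T}.
     (\<lambda>(\<omega>, s). X \<omega> s) \<in> borel_measurable (F t \<Otimes>\<^sub>M restrict_space borel {0..t}))"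

text \<open>A standard Wiener process relative to the filtration: increments over \<open>[s, t]\<close> are
  independent of \<open>F s\<close> and have law \<open>N(0, (t - s) I)\<close>.\<close>

definition wiener_process ::
  "'w measure \<Rightarrow> (real \<Rightarrow> 'w measure) \<Rightarrow> real \<Rightarrow> ('w \<Rightarrow> real \<Rightarrow> 'b::euclidean_space) \<Rightarrow> bool" where
  "wiener_process P F T W \<longleftrightarrow>
     (\<forall>t\<in>{0..T}. (\<lambda>\<omega>. W \<omega> t) \<in> borel_measurable (F t)) \<and>
     (AE \<omega> in P. W \<omega> 0 = 0 \<and> continuous_on {0..T} (W \<omega>)) \<and>
     (\<forall>s t. 0 \<le> s \<and> s < t \<and> t \<le> T \<longrightarrow>
        distributed P lborel (\<lambda>\<omega>. W \<omega> t - W \<omega> s)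
          (\<lambda>z. ennreal (\<Prod>b\<in>Basis. normal_density 0 (sqrt (t - s)) (z \<bullet> b))) \<and>
        prob_space.indep_set P (sets (F s))
          {(\<lambda>\<omega>. W \<omega> t - W \<omega> s) -` A \<inter> space P | A. A \<in> sets borel})"

definition wiener_family ::
  "'w measure \<Rightarrow> (real \<Rightarrow> 'w measure) \<Rightarrow> real \<Rightarrow> (nat \<Rightarrow> 'w \<Rightarrow> real \<Rightarrow> real) \<Rightarrow> bool" where
  "wiener_family P F T W \<longleftrightarrow> (\<forall>k. wiener_process P F T (W k)) \<and>
     prob_space.indep_vars P (\<lambda>_. \<Pi>\<^sub>M t\<in>{0..T}. borel) (\<lambda>k \<omega>. \<lambda>t\<in>{0..T}. W k \<omega> t) UNIV"

definition conv_in_prob ::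
  "'w measure \<Rightarrow> (nat \<Rightarrow> 'w \<Rightarrow> 'b::euclidean_space) \<Rightarrow> ('w \<Rightarrow> 'b) \<Rightarrow> bool" where
  "conv_in_prob P X Y \<longleftrightarrow> (\<forall>n. X n \<in> borel_measurable P) \<and> Y \<in> borel_measurable P \<and>
     (\<forall>e>0. (\<lambda>n. measure P {\<omega> \<in> space P. e < dist (X n \<omega>) (Y \<omega>)}) \<longlonglongrightarrow> 0)"

definition continuous_version ::
  "'w measure \<Rightarrow> real \<Rightarrow> ('w \<Rightarrow> real \<Rightarrow> 'b::euclidean_space) \<Rightarrow> bool" where
  "continuous_version P T X \<longleftrightarrow> (\<forall>t\<in>{0..T}. (\<lambda>\<omega>. X \<omega> t) \<in> borel_measurable P) \<and>
     (AE \<omega> in P. continuous_on {0..T} (X \<omega>))"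


section \<open>Stochastic integrals\<close>

definition time_partition :: "real \<Rightarrow> nat \<Rightarrow> (nat \<Rightarrow> real) \<Rightarrow> bool" where
  "time_partition T n p \<longleftrightarrow> p 0 = 0 \<and> p n = T \<and> (\<forall>i<n. p i \<le> p (Suc i))"

definition step_coefficients ::
  "'w measure \<Rightarrow> (real \<Rightarrow> 'w measure) \<Rightarrow> nat \<Rightarrow> (nat \<Rightarrow> real) \<Rightarrow> (nat \<Rightarrow> 'w \<Rightarrow> 'b::euclidean_space) \<Rightarrow> bool" where
  "step_coefficients P F n p \<eta> \<longleftrightarrow>
     (\<forall>i<n. \<eta> i \<in> borel_measurable (F (p i)) \<and> (\<exists>B. \<forall>\<omega>\<in>space P. norm (\<eta> i \<omega>) \<le> B))"

definition step_process ::
  "nat \<Rightarrow> (nat \<Rightarrow> real) \<Rightarrow> (nat \<Rightarrow> 'w \<Rightarrow> 'b::euclidean_space) \<Rightarrow> 'w \<Rightarrow> real \<Rightarrow> 'b" where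
  "step_process n p \<eta> \<omega> s = (\<Sum>i<n. indicator {p i<..p (Suc i)} s *\<^sub>R \<eta> i \<omega>)"

definition step_integral ::
  "('w \<Rightarrow> real \<Rightarrow> real) \<Rightarrow> nat \<Rightarrow> (nat \<Rightarrow> real) \<Rightarrow> (nat \<Rightarrow> 'w \<Rightarrow> 'b::euclidean_space) \<Rightarrow> 'w \<Rightarrow> real \<Rightarrow> 'b" where
  "step_integral W n p \<eta> \<omega> t =
     (\<Sum>i<n. (W \<omega> (min (p (Suc i)) t) - W \<omega> (min (p i) t)) *\<^sub>R \<eta> i \<omega>)"

text \<open>\<open>I\<close> is a continuous version of the Ito integral \<open>t \<mapsto> \<integral>\<^sub>0\<^sup>t H\<^sub>s dW\<^sub>s\<close> on \<open>[0, T]\<close>, defined for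
  \<open>H\<close> in \<open>L\<^sup>2(\<Omega> \<times> [0, T])\<close> by the isometry. Finiteness of the \<open>L\<^sup>2\<close> norm of \<open>H\<close> is implied
  by the approximation.\<close>

definition ito_integral ::
  "'w measure \<Rightarrow> (real \<Rightarrow> 'w measure) \<Rightarrow> real \<Rightarrow> ('w \<Rightarrow> real \<Rightarrow> real) \<Rightarrow>
    ('w \<Rightarrow> real \<Rightarrow> 'b::euclidean_space) \<Rightarrow> ('w \<Rightarrow> real \<Rightarrow> 'b) \<Rightarrow> bool" where
  "ito_integral P F T W H I \<longleftrightarrow> progressive F T H \<and> continuous_version P T I \<and>
     (\<exists>n p \<eta>. (\<forall>j. time_partition T (n j) (p j) \<and> step_coefficients P F (n j) (p j) (\<eta> j)) \<and>
        (\<lambda>j. \<integral>\<^sup>+\<omega>. (\<integral>\<^sup>+s\<in>{0..T}.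
           ennreal ((norm (step_process (n j) (p j) (\<eta> j) \<omega> s - H \<omega> s))\<^sup>2) \<partial>lborel) \<partial>P) \<longlonglongrightarrow> 0 \<and>
        (\<forall>t\<in>{0..T}. (\<lambda>j. \<integral>\<^sup>+\<omega>.
           ennreal ((norm (step_integral W (n j) (p j) (\<eta> j) \<omega> t - I \<omega> t))\<^sup>2) \<partial>P) \<longlonglongrightarrow> 0))"

definition covariation ::
  "'w measure \<Rightarrow> real \<Rightarrow> ('w \<Rightarrow> real \<Rightarrow> real) \<Rightarrow>
    ('w \<Rightarrow> real \<Rightarrow> 'b::euclidean_space) \<Rightarrow> ('w \<Rightarrow> real \<Rightarrow> 'b) \<Rightarrow> bool" where
  "covariation P T W H A \<longleftrightarrow> continuous_version P T A \<and>
     (\<forall>n p. (\<forall>j. time_partition T (n j) (p j)) \<and>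
        (\<forall>\<delta>>0. \<forall>\<^sub>F j in sequentially. \<forall>i<n j. p j (Suc i) - p j i < \<delta>) \<longrightarrow>
        (\<forall>t\<in>{0..T}. conv_in_prob P
           (\<lambda>j \<omega>. \<Sum>i<n j. (W \<omega> (min (p j (Suc i)) t) - W \<omega> (min (p j i) t)) *\<^sub>R
              (H \<omega> (min (p j (Suc i)) t) - H \<omega> (min (p j i) t)))
           (\<lambda>\<omega>. A \<omega> t)))"

text \<open>\<open>\<integral>\<^sub>0\<^sup>t H \<circ> dW = \<integral>\<^sub>0\<^sup>t H dW + 1/2 [H, W]\<^sub>t\<close>, up to indistinguishability. The integrand is not
  required to be a semimartingale, only to have a covariation with \<open>W\<close>.\<close>

definition stratonovich_integral ::
  "'w measure \<Rightarrow> (real \<Rightarrow> 'w measure) \<Rightarrow> real \<Rightarrow> ('w \<Rightarrow> real \<Rightarrow> real) \<Rightarrow>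
    ('w \<Rightarrow> real \<Rightarrow> 'b::euclidean_space) \<Rightarrow> ('w \<Rightarrow> real \<Rightarrow> 'b) \<Rightarrow> bool" where
  "stratonovich_integral P F T W H S \<longleftrightarrow> continuous_version P T S \<and>
     (\<exists>I A. ito_integral P F T W H I \<and> covariation P T W H A \<and>
        (AE \<omega> in P. \<forall>t\<in>{0..T}. S \<omega> t = I \<omega> t + (1 / 2) *\<^sub>R A \<omega> t))"

text \<open>\<open>S\<^sub>t = \<Sum>\<^sub>k \<integral>\<^sub>0\<^sup>t H\<^sup>k \<circ> dW\<^sup>k\<close>.\<close>

definition stratonovich_series ::
  "'w measure \<Rightarrow> (real \<Rightarrow> 'w measure) \<Rightarrow> real \<Rightarrow> (nat \<Rightarrow> 'w \<Rightarrow> real \<Rightarrow> real) \<Rightarrow>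
    (nat \<Rightarrow> 'w \<Rightarrow> real \<Rightarrow> 'b::euclidean_space) \<Rightarrow> ('w \<Rightarrow> real \<Rightarrow> 'b) \<Rightarrow> bool" where
  "stratonovich_series P F T W H S \<longleftrightarrow> continuous_version P T S \<and>
     (\<exists>J. (\<forall>k. stratonovich_integral P F T (W k) (H k) (J k)) \<and>
        (\<forall>t\<in>{0..T}. conv_in_prob P (\<lambda>n \<omega>. \<Sum>k<n. J k \<omega> t) (\<lambda>\<omega>. S \<omega> t)))"

text \<open>\<open>X = \<Sum>\<^sub>k \<integral>\<^sub>0\<^sup>t H\<^sup>k dW\<^sup>k\<close> for one fixed \<open>t\<close>, so that \<open>H\<close> may depend on \<open>t\<close>.\<close>

definition ito_series_at ::
  "'w measure \<Rightarrow> (real \<Rightarrow> 'w measure) \<Rightarrow> real \<Rightarrow> (nat \<Rightarrow> 'w \<Rightarrow> real \<Rightarrow> real) \<Rightarrow>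
    (nat \<Rightarrow> 'w \<Rightarrow> real \<Rightarrow> 'b::euclidean_space) \<Rightarrow> ('w \<Rightarrow> 'b) \<Rightarrow> bool" where
  "ito_series_at P F t W H X \<longleftrightarrow>
     (\<exists>J. (\<forall>k. ito_integral P F t (W k) (H k) (J k)) \<and>
        conv_in_prob P (\<lambda>n \<omega>. \<Sum>k<n. J k \<omega> t) X)"


section \<open>Stochastic flows and their equations\<close>

type_synonym ('w, 'v) torus_flow = "'w \<Rightarrow> 'v \<Rightarrow> real \<Rightarrow> torus \<Rightarrow> torus"

definition mp_homeo :: "(torus \<Rightarrow> torus) \<Rightarrow> bool" where
  "mp_homeo f \<longleftrightarrow> (\<exists>g. homeomorphism UNIV UNIV f g) \<and> distr torus_lebesgue borel f = torus_lebesgue"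

definition stochastic_flow ::
  "'w measure \<Rightarrow> (real \<Rightarrow> 'w measure) \<Rightarrow> 'v measure \<Rightarrow> real \<Rightarrow> ('w, 'v) torus_flow \<Rightarrow> bool" where
  "stochastic_flow P F P' T \<phi> \<longleftrightarrow>
     (\<lambda>(\<omega>, \<omega>', t, x). \<phi> \<omega> \<omega>' t x)
       \<in> borel_measurable (P \<Otimes>\<^sub>M P' \<Otimes>\<^sub>M restrict_space borel {0..T} \<Otimes>\<^sub>M borel) \<and>
     (\<exists>N\<in>null_sets P. \<exists>N'\<in>null_sets P'.
        (\<forall>\<omega>\<in>space P - N. \<forall>\<omega>'\<in>space P' - N'. \<forall>t\<in>{0..T}. mp_homeo (\<phi> \<omega> \<omega>' t)) \<and>
        (\<forall>\<omega>'\<in>space P' - N'. \<forall>x. progressive F T (\<lambda>\<omega> t. \<phi> \<omega> \<omega>' t x)))"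

definition inviscid :: "'w measure \<Rightarrow> 'v measure \<Rightarrow> real \<Rightarrow> ('w, 'v) torus_flow \<Rightarrow> bool" where
  "inviscid P P' T \<phi> \<longleftrightarrow> (\<exists>N\<in>null_sets P. \<exists>N'\<in>null_sets P'.
     \<forall>\<omega>\<in>space P - N. \<forall>\<omega>'\<in>space P' - N'. \<forall>\<omega>''\<in>space P' - N'. \<forall>t\<in>{0..T}. \<forall>x.
       \<phi> \<omega> \<omega>' t x = \<phi> \<omega> \<omega>'' t x)"

definition indistinguishable ::
  "'w measure \<Rightarrow> 'v measure \<Rightarrow> real \<Rightarrow> ('w, 'v) torus_flow \<Rightarrow> ('w, 'v) torus_flow \<Rightarrow> bool" where
  "indistinguishable P P' T \<phi> \<psi> \<longleftrightarrow> (\<exists>N\<in>null_sets P. \<exists>N'\<in>null_sets P'.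
     \<forall>\<omega>\<in>space P - N. \<forall>\<omega>'\<in>space P' - N'. \<forall>t\<in>{0..T}. \<forall>x. \<phi> \<omega> \<omega>' t x = \<psi> \<omega> \<omega>' t x)"

text \<open>\<open>\<phi>\<^sub>t(x) = x + \<integral>\<^sub>0\<^sup>t v\<^sub>s(\<phi>\<^sub>s(x)) ds + \<integral>\<^sub>0\<^sup>t u\<^sub>s(\<phi>\<^sub>s(x)) ds + z\<^sub>t\<close> on the torus, with the displacement
  in the plane.\<close>

definition random_characteristics ::
  "'w measure \<Rightarrow> 'v measure \<Rightarrow> real \<Rightarrow> ('w \<Rightarrow> real \<Rightarrow> torus \<Rightarrow> real \<times> real) \<Rightarrow>
    ('w \<Rightarrow> real \<Rightarrow> torus \<Rightarrow> real \<times> real) \<Rightarrow> ('v \<Rightarrow> real \<Rightarrow> real \<times> real) \<Rightarrow> ('w, 'v) torus_flow \<Rightarrow> bool" where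
  "random_characteristics P P' T v u z \<phi> \<longleftrightarrow> (\<exists>N\<in>null_sets P. \<exists>N'\<in>null_sets P'.
     \<forall>\<omega>\<in>space P - N. \<forall>\<omega>'\<in>space P' - N'. \<forall>x.
       set_integrable lborel {0..T} (\<lambda>s. v \<omega> s (\<phi> \<omega> \<omega>' s x)) \<and>
       set_integrable lborel {0..T} (\<lambda>s. u \<omega> s (\<phi> \<omega> \<omega>' s x)) \<and>
       (\<forall>t\<in>{0..T}. \<phi> \<omega> \<omega>' t x = x + to_torus
          ((LBINT s:{0..t}. v \<omega> s (\<phi> \<omega> \<omega>' s x)) + (LBINT s:{0..t}. u \<omega> s (\<phi> \<omega> \<omega>' s x)) + z \<omega>' t)))"

text \<open>\<open>\<phi>\<^sub>t(x) = x + \<integral>\<^sub>0\<^sup>t v\<^sub>s(\<phi>\<^sub>s(x)) ds + \<Sum>\<^sub>k \<integral>\<^sub>0\<^sup>t \<sigma>\<^sub>k(\<phi>\<^sub>s(x)) \<circ> dW\<^sup>k\<^sub>s + z\<^sub>t\<close>. The stochastic integral is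
  determined, for each \<open>\<omega>'\<close> and \<open>x\<close>, only up to a null set of \<open>\<omega>\<close>; for the equation to hold off
  a common null set, a version \<open>S\<close> is chosen that is continuous in time off that set.\<close>

definition stratonovich_characteristics ::
  "'w measure \<Rightarrow> (real \<Rightarrow> 'w measure) \<Rightarrow> 'v measure \<Rightarrow> real \<Rightarrow> (nat \<Rightarrow> 'w \<Rightarrow> real \<Rightarrow> real) \<Rightarrow>
    ('w \<Rightarrow> real \<Rightarrow> torus \<Rightarrow> real \<times> real) \<Rightarrow> (nat \<Rightarrow> torus \<Rightarrow> real \<times> real) \<Rightarrow>
    ('v \<Rightarrow> real \<Rightarrow> real \<times> real) \<Rightarrow> ('w, 'v) torus_flow \<Rightarrow> bool" where
  "stratonovich_characteristics P F P' T W v \<sigma> z \<phi> \<longleftrightarrow>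
     (\<exists>N\<in>null_sets P. \<exists>N'\<in>null_sets P'. \<exists>S.
        (\<forall>\<omega>'\<in>space P' - N'. \<forall>x.
           stratonovich_series P F T W (\<lambda>k \<omega> s. \<sigma> k (\<phi> \<omega> \<omega>' s x)) (\<lambda>\<omega> t. S \<omega> \<omega>' t x)) \<and>
        (\<forall>\<omega>\<in>space P - N. \<forall>\<omega>'\<in>space P' - N'. \<forall>x.
           continuous_on {0..T} (\<lambda>t. S \<omega> \<omega>' t x) \<and>
           set_integrable lborel {0..T} (\<lambda>s. v \<omega> s (\<phi> \<omega> \<omega>' s x)) \<and>
           (\<forall>t\<in>{0..T}. \<phi> \<omega> \<omega>' t x = x + to_torus
              ((LBINT s:{0..t}. v \<omega> s (\<phi> \<omega> \<omega>' s x)) + S \<omega> \<omega>' t x + z \<omega>' t))))"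


section \<open>Notions of solution\<close>

text \<open>Elements of \<open>L\<^sup>\<infinity>\<close> are given by representatives; the weak topology is tested against
  \<open>L\<^sup>1\<close>.\<close>

definition weakly_progressive ::
  "'w measure \<Rightarrow> (real \<Rightarrow> 'w measure) \<Rightarrow> real \<Rightarrow> ('w \<Rightarrow> real \<Rightarrow> torus \<Rightarrow> real) \<Rightarrow> bool" where
  "weakly_progressive P F T \<xi> \<longleftrightarrow> (\<forall>\<omega>\<in>space P. \<forall>t\<in>{0..T}. \<xi> \<omega> t \<in> Linf) \<and>
     (\<forall>f. integrable torus_lebesgue f \<longrightarrow>
        progressive F T (\<lambda>\<omega> t. \<integral>x. \<xi> \<omega> t x * f x \<partial>torus_lebesgue))"

text \<open>In the last clause the identity
  \<open>\<xi>\<^sub>t(\<psi>\<^sub>t(x)) = \<epsilon>\<^sup>-\<^sup>1 \<Sum>\<^sub>k \<integral>\<^sub>0\<^sup>t exp(- (t - s) / \<epsilon>) \<zeta>\<^sub>k(\<psi>\<^sub>s(x)) dW\<^sup>k\<^sub>s\<close> is one of \<open>L\<^sup>\<infinity>\<close>-valued random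
  variables: \<open>R\<close> is a jointly measurable version of the right-hand side.\<close>

definition small_scale_solution ::
  "'w measure \<Rightarrow> (real \<Rightarrow> 'w measure) \<Rightarrow> 'v measure \<Rightarrow> real \<Rightarrow> (nat \<Rightarrow> 'w \<Rightarrow> real \<Rightarrow> real) \<Rightarrow>
    (torus \<Rightarrow> real) \<Rightarrow> (nat \<Rightarrow> torus \<Rightarrow> real) \<Rightarrow> real \<Rightarrow> ('w \<Rightarrow> real \<Rightarrow> torus \<Rightarrow> real \<times> real) \<Rightarrow>
    ('w \<Rightarrow> real \<Rightarrow> torus \<Rightarrow> real) \<Rightarrow> ('w, 'v) torus_flow \<Rightarrow> bool" where
  "small_scale_solution P F P' T W G \<zeta> \<epsilon> v \<xi> \<psi> \<longleftrightarrow>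
     weakly_progressive P F T \<xi> \<and>
     stochastic_flow P F P' T \<psi> \<and> inviscid P P' T \<psi> \<and>
     random_characteristics P P' T v (velocity G \<xi>) (\<lambda>_ _. 0) \<psi> \<and>
     (\<forall>\<psi>'. stochastic_flow P F P' T \<psi>' \<and> inviscid P P' T \<psi>' \<and>
        random_characteristics P P' T v (velocity G \<xi>) (\<lambda>_ _. 0) \<psi>' \<longrightarrow>
        indistinguishable P P' T \<psi> \<psi>') \<and>
     (\<exists>N'\<in>null_sets P'. \<forall>\<omega>'\<in>space P' - N'. \<forall>t\<in>{0..T}. \<exists>R.
        (\<lambda>(\<omega>, x). R \<omega> x) \<in> borel_measurable (P \<Otimes>\<^sub>M borel) \<and>
        (AE \<omega> in P. AE x in torus_lebesgue. \<xi> \<omega> t (\<psi> \<omega> \<omega>' t x) = R \<omega> x) \<and>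
        (AE x in torus_lebesgue. ito_series_at P F t W
           (\<lambda>k \<omega> s. inverse \<epsilon> * exp (- inverse \<epsilon> * (t - s)) * \<zeta> k (\<psi> \<omega> \<omega>' s x)) (\<lambda>\<omega>. R \<omega> x)))"

text \<open>\<open>\<E>'[\<Xi>\<^sub>0 \<circ> \<phi>\<^sub>t\<^sup>-\<^sup>1 + \<integral>\<^sub>0\<^sup>t q\<^sub>s \<circ> \<phi>\<^sub>s \<circ> \<phi>\<^sub>t\<^sup>-\<^sup>1 ds]\<close>. The completion of \<^term>\<open>P'\<close> is used because nothing
  is known about the measurability of the integrand on the exceptional null set of the flow.\<close>

definition transported_vorticity ::
  "'v measure \<Rightarrow> (torus \<Rightarrow> real) \<Rightarrow> (real \<Rightarrow> torus \<Rightarrow> real) \<Rightarrow> ('w, 'v) torus_flow \<Rightarrow>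
    'w \<Rightarrow> real \<Rightarrow> torus \<Rightarrow> real" where
  "transported_vorticity P' \<Xi>0 q \<phi> \<omega> t x = (\<integral>\<omega>'.
     \<Xi>0 (inv (\<phi> \<omega> \<omega>' t) x) + (LBINT s:{0..t}. q s (\<phi> \<omega> \<omega>' s (inv (\<phi> \<omega> \<omega>' t) x)))
     \<partial>completion P')"

definition generalized_solution ::
  "'w measure \<Rightarrow> 'v measure \<Rightarrow> real \<Rightarrow> (torus \<Rightarrow> real) \<Rightarrow> (real \<Rightarrow> torus \<Rightarrow> real) \<Rightarrow>
    ('w, 'v) torus_flow \<Rightarrow> ('w \<Rightarrow> real \<Rightarrow> torus \<Rightarrow> real) \<Rightarrow> bool" where
  "generalized_solution P P' T \<Xi>0 q \<phi> \<Xi> \<longleftrightarrow>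
     (\<lambda>(\<omega>, t, x). \<Xi> \<omega> t x) \<in> borel_measurable (P \<Otimes>\<^sub>M restrict_space borel {0..T} \<Otimes>\<^sub>M borel) \<and>
     (\<forall>t\<in>{0..T}. AE (\<omega>, x) in P \<Otimes>\<^sub>M torus_lebesgue.
        \<Xi> \<omega> t x = transported_vorticity P' \<Xi>0 q \<phi> \<omega> t x)"


section \<open>The asserted properties of the velocity fields\<close>

definition progressive_field ::
  "(real \<Rightarrow> 'w measure) \<Rightarrow> real \<Rightarrow> ('w \<Rightarrow> real \<Rightarrow> torus \<Rightarrow> real \<times> real) \<Rightarrow> bool" where
  "progressive_field F T v \<longleftrightarrow> (\<forall>t\<in>{0..T}.
     (\<lambda>(\<omega>, s, x). v \<omega> s x) \<in> borel_measurable (F t \<Otimes>\<^sub>M restrict_space borel {0..t} \<Otimes>\<^sub>M borel))"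

definition log_lipschitz_bounded :: "real \<Rightarrow> (torus \<Rightarrow> real \<times> real) \<Rightarrow> bool" where
  "log_lipschitz_bounded C b \<longleftrightarrow>
     (\<forall>x. norm (b x) \<le> C) \<and> (\<forall>x y. norm (b x - b y) \<le> C * log_modulus (dist x y))"

definition mean_flow_distance ::
  "'v measure \<Rightarrow> ('w, 'v) torus_flow \<Rightarrow> ('w, 'v) torus_flow \<Rightarrow> 'w \<Rightarrow> real \<Rightarrow> real" where
  "mean_flow_distance P' \<phi> \<psi> \<omega> t =
     (\<integral>\<omega>'. (\<integral>x. dist (\<phi> \<omega> \<omega>' t x) (\<psi> \<omega> \<omega>' t x) \<partial>torus_lebesgue) \<partial>P')"

definition velocity_properties ::
  "'w measure \<Rightarrow> (real \<Rightarrow> 'w measure) \<Rightarrow> 'v measure \<Rightarrow> real \<Rightarrow>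
    (real \<Rightarrow> ('w, 'v) torus_flow) \<Rightarrow> ('w, 'v) torus_flow \<Rightarrow>
    (real \<Rightarrow> 'w \<Rightarrow> real \<Rightarrow> torus \<Rightarrow> real \<times> real) \<Rightarrow> ('w \<Rightarrow> real \<Rightarrow> torus \<Rightarrow> real \<times> real) \<Rightarrow> bool" where
  "velocity_properties P F P' T \<phi>e \<phi> ve v \<longleftrightarrow>
     ((\<forall>\<epsilon>>0. progressive_field F T (ve \<epsilon>)) \<and> progressive_field F T v) \<and>
     (\<exists>C. \<exists>N\<in>null_sets P. \<forall>\<omega>\<in>space P - N. \<forall>\<epsilon>>0. \<forall>t\<in>{0..T}.
        div_free (ve \<epsilon> \<omega> t) \<and> div_free (v \<omega> t) \<and>
        log_lipschitz_bounded C (ve \<epsilon> \<omega> t) \<and> log_lipschitz_bounded C (v \<omega> t)) \<and>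
     (\<exists>C. \<exists>N\<in>null_sets P. \<exists>c :: real \<Rightarrow> real. (c \<longlongrightarrow> 0) (at_right 0) \<and>
        (\<forall>\<omega>\<in>space P - N. \<forall>\<epsilon>>0. \<forall>t\<in>{0..T}.
           (\<integral>x. norm (ve \<epsilon> \<omega> t x - v \<omega> t x) \<partial>torus_lebesgue)
             \<le> C * log_modulus (mean_flow_distance P' (\<phi>e \<epsilon>) \<phi> \<omega> t)
               + C * (LBINT s:{0..t}. log_modulus (mean_flow_distance P' (\<phi>e \<epsilon>) \<phi> \<omega> s))
               + c \<epsilon>))"

definition modification ::
  "'w measure \<Rightarrow> real \<Rightarrow> ('w \<Rightarrow> real \<Rightarrow> torus \<Rightarrow> real \<times> real) \<Rightarrow>
    ('w \<Rightarrow> real \<Rightarrow> torus \<Rightarrow> real \<times> real) \<Rightarrow> bool" where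
  "modification P T v v' \<longleftrightarrow> (\<forall>t\<in>{0..T}. AE \<omega> in P. \<forall>x. v \<omega> t x = v' \<omega> t x)"

text \<open>The exceptional null sets of the flows and of the vorticity identities are allowed to depend
  on \<open>\<epsilon>\<close> and, for the latter, on \<open>t\<close>. The following says that one null set serves for all.\<close>

definition common_null_set ::
  "'w measure \<Rightarrow> 'v measure \<Rightarrow> real \<Rightarrow> (torus \<Rightarrow> real) \<Rightarrow>
    (real \<Rightarrow> real \<Rightarrow> torus \<Rightarrow> real) \<Rightarrow> (real \<Rightarrow> torus \<Rightarrow> real) \<Rightarrow>
    (real \<Rightarrow> ('w, 'v) torus_flow) \<Rightarrow> ('w, 'v) torus_flow \<Rightarrow>
    (real \<Rightarrow> 'w \<Rightarrow> real \<Rightarrow> torus \<Rightarrow> real) \<Rightarrow> ('w \<Rightarrow> real \<Rightarrow> torus \<Rightarrow> real) \<Rightarrow> bool" where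
  "common_null_set P P' T \<Xi>0 qe q \<phi>e \<phi> \<Xi>e \<Xi> \<longleftrightarrow> (\<exists>N\<in>null_sets P.
     (\<forall>\<epsilon>>0. \<exists>N'\<in>null_sets P'. \<forall>\<omega>\<in>space P - N. \<forall>\<omega>'\<in>space P' - N'. \<forall>t\<in>{0..T}.
        mp_homeo (\<phi>e \<epsilon> \<omega> \<omega>' t)) \<and>
     (\<forall>\<omega>\<in>space P - N. \<forall>t\<in>{0..T}.
        (\<forall>\<epsilon>>0. AE x in torus_lebesgue.
           \<Xi>e \<epsilon> \<omega> t x = transported_vorticity P' \<Xi>0 (qe \<epsilon>) (\<phi>e \<epsilon>) \<omega> t x) \<and>
        (AE x in torus_lebesgue. \<Xi> \<omega> t x = transported_vorticity P' \<Xi>0 q \<phi> \<omega> t x)))"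

end

(* Let Theta_t be the vorticity carried by a particle: its initial vorticity plus the source
   collected along its path up to time t. Averaging over the auxiliary randomness and changing
   variables by the measure-preserving flow, the velocity becomes the Lagrangian integral
   V_t(x) of Theta_t(z) K(x - phi_t(z)) over the auxiliary space and z in the torus. Only phi
   itself enters this formula, not its inverse, so V is defined for all t off one null set,
   is continuous in (t, x) and is adapted; hence it is progressive and is the required
   modification. Everything else follows from one property of the kernel: the L1-norm of
   K(x - .) - K(x' - .) is at most a constant times gamma(|x - x'|). It gives the modulus of
   continuity of V, and, for two flows, the L1-distance of the velocities in terms of
   gamma of the distance of the particles; the modulus of the source enters through the
   difference of the Thetas. As gamma is concave, Jensen's inequality pulls the mean inside.

   The kernel estimate needs the singularity of K. The Green function is identified, by its
   Fourier coefficients, with an explicit one: summing the modes in one variable leaves the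
   logarithm of |1 - exp(-z)| plus a smooth series over the images, so K is 1/|z| up to a
   Lipschitz term. *)
theory Submission
 imports Defs
begin

text \<open>Three obstacles shape the argument. The Green function is given only by a distributional
  equation and continuity off the pole, so nothing pointwise is known of K before it is identified
  with a formula. The flow is adapted only for each fixed auxiliary point and jointly measurable
  only for the full sigma-field, so Fubini does not show that a mean over the auxiliary space is
  adapted; conditional expectations do. And the estimates must hold off one null set for uncountably
  many \<epsilon>, while each \<epsilon> brings its own exceptional set: there the
  \<epsilon>-velocity is redefined as the limit velocity, which keeps every bound and makes the
  difference vanish. The source, moreover, has its modulus only for almost all pairs of points, and
  the joint law of two particles may be singular. The modulus is therefore first upgraded to all
  pairs off a null set of single points, a set which each particle avoids almost surely.\<close>

section \<open>The flat torus: lattice, metric, topology\<close>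

lemma torus_lattice_iff: "z \<in> torus_lattice \<longleftrightarrow> (\<exists>(m::int) (n::int). z = (2 * pi * m, 2 * pi * n))"
proof
 assume "z \<in> torus_lattice"
 then obtain a where "a \<in> \<int> \<times> \<int>" "z = (2 * pi) *\<^sub>R a" unfolding torus_lattice_def by auto
 then show "\<exists>(m::int) (n::int). z = (2 * pi * m, 2 * pi * n)"
  by (cases a) (auto elim!: Ints_cases)
next
 assume "\<exists>(m::int) (n::int). z = (2 * pi * m, 2 * pi * n)"
 then obtain m n :: int where "z = (2 * pi * m, 2 * pi * n)" by auto
 then have "z = (2 * pi) *\<^sub>R (of_int m, of_int n)" by simp
 then show "z \<in> torus_lattice" unfolding torus_lattice_def
  by (auto intro!: image_eqI[where x = "(of_int m, of_int n)"])
qed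

lemma to_torus_eq_iff: "to_torus x = to_torus y \<longleftrightarrow> x - y \<in> torus_lattice"
 by (rule torus.abs_eq_iff)

lemma to_torus_add: "to_torus (x + y) = to_torus x + to_torus y"
 by (simp add: plus_torus.abs_eq)

lemma to_torus_diff: "to_torus (x - y) = to_torus x - to_torus y"
 by (simp add: minus_torus.abs_eq)

lemma to_torus_uminus: "to_torus (- x) = - to_torus x"
 by (simp add: uminus_torus.abs_eq)

lemma to_torus_0: "to_torus 0 = 0"
 by (simp add: zero_torus_def)

lemma to_torus_rep: "to_torus (rep_torus p) = p"
 by (rule Quotient3_abs_rep[OF Quotient3_torus])

lemma to_torus_periodic:
 "to_torus (x + 2 * pi * of_int m, y + 2 * pi * of_int n) = to_torus (x, y)"
 unfolding to_torus_eq_iff torus_lattice_iff by auto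

lemma dist_to_torus: "dist (to_torus x) (to_torus y) = infdist (x - y) torus_lattice"
 by (rule dist_torus.abs_eq)

lemma dist_to_torus_le: "dist (to_torus x) (to_torus y) \<le> dist x y"
 using infdist_le[OF torus_lattice_zero, of "x - y"] by (simp add: dist_to_torus dist_norm)

lemma dist_torus_add_right: "dist (p + c) (q + c) = dist p (q :: torus)"
 by transfer simp

lemma dist_torus_uminus: "dist (- p) (- q) = dist p (q :: torus)"
 by transfer (metis infdist_torus_lattice_uminus minus_diff_eq minus_diff_minus)

lemma dist_torus_diff: "dist p (q :: torus) = dist (p - q) 0"
 using dist_torus_add_right[of p "- q" q] by simp

text \<open>The lattice is closed, so the infimum in the distance is attained. Kernel estimates can
  thus be made in the plane with a displacement of exactly the geodesic length.\<close>

lemma torus_shortest_rep: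
 obtains h where "to_torus h = p" "norm h = dist p 0"
proof -
 obtain a where a: "a \<in> torus_lattice" "infdist (rep_torus p) torus_lattice = dist (rep_torus p) a"
  using infdist_attains_inf[OF closed_torus_lattice] torus_lattice_zero by blast
 have "to_torus (rep_torus p - a) = p"
  using a(1) to_torus_eq_iff[of a 0] to_torus_rep[of p] by (simp add: to_torus_diff to_torus_0)
 moreover have "norm (rep_torus p - a) = dist p 0"
  using dist_to_torus[of "rep_torus p" 0] a(2) by (simp add: to_torus_rep to_torus_0 dist_norm)
 ultimately show thesis by (rule that)
qed

lemma continuous_to_torus: "continuous_on A to_torus"
 unfolding continuous_on_iff using dist_to_torus_le by (meson le_less_trans)

lemma continuous_on_to_torus[continuous_intros]:
 "continuous_on A f ==> continuous_on A (\<lambda>x. to_torus (f x))"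
 by (rule continuous_on_compose2[OF continuous_to_torus[of UNIV]]) auto

text \<open>\<open>to_torus\<close> does not increase distances, and by
  \<open>torus_shortest_rep\<close> every point of the image ball has a lift in the planar ball.
  Openness of the projection rests on this, and with it second countability and the descent of
  continuity.\<close>

lemma to_torus_ball: "to_torus ` ball x e = ball (to_torus x) e"
proof
 show "to_torus ` ball x e \<subseteq> ball (to_torus x) e"
  by (rule image_subsetI) (use le_less_trans[OF dist_to_torus_le] in \<open>simp only: mem_ball\<close>)
 show "ball (to_torus x) e \<subseteq> to_torus ` ball x e"
 proof
  fix q assume q: "q \<in> ball (to_torus x) e"
  obtain h where h: "to_torus h = to_torus x - q" "norm h = dist (to_torus x - q) 0"
   by (rule torus_shortest_rep)
  have "to_torus (x - h) = q" using h(1) by (simp add: to_torus_diff)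
  moreover have "dist x (x - h) < e" using q h(2) dist_torus_diff[of "to_torus x" q]
   by (simp add: dist_norm)
  ultimately show "q \<in> to_torus ` ball x e" by (auto intro!: image_eqI[where x = "x - h"])
 qed
qed

lemma open_to_torus: "open U ==> open (to_torus ` U)"
 unfolding open_contains_ball
proof
 fix p assume U: "\<forall>x\<in>U. \<exists>e>0. ball x e \<subseteq> U" and "p \<in> to_torus ` U"
 then obtain x where x: "x \<in> U" "p = to_torus x" by blast
 obtain e where "e > 0" "ball x e \<subseteq> U" using U x(1) by blast
 then show "\<exists>e>0. ball p e \<subseteq> to_torus ` U"
  unfolding x(2) to_torus_ball[symmetric] by blast
qed

lemma surj_to_torus: "range to_torus = UNIV"
 using to_torus_rep by (metis surjI)

text \<open>An open continuous surjection carries a countable basis to a countable basis. Second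
  countability is what makes pairs of measurable torus-valued maps measurable.\<close>

instance torus :: second_countable_topology
proof
 obtain B :: "(real \<times> real) set set" where B: "countable B" "topological_basis B"
  using ex_countable_basis by blast
 have "topological_basis ((`) to_torus ` B)"
 proof (rule topological_basisI)
  fix U assume "U \<in> (`) to_torus ` B"
  then show "open U" using B(2) open_to_torus topological_basis_open by auto
 next
  fix U :: "torus set" and p assume U: "open U" "p \<in> U"
  have "open (to_torus -` U)"
   using continuous_to_torus[of UNIV] U(1) by (simp add: continuous_on_open_vimage)
  moreover have "rep_torus p \<in> to_torus -` U" using U(2) by (simp add: to_torus_rep)
  ultimately obtain V where V: "V \<in> B" "rep_torus p \<in> V" "V \<subseteq> to_torus -` U"
   using topological_basisE[OF B(2)] by metis
  have 1: "p \<in> to_torus ` V" using imageI[OF V(2), of to_torus] by (simp add: to_torus_rep)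
  have 2: "to_torus ` V \<subseteq> U" using V(3) by blast
  show "\<exists>B'\<in>(`) to_torus ` B. p \<in> B' \<and> B' \<subseteq> U"
   by (rule bexI[of _ "to_torus ` V"], rule conjI[OF 1 2], rule imageI[OF V(1)])
 qed
 then show "\<exists>B :: torus set set. countable B \<and> open = generate_topology B"
  using B(1) topological_basis_imp_subbasis by blast
qed

text \<open>The metric is translation invariant, so addition is jointly continuous. Measurability of
  \<open>x - p\<close> in both arguments comes from here.\<close>

instance torus :: topological_ab_group_add
proof
 fix a b :: torus
 have "dist (x + y) (a + b) \<le> dist x a + dist y b" for x y
  using dist_triangle[of "x + y" "a + b" "a + y"] dist_torus_add_right[of x y a]
   dist_torus_add_right[of y a b] by (simp add: add.commute)
 then show "((\<lambda>x. fst x + snd x) \<longlongrightarrow> a + b) (nhds a \<times>\<^sub>F nhds b)"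
  unfolding tendsto_iff
 proof (intro allI impI)
  fix e :: real assume e: "e > 0"
  and le: "\<And>x y. dist (x + y) (a + b) \<le> dist x a + dist y b"
  have "\<forall>\<^sub>F x in nhds a. dist x a < e / 2" "\<forall>\<^sub>F x in nhds b. dist x b < e / 2"
   using e by (auto intro!: eventually_nhds_metric[THEN iffD2] exI[of _ "e / 2"])
  then have "\<forall>\<^sub>F x in nhds a \<times>\<^sub>F nhds b. dist (fst x) a < e / 2 \<and> dist (snd x) b < e / 2"
   by (auto simp: eventually_prod_filter split: prod.splits)
  then show "\<forall>\<^sub>F x in nhds a \<times>\<^sub>F nhds b. dist (fst x + snd x) (a + b) < e"
   by eventually_elim (use le in \<open>fastforce intro: le_less_trans\<close>)
 qed
 show "(uminus \<longlongrightarrow> - a) (nhds a)"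
  unfolding tendsto_iff dist_torus_uminus
  by (auto intro!: eventually_nhds_metric[THEN iffD2])
qed

lemma period_reduce:
 obtains k :: int and r where "x = r + 2 * pi * k" "0 \<le> r" "r < 2 * pi"
proof -
 have "0 \<le> x - \<lfloor>x / (2 * pi)\<rfloor> * (2 * pi)" "x - \<lfloor>x / (2 * pi)\<rfloor> * (2 * pi) < 2 * pi"
  using floor_divide_lower[of "2 * pi" x] floor_divide_upper[of "2 * pi" x]
  by (auto simp: algebra_simps)
 then show thesis by (intro that[of "x - \<lfloor>x / (2 * pi)\<rfloor> * (2 * pi)" "\<lfloor>x / (2 * pi)\<rfloor>"]) auto
qed

lemma compact_torus: "compact (UNIV :: torus set)"
proof -
 have "UNIV = to_torus ` ({0..2 * pi} \<times> {0..2 * pi})"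
 proof (intro equalityI subsetI UNIV_I)
  fix p :: torus
  obtain x y where xy: "rep_torus p = (x, y)" by fastforce
  obtain m :: int and r where r: "x = r + 2 * pi * m" "0 \<le> r" "r < 2 * pi"
   by (rule period_reduce)
  obtain n :: int and s where s: "y = s + 2 * pi * n" "0 \<le> s" "s < 2 * pi"
   by (rule period_reduce)
  have "p = to_torus (r, s)"
   using to_torus_periodic[of r m s n] xy to_torus_rep[of p] r(1) s(1) by simp
  with r s show "p \<in> to_torus ` ({0..2 * pi} \<times> {0..2 * pi})" by auto
 qed
 then show ?thesis
  by (metis compact_Icc compact_Times compact_continuous_image continuous_to_torus)
qed

lemma bounded_torus: "bounded (A :: torus set)"
 using compact_imp_bounded[OF compact_torus] bounded_subset by blast

section \<open>Lebesgue measure on the torus\<close>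

lemma measurable_to_torus[measurable]: "to_torus \<in> borel_measurable borel"
 by (intro borel_measurable_continuous_onI continuous_to_torus)

lemma sets_torus_lebesgue[measurable_cong, simp]: "sets torus_lebesgue = sets borel"
 by (simp add: torus_lebesgue_def)

lemma space_torus_lebesgue[simp]: "space torus_lebesgue = UNIV"
 by (simp add: torus_lebesgue_def)

abbreviation square :: "real => real => (real \<times> real) set" where
 "square a b \<equiv> {a..<a + 2 * pi} \<times> {b..<b + 2 * pi}"

lemma measurable_to_torus_restrict[measurable]:
 "to_torus \<in> borel_measurable (restrict_space lborel A)"
 by (rule measurable_restrict_space1) simp

lemma square_sets[measurable]: "square a b \<in> sets borel"
 by (intro borel_Times) auto

lemma nn_integral_torus_lebesgue:
 assumes [measurable]: "f \<in> borel_measurable borel"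
 shows "(\<integral>\<^sup>+p. f p \<partial>torus_lebesgue) = (\<integral>\<^sup>+z. f (to_torus z) * indicator (square 0 0) z \<partial>lborel)"
proof -
 have "(\<integral>\<^sup>+p. f p \<partial>torus_lebesgue) = (\<integral>\<^sup>+z. f (to_torus z) \<partial>restrict_space lborel (square 0 0))"
  unfolding torus_lebesgue_def by (subst nn_integral_distr) auto
 also have "\<dots> = (\<integral>\<^sup>+z. f (to_torus z) * indicator (square 0 0) z \<partial>lborel)"
  by (rule nn_integral_restrict_space) (use square_sets[of 0 0] in simp)
 finally show ?thesis .
qed

text \<open>The starting point is reduced modulo the period; the part of
  \<open>[r, r + 2 pi)\<close> beyond \<open>2 pi\<close> is then shifted back to
  \<open>[0, r)\<close>.\<close>

lemma nn_integral_period: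
 fixes f :: "real => ennreal"
 assumes [measurable]: "f \<in> borel_measurable borel" and per: "\<And>x. f (x + 2 * pi) = f x"
 shows "(\<integral>\<^sup>+x. f x * indicator {a..<a + 2 * pi} x \<partial>lborel)
  = (\<integral>\<^sup>+x. f x * indicator {0..<2 * pi} x \<partial>lborel)"
proof -
 have pern: "f (x + 2 * pi * of_nat n) = f x" for x n
 proof (induction n)
  case (Suc n)
  then show ?case using per[of "x + 2 * pi * of_nat n"] by (simp add: algebra_simps)
 qed simp
 have perk: "f (x + 2 * pi * of_int k) = f x" for x k
 proof (cases "k \<ge> 0")
  case True
  then show ?thesis using pern[of x "nat k"] by simp
 next
  case False
  then show ?thesis using pern[of "x + 2 * pi * of_int k" "nat (- k)"] by simp
 qed
 have shift: "(\<integral>\<^sup>+x. f x * indicator {c + 2 * pi * of_int k..<d + 2 * pi * of_int k} x \<partial>lborel)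
   = (\<integral>\<^sup>+x. f x * indicator {c..<d} x \<partial>lborel)" for c d and k :: int
 proof -
  have "(\<integral>\<^sup>+x. f x * indicator {c + 2 * pi * of_int k..<d + 2 * pi * of_int k} x \<partial>lborel)
   = (\<integral>\<^sup>+x. f (2 * pi * of_int k + 1 * x)
     * indicator {c + 2 * pi * of_int k..<d + 2 * pi * of_int k} (2 * pi * of_int k + 1 * x) \<partial>lborel)"
   by (subst nn_integral_real_affine[where c = 1 and t = "2 * pi * of_int k"]) auto
  also have "\<dots> = (\<integral>\<^sup>+x. f x * indicator {c..<d} x \<partial>lborel)"
   by (intro nn_integral_cong) (auto simp: perk add.commute[of "2 * pi * of_int k"] split: split_indicator)
  finally show ?thesis .
 qed
 obtain k :: int and r where kr: "a = r + 2 * pi * k" and r: "0 \<le> r" "r < 2 * pi"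
  by (rule period_reduce)
 have "(\<integral>\<^sup>+x. f x * indicator {a..<a + 2 * pi} x \<partial>lborel)
   = (\<integral>\<^sup>+x. f x * indicator {r..<r + 2 * pi} x \<partial>lborel)"
  using shift[of r k "r + 2 * pi"] by (simp add: kr algebra_simps)
 also have "\<dots> = (\<integral>\<^sup>+x. f x * indicator {r..<2 * pi} x + f x * indicator {2 * pi..<r + 2 * pi} x \<partial>lborel)"
  using r by (intro nn_integral_cong) (auto split: split_indicator)
 also have "\<dots> = (\<integral>\<^sup>+x. f x * indicator {r..<2 * pi} x \<partial>lborel)
   + (\<integral>\<^sup>+x. f x * indicator {2 * pi..<r + 2 * pi} x \<partial>lborel)"
  by (rule nn_integral_add) auto
 also have "(\<integral>\<^sup>+x. f x * indicator {2 * pi..<r + 2 * pi} x \<partial>lborel)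
   = (\<integral>\<^sup>+x. f x * indicator {0..<r} x \<partial>lborel)"
  using shift[of 0 1 r] by simp
 also have "(\<integral>\<^sup>+x. f x * indicator {r..<2 * pi} x \<partial>lborel) + (\<integral>\<^sup>+x. f x * indicator {0..<r} x \<partial>lborel)
   = (\<integral>\<^sup>+x. f x * indicator {r..<2 * pi} x + f x * indicator {0..<r} x \<partial>lborel)"
  by (rule nn_integral_add[symmetric]) auto
 also have "\<dots> = (\<integral>\<^sup>+x. f x * indicator {0..<2 * pi} x \<partial>lborel)"
  using r by (intro nn_integral_cong) (auto split: split_indicator)
 finally show ?thesis .
qed

lemma nn_integral_lborel_Times:
 fixes f :: "real \<times> real => ennreal"
 assumes [measurable]: "f \<in> borel_measurable borel" "A \<in> sets borel" "B \<in> sets borel"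
 shows "(\<integral>\<^sup>+z. f z * indicator (A \<times> B) z \<partial>lborel)
  = (\<integral>\<^sup>+x. (\<integral>\<^sup>+y. f (x, y) * indicator B y \<partial>lborel) * indicator A x \<partial>lborel)"
  and "(\<integral>\<^sup>+z. f z * indicator (A \<times> B) z \<partial>lborel)
  = (\<integral>\<^sup>+y. (\<integral>\<^sup>+x. f (x, y) * indicator A x \<partial>lborel) * indicator B y \<partial>lborel)"
proof -
 have [measurable]: "f \<in> borel_measurable (borel \<Otimes>\<^sub>M borel)" by (simp add: borel_prod)
 have [measurable]: "(\<lambda>z. f z * indicator (A \<times> B) z) \<in> borel_measurable (lborel \<Otimes>\<^sub>M lborel)"
  by measurable
 have "(\<integral>\<^sup>+z. f z * indicator (A \<times> B) z \<partial>lborel)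
   = (\<integral>\<^sup>+z. f z * indicator (A \<times> B) z \<partial>(lborel \<Otimes>\<^sub>M lborel))"
  by (simp add: lborel_prod)
 also have "\<dots> = (\<integral>\<^sup>+x. \<integral>\<^sup>+y. f (x, y) * indicator (A \<times> B) (x, y) \<partial>lborel \<partial>lborel)"
  by (rule lborel.nn_integral_fst[symmetric]) measurable
 also have "\<dots> = (\<integral>\<^sup>+x. \<integral>\<^sup>+y. (f (x, y) * indicator B y) * indicator A x \<partial>lborel \<partial>lborel)"
  by (intro nn_integral_cong) (auto split: split_indicator)
 also have "\<dots> = (\<integral>\<^sup>+x. (\<integral>\<^sup>+y. f (x, y) * indicator B y \<partial>lborel) * indicator A x \<partial>lborel)"
  by (intro nn_integral_cong nn_integral_multc) measurable
 finally show "(\<integral>\<^sup>+z. f z * indicator (A \<times> B) z \<partial>lborel)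
  = (\<integral>\<^sup>+x. (\<integral>\<^sup>+y. f (x, y) * indicator B y \<partial>lborel) * indicator A x \<partial>lborel)" .
 have "(\<integral>\<^sup>+z. f z * indicator (A \<times> B) z \<partial>lborel)
   = (\<integral>\<^sup>+z. f z * indicator (A \<times> B) z \<partial>(lborel \<Otimes>\<^sub>M lborel))"
  by (simp add: lborel_prod)
 also have "\<dots> = (\<integral>\<^sup>+y. \<integral>\<^sup>+x. f (x, y) * indicator (A \<times> B) (x, y) \<partial>lborel \<partial>lborel)"
  by (rule lborel_pair.nn_integral_snd[symmetric]) measurable
 also have "\<dots> = (\<integral>\<^sup>+y. \<integral>\<^sup>+x. (f (x, y) * indicator A x) * indicator B y \<partial>lborel \<partial>lborel)"
  by (intro nn_integral_cong) (auto split: split_indicator)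
 also have "\<dots> = (\<integral>\<^sup>+y. (\<integral>\<^sup>+x. f (x, y) * indicator A x \<partial>lborel) * indicator B y \<partial>lborel)"
  by (intro nn_integral_cong nn_integral_multc) measurable
 finally show "(\<integral>\<^sup>+z. f z * indicator (A \<times> B) z \<partial>lborel)
  = (\<integral>\<^sup>+y. (\<integral>\<^sup>+x. f (x, y) * indicator A x \<partial>lborel) * indicator B y \<partial>lborel)" .
qed

text \<open>Every translate of the period square is a fundamental domain. The one centred at the
  origin is the useful one later: it has the pole of the kernel in its interior.\<close>

lemma nn_integral_torus_square:
 assumes [measurable]: "f \<in> borel_measurable borel"
 shows "(\<integral>\<^sup>+p. f p \<partial>torus_lebesgue) = (\<integral>\<^sup>+z. f (to_torus z) * indicator (square a b) z \<partial>lborel)"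
proof -
 have [measurable]: "(\<lambda>z. f (to_torus z)) \<in> borel_measurable borel" by measurable
 have [measurable]: "(\<lambda>z. f (to_torus z)) \<in> borel_measurable (borel \<Otimes>\<^sub>M borel)"
  by (simp add: borel_prod)
 have p1: "to_torus (x + 2 * pi, y) = to_torus (x, y)" for x y
  using to_torus_periodic[of x 1 y 0] by simp
 have p2: "to_torus (x, y + 2 * pi) = to_torus (x, y)" for x y
  using to_torus_periodic[of x 0 y 1] by simp
 have "(\<integral>\<^sup>+z. f (to_torus z) * indicator (square a b) z \<partial>lborel)
   = (\<integral>\<^sup>+x. (\<integral>\<^sup>+y. f (to_torus (x, y)) * indicator {b..<b + 2 * pi} y \<partial>lborel)
     * indicator {a..<a + 2 * pi} x \<partial>lborel)"
  by (rule nn_integral_lborel_Times(1)) auto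
 also have "\<dots> = (\<integral>\<^sup>+x. (\<integral>\<^sup>+y. f (to_torus (x, y)) * indicator {0..<2 * pi} y \<partial>lborel)
     * indicator {0..<2 * pi} x \<partial>lborel)"
  by (subst nn_integral_period[of _ b], measurable, simp add: p2,
    subst nn_integral_period[of _ a], measurable, simp_all add: p1)
 also have "\<dots> = (\<integral>\<^sup>+z. f (to_torus z) * indicator (square 0 0) z \<partial>lborel)"
  by (subst nn_integral_lborel_Times(1)) auto
 finally show ?thesis by (simp add: nn_integral_torus_lebesgue)
qed

text \<open>Translation by a lift of c moves the standard square to another period square, over
  which the integral is the same.\<close>

lemma torus_lebesgue_add: "distr torus_lebesgue borel (\<lambda>p. p + c) = torus_lebesgue"
proof (rule measure_eqI)
 fix A assume "A \<in> sets (distr torus_lebesgue borel (\<lambda>p. p + c))"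
 then have [measurable]: "A \<in> sets borel" by simp
 obtain u v where uv: "rep_torus c = (u, v)" by fastforce
 then have c: "c = to_torus (u, v)" using to_torus_rep[of c] by simp
 have "emeasure (distr torus_lebesgue borel (\<lambda>p. p + c)) A
   = (\<integral>\<^sup>+p. indicator A (p + c) \<partial>torus_lebesgue)"
  by (subst nn_integral_indicator[symmetric], simp, subst nn_integral_distr) auto
 also have "\<dots> = (\<integral>\<^sup>+z. indicator A (to_torus z + c) * indicator (square 0 0) z \<partial>lborel)"
  by (rule nn_integral_torus_lebesgue) measurable
 also have "\<dots> = (\<integral>\<^sup>+z. indicator A (to_torus ((u, v) + z)) * indicator (square u v) ((u, v) + z) \<partial>lborel)"
  by (intro nn_integral_cong) (auto simp: c to_torus_add[symmetric] add.commute split: split_indicator)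
 also have "\<dots> = (\<integral>\<^sup>+z. indicator A (to_torus z) * indicator (square u v) z \<partial>distr lborel borel ((+) (u, v)))"
  by (subst nn_integral_distr) auto
 also have "\<dots> = (\<integral>\<^sup>+p. indicator A p \<partial>torus_lebesgue)"
  by (subst lborel_distr_plus, subst nn_integral_torus_square[of _ u v]) auto
 finally show "emeasure (distr torus_lebesgue borel (\<lambda>p. p + c)) A = emeasure torus_lebesgue A"
  by simp
qed simp

lemma torus_lebesgue_uminus: "distr torus_lebesgue borel uminus = torus_lebesgue"
proof (rule measure_eqI)
 fix A assume "A \<in> sets (distr torus_lebesgue borel uminus)"
 then have [measurable]: "A \<in> sets borel" by simp
 have [measurable]: "(uminus :: torus => torus) \<in> borel_measurable borel"
  by (intro borel_measurable_continuous_onI continuous_intros)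
 have [measurable]: "{-2*pi<..0} \<times> {-2*pi<..0} \<in> sets (borel :: (real \<times> real) measure)"
  by (intro borel_Times) auto
 have [measurable]: "(uminus :: real \<times> real => _) \<in> borel_measurable borel"
  by (intro borel_measurable_continuous_onI continuous_intros)
 have "emeasure (distr torus_lebesgue borel uminus) A
   = (\<integral>\<^sup>+p. indicator A (- p) \<partial>torus_lebesgue)"
  by (subst nn_integral_indicator[symmetric], simp, subst nn_integral_distr) auto
 also have "\<dots> = (\<integral>\<^sup>+z. indicator A (- to_torus z) * indicator (square 0 0) z \<partial>lborel)"
  by (rule nn_integral_torus_lebesgue) measurable
 also have "\<dots> = (\<integral>\<^sup>+z. indicator A (to_torus (- z)) * indicator ({-2*pi<..0} \<times> {-2*pi<..0}) (- z) \<partial>lborel)"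
  by (intro nn_integral_cong) (auto simp: to_torus_uminus split: split_indicator)
 also have "\<dots> = (\<integral>\<^sup>+z. indicator A (to_torus z) * indicator ({-2*pi<..0} \<times> {-2*pi<..0}) z
   \<partial>distr lborel borel uminus)"
  by (rule nn_integral_distr[symmetric]) measurable
 also have "distr lborel borel uminus = (lborel :: (real \<times> real) measure)"
  by (subst (2) lborel_affine[of "-1" 0]) (auto simp: density_1)
 also have "(\<integral>\<^sup>+z. indicator A (to_torus z) * indicator ({-2*pi<..0} \<times> {-2*pi<..0}) z \<partial>lborel)
   = (\<integral>\<^sup>+z. indicator A (to_torus z) * indicator (square (-2*pi) (-2*pi)) z \<partial>lborel)"
 proof -
  have m[measurable]: "(\<lambda>z. indicator A (to_torus z) :: ennreal) \<in> borel_measurable borel" by measurable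
  \<comment> \<open>Reflection turns the half-open intervals round. The two kinds differ only in end
    points, which are negligible in each variable.\<close>
  have ae: "AE x in lborel. x \<noteq> -2*pi \<and> x \<noteq> (0::real)"
   using AE_lborel_singleton[of "-2*pi"] AE_lborel_singleton[of "0::real"] by eventually_elim auto
  have m'[measurable]: "(\<lambda>z. indicator A (to_torus z) :: ennreal) \<in> borel_measurable (borel \<Otimes>\<^sub>M borel)"
   by (simp add: borel_prod)
  have 1: "(\<integral>\<^sup>+y. indicator A (to_torus (x, y)) * indicator {-2*pi<..0} y \<partial>lborel)
    = (\<integral>\<^sup>+y. indicator A (to_torus (x, y)) * indicator {-2*pi..<-2*pi+2*pi} y \<partial>lborel)" for x
   by (rule nn_integral_cong_AE, use ae in eventually_elim) (auto split: split_indicator)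
  have "(\<integral>\<^sup>+z. indicator A (to_torus z) * indicator ({-2*pi<..0} \<times> {-2*pi<..0}) z \<partial>lborel)
    = (\<integral>\<^sup>+x. (\<integral>\<^sup>+y. indicator A (to_torus (x, y)) * indicator {-2*pi<..0} y \<partial>lborel)
      * indicator {-2*pi<..0} x \<partial>lborel)"
   by (rule nn_integral_lborel_Times(1)[OF m]) simp_all
  also have "\<dots> = (\<integral>\<^sup>+x. (\<integral>\<^sup>+y. indicator A (to_torus (x, y)) * indicator {-2*pi..<-2*pi+2*pi} y \<partial>lborel)
      * indicator {-2*pi..<-2*pi+2*pi} x \<partial>lborel)"
   unfolding 1 by (rule nn_integral_cong_AE, use ae in eventually_elim) (auto split: split_indicator)
  also have "\<dots> = (\<integral>\<^sup>+z. indicator A (to_torus z) * indicator (square (-2*pi) (-2*pi)) z \<partial>lborel)"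
   by (rule nn_integral_lborel_Times(1)[OF m, symmetric]) simp_all
  finally show ?thesis .
 qed
 also have "\<dots> = (\<integral>\<^sup>+p. indicator A p \<partial>torus_lebesgue)"
  by (subst nn_integral_torus_square[of _ "-2*pi" "-2*pi"]) auto
 finally show "emeasure (distr torus_lebesgue borel uminus) A = emeasure torus_lebesgue A"
  by simp
qed simp

lemma torus_lebesgue_reflect: "distr torus_lebesgue borel (\<lambda>p. c - p) = torus_lebesgue"
proof -
 have [measurable]: "(uminus :: torus => torus) \<in> borel_measurable borel"
  by (intro borel_measurable_continuous_onI continuous_intros)
 have "distr torus_lebesgue borel (\<lambda>p. c - p)
   = distr (distr torus_lebesgue borel uminus) borel (\<lambda>p. p + c)"
  by (subst distr_distr) (auto simp: comp_def)
 then show ?thesis by (simp add: torus_lebesgue_uminus torus_lebesgue_add)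
qed

lemma emeasure_torus: "emeasure torus_lebesgue UNIV = ennreal (4 * pi\<^sup>2)"
proof -
 have "emeasure torus_lebesgue UNIV = (\<integral>\<^sup>+z. 1 * indicator (square 0 0) z \<partial>lborel)"
  using nn_integral_torus_lebesgue[of "\<lambda>_. 1"] by simp
 also have "\<dots> = (\<integral>\<^sup>+x. (\<integral>\<^sup>+y. 1 * indicator {0..<0+2*pi} y \<partial>lborel) * indicator {0..<0+2*pi} x \<partial>lborel)"
  by (rule nn_integral_lborel_Times(1)) auto
 also have "\<dots> = ennreal (2 * pi) * ennreal (2 * pi)"
  by (simp add: nn_integral_cmult)
 finally show ?thesis by (simp add: ennreal_mult[symmetric] power2_eq_square algebra_simps)
qed

interpretation torus: finite_measure torus_lebesgue
 by (rule finite_measureI) (simp add: emeasure_torus)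

lemma measure_torus: "measure torus_lebesgue UNIV = 4 * pi\<^sup>2"
 by (simp add: measure_def emeasure_torus)

lemma integral_torus_square:
 fixes f :: "torus => 'b::{banach, second_countable_topology}"
 assumes [measurable]: "f \<in> borel_measurable borel"
 shows "(\<integral>p. f p \<partial>torus_lebesgue) = (\<integral>z. indicator (square 0 0) z *\<^sub>R f (to_torus z) \<partial>lborel)"
  and "integrable torus_lebesgue f \<longleftrightarrow> integrable lborel (\<lambda>z. indicator (square 0 0) z *\<^sub>R f (to_torus z))"
 using square_sets[of 0 0] unfolding torus_lebesgue_def
 by (simp_all add: integral_distr integrable_distr_eq integral_restrict_space integrable_restrict_space)

section \<open>Planar integrals\<close>

lemma nn_integral_inverse_sqrt:
 assumes "R \<ge> 0"
 shows "(\<integral>\<^sup>+x. ennreal (1 / sqrt \<bar>x\<bar>) * indicator {-R..R} x \<partial>lborel) \<le> ennreal (4 * sqrt R)"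
proof -
 have half: "(\<integral>\<^sup>+x. ennreal (1 / sqrt \<bar>x\<bar>) * indicator {0..R} x \<partial>lborel) = ennreal (2 * sqrt R)"
 proof -
  have "((\<lambda>x. x powr (-1/2)) has_integral (R powr (-1/2 + 1) / (-1/2 + 1))) {0..R}"
   by (rule has_integral_powr_from_0) (use assms in auto)
  also have "R powr (-1/2 + 1) / (-1/2 + 1) = 2 * sqrt R"
   using assms by (simp add: powr_half_sqrt)
  moreover have "(\<lambda>x. indicator {0..R} x *\<^sub>R (x powr (-1/2)))
    = (\<lambda>x. if x \<in> {0..R} then x powr (-1/2) else 0)"
   by (rule ext) (simp add: indicator_def)
  ultimately have "((\<lambda>x. indicator {0..R} x *\<^sub>R (x powr (-1/2))) has_integral (2 * sqrt R)) UNIV"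
   by (simp only: has_integral_restrict_UNIV)
  then have "(\<integral>\<^sup>+x. ennreal (indicator {0..R} x *\<^sub>R (x powr (-1/2))) \<partial>lborel) = ennreal (2 * sqrt R)"
   by (intro nn_integral_has_integral_lborel) auto
  also have "(\<integral>\<^sup>+x. ennreal (indicator {0..R} x *\<^sub>R (x powr (-1/2))) \<partial>lborel)
    = (\<integral>\<^sup>+x. ennreal (1 / sqrt \<bar>x\<bar>) * indicator {0..R} x \<partial>lborel)"
   by (intro nn_integral_cong)
    (auto simp: powr_minus powr_half_sqrt divide_simps split: split_indicator)
  finally show ?thesis .
 qed
 have "(\<integral>\<^sup>+x. ennreal (1 / sqrt \<bar>x\<bar>) * indicator {-R..0} x \<partial>lborel)
   = (\<integral>\<^sup>+x. ennreal (1 / sqrt \<bar>0 + (-1) * x\<bar>) * indicator {-R..0} (0 + (-1) * x) \<partial>lborel)"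
  by (subst nn_integral_real_affine[where c = "-1" and t = 0]) auto
 also have "\<dots> = ennreal (2 * sqrt R)"
  unfolding half[symmetric] by (intro nn_integral_cong) (auto split: split_indicator)
 finally have half': "(\<integral>\<^sup>+x. ennreal (1 / sqrt \<bar>x\<bar>) * indicator {-R..0} x \<partial>lborel) = ennreal (2 * sqrt R)" .
 have "(\<integral>\<^sup>+x. ennreal (1 / sqrt \<bar>x\<bar>) * indicator {-R..R} x \<partial>lborel)
   \<le> (\<integral>\<^sup>+x. ennreal (1 / sqrt \<bar>x\<bar>) * indicator {-R..0} x + ennreal (1 / sqrt \<bar>x\<bar>) * indicator {0..R} x \<partial>lborel)"
  by (intro nn_integral_mono) (auto split: split_indicator)
 also have "\<dots> = ennreal (2 * sqrt R) + ennreal (2 * sqrt R)"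
  unfolding half[symmetric] half'[symmetric] by (subst nn_integral_add) (auto simp: half half')
 finally show ?thesis using assms by (simp add: ennreal_plus[symmetric] del: ennreal_plus)
qed

text \<open>The primitive is \<open>arctan (x / b) / b\<close>, whose total variation is at most
  \<open>pi / b\<close> uniformly in R.\<close>

lemma nn_integral_inverse_quadratic:
 fixes b :: real
 assumes "b > 0" "R \<ge> 0"
 shows "(\<integral>\<^sup>+x. ennreal (1 / (x\<^sup>2 + b\<^sup>2)) * indicator {-R..R} x \<partial>lborel) \<le> ennreal (pi / b)"
proof -
 have "(\<integral>\<^sup>+x. ennreal (1 / (x\<^sup>2 + b\<^sup>2)) * indicator {-R..R} x \<partial>lborel)
   = ennreal (arctan (R / b) / b - arctan (-R / b) / b)"
 proof (rule nn_integral_FTC_Icc)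
  fix x assume "x \<in> {-R..R}"
  have "b * b + x * x > 0" using assms by (simp add: add_pos_nonneg)
  then show "((\<lambda>x. arctan (x / b) / b) has_real_derivative 1 / (x\<^sup>2 + b\<^sup>2)) (at x)"
   using assms
   by (auto intro!: derivative_eq_intros simp:
    power2_eq_square divide_simps)
 qed (use assms in auto)
 also have "\<dots> \<le> ennreal (pi / b)"
 proof (rule ennreal_leI)
  have "arctan (R / b) - arctan (-R / b) \<le> pi"
   using arctan_ubound[of "R / b"] arctan_lbound[of "-R / b"] by linarith
  then show "arctan (R / b) / b - arctan (-R / b) / b \<le> pi / b"
   using assms by (simp add: diff_divide_distrib[symmetric] divide_right_mono)
 qed
 finally show ?thesis .
qed

text \<open>The primitive is an arsinh; its logarithmic growth is where the logarithm of the modulus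
  comes from.\<close>

lemma nn_integral_inverse_sqrt_quadratic:
 fixes d R :: real
 assumes "0 < d" "d \<le> 1" "R \<ge> 0"
 shows "(\<integral>\<^sup>+y. ennreal (1 / sqrt (y\<^sup>2 + d\<^sup>2)) * indicator {-R..R} y \<partial>lborel)
  \<le> ennreal (2 * (ln (2 * R + 1) - ln d))"
proof -
 have "(\<integral>\<^sup>+y. ennreal (1 / sqrt (y\<^sup>2 + d\<^sup>2)) * indicator {-R..R} y \<partial>lborel)
   = ennreal (arsinh (R / d) - arsinh (-R / d))"
 proof (rule nn_integral_FTC_Icc)
  fix x assume "x \<in> {-R..R}"
  have "(x / d)\<^sup>2 + 1 = (x\<^sup>2 + d\<^sup>2) / d\<^sup>2" using assms by (simp add: field_simps)
  then have "sqrt ((x / d)\<^sup>2 + 1) = sqrt (x\<^sup>2 + d\<^sup>2) / d"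
   using assms by (simp add: real_sqrt_divide)
  moreover have "((\<lambda>x. arsinh (x / d)) has_real_derivative 1 / sqrt ((x / d)\<^sup>2 + 1) * (1 / d)) (at x)"
   by (rule DERIV_chain2[OF arsinh_real_has_field_derivative])
    (use assms in \<open>auto intro!: derivative_eq_intros\<close>)
  ultimately show "((\<lambda>x. arsinh (x / d)) has_real_derivative 1 / sqrt (x\<^sup>2 + d\<^sup>2)) (at x)"
   using assms by simp
 qed (use assms in auto)
 also have "arsinh (R / d) - arsinh (-R / d) = 2 * arsinh (R / d)"
  by (simp add: arsinh_minus_real)
 also have "2 * arsinh (R / d) \<le> 2 * (ln (2 * R + 1) - ln d)"
 proof -
  have "sqrt ((R / d)\<^sup>2 + 1) \<le> R / d + 1"
   by (rule real_le_lsqrt) (use assms in \<open>auto simp: power2_eq_square algebra_simps\<close>)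
  moreover have "1 \<le> 1 / d" using assms by simp
  ultimately have "R / d + sqrt ((R / d)\<^sup>2 + 1) \<le> (2 * R + 1) / d"
   unfolding add_divide_distrib by simp
  moreover have "0 < R / d + sqrt ((R / d)\<^sup>2 + 1)" using assms by (intro add_nonneg_pos) (auto intro: add_nonneg_pos)
  ultimately have "arsinh (R / d) \<le> ln ((2 * R + 1) / d)"
   by (simp add: arsinh_real_def)
  then show ?thesis using assms by (simp add: ln_div)
 qed
 finally show ?thesis by (simp add: ennreal_leI)
qed

lemma norm_ge_sqrt_coords: "sqrt \<bar>x\<bar> * sqrt \<bar>y\<bar> \<le> norm (x, y :: real)"
proof -
 have "\<bar>x\<bar> * \<bar>y\<bar> \<le> x\<^sup>2 + y\<^sup>2"
  using mult_nonneg_nonneg[OF abs_ge_zero abs_ge_zero, of x y]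
   sum_squares_bound[of "\<bar>x\<bar>" "\<bar>y\<bar>"] unfolding power2_abs by linarith
 then have "sqrt (\<bar>x\<bar> * \<bar>y\<bar>) \<le> sqrt (x\<^sup>2 + y\<^sup>2)" by (rule real_sqrt_le_mono)
 then show ?thesis by (simp add: real_sqrt_mult norm_Pair)
qed

text \<open>Bounding \<open>1 / norm z\<close> by the product of
  \<open>1 / sqrt \<bar>x\<bar>\<close> and \<open>1 / sqrt \<bar>y\<bar>\<close> separates the
  variables; the constant is the square of \<open>4 * sqrt R\<close>.\<close>

lemma nn_integral_inverse_norm:
 assumes "R \<ge> 0"
 shows "(\<integral>\<^sup>+z. ennreal (1 / norm z) * indicator ({-R..R} \<times> {-R..R}) z \<partial>lborel) \<le> ennreal (16 * R)"
proof -
 let ?g = "\<lambda>x :: real. ennreal (1 / sqrt \<bar>x\<bar>) * indicator {-R..R} x"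
 have "(\<integral>\<^sup>+z. ennreal (1 / norm z) * indicator ({-R..R} \<times> {-R..R}) z \<partial>(lborel :: (real \<times> real) measure))
   = (\<integral>\<^sup>+x. (\<integral>\<^sup>+y. ennreal (1 / norm (x, y)) * indicator {-R..R} y \<partial>lborel) * indicator {-R..R} x \<partial>lborel)"
  by (rule nn_integral_lborel_Times(1)) auto
 also have "\<dots> \<le> (\<integral>\<^sup>+x. (\<integral>\<^sup>+y. ennreal (1 / sqrt \<bar>x\<bar>) * ?g y \<partial>lborel) * indicator {-R..R} x \<partial>lborel)"
 proof (rule nn_integral_mono_AE, use AE_lborel_singleton[of 0] in eventually_elim)
  fix x :: real assume x: "x \<noteq> 0"
  have "(\<integral>\<^sup>+y. ennreal (1 / norm (x, y)) * indicator {-R..R} y \<partial>lborel) \<le> (\<integral>\<^sup>+y. ennreal (1 / sqrt \<bar>x\<bar>) * ?g y \<partial>lborel)"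
  proof (rule nn_integral_mono_AE, use AE_lborel_singleton[of 0] in eventually_elim)
   fix y :: real assume y: "y \<noteq> 0"
   have "1 / norm (x, y) \<le> 1 / (sqrt \<bar>x\<bar> * sqrt \<bar>y\<bar>)"
    using x y norm_ge_sqrt_coords[of x y]
    by (intro divide_left_mono mult_pos_pos) (auto simp: zero_prod_def)
   then have "ennreal (1 / norm (x, y)) \<le> ennreal (1 / sqrt \<bar>x\<bar>) * ennreal (1 / sqrt \<bar>y\<bar>)"
    by (simp add: ennreal_mult[symmetric] ennreal_leI)
   then show "ennreal (1 / norm (x, y)) * indicator {-R..R} y \<le> ennreal (1 / sqrt \<bar>x\<bar>) * ?g y"
    by (auto split: split_indicator)
  qed
  then show "(\<integral>\<^sup>+y. ennreal (1 / norm (x, y)) * indicator {-R..R} y \<partial>lborel) * indicator {-R..R} x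
    \<le> (\<integral>\<^sup>+y. ennreal (1 / sqrt \<bar>x\<bar>) * ?g y \<partial>lborel) * indicator {-R..R} x"
   by (rule mult_right_mono) simp
 qed
 also have "\<dots> = (\<integral>\<^sup>+x. ?g x * (\<integral>\<^sup>+y. ?g y \<partial>lborel) \<partial>lborel)"
  by (intro nn_integral_cong) (subst nn_integral_cmult, auto simp: mult_ac)
 also have "\<dots> = (\<integral>\<^sup>+x. ?g x \<partial>lborel) * (\<integral>\<^sup>+y. ?g y \<partial>lborel)"
  by (rule nn_integral_multc) auto
 also have "\<dots> \<le> ennreal (4 * sqrt R) * ennreal (4 * sqrt R)"
  by (intro mult_mono nn_integral_inverse_sqrt assms) auto
 also have "\<dots> = ennreal (16 * R)"
  using assms by (simp add: ennreal_mult[symmetric])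
 finally show ?thesis .
qed

text \<open>Majorant for \<open>d / (norm z * norm w)\<close> when z and w are at least d apart in
  the sense \<open>d \<le> norm z + norm w\<close>, with r the smaller norm. For
  \<open>r < d\<close> the other norm is at least \<open>d / 2\<close>; for larger r it is at least
  r.\<close>

definition pole_bound :: "real => real => real" where
 "pole_bound d r = (if r < d then 2 / r else 2 * d / (r\<^sup>2 + d\<^sup>2))"

lemma pole_bound_measurable[measurable]: "pole_bound d \<in> borel_measurable borel"
 unfolding pole_bound_def[abs_def] by measurable

lemma pole_bound_nonneg: "d \<ge> 0 ==> r \<ge> 0 ==> pole_bound d r \<ge> 0"
 by (simp add: pole_bound_def)

text \<open>The quotient is charged to the nearer of the two poles; \<open>d \<le> a + b\<close>
  forces the farther one to be at distance at least \<open>d / 2\<close>.\<close>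

lemma two_pole_bound:
 fixes a b d :: real
 assumes "a > 0" "b > 0" "d > 0" "d \<le> a + b"
 shows "d / (a * b) \<le> pole_bound d a + pole_bound d b"
proof -
 have key: "d / (a * b) \<le> pole_bound d a" if ab: "a > 0" "a \<le> b" "d \<le> a + b" for a b :: real
 proof (cases "a < d")
  case True
  have "d * a \<le> 2 * b * a" using ab by (intro mult_right_mono) auto
  then show ?thesis using True ab assms(3) by (simp add: pole_bound_def field_simps)
 next
  case False
  then have "a\<^sup>2 + d\<^sup>2 \<le> 2 * (a * a)"
   using assms(3) power_mono[of d a 2] by (simp add: power2_eq_square)
  also have "\<dots> \<le> 2 * (a * b)" using ab by simp
  finally have "2 * d / (2 * (a * b)) \<le> 2 * d / (a\<^sup>2 + d\<^sup>2)"
   using ab assms(3) by (intro divide_left_mono mult_pos_pos add_pos_pos) auto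
  then show ?thesis using False by (simp add: pole_bound_def)
 qed
 show ?thesis
 proof (cases "a \<le> b")
  case True
  then show ?thesis using key[of a b] assms pole_bound_nonneg[of d b] by simp
 next
  case False
  then show ?thesis using key[of b a] assms pole_bound_nonneg[of d a] by (simp add: mult.commute)
 qed
qed

text \<open>The disc of radius d lies in a square and costs \<open>2 * 16 * d\<close>. The other
  piece, integrated over x, leaves \<open>pi / sqrt (y^2 + d^2)\<close>, and the integral over y
  gives the logarithm.\<close>

lemma nn_integral_pole_bound:
 assumes d: "0 < d" "d \<le> 1" and R: "R \<ge> 1"
 shows "(\<integral>\<^sup>+z. ennreal (pole_bound d (norm z)) * indicator ({-R..R} \<times> {-R..R}) z
  \<partial>(lborel :: (real \<times> real) measure)) \<le> ennreal (32 * d + 4 * pi * d * (ln (2 * R + 1) - ln d))"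
proof -
 let ?S = "{-R..R} \<times> {-R..R}" and ?D = "{-d..d} \<times> {-d..d}"
 have le: "ennreal (pole_bound d (norm z)) * indicator ?S z
   \<le> ennreal 2 * (ennreal (1 / norm z) * indicator ?D z) + ennreal (2 * d) * (ennreal (1 / ((norm z)\<^sup>2 + d\<^sup>2)) * indicator ?S z)"
  for z :: "real \<times> real"
 proof (cases "norm z < d")
  case True
  then have "z \<in> ?D" using norm_fst_le[of "fst z" "snd z"] norm_snd_le[of "snd z" "fst z"]
   by (cases z) (auto simp: abs_le_iff)
  moreover have "ennreal (2 / norm z) = ennreal 2 * ennreal (1 / norm z)"
   using ennreal_mult[of 2 "1 / norm z"] by simp
  ultimately show ?thesis using True by (auto simp: pole_bound_def split: split_indicator)
 next
  case False
  have "ennreal (2 * d / ((norm z)\<^sup>2 + d\<^sup>2)) = ennreal (2 * d) * ennreal (1 / ((norm z)\<^sup>2 + d\<^sup>2))"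
   using d by (simp add: ennreal_mult[symmetric])
  then show ?thesis using False by (auto simp: pole_bound_def split: split_indicator)
 qed
 have D: "(\<integral>\<^sup>+z. ennreal (1 / norm z) * indicator ?D z \<partial>(lborel :: (real \<times> real) measure)) \<le> ennreal (16 * d)"
  using nn_integral_inverse_norm[of d] d by simp
 have "(\<integral>\<^sup>+z. ennreal (1 / ((norm z)\<^sup>2 + d\<^sup>2)) * indicator ?S z \<partial>(lborel :: (real \<times> real) measure))
   = (\<integral>\<^sup>+y. (\<integral>\<^sup>+x. ennreal (1 / ((norm (x, y))\<^sup>2 + d\<^sup>2)) * indicator {-R..R} x \<partial>lborel) * indicator {-R..R} y \<partial>lborel)"
  by (rule nn_integral_lborel_Times(2)) auto
 also have "\<dots> \<le> (\<integral>\<^sup>+y. ennreal pi * (ennreal (1 / sqrt (y\<^sup>2 + d\<^sup>2)) * indicator {-R..R} y) \<partial>lborel)"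
 proof (rule nn_integral_mono)
  fix y :: real
  have b: "sqrt (y\<^sup>2 + d\<^sup>2) > 0" using d by (simp add: add_nonneg_pos)
  have "(\<integral>\<^sup>+x. ennreal (1 / ((norm (x, y))\<^sup>2 + d\<^sup>2)) * indicator {-R..R} x \<partial>lborel)
    = (\<integral>\<^sup>+x. ennreal (1 / (x\<^sup>2 + (sqrt (y\<^sup>2 + d\<^sup>2))\<^sup>2)) * indicator {-R..R} x \<partial>lborel)"
   by (intro nn_integral_cong) (simp add: norm_Pair add.assoc)
  also have "\<dots> \<le> ennreal (pi / sqrt (y\<^sup>2 + d\<^sup>2))"
   by (rule nn_integral_inverse_quadratic[OF b]) (use R in simp)
  also have "\<dots> = ennreal pi * ennreal (1 / sqrt (y\<^sup>2 + d\<^sup>2))"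
   by (simp add: ennreal_mult[symmetric])
  finally show "(\<integral>\<^sup>+x. ennreal (1 / ((norm (x, y))\<^sup>2 + d\<^sup>2)) * indicator {-R..R} x \<partial>lborel) * indicator {-R..R} y
    \<le> ennreal pi * (ennreal (1 / sqrt (y\<^sup>2 + d\<^sup>2)) * indicator {-R..R} y)"
   by (auto split: split_indicator)
 qed
 also have "\<dots> = ennreal pi * (\<integral>\<^sup>+y. ennreal (1 / sqrt (y\<^sup>2 + d\<^sup>2)) * indicator {-R..R} y \<partial>lborel)"
  by (rule nn_integral_cmult) auto
 also have "\<dots> \<le> ennreal pi * ennreal (2 * (ln (2 * R + 1) - ln d))"
  by (intro mult_left_mono nn_integral_inverse_sqrt_quadratic) (use d R in auto)
 finally have S: "(\<integral>\<^sup>+z. ennreal (1 / ((norm z)\<^sup>2 + d\<^sup>2)) * indicator ?S z \<partial>(lborel :: (real \<times> real) measure))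
   \<le> ennreal pi * ennreal (2 * (ln (2 * R + 1) - ln d))" .
 have ln: "ln (2 * R + 1) - ln d \<ge> 0"
  using d R by (simp add: ln_le_cancel_iff)
 have [measurable]: "?S \<in> sets (borel :: (real \<times> real) measure)" "?D \<in> sets (borel :: (real \<times> real) measure)"
  by (intro borel_Times; simp)+
 have "(\<integral>\<^sup>+z. ennreal (pole_bound d (norm z)) * indicator ?S z \<partial>(lborel :: (real \<times> real) measure))
  \<le> (\<integral>\<^sup>+z. ennreal 2 * (ennreal (1 / norm z) * indicator ?D z) + ennreal (2 * d) * (ennreal (1 / ((norm z)\<^sup>2 + d\<^sup>2)) * indicator ?S z)
    \<partial>(lborel :: (real \<times> real) measure))"
  by (rule nn_integral_mono) (rule le)
 also have "\<dots> = ennreal 2 * (\<integral>\<^sup>+z. ennreal (1 / norm z) * indicator ?D z \<partial>(lborel :: (real \<times> real) measure))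
   + ennreal (2 * d) * (\<integral>\<^sup>+z. ennreal (1 / ((norm z)\<^sup>2 + d\<^sup>2)) * indicator ?S z \<partial>(lborel :: (real \<times> real) measure))"
 proof -
  define f g :: "real \<times> real => ennreal" where "f z = ennreal (1 / norm z) * indicator ?D z"
   and "g z = ennreal (1 / ((norm z)\<^sup>2 + d\<^sup>2)) * indicator ?S z" for z
  have [measurable]: "f \<in> borel_measurable borel" "g \<in> borel_measurable borel"
   unfolding f_def[abs_def] g_def[abs_def] by measurable
  have "(\<integral>\<^sup>+z. ennreal 2 * f z + ennreal (2 * d) * g z \<partial>lborel)
    = ennreal 2 * (\<integral>\<^sup>+z. f z \<partial>lborel) + ennreal (2 * d) * (\<integral>\<^sup>+z. g z \<partial>lborel)"
   by (simp add: nn_integral_add nn_integral_cmult)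
  then show ?thesis unfolding f_def g_def .
 qed
 also have "\<dots> \<le> ennreal 2 * ennreal (16 * d) + ennreal (2 * d) * (ennreal pi * ennreal (2 * (ln (2 * R + 1) - ln d)))"
  by (intro add_mono mult_left_mono D S) auto
 also have "\<dots> = ennreal (32 * d + 4 * pi * d * (ln (2 * R + 1) - ln d))"
 proof -
  have "ennreal 2 * ennreal (16 * d) + ennreal (2 * d) * (ennreal pi * ennreal (2 * X))
    = ennreal (2 * (16 * d) + 2 * d * (pi * (2 * X)))" if "X \<ge> 0" for X
  proof -
   have nn: "0 \<le> 2 * X" "0 \<le> pi * (2 * X)" "0 \<le> 2 * d" "0 \<le> 16 * d" "0 \<le> 2 * (16 * d)"
    "0 \<le> 2 * d * (pi * (2 * X))" "0 \<le> pi" "(0::real) \<le> 2" using d that by auto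
   show ?thesis by (simp only: ennreal_mult[symmetric] ennreal_plus[symmetric] nn)
  qed
  from this[OF ln] show ?thesis by (simp add: mult_ac)
 qed
 finally show ?thesis .
qed

section \<open>The explicit Green function\<close>

text \<open>On \<open>[0, pi]\<close> the sine is concave, hence above its chord from 0 to
  \<open>3 * pi / 4\<close>, whose slope exceeds \<open>1 / 5\<close>. The range is half of the one
  allowed for x in \<open>norm_sin_half_ge\<close>.\<close>

lemma sin_lower_bound:
 assumes "\<bar>u\<bar> \<le> 3 * pi / 4"
 shows "\<bar>u\<bar> / 5 \<le> \<bar>sin u\<bar>"
proof -
 have conc: "concave_on {0..pi} sin"
  by (rule f''_le0_imp_concave[where f' = cos and f'' = "\<lambda>x. - sin x"])
   (auto intro!: derivative_eq_intros sin_ge_zero)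
 have pos: "u / 5 \<le> sin u" if u: "0 \<le> u" "u \<le> 3 * pi / 4" for u :: real
 proof -
  define t where "t = u / (3 * pi / 4)"
  have t: "0 \<le> t" "t \<le> 1" using u by (auto simp: t_def)
  have "\<forall>x\<in>{0..pi}. \<forall>y\<in>{0..pi}. \<forall>u\<ge>0. \<forall>v\<ge>0. u + v = 1 \<longrightarrow>
    u * sin x + v * sin y \<le> sin (u *\<^sub>R x + v *\<^sub>R y)"
   using conc unfolding concave_on_iff by blast
  from this[rule_format, of 0 "3 * pi / 4" "1 - t" t]
  have "(1 - t) * sin 0 + t * sin (3 * pi / 4) \<le> sin ((1 - t) *\<^sub>R 0 + t *\<^sub>R (3 * pi / 4))"
   using t by auto
  moreover have "sin (3 * pi / 4) = sqrt 2 / 2"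
   using sin_pi_minus[of "pi / 4"] by (simp add: sin_45 algebra_simps)
  moreover have "t * (3 * pi / 4) = u" by (simp add: t_def)
  ultimately have "t * (sqrt 2 / 2) \<le> sin u" by simp
  moreover have "u / 5 \<le> t * (sqrt 2 / 2)"
  proof -
   have "pi * 3 \<le> sqrt 2 * 10" using pi_less_4 real_le_rsqrt[of "1.4" 2] by (simp add: power2_eq_square)
   then have "u * (pi * 3) \<le> u * (sqrt 2 * 10)" using u by (intro mult_left_mono) auto
   then show ?thesis by (simp add: t_def field_simps)
  qed
  ultimately show ?thesis by simp
 qed
 show ?thesis
 proof (cases "u \<ge> 0")
  case True
  then show ?thesis using pos[of u] assms by auto
 next
  case False
  then show ?thesis using pos[of "- u"] assms by auto
 qed
qed

text \<open>The difference is nondecreasing on the positive half-line because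
  \<open>z \<le> sinh z\<close> there; negative y follow by evenness.\<close>

lemma cosh_ge_quadratic: "1 + y\<^sup>2 / 2 \<le> cosh (y :: real)"
proof -
 have le: "1 + y\<^sup>2 / 2 \<le> cosh y" if "y \<ge> 0" for y :: real
 proof -
  have s: "z \<le> sinh z" if "z \<ge> 0" for z :: real
   using real_le_x_sinh[OF that] by (simp add: sinh_field_def exp_minus)
  have "(\<lambda>y. cosh y - y\<^sup>2 / 2) 0 \<le> (\<lambda>y. cosh y - y\<^sup>2 / 2) y"
   by (rule DERIV_nonneg_imp_nondecreasing[OF that])
    (use s in \<open>auto intro!: exI derivative_eq_intros\<close>)
  then show ?thesis by simp
 qed
 show ?thesis using le[of "\<bar>y\<bar>"] by simp
qed

text \<open>Links the real denominator \<open>cosh y - cos x\<close> to the complex sine, whose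
  zeros are the poles of \<open>cot (z / 2)\<close>.\<close>

lemma norm_sin_half_squared: "(norm (sin (Complex x y / 2)))\<^sup>2 = (cosh y - cos x) / 2"
 by (simp add: norm_sin_squared cosh_field_def exp_minus field_simps)

text \<open>The range of x exceeds the half period pi, so that points of the centred square remain
  covered after a shift of length at most 1.\<close>

lemma norm_sin_half_ge:
 assumes "\<bar>x\<bar> \<le> 3 * pi / 2"
 shows "norm (x, y) / 10 \<le> norm (sin (Complex x y / 2))"
proof -
 have "\<bar>x / 2\<bar> / 5 \<le> \<bar>sin (x / 2)\<bar>" by (rule sin_lower_bound) (use assms in auto)
 then have "(\<bar>x / 2\<bar> / 5)\<^sup>2 \<le> \<bar>sin (x / 2)\<bar>\<^sup>2" by (intro power_mono) auto
 then have "x\<^sup>2 / 100 \<le> (sin (x / 2))\<^sup>2" by (simp add: power_divide)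
 then have cosx: "x\<^sup>2 / 50 \<le> 1 - cos x" using cos_double_sin[of "x / 2"] by simp
 have arith: "X + Y \<le> 50 * (c - k)" if "1 + Y / 2 \<le> c" "0 \<le> Y" "X / 50 \<le> 1 - k" for X Y c k :: real
  using that by (simp add: field_simps)
 have "x\<^sup>2 + y\<^sup>2 \<le> 50 * (cosh y - cos x)"
  by (rule arith[OF cosh_ge_quadratic zero_le_power2 cosx])
 then have "(norm (x, y) / 10)\<^sup>2 \<le> (norm (sin (Complex x y / 2)))\<^sup>2"
  unfolding norm_sin_half_squared norm_Pair power_divide by simp
 then show ?thesis by (rule power2_le_imp_le) simp
qed

lemma cosh_minus_cos_pos:
 assumes "\<not> (x, y) \<in> torus_lattice \<or> y \<noteq> 0"
 shows "cosh y - cos x > (0::real)"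
proof (cases "y = 0")
 case True
 then have "\<not> (x, y) \<in> torus_lattice" using assms by simp
 then have "cos x \<noteq> 1" unfolding cos_one_2pi_int torus_lattice_iff using True by (auto simp: mult_ac)
 then show ?thesis using True cos_le_one[of x] by (simp add: order_less_le)
next
 case False
 then have "y\<^sup>2 > 0" by simp
 then show ?thesis using cosh_ge_quadratic[of y] cos_le_one[of x] by linarith
qed

lemma norm_sin_le:
 assumes "norm (z :: complex) \<le> 1"
 shows "norm (sin z) \<le> 3 * norm z"
proof -
 have "norm (sin z - sin 0) \<le> 3 * norm (z - 0)"
 proof (rule field_differentiable_bound[where S = "cball 0 1" and f' = cos])
  fix w :: complex assume "w \<in> cball 0 1"
  then have "norm (cos w) \<le> exp 1" using norm_cos_le[of w] order_trans by fastforce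
  then show "norm (cos w) \<le> 3" using exp_le by linarith
 qed (use assms in \<open>auto intro!: derivative_eq_intros\<close>)
 then show ?thesis by simp
qed

text \<open>The identity shows both poles of a difference of cotangents as a product, under a
  numerator that is small for close points. A bound by a multiple of
  \<open>norm (z - w) / (norm z * norm w)\<close> follows from it.\<close>

lemma cot_diff:
 fixes a b :: complex
 assumes "sin a \<noteq> 0" "sin b \<noteq> 0"
 shows "cot a - cot b = sin (b - a) / (sin a * sin b)"
 using assms by (simp add: cot_def sin_diff field_simps)

text \<open>\<open>\<Sum>\<^sub>m cos(m z) / (\<pi> m (e\<^sup>2\<^sup>\<pi>\<^sup>m - 1))\<close> over \<open>m \<ge> 1\<close> collects the contributions of the images
 \<open>(0, 2 \<pi> n)\<close>, \<open>n \<noteq> 0\<close>, of the pole.\<close>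

definition image_coeff :: "nat => real" where
 "image_coeff n = 1 / (pi * Suc n * (exp (2 * pi * Suc n) - 1))"

definition image_sum :: "complex => complex" where
 "image_sum z = (\<Sum>n. of_real (image_coeff n) * cos (of_nat (Suc n) * z))"

definition image_sum_deriv :: "complex => complex" where
 "image_sum_deriv z = (\<Sum>n. - of_real (image_coeff n * Suc n) * sin (of_nat (Suc n) * z))"

lemma image_coeff_pos: "image_coeff n > 0"
 unfolding image_coeff_def by (intro divide_pos_pos mult_pos_pos) auto

text \<open>With \<open>E = exp (2 * pi * Suc n) \<ge> 2\<close> one has
  \<open>E \<le> pi * (E - 1)\<close>. The decay rate \<open>2 * pi\<close> is the distance to the
  nearest images of the pole, whence convergence for
  \<open>\<bar>Im z\<bar> < 2 * pi\<close>.\<close>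

lemma image_coeff_le: "image_coeff n * Suc n \<le> exp (- 2 * pi * Suc n)"
proof -
 have "1 + 2 * pi * Suc n \<le> exp (2 * pi * Suc n)" by (rule exp_ge_add_one_self)
 moreover have "2 * pi * Suc n \<ge> 2 * pi * 1" by (intro mult_left_mono) auto
 ultimately have E: "exp (2 * pi * Suc n) \<ge> 2" using pi_ge_two by linarith
 define E where "E = exp (2 * pi * Suc n)"
 have "E \<le> pi * (E - 1)"
  using E pi_ge_two mult_mono[of 2 pi "E - 1" "E - 1"] by (simp add: E_def)
 then have "1 / (pi * (E - 1)) \<le> 1 / E" using E by (intro divide_left_mono mult_pos_pos) (auto simp: E_def)
 moreover have "image_coeff n * Suc n = 1 / (pi * (E - 1))"
  by (simp add: image_coeff_def E_def del: of_nat_Suc)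
 moreover have "exp (- 2 * pi * Suc n) = 1 / E"
  using exp_minus[of "2 * pi * Suc n"] by (simp add: E_def inverse_eq_divide del: of_nat_Suc)
 ultimately show ?thesis by simp
qed

lemma norm_sin_exp_le: "norm (sin w) \<le> exp \<bar>Im w\<bar>" and norm_cos_exp_le: "norm (cos w) \<le> exp \<bar>Im w\<bar>"
 for w :: complex
proof -
 have e: "exp (- Im w) + exp (Im w) \<le> 2 * exp \<bar>Im w\<bar>"
  using add_mono[of "exp (- Im w)" "exp \<bar>Im w\<bar>" "exp (Im w)" "exp \<bar>Im w\<bar>"] by simp
 have "norm (exp (\<i> * w) - exp (- \<i> * w)) \<le> exp (- Im w) + exp (Im w)"
  using norm_triangle_ineq4[of "exp (\<i> * w)" "exp (- \<i> * w)"] by simp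
 then show "norm (sin w) \<le> exp \<bar>Im w\<bar>" using e unfolding sin_exp_eq by (simp add: norm_divide norm_mult)
 have "norm (exp (\<i> * w) + exp (- \<i> * w)) \<le> exp (- Im w) + exp (Im w)"
  using norm_triangle_ineq[of "exp (\<i> * w)" "exp (- \<i> * w)"] by simp
 then show "norm (cos w) \<le> exp \<bar>Im w\<bar>" using e unfolding cos_exp_eq by (simp add: norm_divide)
qed

text \<open>Stated for any s of the right exponential size, so that it serves the cosines of the
  series and the sines of its derivative alike.\<close>

lemma image_term_bound:
 fixes z s :: complex
 assumes "\<bar>Im z\<bar> \<le> c" "norm s \<le> exp \<bar>Im (of_nat (Suc n) * z)\<bar>"
 shows "norm (of_real (image_coeff n * Suc n) * s) \<le> exp (- (2 * pi - c)) ^ Suc n"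
proof -
 have "\<bar>Im (of_nat (Suc n) * z)\<bar> = Suc n * \<bar>Im z\<bar>" by (simp add: abs_mult)
 also have "\<dots> \<le> Suc n * c" using assms(1) by (intro mult_left_mono) auto
 finally have "norm s \<le> exp (Suc n * c)" using assms(2) by (meson exp_le_cancel_iff order_trans)
 then have "norm (of_real (image_coeff n * Suc n) * s) \<le> exp (- 2 * pi * Suc n) * exp (Suc n * c)"
  using image_coeff_le[of n] image_coeff_pos[of n]
  unfolding norm_mult norm_of_real by (intro mult_mono) auto
 also have "\<dots> = exp (- (2 * pi - c)) ^ Suc n"
  unfolding exp_of_nat_mult[symmetric] exp_add[symmetric] by (simp add: algebra_simps)
 finally show ?thesis .
qed

lemma image_geometric_summable:
 assumes "c < 2 * pi" shows "summable (\<lambda>n. exp (- (2 * pi - c)) ^ Suc n)"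
 unfolding summable_Suc_iff by (rule summable_geometric) (use assms in simp)

lemma image_sum_deriv_summable:
 assumes "\<bar>Im z\<bar> < 2 * pi"
 shows "summable (\<lambda>n. - of_real (image_coeff n * Suc n) * sin (of_nat (Suc n) * z))"
proof (rule summable_comparison_test'[OF image_geometric_summable[OF assms], of 0])
 fix n
 show "norm (- of_real (image_coeff n * Suc n) * sin (of_nat (Suc n) * z)) \<le> exp (- (2 * pi - \<bar>Im z\<bar>)) ^ Suc n"
  using image_term_bound[OF order_refl norm_sin_exp_le, of n z] by simp
qed

lemma image_sum_summable:
 assumes "\<bar>Im z\<bar> < 2 * pi"
 shows "summable (\<lambda>n. of_real (image_coeff n) * cos (of_nat (Suc n) * z))"
proof (rule summable_comparison_test'[OF image_geometric_summable[OF assms], of 0])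
 fix n
 have "norm (of_real (image_coeff n) * cos (of_nat (Suc n) * z)) \<le> norm (of_real (image_coeff n * Suc n) * cos (of_nat (Suc n) * z))"
  unfolding norm_mult norm_of_real using image_coeff_pos[of n] by (intro mult_right_mono) auto
 then show "norm (of_real (image_coeff n) * cos (of_nat (Suc n) * z)) \<le> exp (- (2 * pi - \<bar>Im z\<bar>)) ^ Suc n"
  using image_term_bound[OF order_refl norm_cos_exp_le, of n z] by simp
qed

lemma image_sum_has_derivative:
 assumes "\<bar>Im z\<bar> < 2 * pi"
 shows "(image_sum has_field_derivative image_sum_deriv z) (at z)"
proof -
 \<comment> \<open>A closed strip strictly between z and the boundary: z is interior to it, and the
   geometric ratio on it stays below 1.\<close>
 define c where "c = (\<bar>Im z\<bar> + 2 * pi) / 2"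
 have c: "\<bar>Im z\<bar> < c" "c < 2 * pi" using assms by (auto simp: c_def)
 let ?S = "{w. \<bar>Im w\<bar> \<le> c}" and ?U = "{w. \<bar>Im w\<bar> < c}"
 have "open ?U" by (intro open_Collect_less continuous_intros)
 then have int: "z \<in> interior ?S" using c(1) by (intro interiorI[of ?U]) auto
 have cv: "convex ?S"
 proof (rule convexI, clarsimp)
  fix x y :: complex and u v :: real
  assume *: "\<bar>Im x\<bar> \<le> c" "\<bar>Im y\<bar> \<le> c" "0 \<le> u" "0 \<le> v" "u + v = 1"
  have "\<bar>u * Im x + v * Im y\<bar> \<le> u * \<bar>Im x\<bar> + v * \<bar>Im y\<bar>"
   using abs_triangle_ineq[of "u * Im x" "v * Im y"] * by (simp add: abs_mult)
  also have "\<dots> \<le> u * c + v * c" using * by (intro add_mono mult_left_mono) auto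
  also have "\<dots> = c" using * by (simp add: distrib_right[symmetric])
  finally show "\<bar>u * Im x + v * Im y\<bar> \<le> c" .
 qed
 have d: "((\<lambda>z. of_real (image_coeff n) * cos (of_nat (Suc n) * z)) has_field_derivative
   (- of_real (image_coeff n * Suc n) * sin (of_nat (Suc n) * w))) (at w within ?S)" for n and w :: complex
  by (auto intro!: derivative_eq_intros)
 have u: "uniformly_convergent_on ?S (\<lambda>n w. \<Sum>i<n. - of_real (image_coeff i * Suc i) * sin (of_nat (Suc i) * w))"
 proof (rule Weierstrass_m_test'[OF _ image_geometric_summable[OF c(2)]])
  fix n w assume "w \<in> ?S"
  then show "norm (- of_real (image_coeff n * Suc n) * sin (of_nat (Suc n) * w)) \<le> exp (- (2 * pi - c)) ^ Suc n"
   using image_term_bound[OF _ norm_sin_exp_le, of w c n] by simp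
 qed
 show ?thesis
  unfolding image_sum_def[abs_def] image_sum_deriv_def
  by (rule has_field_derivative_series'(2)[where S = ?S and x0 = z, OF cv d u _ image_sum_summable[OF assms] int])
   (use c(1) in auto)
qed

text \<open>On the strip of half-width \<open>3 * pi / 2\<close> the geometric ratio is
  \<open>exp (- pi / 2)\<close>, so another termwise differentiation, which brings in a factor
  \<open>Suc n\<close>, leaves the series summable.\<close>

lemma image_sum_deriv_lipschitz:
 obtains L where "L \<ge> 0" "\<And>z w. \<bar>Im z\<bar> \<le> 3 * pi / 2 ==> \<bar>Im w\<bar> \<le> 3 * pi / 2 ==>
  norm (image_sum_deriv z - image_sum_deriv w) \<le> L * norm (z - w)"
proof -
 define r where "r = exp (- (2 * pi - 3 * pi / 2))"
 have r: "norm r < 1" "r \<ge> 0" by (auto simp: r_def)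
 have s: "summable (\<lambda>n. of_nat (Suc n) * r ^ Suc n)"
  using summable_mult[OF sums_summable[OF geometric_deriv_sums[OF r(1)]], of r]
  by (simp add: mult_ac)
 let ?S = "{w. \<bar>Im w\<bar> \<le> 3 * pi / 2}"
 have conv: "convex ?S"
 proof (rule convexI, clarsimp)
  fix x y :: complex and u v :: real
  assume *: "\<bar>Im x\<bar> * 2 \<le> 3 * pi" "\<bar>Im y\<bar> * 2 \<le> 3 * pi" "0 \<le> u" "0 \<le> v" "u + v = 1"
  have "\<bar>u * Im x + v * Im y\<bar> \<le> u * \<bar>Im x\<bar> + v * \<bar>Im y\<bar>"
   using abs_triangle_ineq[of "u * Im x" "v * Im y"] * by (simp add: abs_mult)
  also have "\<dots> \<le> u * (3 * pi / 2) + v * (3 * pi / 2)" using * by (intro add_mono mult_left_mono) auto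
  also have "\<dots> = (u + v) * (3 * pi / 2)" by (simp only: distrib_right)
  also have "\<dots> = 3 * pi / 2" using * by simp
  finally show "\<bar>u * Im x + v * Im y\<bar> * 2 \<le> 3 * pi" by simp
 qed
 define L where "L = (\<Sum>n. of_nat (Suc n) * r ^ Suc n)"
 have "norm (image_sum_deriv z - image_sum_deriv w) \<le> L * norm (z - w)"
  if zw: "\<bar>Im z\<bar> \<le> 3 * pi / 2" "\<bar>Im w\<bar> \<le> 3 * pi / 2" for z w
 proof -
  let ?f = "\<lambda>n z. - of_real (image_coeff n * Suc n) * sin (of_nat (Suc n) * z) :: complex"
  have strip: "\<bar>Im z\<bar> < 2 * pi" "\<bar>Im w\<bar> < 2 * pi" using zw pi_gt_zero by linarith+
  have lip: "norm (?f n z - ?f n w) \<le> of_nat (Suc n) * r ^ Suc n * norm (z - w)" for n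
  proof (rule field_differentiable_bound[OF conv, where f = "?f n"
    and f' = "\<lambda>z. - of_nat (Suc n) * (of_real (image_coeff n * Suc n) * cos (of_nat (Suc n) * z))"])
   fix u assume u: "u \<in> ?S"
   show "(?f n has_field_derivative - of_nat (Suc n) * (of_real (image_coeff n * Suc n) * cos (of_nat (Suc n) * u))) (at u within ?S)"
    by (auto intro!: derivative_eq_intros simp: algebra_simps)
   show "norm (- of_nat (Suc n) * (of_real (image_coeff n * Suc n) * cos (of_nat (Suc n) * u))) \<le> of_nat (Suc n) * r ^ Suc n"
    unfolding norm_mult[of "- of_nat (Suc n)"] r_def
    using u image_term_bound[OF _ norm_cos_exp_le, of u "3 * pi / 2" n]
    by (intro mult_mono) (auto simp del: of_nat_Suc)
  qed (use zw in auto)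
  have sm: "summable (\<lambda>n. of_nat (Suc n) * r ^ Suc n * norm (z - w))"
   by (rule summable_mult2[OF s])
  have "image_sum_deriv z - image_sum_deriv w = (\<Sum>n. ?f n z - ?f n w)"
   unfolding image_sum_deriv_def
   by (rule suminf_diff) (rule image_sum_deriv_summable, use strip in simp)+
  also have "norm \<dots> \<le> (\<Sum>n. of_nat (Suc n) * r ^ Suc n * norm (z - w))"
   by (rule norm_suminf_le[OF lip sm])
  also have "\<dots> = L * norm (z - w)"
   unfolding L_def by (rule suminf_mult2[OF s, symmetric])
  finally show ?thesis .
 qed
 moreover have "L \<ge> 0" unfolding L_def by (rule suminf_nonneg[OF s]) (use r in auto)
 ultimately show thesis using that by blast
qed

section \<open>The modes of the Green function in one variable\<close>

text \<open>The quadratic term has Laplacian \<open>1 / (4 * pi^2)\<close> and balances the uniform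
  background, the logarithm carries the pole, the image sum restores periodicity in y, and
  \<open>1 / 12\<close> makes the mean zero.\<close>

definition green_expl :: "real => real => real" where
 "green_expl x y = y\<^sup>2 / (8 * pi\<^sup>2) + 1 / 12 - ln (2 * cosh y - 2 * cos x) / (4 * pi)
  + Re (image_sum (Complex x y))"

text \<open>The average in x of the Green function: its second derivative on
  \<open>(0, 2 pi)\<close> is \<open>1 / (4 * pi^2)\<close>, its slope jumps by
  \<open>- 1 / (2 * pi)\<close> at the pole, and its mean is zero.\<close>

definition mode0 :: "real => real" where
 "mode0 y = y\<^sup>2 / (8 * pi\<^sup>2) - y / (4 * pi) + 1 / 12"

text \<open>With \<open>m = Suc n\<close>, the periodic solution of
  \<open>- f'' + m^2 f = \<delta> / pi\<close> in y. It is the coefficient of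
  \<open>cos (m x)\<close> in the Green function.\<close>

definition mode :: "nat => real => real" where
 "mode n y = cosh (Suc n * (pi - y)) / (2 * pi * Suc n * sinh (Suc n * pi))"

lemma sinh_Suc_pi_pos: "sinh (Suc n * pi) > 0"
 by (simp add: sinh_real_pos_iff del: of_nat_Suc)

lemma mode_nonneg: "mode n y \<ge> 0"
 unfolding mode_def using sinh_Suc_pi_pos[of n]
 by (intro divide_nonneg_pos mult_pos_pos) (auto simp del: of_nat_Suc)

text \<open>The exponential is the part without images, which sums to the logarithm; the remainder
  has exponentially small coefficients and gives \<open>image_sum\<close>.\<close>

lemma mode_split: "mode n y = exp (- real (Suc n) * y) / (2 * pi * Suc n) + image_coeff n * cosh (Suc n * y)"
 for y :: real
proof -
 define m where "m = real (Suc n)"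
 define E where "E = exp (m * pi)"
 define Y where "Y = exp (m * y)"
 have m: "m > 0" by (simp add: m_def)
 have E: "E > 1" using m by (simp add: E_def)
 have Y: "Y > 0" by (simp add: Y_def)
 have E2: "E * E > 1" using E by (simp add: less_1_mult)
 have 1: "cosh (m * (pi - y)) = (E / Y + Y / E) / 2"
  unfolding cosh_field_def E_def Y_def by (simp add: right_diff_distrib exp_diff)
 have 2: "sinh (m * pi) = (E - 1 / E) / 2"
  unfolding sinh_field_def E_def by (simp add: exp_minus inverse_eq_divide)
 have 3: "cosh (m * y) = (Y + 1 / Y) / 2"
  unfolding cosh_field_def Y_def by (simp add: exp_minus inverse_eq_divide)
 have 4: "exp (- m * y) = 1 / Y" unfolding Y_def by (simp add: exp_minus inverse_eq_divide)
 have 5: "exp (2 * pi * m) = E * E" unfolding E_def by (simp add: exp_add[symmetric] mult.commute)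
 have "(E / Y + Y / E) / 2 / (2 * pi * m * ((E - 1 / E) / 2))
   = 1 / Y / (2 * pi * m) + 1 / (pi * m * (E * E - 1)) * ((Y + 1 / Y) / 2)"
  using m E Y E2 by (simp add: divide_simps)
 then show ?thesis
  unfolding mode_def image_coeff_def m_def[symmetric] 1 2 3 4 5 .
qed

text \<open>Real part of the Taylor series of \<open>Ln (1 - w)\<close> at
  \<open>w = exp (- y + i x)\<close>, where \<open>norm (1 - w)\<close> squared is
  \<open>exp (- y) * (2 * cosh y - 2 * cos x)\<close>.\<close>

lemma log_series:
 fixes x y :: real
 assumes "y > 0"
 shows "(\<lambda>n. exp (- real (Suc n) * y) / Suc n * cos (Suc n * x)) sums (y / 2 - ln (2 * cosh y - 2 * cos x) / 2)"
proof -
 define w where "w = of_real (exp (- y)) * cis x"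
 have nw: "norm w < 1" using assms by (simp add: w_def norm_mult)
 have w: "w ^ n = of_real (exp (- real n * y)) * cis (n * x)" for n
  unfolding w_def power_mult_distrib of_real_power[symmetric] exp_of_nat_mult[symmetric] Complex.DeMoivre[symmetric]
  by simp
 have "(\<lambda>n. - (w ^ n) / of_nat n) sums ln (1 - w)"
  using Ln_series'[of "- w"] nw by simp
 then have "(\<lambda>n. - (w ^ Suc n) / of_nat (Suc n)) sums ln (1 - w)"
  by (subst sums_Suc_iff) simp
 then have "(\<lambda>n. Re (- (w ^ Suc n) / of_nat (Suc n))) sums Re (ln (1 - w))"
  by (rule sums_Re)
 then have "(\<lambda>n. - Re (- (w ^ Suc n) / of_nat (Suc n))) sums - Re (ln (1 - w))"
  by (rule sums_minus)
 moreover have "- Re (- (w ^ Suc n) / of_nat (Suc n)) = exp (- real (Suc n) * y) / Suc n * cos (Suc n * x)" for n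
  unfolding w by (simp add: Re_divide_of_nat del: of_nat_Suc)
 moreover have "1 - w \<noteq> 0" using nw by auto
 moreover have "(norm (1 - w))\<^sup>2 = exp (- y) * (2 * cosh y - 2 * cos x)"
 proof -
  have "(norm (1 - w))\<^sup>2 = (1 - exp (- y) * cos x)\<^sup>2 + (exp (- y) * sin x)\<^sup>2"
   by (simp add: cmod_power2 w_def)
  also have "\<dots> = 1 - 2 * exp (- y) * cos x + (exp (- y))\<^sup>2 * ((sin x)\<^sup>2 + (cos x)\<^sup>2)"
   by algebra
  also have "\<dots> = 1 - 2 * exp (- y) * cos x + (exp (- y))\<^sup>2"
   by (simp only: sin_cos_squared_add mult_1_right)
  also have "\<dots> = exp (- y) * (2 * cosh y - 2 * cos x)"
   by (simp add: cosh_field_def algebra_simps power2_eq_square exp_add[symmetric])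
  finally show ?thesis .
 qed
 moreover have "cosh y - cos x > 0" by (rule cosh_minus_cos_pos) (use assms in auto)
 ultimately have "2 * ln (norm (1 - w)) = - y + ln (2 * cosh y - 2 * cos x)"
  and "(\<lambda>n. exp (- real (Suc n) * y) / Suc n * cos (Suc n * x)) sums - ln (norm (1 - w))"
  using ln_realpow[of "norm (1 - w)" 2] by (simp_all add: ln_mult Re_Ln)
 moreover from this(1) have "- ln (norm (1 - w)) = y / 2 - ln (2 * cosh y - 2 * cos x) / 2"
  by (simp add: field_simps)
 ultimately show ?thesis by simp
qed

lemma Re_image_term: "Re (of_real c * cos (of_nat m * Complex x y)) = c * cosh (m * y) * cos (m * x)"
 for x y :: real
 by (simp add: Re_cos cosh_field_def)

text \<open>The two parts of the split modes are summed separately. The term \<open>y / 2\<close> of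
  the logarithmic series cancels the linear term of \<open>mode0\<close>.\<close>

lemma green_expl_series:
 fixes x y :: real
 assumes "0 < y" "y < 2 * pi"
 shows "(\<lambda>n. mode n y * cos (Suc n * x)) sums (green_expl x y - mode0 y)"
proof -
 have "(\<lambda>n. of_real (image_coeff n) * cos (of_nat (Suc n) * Complex x y)) sums image_sum (Complex x y)"
  unfolding image_sum_def by (rule summable_sums[OF image_sum_summable]) (use assms in simp)
 from sums_Re[OF this]
 have 1: "(\<lambda>n. image_coeff n * cosh (Suc n * y) * cos (Suc n * x)) sums Re (image_sum (Complex x y))"
  unfolding Re_image_term .
 have 2: "(\<lambda>n. 1 / (2 * pi) * (exp (- real (Suc n) * y) / Suc n * cos (Suc n * x)))
   sums (1 / (2 * pi) * (y / 2 - ln (2 * cosh y - 2 * cos x) / 2))"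
  by (rule sums_mult[OF log_series[OF assms(1)]])
 have "(\<lambda>n. mode n y * cos (Suc n * x)) sums
   (1 / (2 * pi) * (y / 2 - ln (2 * cosh y - 2 * cos x) / 2) + Re (image_sum (Complex x y)))"
  using sums_add[OF 2 1] unfolding mode_split by (simp add: algebra_simps del: of_nat_Suc)
 also have "1 / (2 * pi) * (y / 2 - ln (2 * cosh y - 2 * cos x) / 2) + Re (image_sum (Complex x y))
   = green_expl x y - mode0 y"
  unfolding green_expl_def mode0_def by (simp add: field_simps)
 finally show ?thesis .
qed

text \<open>Every mode is symmetric about \<open>y = pi\<close>, hence so is their sum, although the
  closed formula does not show it. Together with evenness this amounts to periodicity in y.\<close>

lemma green_expl_reflect:
 fixes x y :: real
 assumes "0 < y" "y < 2 * pi"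
 shows "green_expl x (2 * pi - y) = green_expl x y"
proof -
 have "mode n (2 * pi - y) = mode n y" for n
  using cosh_minus[of "Suc n * (pi - y)"] unfolding mode_def
  by (simp add: algebra_simps del: of_nat_Suc cosh_minus)
 then have "green_expl x (2 * pi - y) - mode0 (2 * pi - y) = green_expl x y - mode0 y"
  using green_expl_series[OF assms, of x] green_expl_series[of "2 * pi - y" x] assms sums_unique2
  by fastforce
 moreover have "mode0 (2 * pi - y) = mode0 y"
  unfolding mode0_def by (simp add: power2_eq_square field_simps)
 ultimately show ?thesis by simp
qed

lemma image_sum_uminus: "image_sum (- z) = image_sum z" and image_sum_cnj: "image_sum (cnj z) = cnj (image_sum z)"
 if "\<bar>Im z\<bar> < 2 * pi"
proof -
 show "image_sum (- z) = image_sum z" unfolding image_sum_def by simp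
 have "(\<lambda>n. of_real (image_coeff n) * cos (of_nat (Suc n) * z)) sums image_sum z"
  unfolding image_sum_def by (rule summable_sums[OF image_sum_summable[OF that]])
 then have "(\<lambda>n. cnj (of_real (image_coeff n) * cos (of_nat (Suc n) * z))) sums cnj (image_sum z)"
  by (simp only: sums_cnj)
 then show "image_sum (cnj z) = cnj (image_sum z)"
  unfolding image_sum_def by (simp add: sums_iff cnj_cos del: of_nat_Suc)
qed

text \<open>The coefficients of the image sum are real, so conjugating the argument changes the sign
  of y and keeps the real part.\<close>

lemma green_expl_even: "\<bar>y\<bar> < 2 * pi ==> green_expl x (- y) = green_expl x y"
 using image_sum_cnj[of "Complex x y"] unfolding green_expl_def by (simp add: complex_cnj)

lemma green_expl_period: "green_expl (x + 2 * pi * of_int k) y = green_expl x y"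
proof -
 have 1: "cos (x + 2 * pi * of_int k) = cos x" by (simp add: cos_add)
 have "cos (of_nat (Suc n) * Complex (x + 2 * pi * of_int k) y) = cos (of_nat (Suc n) * Complex x y)" for n
 proof -
  have "of_nat (Suc n) * Complex (x + 2 * pi * of_int k) y
    = of_nat (Suc n) * Complex x y + of_real (2 * pi * of_int (int (Suc n) * k))"
   by (simp add: complex_eq_iff algebra_simps)
  then show ?thesis by (simp only: cos_add cos_of_real sin_of_real sin_int_2pin cos_int_2pin) simp
 qed
 then show ?thesis unfolding green_expl_def image_sum_def 1 by simp
qed

section \<open>Fourier coefficients\<close>

abbreviation closed_square :: "(real \<times> real) set" where
 "closed_square \<equiv> {0..2 * pi} \<times> {0..2 * pi}"

lemma closed_square_sets[measurable]: "closed_square \<in> sets borel"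
 by (intro borel_Times) auto

lemma integral_product:
 fixes f g :: "real => real"
 assumes f: "integrable lborel f" and g: "integrable lborel g"
 shows "integrable lborel (\<lambda>z :: real \<times> real. f (fst z) * g (snd z))"
  and "(\<integral>z. f (fst z) * g (snd z) \<partial>(lborel :: (real \<times> real) measure)) = (\<integral>x. f x \<partial>lborel) * (\<integral>y. g y \<partial>lborel)"
proof -
 note [measurable] = borel_measurable_integrable[OF f] borel_measurable_integrable[OF g]
 have int: "integrable (lborel \<Otimes>\<^sub>M lborel) (\<lambda>z. f (fst z) * g (snd z))"
 proof (rule lborel_pair.Fubini_integrable)
  show "integrable lborel (\<lambda>x. \<integral>y. norm (f (fst (x, y)) * g (snd (x, y))) \<partial>lborel)"
   using f by (simp add: abs_mult)
 qed (use g in auto)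
 then show "integrable lborel (\<lambda>z :: real \<times> real. f (fst z) * g (snd z))" by (simp add: lborel_prod)
 have "(\<integral>z. f (fst z) * g (snd z) \<partial>(lborel \<Otimes>\<^sub>M lborel)) = (\<integral>x. \<integral>y. f (fst (x, y)) * g (snd (x, y)) \<partial>lborel \<partial>lborel)"
  by (rule lborel_pair.integral_fst'[OF int, symmetric])
 then show "(\<integral>z. f (fst z) * g (snd z) \<partial>(lborel :: (real \<times> real) measure)) = (\<integral>x. f x \<partial>lborel) * (\<integral>y. g y \<partial>lborel)"
  by (simp add: lborel_prod)
qed

lemma AE_plane_coords: "AE z in lborel. fst z \<noteq> a \<and> snd z \<noteq> (b :: real)" for a :: real
proof -
 have "AE z in lborel \<Otimes>\<^sub>M lborel. fst z \<noteq> a \<and> snd z \<noteq> b"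
 proof (rule lborel_pair.AE_pair_measure)
  show "AE x in lborel. AE y in lborel. fst (x, y) \<noteq> a \<and> snd (x, y) \<noteq> b"
   using AE_lborel_singleton[of a]
  proof eventually_elim
   case (elim x)
   show ?case using AE_lborel_singleton[of b] by eventually_elim (use elim in auto)
  qed
 qed measurable
 then show ?thesis by (simp only: lborel_prod)
qed

text \<open>The half-open square suits the quotient, the closed one the fundamental theorem of
  calculus, the open one the series; all three agree almost everywhere.\<close>

lemma AE_plane_square: "AE z in lborel. indicator (square 0 0) z = (indicator closed_square z :: real)
  \<and> (z \<in> closed_square \<longrightarrow> 0 < fst z \<and> fst z < 2 * pi \<and> 0 < snd z \<and> snd z < 2 * pi)"
 using AE_plane_coords[of 0 0] AE_plane_coords[of "2 * pi" "2 * pi"]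
 by eventually_elim (auto simp: mem_Times_iff less_le split: split_indicator)

text \<open>The free phase covers sines and cosines in one statement.\<close>

lemma trig_integral:
 fixes a :: int
 shows "has_bochner_integral lborel (\<lambda>x. indicator {0..2 * pi} x * cos (a * x + \<alpha>))
  (if a = 0 then 2 * pi * cos \<alpha> else 0)"
proof (cases "a = 0")
 case True
 have "has_bochner_integral lborel (\<lambda>x. indicator {0..2 * pi} x *\<^sub>R cos \<alpha>) (cos \<alpha> * (2 * pi) - cos \<alpha> * 0)"
  by (rule has_bochner_integral_FTC_Icc)
   (auto intro!: derivative_eq_intros continuous_intros simp: has_real_derivative_iff_has_vector_derivative[symmetric])
 then show ?thesis using True by (simp add: mult.commute)
next
 case False
 have "has_bochner_integral lborel (\<lambda>x. indicator {0..2 * pi} x *\<^sub>R cos (a * x + \<alpha>))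
   (sin (of_int a * (2 * pi) + \<alpha>) / of_int a - sin (of_int a * (0::real) + \<alpha>) / of_int a)"
  by (rule has_bochner_integral_FTC_Icc)
   (use False in \<open>auto intro!: derivative_eq_intros continuous_intros simp: has_real_derivative_iff_has_vector_derivative[symmetric]\<close>)
 moreover have "sin (a * (2 * pi) + \<alpha>) = sin \<alpha>"
  using sin_int_2pin[of a] cos_int_2pin[of a] by (simp add: sin_add mult.commute)
 ultimately show ?thesis using False by simp
qed

text \<open>For \<open>a \<ge> 0\<close> only the difference frequency can vanish, so at most one n
  resonates with a. Negative frequencies are later reduced to this case by symmetry of the
  cosine.\<close>

lemma cos_Suc_integral:
 fixes a :: int
 assumes "a \<ge> 0"
 shows "has_bochner_integral lborel (\<lambda>x. indicator {0..2 * pi} x * (cos (Suc n * x) * cos (a * x + \<alpha>)))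
  (if a = int (Suc n) then pi * cos \<alpha> else 0)"
proof -
 have "cos (Suc n * x) * cos (a * x + \<alpha>)
   = (1/2) * cos ((a + int (Suc n)) * x + \<alpha>) + (1/2) * cos ((a - int (Suc n)) * x + \<alpha>)" for x :: real
 proof -
  have "cos (a * x + \<alpha>) * cos (Suc n * x) = (cos (a * x + \<alpha> - Suc n * x) + cos (a * x + \<alpha> + Suc n * x)) / 2"
   by (rule cos_times_cos)
  then show ?thesis by (simp add: algebra_simps)
 qed
 then have eq: "(\<lambda>x :: real. indicator {0..2 * pi} x * (cos (Suc n * x) * cos (a * x + \<alpha>)))
   = (\<lambda>x :: real. (1/2) * (indicator {0..2 * pi} x * cos ((a + int (Suc n)) * x + \<alpha>))
     + (1/2) * (indicator {0..2 * pi} x * cos ((a - int (Suc n)) * x + \<alpha>)))"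
  by (auto simp: algebra_simps)
 have "has_bochner_integral lborel (\<lambda>x. indicator {0..2 * pi} x * (cos (Suc n * x) * cos (a * x + \<alpha>)))
  ((1/2) * (if a + int (Suc n) = 0 then 2 * pi * cos \<alpha> else 0)
   + (1/2) * (if a - int (Suc n) = 0 then 2 * pi * cos \<alpha> else 0))"
  unfolding eq
  by (intro has_bochner_integral_add has_bochner_integral_mult_right impI trig_integral)
 also have "((1/2) * (if a + int (Suc n) = 0 then 2 * pi * cos \<alpha> else 0)
   + (1/2) * (if a - int (Suc n) = 0 then 2 * pi * cos \<alpha> else 0)) = (if a = int (Suc n) then pi * cos \<alpha> else 0)"
  using assms by auto
 finally show ?thesis .
qed

lemma mode_integral:
 fixes b :: int
 shows "has_bochner_integral lborel (\<lambda>y. indicator {0..2 * pi} y * (mode n y * cos (of_int b * y + \<beta>)))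
  (cos \<beta> / (pi * ((real (Suc n))\<^sup>2 + (real_of_int b)\<^sup>2)))"
proof -
 define m where "m = real (Suc n)"
 define s where "s = 2 * pi * m * sinh (m * pi)"
 have m: "m > 0" by (simp add: m_def)
 have mb: "m\<^sup>2 + (real_of_int b)\<^sup>2 > 0" using m by (simp add: add_pos_nonneg)
 have s: "s > 0" using m sinh_Suc_pi_pos[of n] unfolding s_def m_def[symmetric] by simp
 \<comment> \<open>Primitive found by integrating by parts twice. Over a full period the terms with
   the sine agree at both ends, while those with the hyperbolic sine add up.\<close>
 let ?F = "\<lambda>y::real. (- m * sinh (m * (pi - y)) * cos (of_int b * y + \<beta>) + of_int b * cosh (m * (pi - y)) * sin (of_int b * y + \<beta>))
   / ((m\<^sup>2 + (real_of_int b)\<^sup>2) * s)"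
 have per: "sin (real_of_int b * (2 * pi) + \<beta>) = sin \<beta>" "cos (real_of_int b * (2 * pi) + \<beta>) = cos \<beta>"
  using sin_int_2pin[of b] cos_int_2pin[of b] by (simp_all add: sin_add cos_add mult.commute)
 have "has_bochner_integral lborel (\<lambda>y. indicator {0..2 * pi} y *\<^sub>R (cosh (m * (pi - y)) / s * cos (of_int b * y + \<beta>)))
   (?F (2 * pi) - ?F 0)"
 proof (rule has_bochner_integral_FTC_Icc)
  fix y :: real
  define c where "c = (m\<^sup>2 + (real_of_int b)\<^sup>2) * s"
  have c: "c \<noteq> 0" using mb s m by (simp add: c_def)
  have "((\<lambda>y. (- m * sinh (m * (pi - y)) * cos (of_int b * y + \<beta>) + of_int b * cosh (m * (pi - y)) * sin (of_int b * y + \<beta>)) / c)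
    has_real_derivative ((m\<^sup>2 + (real_of_int b)\<^sup>2) * (cosh (m * (pi - y)) * cos (of_int b * y + \<beta>))) / c) (at y within {0..2 * pi})"
   using c by (auto intro!: derivative_eq_intros simp: power2_eq_square algebra_simps add_divide_distrib)
  also have "((m\<^sup>2 + (real_of_int b)\<^sup>2) * (cosh (m * (pi - y)) * cos (of_int b * y + \<beta>))) / c = cosh (m * (pi - y)) / s * cos (of_int b * y + \<beta>)"
   using mb s m by (simp add: c_def)
  finally show "(?F has_vector_derivative (cosh (m * (pi - y)) / s * cos (of_int b * y + \<beta>))) (at y within {0..2 * pi})"
   unfolding has_real_derivative_iff_has_vector_derivative[symmetric] c_def .
 qed (use s in \<open>auto intro!: continuous_intros\<close>)
 also have "?F (2 * pi) - ?F 0 = cos \<beta> / (pi * (m\<^sup>2 + (real_of_int b)\<^sup>2))"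
 proof -
  have 1: "m * (pi - 2 * pi) = - (m * pi)" by (simp add: algebra_simps)
  have "?F (2 * pi) - ?F 0 = (2 * m * sinh (m * pi)) * cos \<beta> / ((m\<^sup>2 + (real_of_int b)\<^sup>2) * s)"
   unfolding per 1 by (simp add: diff_divide_distrib[symmetric])
  also have "\<dots> = cos \<beta> / (pi * (m\<^sup>2 + (real_of_int b)\<^sup>2))"
  proof -
   have "2 * m * h * C / (D * (2 * pi * m * h)) = C / (pi * D)" if "h \<noteq> 0" for h C D :: real
    using that m by simp
   from this[of "sinh (m * pi)"] show ?thesis
    using sinh_Suc_pi_pos[of n] m unfolding s_def m_def[symmetric] by simp
  qed
  finally show ?thesis .
 qed
 finally show ?thesis
  unfolding mode_def m_def[symmetric] s_def by simp
qed

lemma mode0_integral: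
 fixes b :: int
 shows "has_bochner_integral lborel (\<lambda>y. indicator {0..2 * pi} y * (mode0 y * cos (b * y + \<beta>)))
  (if b = 0 then 0 else cos \<beta> / (2 * pi * b\<^sup>2))"
proof (cases "b = 0")
 case True
 have "has_bochner_integral lborel (\<lambda>y. indicator {0..2 * pi} y *\<^sub>R (mode0 y * cos \<beta>))
  (((2 * pi) ^ 3 / (24 * pi\<^sup>2) - (2 * pi)\<^sup>2 / (8 * pi) + (2 * pi) / 12) * cos \<beta>
   - (0 ^ 3 / (24 * pi\<^sup>2) - 0\<^sup>2 / (8 * pi) + 0 / 12) * cos \<beta>)"
  by (rule has_bochner_integral_FTC_Icc)
   (auto intro!: derivative_eq_intros continuous_intros simp: mode0_def field_simps
    has_real_derivative_iff_has_vector_derivative[symmetric])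
 moreover have "(2 * pi) ^ 3 / (24 * pi\<^sup>2) - (2 * pi)\<^sup>2 / (8 * pi) + (2 * pi) / 12 = 0"
  by (simp add: power2_eq_square power3_eq_cube)
 ultimately show ?thesis using True by simp
next
 case False
 define c where "c = real_of_int b"
 have c: "c \<noteq> 0" using False by (simp add: c_def)
 define k1 k2 where "k1 = 1 / (4 * pi\<^sup>2)" and "k2 = 1 / (4 * pi)"
 \<comment> \<open>Repeated integration by parts, \<open>k1 * y - k2\<close> being the derivative of
   \<open>mode0\<close>. Over a period only the jump \<open>2 * k2\<close> of that derivative
   survives.\<close>
 let ?F = "\<lambda>y. mode0 y * sin (c * y + \<beta>) / c + (k1 * y - k2) * cos (c * y + \<beta>) / c\<^sup>2
   - k1 * sin (c * y + \<beta>) / c ^ 3"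
 have per: "sin (c * (2 * pi) + \<beta>) = sin \<beta>" "cos (c * (2 * pi) + \<beta>) = cos \<beta>"
  using sin_int_2pin[of b] cos_int_2pin[of b] by (simp_all add: c_def sin_add cos_add mult.commute)
 have "has_bochner_integral lborel (\<lambda>y. indicator {0..2 * pi} y *\<^sub>R (mode0 y * cos (c * y + \<beta>))) (?F (2 * pi) - ?F 0)"
 proof (rule has_bochner_integral_FTC_Icc)
  fix y :: real
  have [derivative_intros]: "(mode0 has_real_derivative (k1 * y - k2)) (at y within S)" for S
   unfolding mode0_def[abs_def] k1_def k2_def
   by (auto intro!: derivative_eq_intros simp: power2_eq_square)
  show "(?F has_vector_derivative (mode0 y * cos (c * y + \<beta>))) (at y within {0..2 * pi})"
   unfolding has_real_derivative_iff_has_vector_derivative[symmetric] using c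
   by (auto intro!: derivative_eq_intros simp: field_simps power2_eq_square power3_eq_cube)
 qed (auto intro!: continuous_intros simp: mode0_def)
 also have "?F (2 * pi) - ?F 0 = cos \<beta> / (2 * pi * c\<^sup>2)"
 proof -
  have 1: "mode0 (2 * pi) = mode0 0" by (simp add: mode0_def power2_eq_square)
  have 2: "k1 * (2 * pi) = 2 * k2" by (simp add: k1_def k2_def power2_eq_square)
  have "?F (2 * pi) - ?F 0 = 2 * k2 * cos \<beta> / c\<^sup>2"
   unfolding per 1 2 using c by (simp add: field_simps)
  then show ?thesis by (simp add: k2_def)
 qed
 finally show ?thesis using False by (simp add: c_def)
qed

lemma has_bochner_integral_product:
 fixes f g :: "real => real"
 assumes "has_bochner_integral lborel f I" "has_bochner_integral lborel g J"
 shows "has_bochner_integral lborel (\<lambda>z :: real \<times> real. f (fst z) * g (snd z)) (I * J)"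
 using integral_product[of f g] assms unfolding has_bochner_integral_iff by auto

lemma measurable_plane_coords[measurable]:
 "(\<lambda>z :: real \<times> real. fst z) \<in> borel_measurable borel"
 "(\<lambda>z :: real \<times> real. snd z) \<in> borel_measurable borel"
 by (intro borel_measurable_continuous_onI continuous_intros)+

lemma measurable_green_expl[measurable]:
 "(\<lambda>z. green_expl (fst z) (snd z)) \<in> borel_measurable borel"
proof -
 have [measurable]: "(\<lambda>z :: real \<times> real. cos (of_nat m * Complex (fst z) (snd z))) \<in> borel_measurable borel" for m
  by (intro borel_measurable_continuous_onI) (auto simp: Complex_eq intro!: continuous_intros)
 have [measurable]: "(cosh :: real => real) \<in> borel_measurable borel"
  by (intro borel_measurable_continuous_onI continuous_intros)

 show ?thesis unfolding green_expl_def image_sum_def by measurable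
qed

lemma measurable_mode[measurable]: "mode n \<in> borel_measurable borel" "mode0 \<in> borel_measurable borel"
 unfolding mode_def[abs_def] mode0_def[abs_def]
 by (intro borel_measurable_continuous_onI continuous_intros; use sinh_Suc_pi_pos[of n] in \<open>simp del: of_nat_Suc\<close>)+

text \<open>The mode series is integrated term by term, the integrals of the absolute values being
  at most \<open>2 / (Suc n)^2\<close>. The outcome is what the inverse of \<open>- \<Delta>\<close>
  assigns to the pole.\<close>

lemma green_expl_fourier:
 fixes a b :: int
 assumes a: "a \<ge> 0"
 shows "has_bochner_integral lborel (\<lambda>z. indicator closed_square z
   * (green_expl (fst z) (snd z) * (cos (a * fst z + \<alpha>) * cos (b * snd z + \<beta>))))
  (if a = 0 \<and> b = 0 then 0 else cos \<alpha> * cos \<beta> / ((of_int a)\<^sup>2 + (of_int b)\<^sup>2))"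
proof -
 define e where "e z = cos (a * fst z + \<alpha>) * cos (b * snd z + \<beta>)" for z :: "real \<times> real"
 define f where "f n z = indicator closed_square z * (mode n (snd z) * cos (Suc n * fst z) * e z)"
  for n and z :: "real \<times> real"
 define c where "c n = (if a = int (Suc n) then pi * cos \<alpha> else 0)
  * (cos \<beta> / (pi * ((real (Suc n))\<^sup>2 + (of_int b)\<^sup>2)))" for n
 have [measurable]: "e \<in> borel_measurable borel"
  unfolding e_def[abs_def] by (intro borel_measurable_continuous_onI continuous_intros)
 have ind: "(indicator closed_square z :: real) = indicator {0..2 * pi} (fst z) * indicator {0..2 * pi} (snd z)" for z
  by (auto simp: mem_Times_iff split: split_indicator)
 have f: "has_bochner_integral lborel (f n) (c n)" for n
  using has_bochner_integral_product[OF cos_Suc_integral[OF a, of n \<alpha>] mode_integral[of n b \<beta>]]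
  unfolding f_def[abs_def] c_def e_def ind by (simp add: mult_ac del: of_nat_Suc)
 \<comment> \<open>The modes are nonnegative, so without the cosines they dominate the terms; their
   integrals are the coefficients at frequency zero.\<close>
 define h where "h n z = indicator closed_square z * mode n (snd z)" for n and z :: "real \<times> real"
 have h: "has_bochner_integral lborel (h n) (2 / (real (Suc n))\<^sup>2)" for n
  using has_bochner_integral_product[OF trig_integral[of 0 0] mode_integral[of n 0 0]]
  unfolding h_def[abs_def] ind by (simp add: mult_ac del: of_nat_Suc)
 have le: "norm (f n z) \<le> h n z" for n z
 proof -
  have "\<bar>e z\<bar> \<le> 1" unfolding e_def abs_mult by (intro mult_le_one) auto
  then have "\<bar>cos (Suc n * fst z) * e z\<bar> \<le> 1" unfolding abs_mult by (intro mult_le_one) (auto simp del: of_nat_Suc)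
  then have "mode n (snd z) * \<bar>cos (Suc n * fst z) * e z\<bar> \<le> mode n (snd z) * 1"
   by (intro mult_left_mono mode_nonneg)
  then show ?thesis using mode_nonneg[of n "snd z"]
   unfolding f_def h_def by (auto simp: abs_mult mult.assoc split: split_indicator)
 qed
 have int: "integrable lborel (f n)" for n using f by (simp add: has_bochner_integral_iff)
 have "summable (\<lambda>n. 2 * inverse ((real (Suc n))\<^sup>2))"
  unfolding summable_Suc_iff[of "\<lambda>n. 2 * inverse ((real n)\<^sup>2)"]
  by (intro summable_mult inverse_power_summable) simp
 then have sn: "summable (\<lambda>n. \<integral>z. norm (f n z) \<partial>lborel)"
 proof (rule summable_comparison_test'[where N = 0])
  fix n
  have "(\<integral>z. norm (f n z) \<partial>lborel) \<le> (\<integral>z. h n z \<partial>lborel)"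
   using h[of n] int[of n] le by (intro integral_mono) (auto simp: has_bochner_integral_iff)
  then show "norm (\<integral>z. norm (f n z) \<partial>lborel) \<le> 2 * inverse ((real (Suc n))\<^sup>2)"
   using h[of n] by (simp add: has_bochner_integral_iff inverse_eq_divide)
 qed
 have sae: "AE z in lborel. summable (\<lambda>n. norm (f n z))"
  using AE_plane_square
 proof eventually_elim
  case (elim z)
  show ?case
  proof (cases "z \<in> closed_square")
   case True
   \<comment> \<open>At \<open>x = 0\<close> all cosines are 1, and the known expansion becomes the
     series of the modes themselves.\<close>
   then have "(\<lambda>n. mode n (snd z) * cos (real (Suc n) * 0)) sums (green_expl 0 (snd z) - mode0 (snd z))"
    using elim by (intro green_expl_series) auto
   then have "summable (\<lambda>n. mode n (snd z))" by (simp add: sums_iff)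
   then show ?thesis
    by (rule summable_comparison_test'[where N = 0]) (use le[of _ z] True in \<open>simp add: h_def\<close>)
  qed (simp add: f_def)
 qed
 have eq: "AE z in lborel. (\<Sum>n. f n z) = indicator closed_square z * ((green_expl (fst z) (snd z) - mode0 (snd z)) * e z)"
  using AE_plane_square
 proof eventually_elim
  case (elim z)
  show ?case
  proof (cases "z \<in> closed_square")
   case True
   then have "(\<lambda>n. mode n (snd z) * cos (Suc n * fst z) * e z) sums ((green_expl (fst z) (snd z) - mode0 (snd z)) * e z)"
    using elim by (intro sums_mult2 green_expl_series) auto
   then show ?thesis using True by (simp add: f_def sums_iff del: of_nat_Suc)
  qed (simp add: f_def)
 qed
 have [measurable]: "f n \<in> borel_measurable borel" for n
  using borel_measurable_integrable[OF int[of n]] by simp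
 have csum: "c sums (if a = 0 then 0 else cos \<alpha> * cos \<beta> / ((of_int a)\<^sup>2 + (of_int b)\<^sup>2))"
 proof (cases "a = 0")
  case True
  then show ?thesis by (simp add: c_def[abs_def])
 next
  case False
  \<comment> \<open>Modes are counted from 0 but have frequency \<open>Suc n\<close>, so the one
    resonating with a has index \<open>a - 1\<close>.\<close>
  define k where "k = nat a - 1"
  have k: "a = int (Suc k)" using False a by (simp add: k_def)
  have ceq: "c = (\<lambda>n. if n = k then c k else 0)" by (auto simp: c_def k)
  have "c sums c k"
   by (rule ssubst[OF ceq, of "\<lambda>f. f sums c k"]) (rule sums_single[of k "\<lambda>_. c k"])
  then show ?thesis using False by (simp add: c_def k)
 qed
 have "has_bochner_integral lborel (\<lambda>z. \<Sum>n. f n z) (if a = 0 then 0 else cos \<alpha> * cos \<beta> / ((of_int a)\<^sup>2 + (of_int b)\<^sup>2))"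
  unfolding has_bochner_integral_iff
 proof
  show "integrable lborel (\<lambda>z. \<Sum>n. f n z)" by (rule integrable_suminf[OF int sae sn])
  have "c sums (\<integral>z. (\<Sum>n. f n z) \<partial>lborel)"
   using sums_integral[OF int sae sn] f by (simp add: has_bochner_integral_iff)
  then show "(\<integral>z. (\<Sum>n. f n z) \<partial>lborel) = (if a = 0 then 0 else cos \<alpha> * cos \<beta> / ((of_int a)\<^sup>2 + (of_int b)\<^sup>2))"
   using csum sums_unique2 by blast
 qed
 then have 1: "has_bochner_integral lborel (\<lambda>z. indicator closed_square z * ((green_expl (fst z) (snd z) - mode0 (snd z)) * e z))
   (if a = 0 then 0 else cos \<alpha> * cos \<beta> / ((of_int a)\<^sup>2 + (of_int b)\<^sup>2))"
 proof (rule has_bochner_integralI_AE[OF _ _ eq])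
  have [measurable]: "(indicator closed_square :: _ => real) \<in> borel_measurable borel"
   using closed_square_sets by (rule borel_measurable_indicator)
  have [measurable]: "(\<lambda>z :: real \<times> real. mode0 (snd z)) \<in> borel_measurable borel"
   by (rule measurable_compose[OF measurable_plane_coords(2) measurable_mode(2)])
  show "(\<lambda>z. indicator closed_square z * ((green_expl (fst z) (snd z) - mode0 (snd z)) * e z)) \<in> borel_measurable lborel"
   unfolding measurable_lborel2 by (intro borel_measurable_times borel_measurable_diff) measurable
 qed
 have 2: "has_bochner_integral lborel (\<lambda>z. indicator closed_square z * (mode0 (snd z) * e z))
  ((if a = 0 then 2 * pi * cos \<alpha> else 0) * (if b = 0 then 0 else cos \<beta> / (2 * pi * b\<^sup>2)))"
  using has_bochner_integral_product[OF trig_integral[of a \<alpha>] mode0_integral[of b \<beta>]]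
  unfolding e_def ind by (simp only: mult_ac)
 have 3: "(\<lambda>z. indicator closed_square z * (green_expl (fst z) (snd z) * e z))
  = (\<lambda>z. indicator closed_square z * ((green_expl (fst z) (snd z) - mode0 (snd z)) * e z)
     + indicator closed_square z * (mode0 (snd z) * e z))"
  by (auto simp: algebra_simps)
 show ?thesis
  using has_bochner_integral_add[OF 1 2] unfolding 3[symmetric]
  by (auto simp: e_def split: if_splits)
qed

section \<open>Trigonometric polynomials on the torus\<close>

text \<open>The free phases make the family stable under differentiation, which shifts a phase by
  \<open>pi / 2\<close>, and, up to sums, under multiplication. Periodicity makes the choice of the
  lift irrelevant.\<close>

definition trig :: "int => int => real => real => torus => real" where
 "trig a b \<alpha> \<beta> p = cos (a * fst (rep_torus p) + \<alpha>) * cos (b * snd (rep_torus p) + \<beta>)"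

lemma cos_period_int: "cos (of_int a * (x + 2 * pi * of_int m) + \<alpha>) = cos (of_int a * x + \<alpha>)"
proof -
 have "of_int a * (x + 2 * pi * of_int m) + \<alpha> = (of_int a * x + \<alpha>) + 2 * pi * of_int (a * m)"
  by (simp add: algebra_simps)
 then show ?thesis by (simp only: cos_add sin_int_2pin cos_int_2pin) simp
qed

lemma trig_to_torus: "trig a b \<alpha> \<beta> (to_torus (x, y)) = cos (of_int a * x + \<alpha>) * cos (of_int b * y + \<beta>)"
proof -
 obtain x' y' where xy: "rep_torus (to_torus (x, y)) = (x', y')" by fastforce
 have "to_torus (x', y') = to_torus (x, y)" using to_torus_rep[of "to_torus (x, y)"] xy by simp
 then obtain m n :: int where mn: "x' = x + 2 * pi * of_int m" "y' = y + 2 * pi * of_int n"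
  unfolding to_torus_eq_iff torus_lattice_iff by (auto simp: algebra_simps)
 show ?thesis unfolding trig_def xy fst_conv snd_conv mn cos_period_int ..
qed

lemma torus_cases: obtains x y where "p = to_torus (x, y)"
 using to_torus_rep[of p] by (metis surj_pair)

text \<open>The projection is open, so the preimage of an open set under f is the image of an open
  set of the plane.\<close>

lemma continuous_on_torusI:
 fixes f :: "torus => 'a :: topological_space"
 assumes "continuous_on UNIV (\<lambda>z. f (to_torus z))"
 shows "continuous_on UNIV f"
proof -
 have "open (f -` U)" if "open U" for U
 proof -
  have "open ((\<lambda>z. f (to_torus z)) -` U)" using assms that by (simp add: continuous_on_open_vimage)
  then have "open (to_torus ` ((\<lambda>z. f (to_torus z)) -` U))" by (rule open_to_torus)
  also have "to_torus ` ((\<lambda>z. f (to_torus z)) -` U) = f -` U"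
  proof (intro equalityI subsetI)
   fix p assume p: "p \<in> f -` U"
   show "p \<in> to_torus ` ((\<lambda>z. f (to_torus z)) -` U)"
    by (rule image_eqI[of _ _ "rep_torus p"]) (use p in \<open>simp_all add: to_torus_rep\<close>)
  qed auto
  finally show ?thesis .
 qed
 then show ?thesis by (simp add: continuous_on_open_vimage)
qed

lemma continuous_trig: "continuous_on UNIV (trig a b \<alpha> \<beta>)"
proof (rule continuous_on_torusI)
 have "(\<lambda>z. trig a b \<alpha> \<beta> (to_torus z)) = (\<lambda>z. cos (of_int a * fst z + \<alpha>) * cos (of_int b * snd z + \<beta>))"
  by (auto simp: trig_to_torus)
 moreover have "continuous_on UNIV (\<lambda>z :: real \<times> real. cos (of_int a * fst z + \<alpha>) * cos (of_int b * snd z + \<beta>))"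
  by (intro continuous_intros)
 ultimately show "continuous_on UNIV (\<lambda>z. trig a b \<alpha> \<beta> (to_torus z))" by (simp only:)
qed

lemma trig_partials:
 "((\<lambda>h. c * trig a b \<alpha> \<beta> (p + to_torus (h, 0))) has_field_derivative (c * a * trig a b (\<alpha> + pi / 2) \<beta> p)) (at 0)"
 "((\<lambda>h. c * trig a b \<alpha> \<beta> (p + to_torus (0, h))) has_field_derivative (c * b * trig a b \<alpha> (\<beta> + pi / 2) p)) (at 0)"
proof -
 obtain x y where p: "p = to_torus (x, y)" by (rule torus_cases)
 have "cos (u + pi / 2) = - sin u" for u :: real by (simp add: cos_add)
 note q = this[of "of_int a * x + \<alpha>"] this[of "of_int b * y + \<beta>"]
 show "((\<lambda>h. c * trig a b \<alpha> \<beta> (p + to_torus (h, 0))) has_field_derivative (c * a * trig a b (\<alpha> + pi / 2) \<beta> p)) (at 0)"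
  "((\<lambda>h. c * trig a b \<alpha> \<beta> (p + to_torus (0, h))) has_field_derivative (c * b * trig a b \<alpha> (\<beta> + pi / 2) p)) (at 0)"
  unfolding p to_torus_add[symmetric] add_Pair trig_to_torus add.assoc[symmetric] q
  by (auto intro!: derivative_eq_intros)
qed

lemma trig_pd:
 "pd1 (\<lambda>p. c * trig a b \<alpha> \<beta> p) = (\<lambda>p. c * a * trig a b (\<alpha> + pi / 2) \<beta> p)"
 "pd2 (\<lambda>p. c * trig a b \<alpha> \<beta> p) = (\<lambda>p. c * b * trig a b \<alpha> (\<beta> + pi / 2) p)"
 unfolding pd1_def[abs_def] pd2_def[abs_def] by (auto intro!: DERIV_imp_deriv trig_partials)

lemma smooth_trig: "smooth (\<lambda>p. c * trig a b \<alpha> \<beta> p)"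
proof -
 have "C_class n (\<lambda>p. c * trig a b \<alpha> \<beta> p)" for n c \<alpha> \<beta>
 proof (induction n arbitrary: c \<alpha> \<beta>)
  case 0
  show ?case by (auto intro!: continuous_intros continuous_trig)
 next
  case (Suc n)
  have "(\<lambda>h. c * trig a b \<alpha> \<beta> (p + to_torus (h, 0))) field_differentiable at 0"
   "(\<lambda>h. c * trig a b \<alpha> \<beta> (p + to_torus (0, h))) field_differentiable at 0" for p
   unfolding field_differentiable_def using trig_partials by blast+
  then show ?case unfolding C_class.simps trig_pd
   using Suc by (auto intro!: continuous_intros continuous_trig)
 qed
 then show ?thesis by (simp add: smooth_def)
qed

lemma integral_torus_closed_square:
 fixes f :: "torus => real"
 assumes [measurable]: "f \<in> borel_measurable borel"
 shows "(\<integral>p. f p \<partial>torus_lebesgue) = (\<integral>z. indicator closed_square z * f (to_torus z) \<partial>lborel)"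
  and "integrable torus_lebesgue f \<longleftrightarrow> integrable lborel (\<lambda>z. indicator closed_square z * f (to_torus z))"
proof -
 have ae: "AE z in lborel. indicator (square 0 0) z *\<^sub>R f (to_torus z) = indicator closed_square z * f (to_torus z)"
  using AE_plane_square by eventually_elim auto
 show "(\<integral>p. f p \<partial>torus_lebesgue) = (\<integral>z. indicator closed_square z * f (to_torus z) \<partial>lborel)"
  unfolding integral_torus_square(1)[OF assms] by (rule integral_cong_AE[OF _ _ ae]) measurable
 show "integrable torus_lebesgue f \<longleftrightarrow> integrable lborel (\<lambda>z. indicator closed_square z * f (to_torus z))"
  unfolding integral_torus_square(2)[OF assms] by (rule integrable_cong_AE[OF _ _ ae]) measurable
qed

lemma measurable_trig[measurable]: "trig a b \<alpha> \<beta> \<in> borel_measurable borel"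
 by (intro borel_measurable_continuous_onI continuous_trig)

lemma trig_mean: "(\<integral>p. trig a b \<alpha> \<beta> p \<partial>torus_lebesgue) = (if a = 0 \<and> b = 0 then 4 * pi\<^sup>2 * (cos \<alpha> * cos \<beta>) else 0)"
proof -
 have "(\<integral>p. trig a b \<alpha> \<beta> p \<partial>torus_lebesgue) = (\<integral>z. indicator closed_square z * trig a b \<alpha> \<beta> (to_torus z) \<partial>lborel)"
  by (rule integral_torus_closed_square) measurable
 also have "\<dots> = (\<integral>z. indicator {0..2 * pi} (fst z) * cos (a * fst z + \<alpha>) * (indicator {0..2 * pi} (snd z) * cos (b * snd z + \<beta>)) \<partial>(lborel :: (real \<times> real) measure))"
  by (intro Bochner_Integration.integral_cong refl)
   (auto simp: trig_to_torus mem_Times_iff split: split_indicator)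
 also have "\<dots> = (if a = 0 then 2 * pi * cos \<alpha> else 0) * (if b = 0 then 2 * pi * cos \<beta> else 0)"
  by (rule has_bochner_integral_integral_eq[OF has_bochner_integral_product[OF trig_integral trig_integral]])
 finally show ?thesis by (auto simp: power2_eq_square)
qed

text \<open>The defining equation is tested with \<open>trig a b \<alpha> \<beta>\<close>, an
  eigenfunction of \<open>- \<Delta>\<close> with eigenvalue \<open>a^2 + b^2\<close> and zero mean,
  so that only its value at the origin remains. The constant case is the zero mean of G.\<close>

lemma green_fourier:
 assumes G: "green_function G"
 shows "(\<integral>p. G p * trig a b \<alpha> \<beta> p \<partial>torus_lebesgue)
  = (if a = 0 \<and> b = 0 then 0 else cos \<alpha> * cos \<beta> / ((of_int a)\<^sup>2 + (of_int b)\<^sup>2))"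
proof (cases "a = 0 \<and> b = 0")
 case True
 then have "trig a b \<alpha> \<beta> p = cos \<alpha> * cos \<beta>" for p by (simp add: trig_def)
 then show ?thesis using G True by (simp add: green_function_def zero_mean_def)
next
 case False
 then have pos: "(of_int a)\<^sup>2 + (of_int b)\<^sup>2 > (0::real)"
  by (simp add: sum_power2_gt_zero_iff)
 have cos_shift: "cos (u + pi / 2 + pi / 2) = - cos u" for u :: real
  by (simp add: cos_add sin_add)
 have shift: "trig a b (\<alpha> + pi / 2 + pi / 2) \<beta> p = - trig a b \<alpha> \<beta> p"
  "trig a b \<alpha> (\<beta> + pi / 2 + pi / 2) p = - trig a b \<alpha> \<beta> p" for p
  by (simp_all only: trig_def add.assoc[symmetric] cos_shift mult_minus_left mult_minus_right)
 have pd: "- (pd1 (pd1 (trig a b \<alpha> \<beta>)) p + pd2 (pd2 (trig a b \<alpha> \<beta>)) p)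
   = ((of_int a)\<^sup>2 + (of_int b)\<^sup>2) * trig a b \<alpha> \<beta> p" for p
  using trig_pd[of 1 a b \<alpha> \<beta>] shift by (simp add: trig_pd power2_eq_square algebra_simps)
 have "(\<integral>p. G p * (- (pd1 (pd1 (trig a b \<alpha> \<beta>)) p + pd2 (pd2 (trig a b \<alpha> \<beta>)) p)) \<partial>torus_lebesgue)
   = trig a b \<alpha> \<beta> 0 - (\<integral>p. trig a b \<alpha> \<beta> p \<partial>torus_lebesgue) / (4 * pi\<^sup>2)"
  using G smooth_trig[of 1] unfolding green_function_def by simp
 then have "(\<integral>p. ((of_int a)\<^sup>2 + (of_int b)\<^sup>2) * (G p * trig a b \<alpha> \<beta> p) \<partial>torus_lebesgue) = trig a b \<alpha> \<beta> 0"
  unfolding pd trig_mean using False by (auto simp: mult_ac)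
 then have "((of_int a)\<^sup>2 + (of_int b)\<^sup>2) * (\<integral>p. G p * trig a b \<alpha> \<beta> p \<partial>torus_lebesgue) = cos \<alpha> * cos \<beta>"
  using trig_to_torus[of a b \<alpha> \<beta> 0 0] by (simp add: to_torus_0[unfolded zero_prod_def])
 then have "(\<integral>p. G p * trig a b \<alpha> \<beta> p \<partial>torus_lebesgue) = cos \<alpha> * cos \<beta> / ((of_int a)\<^sup>2 + (of_int b)\<^sup>2)"
  by (intro eq_divide_imp[OF less_imp_neq[OF pos, symmetric]]) (simp add: mult.commute)
 then show ?thesis using False by auto
qed

inductive trig_poly :: "(torus => real) => bool" where
 trig: "trig_poly (\<lambda>p. c * trig a b \<alpha> \<beta> p)"
| add: "trig_poly f ==> trig_poly g ==> trig_poly (\<lambda>p. f p + g p)"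

text \<open>Product-to-sum formulas in each variable turn a product into four terms of the same
  kind.\<close>

lemma trig_poly_mult_trig: "trig_poly f ==> trig_poly (\<lambda>p. (c * trig a b \<alpha> \<beta> p) * f p)"
proof (induction rule: trig_poly.induct)
 case (trig d a' b' \<alpha>' \<beta>')
 have "(c * trig a b \<alpha> \<beta> p) * (d * trig a' b' \<alpha>' \<beta>' p)
  = (c * d / 4 * trig (a - a') (b - b') (\<alpha> - \<alpha>') (\<beta> - \<beta>') p + c * d / 4 * trig (a - a') (b + b') (\<alpha> - \<alpha>') (\<beta> + \<beta>') p)
  + (c * d / 4 * trig (a + a') (b - b') (\<alpha> + \<alpha>') (\<beta> - \<beta>') p + c * d / 4 * trig (a + a') (b + b') (\<alpha> + \<alpha>') (\<beta> + \<beta>') p)" for p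
 proof -
  define u u' v v' where "u = a * fst (rep_torus p) + \<alpha>" and "u' = a' * fst (rep_torus p) + \<alpha>'"
   and "v = b * snd (rep_torus p) + \<beta>" and "v' = b' * snd (rep_torus p) + \<beta>'"
  have t: "trig a b \<alpha> \<beta> p = cos u * cos v" "trig a' b' \<alpha>' \<beta>' p = cos u' * cos v'"
   "trig (a - a') (b - b') (\<alpha> - \<alpha>') (\<beta> - \<beta>') p = cos (u - u') * cos (v - v')"
   "trig (a - a') (b + b') (\<alpha> - \<alpha>') (\<beta> + \<beta>') p = cos (u - u') * cos (v + v')"
   "trig (a + a') (b - b') (\<alpha> + \<alpha>') (\<beta> - \<beta>') p = cos (u + u') * cos (v - v')"
   "trig (a + a') (b + b') (\<alpha> + \<alpha>') (\<beta> + \<beta>') p = cos (u + u') * cos (v + v')"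
   by (simp_all add: trig_def u_def u'_def v_def v'_def algebra_simps)
  have "(c * (cos u * cos v)) * (d * (cos u' * cos v')) = c * d * ((cos u * cos u') * (cos v * cos v'))"
   by simp
  also have "\<dots> = c * d * ((cos (u - u') + cos (u + u')) / 2 * ((cos (v - v') + cos (v + v')) / 2))"
   by (simp only: cos_times_cos)
  finally show ?thesis unfolding t by (simp add: field_simps)
 qed
 then show ?case by (simp only:) (intro trig_poly.intros)
next
 case (add f g)
 then show ?case using trig_poly.add[OF add.IH] by (simp add: algebra_simps)
qed

lemma trig_poly_mult: "trig_poly f ==> trig_poly g ==> trig_poly (\<lambda>p. f p * g p)"
proof (induction rule: trig_poly.induct)
 case (trig c a b \<alpha> \<beta>)
 then show ?case by (rule trig_poly_mult_trig)
next
 case (add f g')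
 then show ?case using trig_poly.add[of "\<lambda>p. f p * g p" "\<lambda>p. g' p * g p"] by (simp add: algebra_simps)
qed

lemma continuous_trig_poly: "trig_poly f ==> continuous_on UNIV f"
 by (induction rule: trig_poly.induct) (auto intro!: continuous_intros continuous_trig)

text \<open>Stone-Weierstrass. Distinct points have a coordinate in which they differ by no multiple
  of \<open>2 * pi\<close>, and a cosine centred at the first point tells them apart.\<close>

lemma trig_poly_dense:
 assumes "continuous_on UNIV f" "e > 0"
 shows "\<exists>g. trig_poly g \<and> (\<forall>p\<in>UNIV. \<bar>f p - g p\<bar> < e)"
proof (rule Stone_Weierstrass_HOL[OF compact_torus _ _ _ _ _ assms])
 show "trig_poly (\<lambda>p. c)" for c using trig_poly.trig[of c 0 0 0 0] by (simp add: trig_def)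
 show "continuous_on UNIV f" if "trig_poly f" for f using that by (rule continuous_trig_poly)
 show "trig_poly (\<lambda>p. f p + g p)" if "trig_poly f \<and> trig_poly g" for f g using that trig_poly.add by blast
 show "trig_poly (\<lambda>p. f p * g p)" if "trig_poly f \<and> trig_poly g" for f g using that trig_poly_mult by blast
 fix p q :: torus assume pq: "p \<in> UNIV \<and> q \<in> UNIV \<and> p \<noteq> q"
 obtain x y where p: "p = to_torus (x, y)" by (rule torus_cases)
 obtain x' y' where q: "q = to_torus (x', y')" by (rule torus_cases)
 have tr: "trig_poly (trig a b \<alpha> \<beta>)" for a b \<alpha> \<beta> using trig_poly.trig[of 1] by simp
 have "cos (x' - x) \<noteq> 1 \<or> cos (y' - y) \<noteq> 1"
 proof (rule ccontr)
  assume "\<not> ?thesis"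
  then obtain m n :: int where "x' - x = of_int m * 2 * pi" "y' - y = of_int n * 2 * pi"
   by (auto simp: cos_one_2pi_int)
  then have "x' = x + 2 * pi * of_int m" "y' = y + 2 * pi * of_int n" by (simp_all add: algebra_simps)
  then show False using pq to_torus_periodic[of x m y n] by (simp add: p q)
 qed
 then consider "cos (x' - x) \<noteq> 1" | "cos (y' - y) \<noteq> 1" by blast
 then show "\<exists>f. trig_poly f \<and> f p \<noteq> f q"
 proof cases
  case 1
  then show ?thesis using tr[of 1 0 "-x" 0] by (intro exI[of _ "trig 1 0 (-x) 0"]) (simp add: p q trig_to_torus)
 next
  case 2
  then show ?thesis using tr[of 0 1 0 "-y"] by (intro exI[of _ "trig 0 1 0 (-y)"]) (simp add: p q trig_to_torus)
 qed
qed


section \<open>Identification of the Green function\<close>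

text \<open>Uniqueness of Fourier coefficients for an integrable function, by uniform approximation
  of f. E lives in the plane because it will be cut off to one period square: the explicit formula
  is a function of lifts, not of torus points.\<close>

lemma integral_zero_if_fourier_zero:
 fixes E :: "real \<times> real => real"
 assumes D: "integrable lborel E"
  and zero: "\<And>a b \<alpha> \<beta>. (\<integral>z. E z * trig a b \<alpha> \<beta> (to_torus z) \<partial>lborel) = 0"
  and f: "continuous_on UNIV f"
 shows "(\<integral>z. E z * f (to_torus z) \<partial>lborel) = 0"
proof -
 note [measurable] = borel_measurable_integrable[OF D]
 have cont_meas: "(\<lambda>z. g (to_torus z)) \<in> borel_measurable borel" if "continuous_on UNIV g" for g :: "torus => real"
  by (rule measurable_compose[OF measurable_to_torus borel_measurable_continuous_onI[OF that]])
 have int: "integrable lborel (\<lambda>z. E z * g (to_torus z))"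
  if g: "continuous_on UNIV g" for g :: "torus => real"
 proof -
  obtain B where B: "\<And>p. \<bar>g p\<bar> \<le> B"
   using compact_continuous_image[OF g compact_torus] compact_imp_bounded bounded_iff
   by (metis rangeI real_norm_def)
  have [measurable]: "(\<lambda>z. g (to_torus z)) \<in> borel_measurable borel" by (rule cont_meas[OF g])
  have "integrable lborel (\<lambda>z. E z * g (to_torus z))"
  proof (rule Bochner_Integration.integrable_bound[of _ "\<lambda>z. B * E z"])
   show "AE z in lborel. norm (E z * g (to_torus z)) \<le> norm (B * E z)"
   proof (rule AE_I2)
    fix z
    have "\<bar>g (to_torus z)\<bar> \<le> \<bar>B\<bar>" using B[of "to_torus z"] by simp
    then show "norm (E z * g (to_torus z)) \<le> norm (B * E z)"
     unfolding real_norm_def abs_mult by (subst mult.commute) (intro mult_right_mono abs_ge_zero)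
   qed
  qed (use D in auto)
  then show ?thesis .
 qed
 have poly: "(\<integral>z. E z * g (to_torus z) \<partial>lborel) = 0" if "trig_poly g" for g
  using that
 proof (induction rule: trig_poly.induct)
  case (trig c a b \<alpha> \<beta>)
  have "(\<lambda>z. E z * (c * trig a b \<alpha> \<beta> (to_torus z)))
   = (\<lambda>z. c * (E z * trig a b \<alpha> \<beta> (to_torus z)))" by auto
  then show ?case using zero by simp
 next
  case (add f g)
  have "(\<lambda>z. E z * (f (to_torus z) + g (to_torus z)))
   = (\<lambda>z. E z * f (to_torus z) + E z * g (to_torus z))"
   by (auto simp: algebra_simps)
  then show ?case using add int[OF continuous_trig_poly] by simp
 qed
 define J where "J = (\<integral>z. \<bar>E z\<bar> \<partial>lborel)"
 have J: "J \<ge> 0" unfolding J_def by simp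
 have "\<bar>\<integral>z. E z * f (to_torus z) \<partial>lborel\<bar> \<le> e" if e: "e > 0" for e
 proof -
  \<comment> \<open>The summand 1 keeps the divisor positive when E vanishes almost
    everywhere.\<close>
  define d where "d = e / (J + 1)"
  have d: "d > 0" using e J by (simp add: d_def)
  obtain g where g: "trig_poly g" "\<And>p. \<bar>f p - g p\<bar> < d" using trig_poly_dense[OF f d] by auto
  have cg: "continuous_on UNIV g" by (rule continuous_trig_poly[OF g(1)])
  have cfg: "continuous_on UNIV (\<lambda>p. f p - g p)" by (intro continuous_intros f cg)
  have "(\<integral>z. E z * f (to_torus z) \<partial>lborel)
    = (\<integral>z. E z * f (to_torus z) \<partial>lborel) - (\<integral>z. E z * g (to_torus z) \<partial>lborel)"
   using poly[OF g(1)] by simp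
  also have "\<dots> = (\<integral>z. E z * f (to_torus z) - E z * g (to_torus z) \<partial>lborel)"
   by (rule Bochner_Integration.integral_diff[OF int[OF f] int[OF cg], symmetric])
  also have "\<dots> = (\<integral>z. E z * (f (to_torus z) - g (to_torus z)) \<partial>lborel)"
   by (simp add: algebra_simps)
  also have "\<bar>\<dots>\<bar> \<le> (\<integral>z. \<bar>E z * (f (to_torus z) - g (to_torus z))\<bar> \<partial>lborel)"
   by (rule integral_abs_bound)
  also have "\<dots> \<le> (\<integral>z. d * \<bar>E z\<bar> \<partial>lborel)"
  proof (rule integral_mono)
   show "integrable lborel (\<lambda>z. \<bar>E z * (f (to_torus z) - g (to_torus z))\<bar>)"
    using int[OF cfg] by (rule integrable_abs)
   show "integrable lborel (\<lambda>z. d * \<bar>E z\<bar>)"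
    by (intro integrable_mult_right integrable_abs D)
   fix z
   have "\<bar>E z\<bar> * \<bar>f (to_torus z) - g (to_torus z)\<bar> \<le> \<bar>E z\<bar> * d"
    using g(2)[of "to_torus z"] by (intro mult_left_mono) auto
   then show "\<bar>E z * (f (to_torus z) - g (to_torus z))\<bar> \<le> d * \<bar>E z\<bar>"
    by (simp add: abs_mult mult_ac)
  qed
  also have "\<dots> = d * J" by (simp add: J_def)
  also have "\<dots> \<le> e" using e J by (simp add: d_def field_simps)
  finally show ?thesis .
 qed
 then have "\<bar>\<integral>z. E z * f (to_torus z) \<partial>lborel\<bar> \<le> 0"
  by (rule field_le_epsilon) simp
 then show ?thesis by simp
qed

text \<open>If the two continuous functions differed at a point, their difference would have a fixed
  sign near it and a nonzero integral against a bump there, although all its Fourier coefficients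
  vanish.\<close>

lemma green_eq_expl_open_square:
 assumes G: "green_function G" and z0: "0 < x0" "x0 < 2 * pi" "0 < y0" "y0 < 2 * pi"
 shows "G (to_torus (x0, y0)) = green_expl x0 y0"
proof (rule ccontr)
 define Q where "Q = {0<..<2 * pi} \<times> {0<..<2 * pi :: real}"
 have oQ: "open Q" unfolding Q_def by (intro open_Times) auto
 define D where "D z = G (to_torus z) - green_expl (fst z) (snd z)" for z
 assume "G (to_torus (x0, y0)) \<noteq> green_expl x0 y0"
 then have D0: "D (x0, y0) \<noteq> 0" by (simp add: D_def)
 define s where "s = sgn (D (x0, y0))"
 have s: "s \<noteq> 0" "s * D (x0, y0) > 0" using D0 by (auto simp: s_def sgn_if)
 have Gint: "integrable torus_lebesgue G" and Gcont: "continuous_on (- {0}) G"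
  using G by (auto simp: green_function_def zero_mean_def)
 have [measurable]: "G \<in> borel_measurable borel" using borel_measurable_integrable[OF Gint] by (simp cong: measurable_cong_sets)
 have [measurable]: "(\<lambda>z. G (to_torus z)) \<in> borel_measurable borel" by measurable
 have Gi: "integrable lborel (\<lambda>z. indicator closed_square z * G (to_torus z))"
  using Gint integral_torus_closed_square(2)[of G] by simp
 have gi: "integrable lborel (\<lambda>z. indicator closed_square z * green_expl (fst z) (snd z))"
  using green_expl_fourier[of 0 0 0 0] by (simp add: has_bochner_integral_iff)
 have Di: "integrable lborel (\<lambda>z. indicator closed_square z * D z)"
  using Bochner_Integration.integrable_diff[OF Gi gi] unfolding D_def right_diff_distrib .
 \<comment> \<open>Changing the sign of frequency and phase leaves a cosine unchanged; this reduces
   \<open>a < 0\<close> to the computed coefficients.\<close>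
 have neg: "trig a b \<alpha> \<beta> = trig (- a) b (- \<alpha>) \<beta>" for a b \<alpha> \<beta>
 proof
  fix p
  have "of_int (- a) * fst (rep_torus p) + - \<alpha> = - (of_int a * fst (rep_torus p) + \<alpha>)" by simp
  then show "trig a b \<alpha> \<beta> p = trig (- a) b (- \<alpha>) \<beta> p" unfolding trig_def by (simp only: cos_minus)
 qed
 have "(\<integral>z. indicator closed_square z * (D z * trig a b \<alpha> \<beta> (to_torus z)) \<partial>lborel) = 0" if a: "a \<ge> 0" for a b \<alpha> \<beta>
 proof -
  have t: "trig a b \<alpha> \<beta> (to_torus z) = cos (a * fst z + \<alpha>) * cos (b * snd z + \<beta>)" for z :: "real \<times> real"
   using trig_to_torus[of a b \<alpha> \<beta> "fst z" "snd z"] by simp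
  let ?c = "if a = 0 \<and> b = 0 then 0 else cos \<alpha> * cos \<beta> / ((of_int a)\<^sup>2 + (of_int b)\<^sup>2)"
  have 1: "has_bochner_integral lborel (\<lambda>z. indicator closed_square z * (green_expl (fst z) (snd z) * trig a b \<alpha> \<beta> (to_torus z))) ?c"
   unfolding t by (rule green_expl_fourier[OF a])
  have mt: "(\<lambda>p. G p * trig a b \<alpha> \<beta> p) \<in> borel_measurable borel" by measurable
  have "integrable torus_lebesgue (\<lambda>p. G p * trig a b \<alpha> \<beta> p)"
  proof (rule Bochner_Integration.integrable_bound[OF Gint])
   have "\<bar>trig a b \<alpha> \<beta> p\<bar> \<le> 1" for p unfolding trig_def abs_mult by (intro mult_le_one) auto
   then show "AE p in torus_lebesgue. norm (G p * trig a b \<alpha> \<beta> p) \<le> norm (G p)"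
    by (intro AE_I2) (auto simp: abs_mult intro!: mult_left_le)
  qed (simp cong: measurable_cong_sets)
  then have 2: "integrable lborel (\<lambda>z. indicator closed_square z * (G (to_torus z) * trig a b \<alpha> \<beta> (to_torus z)))"
   using integral_torus_closed_square(2)[OF mt] by simp
  have 3: "(\<integral>z. indicator closed_square z * (G (to_torus z) * trig a b \<alpha> \<beta> (to_torus z)) \<partial>lborel) = ?c"
   using integral_torus_closed_square(1)[OF mt] green_fourier[OF G, of a b \<alpha> \<beta>] by simp
  have "(\<lambda>z. indicator closed_square z * (D z * trig a b \<alpha> \<beta> (to_torus z)))
   = (\<lambda>z. indicator closed_square z * (G (to_torus z) * trig a b \<alpha> \<beta> (to_torus z))
     - indicator closed_square z * (green_expl (fst z) (snd z) * trig a b \<alpha> \<beta> (to_torus z)))"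
   by (auto simp: D_def algebra_simps)
  then show ?thesis using 1 2 3 by (simp add: has_bochner_integral_iff)
 qed
 then have zero: "(\<integral>z. indicator closed_square z * (D z * trig a b \<alpha> \<beta> (to_torus z)) \<partial>lborel) = 0" for a b \<alpha> \<beta>
 proof (cases "a \<ge> 0")
  case False
  then have "- a \<ge> 0" by simp
  then show ?thesis unfolding neg[of a b \<alpha> \<beta>]
   using \<open>\<And>b a \<beta> \<alpha>. 0 \<le> a ==> (\<integral>z. indicator closed_square z * (D z * trig a b \<alpha> \<beta> (to_torus z)) \<partial>lborel) = 0\<close>
   by blast
 qed
 have Dcont: "isCont D (x0, y0)"
 proof -
  have nl: "\<not> z \<in> torus_lattice" if "z \<in> Q" for z
  proof
   assume "z \<in> torus_lattice"
   then obtain m :: int where "fst z = 2 * pi * m" unfolding torus_lattice_iff by auto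
   with that have "0 < 2 * pi * m" "2 * pi * m < 2 * pi * 1" by (auto simp: Q_def)
   then have "0 < m" "m < 1" by (auto simp: zero_less_mult_iff mult_less_cancel_left)
   then show False by simp
  qed
  have "continuous_on Q (\<lambda>z. G (to_torus z))"
   by (rule continuous_on_compose2[OF Gcont continuous_to_torus])
    (use nl to_torus_eq_iff[of _ 0] in \<open>auto simp: to_torus_0\<close>)
  moreover have "continuous_on Q (\<lambda>z. green_expl (fst z) (snd z))"
  proof -
   have "continuous_on {w. \<bar>Im w\<bar> < 2 * pi} image_sum"
    by (rule DERIV_continuous_on[of _ _ image_sum_deriv]) (auto intro: has_field_derivative_at_within image_sum_has_derivative)
   then have "continuous_on Q (\<lambda>z. image_sum (Complex (fst z) (snd z)))"
    by (rule continuous_on_compose2) (auto simp: Q_def Complex_eq intro!: continuous_intros)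
   moreover have "2 * cosh (snd z) - 2 * cos (fst z) \<noteq> 0" if "z \<in> Q" for z
    using cosh_minus_cos_pos[of "fst z" "snd z"] nl[OF that] by simp
   ultimately show ?thesis unfolding green_expl_def
    by (intro continuous_intros) auto
  qed
  ultimately have "continuous_on Q D" unfolding D_def by (intro continuous_intros)
  moreover have "(x0, y0) \<in> Q" using z0 by (simp add: Q_def)
  ultimately show ?thesis using continuous_on_eq_continuous_at[OF oQ, of D] by blast
 qed
 have "\<forall>\<^sub>F z in nhds (x0, y0). s * D z > 0"
 proof (rule order_tendstoD(1)[of "\<lambda>z. s * D z" "s * D (x0, y0)"])
  show "((\<lambda>z. s * D z) \<longlongrightarrow> s * D (x0, y0)) (nhds (x0, y0))"
   using Dcont unfolding isCont_def tendsto_at_iff_tendsto_nhds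
   by (intro tendsto_mult_left)
 qed (rule s(2))
 moreover have "\<forall>\<^sub>F z in nhds (x0, y0). z \<in> Q"
  using oQ z0 by (intro eventually_nhds_in_open) (auto simp: Q_def)
 ultimately have "\<forall>\<^sub>F z in nhds (x0, y0). s * D z > 0 \<and> z \<in> Q" by eventually_elim simp
 then obtain r where r: "r > 0" "\<And>z. dist z (x0, y0) < r ==> s * D z > 0 \<and> z \<in> Q"
  unfolding eventually_nhds_metric by blast
 define f where "f p = max 0 (r - dist p (to_torus (x0, y0)))" for p
 have fc: "continuous_on UNIV f" unfolding f_def[abs_def] by (intro continuous_intros)
 \<comment> \<open>The bump lives on the torus, but in the open square two points of one class
   coincide, as their coordinates differ by less than a period. Hence its support meets the square
   only in the planar ball.\<close>
 have near: "dist z (x0, y0) < r" if z: "z \<in> Q" and fz: "f (to_torus z) > 0" for z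
 proof -
  have "to_torus z \<in> ball (to_torus (x0, y0)) r" using fz by (auto simp: f_def dist_commute max_def split: if_splits)
  then obtain w where w: "w \<in> ball (x0, y0) r" "to_torus w = to_torus z" unfolding to_torus_ball[symmetric] by auto
  then have wQ: "w \<in> Q" using r(2)[of w] by (simp add: dist_commute)
  obtain m n :: int where mn: "w - z = (2 * pi * m, 2 * pi * n)"
   using w(2) unfolding to_torus_eq_iff torus_lattice_iff by blast
  have "\<bar>fst w - fst z\<bar> < 2 * pi" "\<bar>snd w - snd z\<bar> < 2 * pi"
   using wQ z by (auto simp: Q_def mem_Times_iff)
  moreover have "fst w - fst z = 2 * pi * of_int m" "snd w - snd z = 2 * pi * of_int n"
   using mn by (simp_all add: prod_eq_iff)
  ultimately have "2 * pi * \<bar>real_of_int m\<bar> < 2 * pi * 1" "2 * pi * \<bar>real_of_int n\<bar> < 2 * pi * 1"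
   by (simp_all only: abs_mult) simp_all
  then have "\<bar>real_of_int m\<bar> < 1" "\<bar>real_of_int n\<bar> < 1" by simp_all
  then have "\<bar>m\<bar> < 1" "\<bar>n\<bar> < 1" by linarith+
  then have "w = z" using mn by (simp add: prod_eq_iff)
  then show ?thesis using w(1) by (simp add: dist_commute)
 qed
 define E where "E z = indicator closed_square z * D z" for z
 have Ei: "integrable lborel E" using Di by (simp add: E_def[abs_def])
 define h where "h z = E z * f (to_torus z)" for z
 have hi: "(\<integral>z. h z \<partial>lborel) = 0" unfolding h_def
 proof (rule integral_zero_if_fourier_zero[OF Ei _ fc])
  show "(\<integral>z. E z * trig a b \<alpha> \<beta> (to_torus z) \<partial>lborel) = 0" for a b \<alpha> \<beta>
   using zero[of a b \<alpha> \<beta>] by (simp only: E_def mult.assoc)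
 qed
 have nn: "AE z in lborel. 0 \<le> s * h z"
  using AE_plane_square
 proof eventually_elim
  case (elim z)
  show ?case
  proof (cases "z \<in> closed_square \<and> f (to_torus z) > 0")
   case True
   then have "z \<in> Q" using elim by (auto simp: Q_def mem_Times_iff)
   then have "s * D z > 0" using near True r(2) by blast
   then have "0 \<le> (s * D z) * f (to_torus z)" using True by simp
   then show ?thesis using True by (simp add: h_def E_def mult.assoc)
  next
   case False
   moreover have "f (to_torus z) \<ge> 0" by (simp add: f_def)
   ultimately show ?thesis by (auto simp: h_def E_def)
  qed
 qed
 have [measurable]: "(\<lambda>z. f (to_torus z)) \<in> borel_measurable borel"
  by (rule measurable_compose[OF measurable_to_torus borel_measurable_continuous_onI[OF fc]])
 have hint: "integrable lborel h"
 proof -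
  have "\<bar>f p\<bar> \<le> \<bar>r\<bar>" for p using r(1) by (auto simp: f_def)
  then have "norm (E z * f (to_torus z)) \<le> norm (r * E z)" for z
   unfolding real_norm_def abs_mult by (subst mult.commute) (intro mult_right_mono abs_ge_zero)
  then have "AE z in lborel. norm (E z * f (to_torus z)) \<le> norm (r * E z)" by (rule AE_I2)
  moreover have "integrable lborel (\<lambda>z. r * E z)" by (rule integrable_mult_right) (rule Ei)
  moreover have "(\<lambda>z. E z * f (to_torus z)) \<in> borel_measurable lborel"
   by (rule borel_measurable_times[OF borel_measurable_integrable[OF Ei]]) simp
  ultimately show ?thesis unfolding h_def[abs_def] using Bochner_Integration.integrable_bound by blast
 qed
 \<comment> \<open>A nonnegative function with zero integral vanishes almost everywhere. As it is
   positive on a ball, that ball would be negligible.\<close>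
 have "AE z in lborel. s * h z = 0"
  using integral_nonneg_eq_0_iff_AE[of lborel "\<lambda>z. s * h z"] hint nn hi by simp
 then have "AE z in lborel. z \<notin> ball (x0, y0) r"
 proof eventually_elim
  case (elim z)
  show ?case
  proof
   assume z: "z \<in> ball (x0, y0) r"
   then have "dist z (x0, y0) < r" by (simp add: dist_commute)
   then have "s * D z > 0" "z \<in> Q" using r(2) by auto
   moreover have "f (to_torus z) > 0"
    using z dist_to_torus_le[of z "(x0, y0)"] by (simp add: f_def dist_commute)
   moreover have "z \<in> closed_square" using \<open>z \<in> Q\<close> by (auto simp: Q_def)
   ultimately show False using elim by (auto simp: h_def E_def)
  qed
 qed
 then have "ball (x0, y0) r \<in> null_sets lborel"
  by (subst AE_iff_null_sets) auto
 then have "negligible (ball (x0, y0) r)"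
  unfolding negligible_iff_null_sets by (rule null_sets_completionI)
 then show False using open_not_negligible[OF open_ball, of "(x0, y0)" r] r(1) by auto
qed

text \<open>Where the explicit formula is differentiable: the image series converges for
  \<open>\<bar>y\<bar> < 2 * pi\<close>, and the logarithm is singular at lattice points.\<close>

definition strip :: "(real \<times> real) set" where
 "strip = {z. \<bar>snd z\<bar> < 2 * pi} - torus_lattice"

lemma open_strip: "open strip"
 unfolding strip_def
 by (intro open_Diff closed_torus_lattice open_Collect_less continuous_intros)

lemma strip_cosh_cos: "(x, y) \<in> strip ==> cosh y - cos x > 0"
 by (rule cosh_minus_cos_pos) (simp add: strip_def)

lemma continuous_image_sum: "continuous_on {z. \<bar>Im z\<bar> < 2 * pi} image_sum"
 by (rule DERIV_continuous_on[of _ _ image_sum_deriv])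
  (auto intro: has_field_derivative_at_within image_sum_has_derivative)

lemma continuous_green_expl: "continuous_on strip (\<lambda>z. green_expl (fst z) (snd z))"
proof -
 have "continuous_on strip (\<lambda>z. image_sum (Complex (fst z) (snd z)))"
  by (rule continuous_on_compose2[OF continuous_image_sum])
   (auto simp: strip_def Complex_eq intro!: continuous_intros)
 moreover have "2 * cosh (snd z) - 2 * cos (fst z) \<noteq> 0" if "z \<in> strip" for z
  using strip_cosh_cos[of "fst z" "snd z"] that by simp
 ultimately show ?thesis unfolding green_expl_def by (intro continuous_intros) auto
qed

lemma to_torus_eq_0_iff: "to_torus z = 0 \<longleftrightarrow> z \<in> torus_lattice"
 using to_torus_eq_iff[of z 0] by (simp add: to_torus_0)

lemma continuous_green_strip:
 assumes "green_function G"
 shows "continuous_on strip (\<lambda>z. G (to_torus z))"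
 using assms by (intro continuous_on_compose2[OF _ continuous_to_torus, of "- {0}"])
  (auto simp: green_function_def to_torus_eq_0_iff strip_def)

text \<open>Both sides are continuous on the strip, so equality passes to limits along a ray. This
  reaches the lines x = 0 and y = 0, which the open period square omits.\<close>

lemma green_eq_expl_limit:
 assumes G: "green_function G" and z: "z \<in> strip"
  and ev: "\<forall>\<^sub>F h in at_right (0::real). G (to_torus (z + h *\<^sub>R e)) = green_expl (fst (z + h *\<^sub>R e)) (snd (z + h *\<^sub>R e))"
 shows "G (to_torus z) = green_expl (fst z) (snd z)"
proof -
 have tend: "((\<lambda>h::real. z + h *\<^sub>R e) \<longlongrightarrow> z) (at_right 0)"
  by (rule tendsto_eq_intros refl)+ simp
 have "isCont (\<lambda>z. G (to_torus z)) z"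
  using continuous_green_strip[OF G] open_strip z continuous_on_eq_continuous_at by blast
 then have 1: "((\<lambda>h::real. G (to_torus (z + h *\<^sub>R e))) \<longlongrightarrow> G (to_torus z)) (at_right 0)"
  by (rule isCont_tendsto_compose[OF _ tend])
 have "isCont (\<lambda>z. green_expl (fst z) (snd z)) z"
  using continuous_green_expl open_strip z continuous_on_eq_continuous_at by blast
 then have "((\<lambda>h::real. green_expl (fst (z + h *\<^sub>R e)) (snd (z + h *\<^sub>R e))) \<longlongrightarrow> green_expl (fst z) (snd z)) (at_right 0)"
  by (rule isCont_tendsto_compose[OF _ tend])
 then have "((\<lambda>h::real. G (to_torus (z + h *\<^sub>R e))) \<longlongrightarrow> green_expl (fst z) (snd z)) (at_right 0)"
  by (rule Lim_transform_eventually) (use ev in eventually_elim, simp)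
 then show ?thesis by (rule tendsto_unique[OF trivial_limit_at_right_real 1])
qed

lemma lattice_snd_in: "z \<in> torus_lattice ==> 0 < snd z ==> snd z < 2 * pi ==> False"
proof -
 assume "z \<in> torus_lattice" "0 < snd z" "snd z < 2 * pi"
 then obtain n :: int where "0 < 2 * pi * n" "2 * pi * n < 2 * pi * 1" unfolding torus_lattice_iff by auto
 then have "0 < n" "n < 1" by (auto simp: zero_less_mult_iff)
 then show False by simp
qed

lemma green_eq_expl_upper:
 assumes G: "green_function G" and y: "0 < y" "y < 2 * pi"
 shows "G (to_torus (x, y)) = green_expl x y"
proof -
 obtain k :: int and r where r: "x = r + 2 * pi * k" "0 \<le> r" "r < 2 * pi" by (rule period_reduce)
 have "G (to_torus (r, y)) = green_expl r y"
 proof (cases "r = 0")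
  case False
  then show ?thesis using green_eq_expl_open_square[OF G _ _ y, of r] r by simp
 next
  case True
  have ev: "\<forall>\<^sub>F h in at_right (0::real). 0 < h \<and> h < 2 * pi"
   by (rule eventually_at_rightI[of 0 "2 * pi"]) auto
  have "G (to_torus (0, y)) = green_expl (fst (0::real, y)) (snd (0::real, y))"
  proof (rule green_eq_expl_limit[OF G, where z = "(0, y)" and e = "(1, 0)"])
   show "(0, y) \<in> strip" using lattice_snd_in[of "(0, y)"] y by (auto simp: strip_def)
   show "\<forall>\<^sub>F h in at_right (0::real). G (to_torus ((0, y) + h *\<^sub>R (1, 0)))
     = green_expl (fst ((0, y) + h *\<^sub>R (1, 0))) (snd ((0, y) + h *\<^sub>R (1, 0)))"
    using ev by eventually_elim (use green_eq_expl_open_square[OF G _ _ y] in simp)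
  qed
  then show ?thesis using True by (simp only: fst_conv snd_conv)
 qed
 then show ?thesis
  using to_torus_periodic[of r k y 0] green_expl_period[of r k y] by (simp add: r(1))
qed

text \<open>Positive y are known and \<open>y = 0\<close> is a limit from above. For negative y the
  point is moved up by a period, and evenness and reflection of the explicit function match the
  values.\<close>

lemma green_eq_expl:
 assumes G: "green_function G" and z: "(x, y) \<in> strip"
 shows "G (to_torus (x, y)) = green_expl x y"
proof -
 consider "y > 0" | "y = 0" | "y < 0" by linarith
 then show ?thesis
 proof cases
  case 1
  then show ?thesis using green_eq_expl_upper[OF G] z by (simp add: strip_def)
 next
  case 2
  have ev: "\<forall>\<^sub>F h in at_right (0::real). 0 < h \<and> h < 2 * pi"
   by (rule eventually_at_rightI[of 0 "2 * pi"]) auto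
  have "G (to_torus (x, y)) = green_expl (fst (x, y)) (snd (x, y))"
  proof (rule green_eq_expl_limit[OF G z, where e = "(0, 1)"])
   show "\<forall>\<^sub>F h in at_right (0::real). G (to_torus ((x, y) + h *\<^sub>R (0, 1)))
     = green_expl (fst ((x, y) + h *\<^sub>R (0, 1))) (snd ((x, y) + h *\<^sub>R (0, 1)))"
    using ev by eventually_elim (use green_eq_expl_upper[OF G] 2 in simp)
  qed
  then show ?thesis by simp
 next
  case 3
  have y: "\<bar>- y\<bar> < 2 * pi" "0 < - y" "- y < 2 * pi" using z 3 by (auto simp: strip_def)
  have "green_expl x y = green_expl x (- y)" using green_expl_even[of "- y" x] y by simp
  also have "\<dots> = green_expl x (2 * pi - (- y))" using green_expl_reflect[OF y(2,3)] by simp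
  also have "\<dots> = G (to_torus (x, 2 * pi - (- y)))"
   using green_eq_expl_upper[OF G, of "2 * pi - (- y)" x] y by simp
  also have "\<dots> = G (to_torus (x, y))"
   using to_torus_periodic[of x 0 y 1] by (simp add: add.commute)
  finally show ?thesis by simp
 qed
qed

section \<open>The derivatives of the Green function as a complex kernel\<close>

definition green_dx :: "real => real => real" where
 "green_dx x y = - sin x / (4 * pi * (cosh y - cos x)) + Re (image_sum_deriv (Complex x y))"

definition green_dy :: "real => real => real" where
 "green_dy x y = y / (4 * pi\<^sup>2) - sinh y / (4 * pi * (cosh y - cos x)) - Im (image_sum_deriv (Complex x y))"

lemma green_expl_has_derivative:
 assumes z: "(x, y) \<in> strip"
 shows "((\<lambda>x. green_expl x y) has_real_derivative green_dx x y) (at x)"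
  and "((\<lambda>y. green_expl x y) has_real_derivative green_dy x y) (at y)"
proof -
 have D: "(image_sum has_field_derivative image_sum_deriv (Complex x y)) (at (Complex x y))"
  by (rule image_sum_has_derivative) (use z in \<open>simp add: strip_def\<close>)
 \<comment> \<open>Chain rule for the holomorphic image sum along horizontal and vertical lines,
   with directions 1 and i.\<close>
 have path: "((\<lambda>t. image_sum (p t)) has_vector_derivative (p' * image_sum_deriv (Complex x y))) (at t)"
  if "(p has_vector_derivative p') (at t)" "p t = Complex x y" for p p' t
  using field_vector_diff_chain_at[OF that(1), of image_sum "image_sum_deriv (Complex x y)"] D that(2)
  by (simp add: comp_def)
 have "((\<lambda>x. Complex x y) has_vector_derivative 1) (at x)" "((\<lambda>y. Complex x y) has_vector_derivative \<i>) (at y)"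
  unfolding Complex_eq by (auto intro!: derivative_eq_intros)
 note P = path[OF this(1)] path[OF this(2)]
 have Hx: "((\<lambda>x. Re (image_sum (Complex x y))) has_real_derivative Re (image_sum_deriv (Complex x y))) (at x)"
  using bounded_linear.has_vector_derivative[OF bounded_linear_Re P(1)]
  by (simp add: has_real_derivative_iff_has_vector_derivative)
 have Hy: "((\<lambda>y. Re (image_sum (Complex x y))) has_real_derivative - Im (image_sum_deriv (Complex x y))) (at y)"
  using bounded_linear.has_vector_derivative[OF bounded_linear_Re P(2)]
  by (simp add: has_real_derivative_iff_has_vector_derivative)
 have pos: "cosh y - cos x > 0" by (rule strip_cosh_cos[OF z])
 have L: "ln (2 * cosh y - 2 * cos x) = ln 2 + ln (cosh y - cos x)" if "cosh y - cos x > 0" for x y :: real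
  using that ln_mult[of 2 "cosh y - cos x"] by (simp add: right_diff_distrib)
 have Lx: "((\<lambda>x. ln (2 * cosh y - 2 * cos x)) has_real_derivative sin x / (cosh y - cos x)) (at x)"
  using pos by (auto intro!: derivative_eq_intros simp: divide_simps)
 have Ly: "((\<lambda>y. ln (2 * cosh y - 2 * cos x)) has_real_derivative sinh y / (cosh y - cos x)) (at y)"
  using pos by (auto intro!: derivative_eq_intros simp: divide_simps)
 have "((\<lambda>x. y\<^sup>2 / (8 * pi\<^sup>2) + 1 / 12 - ln (2 * cosh y - 2 * cos x) / (4 * pi) + Re (image_sum (Complex x y)))
   has_real_derivative (0 - sin x / (cosh y - cos x) / (4 * pi) + Re (image_sum_deriv (Complex x y)))) (at x)"
  by (intro DERIV_add DERIV_diff DERIV_const DERIV_cdivide Hx Lx)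
 then show "((\<lambda>x. green_expl x y) has_real_derivative green_dx x y) (at x)"
  unfolding green_expl_def green_dx_def by (simp add: mult_ac)
 have "((\<lambda>y. y\<^sup>2 / (8 * pi\<^sup>2) + 1 / 12) has_real_derivative y / (4 * pi\<^sup>2)) (at y)"
  by (auto intro!: derivative_eq_intros simp: power2_eq_square)
 then have "((\<lambda>y. y\<^sup>2 / (8 * pi\<^sup>2) + 1 / 12 - ln (2 * cosh y - 2 * cos x) / (4 * pi) + Re (image_sum (Complex x y)))
   has_real_derivative (y / (4 * pi\<^sup>2) - sinh y / (cosh y - cos x) / (4 * pi) + - Im (image_sum_deriv (Complex x y)))) (at y)"
  by (intro DERIV_add DERIV_diff DERIV_cdivide Hy Ly)
 then show "((\<lambda>y. green_expl x y) has_real_derivative green_dy x y) (at y)"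
  unfolding green_expl_def green_dy_def by (simp add: mult_ac)
qed

text \<open>The strip is open, so G and the explicit function agree on a whole neighbourhood of the
  point and share their partial derivatives.\<close>

lemma green_has_partials:
 assumes G: "green_function G" and z: "(x, y) \<in> strip"
 shows "((\<lambda>h. G (to_torus (x, y) + to_torus (h, 0))) has_real_derivative green_dx x y) (at 0)"
  and "((\<lambda>h. G (to_torus (x, y) + to_torus (0, h))) has_real_derivative green_dy x y) (at 0)"
proof -
 have D: "((\<lambda>h. green_expl (x + h) y) has_real_derivative green_dx x y) (at 0)"
  using DERIV_shift[of "\<lambda>x. green_expl x y" "green_dx x y" 0 x] green_expl_has_derivative(1)[OF z]
  by (simp add: add.commute)
 have D': "((\<lambda>h. green_expl x (y + h)) has_real_derivative green_dy x y) (at 0)"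
  using DERIV_shift[of "\<lambda>y. green_expl x y" "green_dy x y" 0 y] green_expl_has_derivative(2)[OF z]
  by (simp add: add.commute)
 have o: "open ((\<lambda>h. (x + h, y)) -` strip)" "open ((\<lambda>h. (x, y + h)) -` strip)"
  by (intro open_vimage[OF open_strip] continuous_intros)+
 have "\<forall>\<^sub>F h in nhds 0. h \<in> (\<lambda>h. (x + h, y)) -` strip" "\<forall>\<^sub>F h in nhds 0. h \<in> (\<lambda>h. (x, y + h)) -` strip"
  by (rule eventually_nhds_in_open[OF o(1)], use z in simp) (rule eventually_nhds_in_open[OF o(2)], use z in simp)
 then have e: "\<forall>\<^sub>F h in nhds 0. G (to_torus (x, y) + to_torus (h, 0)) = green_expl (x + h) y"
  "\<forall>\<^sub>F h in nhds 0. G (to_torus (x, y) + to_torus (0, h)) = green_expl x (y + h)"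
  by (eventually_elim, simp add: to_torus_add[symmetric] green_eq_expl[OF G])+
 show "((\<lambda>h. G (to_torus (x, y) + to_torus (h, 0))) has_real_derivative green_dx x y) (at 0)"
  using D DERIV_cong_ev[OF refl e(1) refl] by blast
 show "((\<lambda>h. G (to_torus (x, y) + to_torus (0, h))) has_real_derivative green_dy x y) (at 0)"
  using D' DERIV_cong_ev[OF refl e(2) refl] by blast
qed

lemma green_pd:
 assumes "green_function G" "(x, y) \<in> strip"
 shows "pd1 G (to_torus (x, y)) = green_dx x y" "pd2 G (to_torus (x, y)) = green_dy x y"
 unfolding pd1_def pd2_def by (intro DERIV_imp_deriv green_has_partials assms)+

text \<open>The combination \<open>green_dx - i * green_dy\<close>. It is holomorphic up to the
  linear term in y, and since \<open>cot (z / 2)\<close> behaves like \<open>2 / z\<close>, its pole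
  is that of \<open>- 1 / (2 * pi * z)\<close>.\<close>

definition planar_kernel :: "real \<times> real => complex" where
 "planar_kernel z = - cot (Complex (fst z) (snd z) / 2) / (4 * pi)
  + image_sum_deriv (Complex (fst z) (snd z)) - \<i> * (snd z / (4 * pi\<^sup>2))"

text \<open>Expanding the fraction by the conjugate of the sine leaves sines of
  \<open>w + cnj w = x\<close> and \<open>w - cnj w = i y\<close> over the squared norm.\<close>

lemma cot_half: "cot (Complex x y / 2) = Complex (sin x / (cosh y - cos x)) (- sinh y / (cosh y - cos x))"
proof -
 define w where "w = Complex x y / 2"
 have "w + cnj w = of_real x" "w - cnj w = \<i> * of_real y"
  by (simp_all add: w_def complex_eq_iff)
 moreover have "sin (\<i> * of_real y) = \<i> * of_real (sinh y)"
  by (simp add: complex_eq_iff Re_sin Im_sin sinh_field_def)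
 ultimately have "cos w * cnj (sin w) = (of_real (sin x) - \<i> * of_real (sinh y)) / 2"
  unfolding cnj_sin cos_times_sin by (simp add: sin_of_real)
 moreover have "cot w = cos w * cnj (sin w) / of_real ((norm (sin w))\<^sup>2)"
  unfolding cot_def by (subst complex_div_cnj) simp
 moreover have "(norm (sin w))\<^sup>2 = (cosh y - cos x) / 2" unfolding w_def by (rule norm_sin_half_squared)
 ultimately have "cot w = (of_real (sin x) - \<i> * of_real (sinh y)) / of_real (cosh y - cos x)"
  by simp
 then show ?thesis unfolding w_def[symmetric]
  by (simp only: complex_eq_iff Re_divide_of_real Im_divide_of_real) simp
qed

lemma planar_kernel_eq: "planar_kernel (x, y) = Complex (green_dx x y) (- green_dy x y)"
 unfolding planar_kernel_def cot_half fst_conv snd_conv green_dx_def green_dy_def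
 by (simp add: complex_eq_iff)

text \<open>The Biot-Savart kernel has components \<open>green_dy\<close> and
  \<open>- green_dx\<close>, a linear isometric image of the planar kernel; so norms of values and
  of differences agree.\<close>

lemma norm_kernel_diff:
 assumes "green_function G" "z \<in> strip" "w \<in> strip"
 shows "norm (biot_savart_kernel G (to_torus z) - biot_savart_kernel G (to_torus w)) = norm (planar_kernel z - planar_kernel w)"
  and "norm (biot_savart_kernel G (to_torus z)) = norm (planar_kernel z)"
proof -
 obtain x y u v where zw: "z = (x, y)" "w = (u, v)" by fastforce
 show "norm (biot_savart_kernel G (to_torus z) - biot_savart_kernel G (to_torus w)) = norm (planar_kernel z - planar_kernel w)"
  "norm (biot_savart_kernel G (to_torus z)) = norm (planar_kernel z)"
  using assms green_pd[of G x y] green_pd[of G u v]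
  by (simp_all add: zw planar_kernel_eq biot_savart_kernel_def norm_Pair cmod_def complex_diff power2_commute[of "green_dy u v"] power2_commute[of "green_dx u v"] add.commute)
qed

text \<open>Large enough for the centred period square and its shifts of length at most 1, small
  enough for the origin to be its only lattice point.\<close>

definition pole_box :: "(real \<times> real) set" where
 "pole_box = {z. \<bar>fst z\<bar> \<le> 3 * pi / 2 \<and> \<bar>snd z\<bar> \<le> 3 * pi / 2}"

lemma pole_box_strip: assumes "z \<in> pole_box" "z \<noteq> 0" shows "z \<in> strip"
proof -
 have "z \<notin> torus_lattice"
 proof
  assume "z \<in> torus_lattice"
  then obtain m n :: int where mn: "z = (2 * pi * m, 2 * pi * n)" unfolding torus_lattice_iff by blast
  then have "2 * pi * \<bar>real_of_int m\<bar> \<le> 3 * pi / 2" "2 * pi * \<bar>real_of_int n\<bar> \<le> 3 * pi / 2"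
   using assms(1) by (simp_all add: pole_box_def abs_mult)
  then have "2 * pi * \<bar>real_of_int m\<bar> < 2 * pi * 1" "2 * pi * \<bar>real_of_int n\<bar> < 2 * pi * 1"
   using pi_gt_zero by linarith+
  then have "\<bar>real_of_int m\<bar> < 1" "\<bar>real_of_int n\<bar> < 1" by simp_all
  then have "m = 0" "n = 0" by linarith+
  then show False using mn assms(2) by (simp add: zero_prod_def)
 qed
 moreover have "\<bar>snd z\<bar> < 2 * pi"
 proof -
  have "\<bar>snd z\<bar> \<le> 3 * pi / 2" using assms(1) by (simp add: pole_box_def)
  then show ?thesis using pi_gt_zero by linarith
 qed
 ultimately show ?thesis by (simp add: strip_def)
qed

lemma pole_box_sin_ge: "z \<in> pole_box ==> norm z / 10 \<le> norm (sin (Complex (fst z) (snd z) / 2))"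
 using norm_sin_half_ge[of "fst z" "snd z"] by (simp add: pole_box_def)

lemma norm_Complex_Pair: "norm (Complex x y) = norm (x, y)"
 by (simp add: cmod_def norm_Pair)

lemma norm_i_times: "norm (\<i> * complex_of_real r) = \<bar>r\<bar>"
 by (simp add: norm_mult)

text \<open>By \<open>cot_diff\<close> the cotangent part is at most
  \<open>(3 / 2) * 10 * 10 = 150\<close> times the quotient, and division by
  \<open>4 * pi \<ge> 8\<close> leaves less than 20. The remaining terms are Lipschitz.\<close>

lemma planar_kernel_lipschitz:
 obtains C where "C \<ge> 0" "\<And>z w. z \<in> pole_box ==> w \<in> pole_box ==> z \<noteq> 0 ==> w \<noteq> 0 ==> norm (z - w) \<le> 1 ==>
  norm (planar_kernel z - planar_kernel w) \<le> 20 * (norm (z - w) / (norm z * norm w)) + C * norm (z - w)"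
proof -
 obtain L where L: "L \<ge> 0" "\<And>z w. \<bar>Im z\<bar> \<le> 3 * pi / 2 ==> \<bar>Im w\<bar> \<le> 3 * pi / 2 ==>
  norm (image_sum_deriv z - image_sum_deriv w) \<le> L * norm (z - w)"
  by (rule image_sum_deriv_lipschitz) blast
 have "norm (planar_kernel z - planar_kernel w) \<le> 20 * (norm (z - w) / (norm z * norm w)) + (L + 1) * norm (z - w)"
  if zw: "z \<in> pole_box" "w \<in> pole_box" "z \<noteq> 0" "w \<noteq> 0" "norm (z - w) \<le> 1" for z w
 proof -
  define Z W where "Z = Complex (fst z) (snd z)" and "W = Complex (fst w) (snd w)"
  have nd: "norm (Z - W) = norm (z - w)"
   unfolding Z_def W_def complex_diff norm_Complex_Pair by (simp add: minus_prod_def)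
  have nz: "norm z > 0" "norm w > 0" using zw by auto
  have s: "norm (sin (Z / 2)) \<ge> norm z / 10" "norm (sin (W / 2)) \<ge> norm w / 10"
   using pole_box_sin_ge zw unfolding Z_def W_def by auto
  then have s0: "sin (Z / 2) \<noteq> 0" "sin (W / 2) \<noteq> 0" using nz by auto
  have "norm (W / 2 - Z / 2) = norm (z - w) / 2"
   using nd by (simp add: norm_divide diff_divide_distrib[symmetric] norm_minus_commute)
  then have num: "norm (sin (W / 2 - Z / 2)) \<le> 3 * (norm (z - w) / 2)"
   using norm_sin_le[of "W / 2 - Z / 2"] zw(5) by simp
  have "norm (cot (Z / 2) - cot (W / 2)) = norm (sin (W / 2 - Z / 2)) / (norm (sin (Z / 2)) * norm (sin (W / 2)))"
   unfolding cot_diff[OF s0] by (simp add: norm_divide norm_mult)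
  also have "\<dots> \<le> 3 * (norm (z - w) / 2) / ((norm z / 10) * (norm w / 10))"
   using num s nz by (intro frac_le mult_mono mult_pos_pos) auto
  also have "\<dots> = 150 * (norm (z - w) / (norm z * norm w))" by simp
  finally have c: "norm (cot (Z / 2) - cot (W / 2)) \<le> 150 * (norm (z - w) / (norm z * norm w))" .
  have "norm (- (cot (Z / 2) - cot (W / 2)) / (4 * pi)) = norm (cot (Z / 2) - cot (W / 2)) / (4 * pi)"
   by (simp add: norm_divide norm_minus_commute norm_mult)
  also have "\<dots> \<le> 150 * (norm (z - w) / (norm z * norm w)) / 8"
   using c pi_ge_two by (intro frac_le) auto
  also have "\<dots> \<le> 20 * (norm (z - w) / (norm z * norm w))"
  proof -
   have *: "150 * X / 8 \<le> 20 * X" if "X \<ge> 0" for X :: real using that by simp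
   show ?thesis by (rule *) simp
  qed
  finally have t1: "norm (- (cot (Z / 2) - cot (W / 2)) / (4 * pi)) \<le> 20 * (norm (z - w) / (norm z * norm w))" .
  have t2: "norm (image_sum_deriv Z - image_sum_deriv W) \<le> L * norm (z - w)"
   using L(2)[of Z W] zw(1,2) nd unfolding Z_def W_def pole_box_def by simp
  have t3: "norm (\<i> * complex_of_real ((snd z - snd w) / (4 * pi\<^sup>2))) \<le> norm (z - w)"
  proof -
   have "4 * pi\<^sup>2 \<ge> 1" using pi_ge_two power_mono[of 2 pi 2] by simp
   then have "\<bar>snd z - snd w\<bar> / (4 * pi\<^sup>2) \<le> \<bar>snd z - snd w\<bar> / 1" by (intro frac_le) auto
   also have "\<dots> \<le> norm (z - w)" by (cases z, cases w) (use norm_snd_le[where 'b = real] in \<open>simp only: diff_Pair snd_conv real_norm_def[symmetric] div_by_1\<close>)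
   finally show ?thesis unfolding norm_i_times abs_divide by simp
  qed
  have "planar_kernel z - planar_kernel w = - (cot (Z / 2) - cot (W / 2)) / (4 * pi)
    + (image_sum_deriv Z - image_sum_deriv W) - \<i> * complex_of_real ((snd z - snd w) / (4 * pi\<^sup>2))"
   unfolding planar_kernel_def Z_def[symmetric] W_def[symmetric] by (simp add: diff_divide_distrib algebra_simps)
  also have "norm \<dots> \<le> (20 * (norm (z - w) / (norm z * norm w)) + L * norm (z - w)) + norm (z - w)"
   by (rule order_trans[OF norm_triangle_ineq4 add_mono[OF order_trans[OF norm_triangle_ineq add_mono[OF t1 t2]] t3]])
  finally show ?thesis by (simp add: algebra_simps)
 qed
 then show thesis using L(1) by (intro that[of "L + 1"]) auto
qed

text \<open>On the box the cosine is bounded and the sine in the denominator is at least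
  \<open>norm z / 10\<close>; the other terms are bounded.\<close>

lemma planar_kernel_bound:
 obtains C where "C \<ge> 0" "\<And>z. z \<in> pole_box ==> z \<noteq> 0 ==> norm (planar_kernel z) \<le> C * (1 / norm z) + C"
proof -
 obtain L where L: "L \<ge> 0" "\<And>z w. \<bar>Im z\<bar> \<le> 3 * pi / 2 ==> \<bar>Im w\<bar> \<le> 3 * pi / 2 ==>
  norm (image_sum_deriv z - image_sum_deriv w) \<le> L * norm (z - w)"
  by (rule image_sum_deriv_lipschitz) blast
 define A where "A = 10 * exp (3 * pi / 4)"
 define B where "B = L * (3 * pi) + norm (image_sum_deriv 0) + 1"
 have A: "A \<ge> 0" by (simp add: A_def)
 have B: "B \<ge> 0" using L(1) by (simp add: B_def)
 have "norm (planar_kernel z) \<le> (A + B) * (1 / norm z) + (A + B)" if z: "z \<in> pole_box" "z \<noteq> 0" for z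
 proof -
  define Z where "Z = Complex (fst z) (snd z)"
  have b: "\<bar>fst z\<bar> \<le> 3 * pi / 2" "\<bar>snd z\<bar> \<le> 3 * pi / 2" using z(1) by (auto simp: pole_box_def)
  have nz: "norm z > 0" using z by auto
  have s: "norm (sin (Z / 2)) \<ge> norm z / 10" using pole_box_sin_ge z unfolding Z_def by auto
  have "\<bar>Im (Z / 2)\<bar> \<le> 3 * pi / 4" using b(2) by (simp add: Z_def)
  then have "exp \<bar>Im (Z / 2)\<bar> \<le> exp (3 * pi / 4)" by (simp only: exp_le_cancel_iff)
  then have "norm (cos (Z / 2)) \<le> exp (3 * pi / 4)" by (rule order_trans[OF norm_cos_exp_le])
  then have "norm (cot (Z / 2)) \<le> exp (3 * pi / 4) / (norm z / 10)"
   unfolding cot_def norm_divide using s nz by (intro frac_le) auto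
  then have c: "norm (cot (Z / 2)) \<le> A * (1 / norm z)" by (simp add: A_def mult.commute)
  have "norm (- cot (Z / 2) / (4 * pi)) = norm (cot (Z / 2)) / (4 * pi)"
   by (simp add: norm_divide norm_mult)
  also have "\<dots> \<le> norm (cot (Z / 2)) / 1" using pi_ge_two by (intro frac_le) auto
  finally have t1: "norm (- cot (Z / 2) / (4 * pi)) \<le> A * (1 / norm z)" using c by simp
  have "norm Z \<le> 3 * pi" using norm_Pair_le[of "fst z" "snd z"] b unfolding Z_def norm_Complex_Pair by simp
  then have "L * norm Z \<le> L * (3 * pi)" using L(1) by (rule mult_left_mono)
  then have t2: "norm (image_sum_deriv Z) \<le> L * (3 * pi) + norm (image_sum_deriv 0)"
   using L(2)[of Z 0] b(2) norm_triangle_sub[of "image_sum_deriv Z" "image_sum_deriv 0"] by (simp add: Z_def)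
  have t3: "norm (\<i> * complex_of_real (snd z / (4 * pi\<^sup>2))) \<le> 1"
  proof -
   have "\<bar>snd z\<bar> \<le> 4 * pi\<^sup>2"
   proof -
    have "3 * pi / 2 \<le> 4 * pi * 1" by simp
    also have "\<dots> \<le> 4 * pi * pi" using pi_ge_two by (intro mult_left_mono) auto
    finally have "3 * pi / 2 \<le> 4 * pi * pi" .
    then have "\<bar>snd z\<bar> \<le> 4 * pi * pi" using b(2) by (rule order_trans[rotated])
    then show ?thesis by (simp only: power2_eq_square mult.assoc)
   qed
   then show ?thesis unfolding norm_i_times abs_divide by simp
  qed
  have "norm (planar_kernel z) \<le> A * (1 / norm z) + (L * (3 * pi) + norm (image_sum_deriv 0)) + 1"
   unfolding planar_kernel_def Z_def[symmetric]
   by (rule order_trans[OF norm_triangle_ineq4 add_mono[OF order_trans[OF norm_triangle_ineq add_mono[OF t1 t2]] t3]])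
  also have "\<dots> = A * (1 / norm z) + B" by (simp add: B_def)
  also have "\<dots> \<le> (A + B) * (1 / norm z) + (A + B)"
   using A B nz by (intro add_mono mult_right_mono) auto
  finally show ?thesis .
 qed
 then show thesis using A B by (intro that[of "A + B"]) auto
qed

lemma borel_measurable_torus_diff[measurable (raw)]:
 fixes f g :: "'a => torus"
 assumes "f \<in> borel_measurable M" "g \<in> borel_measurable M"
 shows "(\<lambda>x. f x - g x) \<in> borel_measurable M"
 by (rule borel_measurable_continuous_Pair[OF assms]) (intro continuous_intros)

lemma borel_measurable_torus_add[measurable (raw)]:
 fixes f g :: "'a => torus"
 assumes "f \<in> borel_measurable M" "g \<in> borel_measurable M"
 shows "(\<lambda>x. f x + g x) \<in> borel_measurable M"
 by (rule borel_measurable_continuous_Pair[OF assms]) (intro continuous_intros)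

section \<open>The modulus\<close>

lemma log_modulus_nonneg: "log_modulus r \<ge> 0"
proof -
 have "0 \<le> r * (1 - ln r)" if "r > 0" "r < 1 / exp 1"
 proof -
  have "ln r < ln (1 / exp 1)" using that by (subst ln_less_cancel_iff) auto
  then show ?thesis using that by (simp add: ln_div)
 qed
 then show ?thesis unfolding log_modulus_def by auto
qed

lemma log_modulus_measurable[measurable]: "log_modulus \<in> borel_measurable borel"
 unfolding log_modulus_def[abs_def] by measurable

text \<open>The modulus is the infimum of the lines \<open>r \<mapsto> \<lambda> r + exp (-\<lambda>)\<close>, \<open>\<lambda> \<ge> 1\<close>; monotonicity,
 continuity and Jensen's inequality are read off from this.\<close>

lemma log_modulus_le_line:
 assumes "1 \<le> l" "0 \<le> r"
 shows "log_modulus r \<le> l * r + exp (- l)"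
proof -
 consider "r = 0" | "0 < r" "r < 1 / exp 1" | "1 / exp 1 \<le> r" "0 < r" using assms by fastforce
 then show ?thesis
 proof cases
  case 1
  then show ?thesis by (simp add: log_modulus_def)
 next
  case 2
  \<comment> \<open>For this u the inequality \<open>ln u \<le> u - 1\<close> is the claim divided
    by r.\<close>
  define u where "u = exp (- l) / r"
  have u: "u > 0" using 2 by (simp add: u_def)
  have "ln u = - l - ln r" using 2 by (simp add: u_def ln_div)
  then have "1 - ln r - l \<le> u" using ln_le_minus_one[OF u] by simp
  then have "r * (1 - ln r - l) \<le> r * u" using 2 by (intro mult_left_mono) auto
  also have "r * u = exp (- l)" using 2 by (simp add: u_def)
  finally show ?thesis using 2 by (simp add: log_modulus_def algebra_simps)
 next
  case 3
  have "1 + (1 - l) \<le> exp (1 - l)" by (rule exp_ge_add_one_self)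
  then have "(1 + (1 - l)) * (1 / exp 1) \<le> exp (1 - l) * (1 / exp 1)" by (intro mult_right_mono) auto
  also have "\<dots> = exp (- l)" by (simp add: exp_diff exp_minus field_simps)
  finally have 1: "(1 + (1 - l)) * (1 / exp 1) \<le> exp (- l)" .
  have "(l - 1) * (1 / exp 1) \<le> (l - 1) * r" using 3 assms by (intro mult_left_mono) auto
  then have "r + 1 / exp 1 \<le> l * r + (1 + (1 - l)) * (1 / exp 1)"
   by (simp add: algebra_simps diff_divide_distrib)
  with 1 have "r + 1 / exp 1 \<le> l * r + exp (- l)" by linarith
  then show ?thesis using 3 by (simp add: log_modulus_def)
 qed
qed

text \<open>The touching line has slope \<open>- ln r\<close> below \<open>1 / exp 1\<close> and
  slope 1 from there on; the branches meet with equal derivative.\<close>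

lemma log_modulus_eq_line:
 assumes "0 < r"
 obtains l where "1 \<le> l" "log_modulus r = l * r + exp (- l)"
proof (cases "r < 1 / exp 1")
 case True
 have "ln r < ln (1 / exp 1)" using assms True by (subst ln_less_cancel_iff) auto
 then have "1 \<le> - ln r" by (simp add: ln_div)
 moreover have "log_modulus r = - ln r * r + exp (- (- ln r))"
  using assms True by (simp add: log_modulus_def algebra_simps)
 ultimately show thesis by (rule that)
next
 case False
 then have "log_modulus r = 1 * r + exp (- 1)"
  using assms by (simp add: log_modulus_def exp_minus inverse_eq_divide)
 then show thesis by (intro that[of 1]) auto
qed

lemma log_modulus_0[simp]: "log_modulus 0 = 0"
 by (simp add: log_modulus_def)

lemma log_modulus_mono: assumes "0 \<le> r" "r \<le> s" shows "log_modulus r \<le> log_modulus s"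
proof (cases "s = 0")
 case False
 then obtain l where l: "1 \<le> l" "log_modulus s = l * s + exp (- l)"
  using log_modulus_eq_line[of s] assms by auto
 have "log_modulus r \<le> l * r + exp (- l)" by (rule log_modulus_le_line) (use l assms in auto)
 also have "\<dots> \<le> l * s + exp (- l)" using l assms by (intro add_right_mono mult_left_mono) auto
 finally show ?thesis using l by simp
qed (use assms in simp)

text \<open>A line touching at r stays above the modulus and grows by only \<open>l * d\<close>. At
  0 no line touches; a steep one with \<open>exp (- l) \<le> e / 2\<close> takes its place.\<close>

lemma log_modulus_right_continuous:
 assumes "0 \<le> r" "e > 0"
 obtains d where "d > 0" "log_modulus (r + d) < log_modulus r + e"
proof (cases "r = 0")
 case True
 define l where "l = max 1 (- ln (e / 2))"
 have "exp (- l) \<le> exp (ln (e / 2))" unfolding l_def by simp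
 then have l: "1 \<le> l" "exp (- l) \<le> e / 2" using assms by (auto simp: l_def)
 have "log_modulus (e / (4 * l)) \<le> l * (e / (4 * l)) + exp (- l)"
  by (rule log_modulus_le_line) (use l assms in auto)
 also have "\<dots> \<le> e / 4 + e / 2" using l by (intro add_mono) auto
 also have "\<dots> < e" using assms by simp
 finally show thesis using True l assms by (intro that[of "e / (4 * l)"]) auto
next
 case False
 then obtain l where l: "1 \<le> l" "log_modulus r = l * r + exp (- l)"
  using log_modulus_eq_line[of r] assms by auto
 have "log_modulus (r + e / (2 * l)) \<le> l * (r + e / (2 * l)) + exp (- l)"
  by (rule log_modulus_le_line) (use l assms in auto)
 also have "\<dots> = log_modulus r + e / 2" using l by (simp add: distrib_left)
 also have "\<dots> < log_modulus r + e" using assms by simp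
 finally show thesis using l assms by (intro that[of "e / (2 * l)"]) auto
qed

text \<open>Beyond \<open>1 / exp 1\<close> this amounts to
  \<open>- d * ln d \<le> 1 / exp 1\<close>, the maximum of the entropy function. The kernel
  estimate produces \<open>d * (1 - ln d)\<close> for all \<open>d \<le> 1\<close>.\<close>

lemma log_modulus_ge_entropy:
 assumes "0 < d" "d \<le> 1"
 shows "d * (1 - ln d) \<le> log_modulus d"
proof (cases "d < 1 / exp 1")
 case False
 have "ln (1 / (exp 1 * d)) \<le> 1 / (exp 1 * d) - 1" by (rule ln_le_minus_one) (use assms in simp)
 then have "- ln d \<le> 1 / (exp 1 * d)" using assms by (simp add: ln_div ln_mult)
 then have "d * (- ln d) \<le> d * (1 / (exp 1 * d))" using assms by (intro mult_left_mono) auto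
 also have "\<dots> = 1 / exp 1" using assms by simp
 finally show ?thesis using False assms by (simp add: log_modulus_def algebra_simps)
qed (use assms in \<open>simp add: log_modulus_def\<close>)

lemma log_modulus_ge_1: "d \<ge> 1 ==> log_modulus d \<ge> 1"
proof -
 assume d: "d \<ge> 1"
 have "1 / exp 1 \<le> (1 :: real)" by simp
 then have "\<not> d < 1 / exp 1" using d by linarith
 then show ?thesis using d by (simp add: log_modulus_def add_increasing2)
qed

section \<open>Estimates for the Biot-Savart kernel\<close>

lemma torus_centered_rep:
 obtains z where "to_torus z = p" "-pi \<le> fst z" "fst z < pi" "-pi \<le> snd z" "snd z < pi"
proof -
 obtain x y where p: "p = to_torus (x, y)" by (rule torus_cases)
 obtain m :: int and r where r: "x + pi = r + 2 * pi * m" "0 \<le> r" "r < 2 * pi" by (rule period_reduce)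
 obtain n :: int and s where s: "y + pi = s + 2 * pi * n" "0 \<le> s" "s < 2 * pi" by (rule period_reduce)
 have "x = (r - pi) + 2 * pi * m" "y = (s - pi) + 2 * pi * n" using r(1) s(1) by simp_all
 then have "to_torus (r - pi, s - pi) = p" unfolding p by (simp only: to_torus_periodic)
 then show thesis by (rule that) (use r s in auto)
qed

lemma isCont_torusI:
 fixes f :: "torus => 'a :: topological_space"
 assumes "isCont (\<lambda>z. f (to_torus z)) z"
 shows "isCont f (to_torus z)"
proof (rule continuous_at_open[THEN iffD2], intro allI impI)
 fix T assume T: "open T \<and> f (to_torus z) \<in> T"
 obtain S where S: "open S" "z \<in> S" "\<forall>w\<in>S. f (to_torus w) \<in> T"
  using continuous_at_open[THEN iffD1, OF assms, rule_format, OF T] by metis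
 have "open (to_torus ` S)" "to_torus z \<in> to_torus ` S" using S open_to_torus by auto
 moreover have "\<forall>p\<in>to_torus ` S. f p \<in> T" using S(3) by blast
 ultimately show "\<exists>S. open S \<and> to_torus z \<in> S \<and> (\<forall>x'\<in>S. f x' \<in> T)" by blast
qed

text \<open>The right-hand side of the difference estimate tends to 0 as the two points merge away
  from the pole. Measurability of K follows from this.\<close>

lemma continuous_biot_savart_kernel:
 assumes G: "green_function G"
 shows "continuous_on (- {0}) (biot_savart_kernel G)"
proof (rule continuous_at_imp_continuous_on, rule ballI)
 fix p :: torus assume p: "p \<in> - {0}"
 obtain z where z: "to_torus z = p" "-pi \<le> fst z" "fst z < pi" "-pi \<le> snd z" "snd z < pi"
  by (rule torus_centered_rep)
 have z0: "z \<noteq> 0" using p z(1) to_torus_0 by auto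
 obtain C where C: "C \<ge> 0" "\<And>z w. z \<in> pole_box ==> w \<in> pole_box ==> z \<noteq> 0 ==> w \<noteq> 0 ==> norm (z - w) \<le> 1 ==>
  norm (planar_kernel z - planar_kernel w) \<le> 20 * (norm (z - w) / (norm z * norm w)) + C * norm (z - w)"
  by (rule planar_kernel_lipschitz) blast
 have zb: "z \<in> pole_box" using z by (auto simp: pole_box_def abs_le_iff)
 define U where "U = {w :: real \<times> real. \<bar>fst w\<bar> < 3 * pi / 2 \<and> \<bar>snd w\<bar> < 3 * pi / 2 \<and> w \<noteq> 0 \<and> norm (w - z) < 1}"
 have "open U" unfolding U_def
  by (intro open_Collect_conj open_Collect_less open_Collect_neq continuous_intros)
 moreover have "z \<in> U" using z z0 by (auto simp: U_def abs_less_iff)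
 ultimately have ev: "\<forall>\<^sub>F w in at z. w \<in> U"
  by (intro eventually_at_in_open')
 have "isCont (\<lambda>w. biot_savart_kernel G (to_torus w)) z"
  unfolding isCont_def Lim_null[of _ "biot_savart_kernel G (to_torus z)"]
 proof (rule Lim_null_comparison)
  show "\<forall>\<^sub>F w in at z. norm (biot_savart_kernel G (to_torus w) - biot_savart_kernel G (to_torus z))
    \<le> 20 * (norm (w - z) / (norm w * norm z)) + C * norm (w - z)"
   using ev
  proof eventually_elim
   case (elim w)
   then have w: "w \<in> pole_box" "w \<noteq> 0" "norm (w - z) \<le> 1" by (auto simp: U_def pole_box_def)
   show ?case
    using norm_kernel_diff(1)[OF G pole_box_strip[OF w(1,2)] pole_box_strip[OF zb z0]] C(2)[OF w(1) zb w(2) z0 w(3)]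
    by simp
  qed
  have "((\<lambda>w. 20 * (norm (w - z) / (norm w * norm z)) + C * norm (w - z)) \<longlongrightarrow>
    20 * (norm (z - z) / (norm z * norm z)) + C * norm (z - z)) (at z)"
   using z0 by (intro tendsto_intros) auto
  then show "((\<lambda>w. 20 * (norm (w - z) / (norm w * norm z)) + C * norm (w - z)) \<longlongrightarrow> 0) (at z)" by simp
 qed
 then show "isCont (biot_savart_kernel G) p" unfolding z(1)[symmetric] by (rule isCont_torusI)
qed

lemma measurable_biot_savart_kernel:
 "green_function G ==> biot_savart_kernel G \<in> borel_measurable borel"
 using borel_measurable_continuous_countable_exceptions[of "{0}"] continuous_biot_savart_kernel by blast

lemma centered_square_pole_box: "z \<in> square (-pi) (-pi) ==> z \<in> pole_box \<and> z \<in> {-pi..pi} \<times> {-pi..pi}"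
proof -
 assume "z \<in> square (-pi) (-pi)"
 then have "- pi \<le> fst z" "fst z \<le> pi" "- pi \<le> snd z" "snd z \<le> pi"
  by (auto simp: mem_Times_iff)
 moreover have "pi \<le> 3 * pi / 2" by simp
 ultimately show ?thesis unfolding pole_box_def mem_Times_iff by auto
qed

text \<open>On the centred square the kernel is at most a constant times \<open>1 / norm z\<close>
  plus a constant, and \<open>1 / norm z\<close> is integrable on bounded planar sets.\<close>

lemma integrable_biot_savart_kernel:
 assumes G: "green_function G"
 shows "integrable torus_lebesgue (biot_savart_kernel G)"
proof (rule integrableI_bounded)
 note K = measurable_biot_savart_kernel[OF G]
 note [measurable] = K
 show "biot_savart_kernel G \<in> borel_measurable torus_lebesgue"
  using K by (simp cong: measurable_cong_sets)
 obtain C where C: "C \<ge> 0" "\<And>z. z \<in> pole_box ==> z \<noteq> 0 ==> norm (planar_kernel z) \<le> C * (1 / norm z) + C"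
  by (rule planar_kernel_bound) blast
 let ?S = "{-pi..pi :: real} \<times> {-pi..pi :: real}"
 have [measurable]: "?S \<in> sets borel" by (intro borel_Times) auto
 have [measurable]: "(indicator ?S :: _ => ennreal) \<in> borel_measurable borel" by (rule borel_measurable_indicator) measurable
 have "(\<integral>\<^sup>+p. ennreal (norm (biot_savart_kernel G p)) \<partial>torus_lebesgue)
   = (\<integral>\<^sup>+z. ennreal (norm (biot_savart_kernel G (to_torus z))) * indicator (square (-pi) (-pi)) z \<partial>lborel)"
  by (rule nn_integral_torus_square) measurable
 also have "\<dots> \<le> (\<integral>\<^sup>+z. ennreal C * (ennreal (1 / norm z) * indicator ?S z) + ennreal C * indicator ?S z \<partial>lborel)"
 proof (rule nn_integral_mono_AE, use AE_lborel_singleton[of "0 :: real \<times> real"] in eventually_elim)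
  fix z :: "real \<times> real" assume z: "z \<noteq> 0"
  show "ennreal (norm (biot_savart_kernel G (to_torus z))) * indicator (square (-pi) (-pi)) z
    \<le> ennreal C * (ennreal (1 / norm z) * indicator ?S z) + ennreal C * indicator ?S z"
  proof (cases "z \<in> square (-pi) (-pi)")
   case True
   then have zb: "z \<in> pole_box" "z \<in> ?S" using centered_square_pole_box by blast+
   have "ennreal (norm (biot_savart_kernel G (to_torus z))) \<le> ennreal (C * (1 / norm z) + C)"
    using C(2)[OF zb(1) z] norm_kernel_diff(2)[OF G pole_box_strip[OF zb(1) z] pole_box_strip[OF zb(1) z]]
    by (intro ennreal_leI) simp
   also have "\<dots> = ennreal C * ennreal (1 / norm z) + ennreal C"
    using C(1) by (simp only: ennreal_plus ennreal_mult zero_le_divide_1_iff norm_ge_zero mult_nonneg_nonneg)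
   finally show ?thesis using True zb by (simp add: indicator_def)
  qed simp
 qed
 also have "\<dots> = ennreal C * (\<integral>\<^sup>+z. ennreal (1 / norm z) * indicator ?S z \<partial>lborel) + ennreal C * (\<integral>\<^sup>+z. indicator ?S z \<partial>lborel)"
 proof -
  define f :: "real \<times> real => ennreal" where "f z = ennreal (1 / norm z) * indicator ?S z" for z
  define g :: "real \<times> real => ennreal" where "g = indicator ?S"
  have [measurable]: "f \<in> borel_measurable borel" "g \<in> borel_measurable borel"
   unfolding f_def[abs_def] g_def by measurable
  have "(\<integral>\<^sup>+z. ennreal C * f z + ennreal C * g z \<partial>lborel)
    = ennreal C * (\<integral>\<^sup>+z. f z \<partial>lborel) + ennreal C * (\<integral>\<^sup>+z. g z \<partial>lborel)"
   by (simp add: nn_integral_add nn_integral_cmult)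
  then show ?thesis unfolding f_def g_def .
 qed
 also have "\<dots> \<le> ennreal C * ennreal (16 * pi) + ennreal C * emeasure lborel ?S"
  using nn_integral_inverse_norm[of pi] by (intro add_mono mult_left_mono) auto
 also have "\<dots> < \<infinity>"
 proof -
  have "bounded ?S" by (intro bounded_Times bounded_closed_interval)
  then have "emeasure lborel ?S < \<infinity>" by (rule emeasure_bounded_finite)
  then show ?thesis by (simp add: ennreal_mult_less_top)
 qed
 finally show "(\<integral>\<^sup>+p. ennreal (norm (biot_savart_kernel G p)) \<partial>torus_lebesgue) < \<infinity>" .
qed

lemma nn_integral_torus_reflect:
 assumes [measurable]: "f \<in> borel_measurable borel"
 shows "(\<integral>\<^sup>+p. f (c - p) \<partial>torus_lebesgue) = (\<integral>\<^sup>+p. f p \<partial>torus_lebesgue)"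
proof -
 have "(\<integral>\<^sup>+p. f p \<partial>torus_lebesgue) = (\<integral>\<^sup>+p. f p \<partial>distr torus_lebesgue borel (\<lambda>p. c - p))"
  by (simp only: torus_lebesgue_reflect)
 also have "\<dots> = (\<integral>\<^sup>+p. f (c - p) \<partial>torus_lebesgue)" by (rule nn_integral_distr) auto
 finally show ?thesis by simp
qed

text \<open>The shifted kernel has its pole at -h. \<open>two_pole_bound\<close> splits the product
  of the two poles, each share integrates to d times a logarithm, and the Lipschitz part contributes
  a multiple of d.\<close>

lemma kernel_small_shift:
 assumes G: "green_function G"
 obtains C where "C \<ge> 0" "\<And>h. 0 < norm h ==> norm h \<le> 1 ==>
  (\<integral>\<^sup>+p. ennreal (norm (biot_savart_kernel G (to_torus h + p) - biot_savart_kernel G p)) \<partial>torus_lebesgue)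
   \<le> ennreal (C * log_modulus (norm h))"
proof -
 note K = measurable_biot_savart_kernel[OF G]
 note [measurable] = K
 obtain C where C: "C \<ge> 0" "\<And>z w. z \<in> pole_box ==> w \<in> pole_box ==> z \<noteq> 0 ==> w \<noteq> 0 ==> norm (z - w) \<le> 1 ==>
  norm (planar_kernel z - planar_kernel w) \<le> 20 * (norm (z - w) / (norm z * norm w)) + C * norm (z - w)"
  by (rule planar_kernel_lipschitz) blast
 \<comment> \<open>Here \<open>40 = 2 * 20\<close> counts the two poles, \<open>ln 11\<close> comes
   from \<open>2 * R + 1\<close> at \<open>R = 5\<close>, and 100 is the area of the box.\<close>
 define C' where "C' = 40 * (32 + 4 * pi * ln 11 + 4 * pi) + 100 * C"
 have "(\<integral>\<^sup>+p. ennreal (norm (biot_savart_kernel G (to_torus h + p) - biot_savart_kernel G p)) \<partial>torus_lebesgue)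
   \<le> ennreal (C' * log_modulus (norm h))" if h: "0 < norm h" "norm h \<le> 1" for h :: "real \<times> real"
 proof -
  define d where "d = norm h"
  have d: "0 < d" "d \<le> 1" using h by (auto simp: d_def)
  define J where "J = 32 * d + 4 * pi * d * (ln (2 * 5 + 1) - ln d)"
  \<comment> \<open>The half side 5 is at least \<open>pi + 1\<close>, so the box contains the
    centred square together with its shift by h.\<close>
  let ?S = "{-5..5 :: real} \<times> {-5..5 :: real}"
  have [measurable]: "?S \<in> sets borel" by (intro borel_Times) auto
  define g :: "real \<times> real => ennreal" where "g z = ennreal (pole_bound d (norm z)) * indicator ?S z" for z
  have [measurable]: "g \<in> borel_measurable borel" unfolding g_def[abs_def] by measurable
  define s :: "real \<times> real => ennreal" where "s = indicator ?S"
  have [measurable]: "s \<in> borel_measurable borel" unfolding s_def by measurable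
  have gJ: "(\<integral>\<^sup>+z. g z \<partial>lborel) \<le> ennreal J"
   unfolding g_def J_def by (rule nn_integral_pole_bound) (use d in auto)
  have gJ': "(\<integral>\<^sup>+z. g (h + z) \<partial>lborel) \<le> ennreal J"
  proof -
   have "(\<integral>\<^sup>+z. g (h + z) \<partial>lborel) = (\<integral>\<^sup>+z. g z \<partial>distr lborel borel ((+) h))"
    by (subst nn_integral_distr) auto
   then show ?thesis using gJ by (simp add: lborel_distr_plus)
  qed
  have "(\<integral>\<^sup>+p. ennreal (norm (biot_savart_kernel G (to_torus h + p) - biot_savart_kernel G p)) \<partial>torus_lebesgue)
    = (\<integral>\<^sup>+z. ennreal (norm (biot_savart_kernel G (to_torus h + to_torus z) - biot_savart_kernel G (to_torus z)))
      * indicator (square (-pi) (-pi)) z \<partial>lborel)"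
   by (rule nn_integral_torus_square) measurable
  also have "\<dots> \<le> (\<integral>\<^sup>+z. ennreal 20 * (g (h + z) + g z) + ennreal (C * d) * s z \<partial>lborel)"
  proof (rule nn_integral_mono_AE, use AE_lborel_singleton[of "0 :: real \<times> real"] AE_lborel_singleton[of "- h"] in eventually_elim)
   fix z :: "real \<times> real" assume z: "z \<noteq> 0" "z \<noteq> - h"
   show "ennreal (norm (biot_savart_kernel G (to_torus h + to_torus z) - biot_savart_kernel G (to_torus z))) * indicator (square (-pi) (-pi)) z
    \<le> ennreal 20 * (g (h + z) + g z) + ennreal (C * d) * s z"
   proof (cases "z \<in> square (-pi) (-pi)")
    case True
    then have zb: "z \<in> pole_box" "z \<in> {-pi..pi} \<times> {-pi..pi}" using centered_square_pole_box by blast+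
    have hc: "\<bar>fst h\<bar> \<le> 1" "\<bar>snd h\<bar> \<le> 1"
     using h(2) norm_fst_le[of "fst h" "snd h"] norm_snd_le[of "snd h" "fst h"] by auto
    have zc: "\<bar>fst z\<bar> \<le> pi" "\<bar>snd z\<bar> \<le> pi" using zb(2) by (auto simp: mem_Times_iff abs_le_iff)
    have "pi \<le> 4" using pi_less_4 by simp
    have hz: "\<bar>fst (h + z)\<bar> \<le> 1 + pi" "\<bar>snd (h + z)\<bar> \<le> 1 + pi" using hc zc by auto
    then have hzb: "h + z \<in> pole_box" using pi_ge_two unfolding pole_box_def by auto
    have S: "z \<in> ?S" "h + z \<in> ?S"
     using hz zc \<open>pi \<le> 4\<close> unfolding mem_Times_iff atLeastAtMost_iff by linarith+
    have hz0: "h + z \<noteq> 0" using z(2) by (metis add_eq_0_iff minus_equation_iff)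
    have "norm (biot_savart_kernel G (to_torus (h + z)) - biot_savart_kernel G (to_torus z))
      = norm (planar_kernel (h + z) - planar_kernel z)"
     by (rule norm_kernel_diff(1)[OF G pole_box_strip[OF hzb hz0] pole_box_strip[OF zb(1) z(1)]])
    also have "\<dots> \<le> 20 * (norm (h + z - z) / (norm (h + z) * norm z)) + C * norm (h + z - z)"
     by (rule C(2)[OF hzb zb(1) hz0 z(1)]) (use h in simp)
    also have "\<dots> = 20 * (d / (norm (h + z) * norm z)) + C * d" by (simp add: d_def)
    also have "\<dots> \<le> 20 * (pole_bound d (norm (h + z)) + pole_bound d (norm z)) + C * d"
    proof (intro add_right_mono mult_left_mono two_pole_bound)
     show "d \<le> norm (h + z) + norm z" using norm_triangle_ineq4[of "h + z" z] by (simp add: d_def)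
    qed (use hz0 z d in auto)
    finally have le: "norm (biot_savart_kernel G (to_torus h + to_torus z) - biot_savart_kernel G (to_torus z))
      \<le> 20 * (pole_bound d (norm (h + z)) + pole_bound d (norm z)) + C * d"
     by (simp add: to_torus_add)
    have nn: "0 \<le> pole_bound d (norm (h + z))" "0 \<le> pole_bound d (norm z)" "0 \<le> C * d"
     using d C(1) by (auto intro!: pole_bound_nonneg)
    have "ennreal (norm (biot_savart_kernel G (to_torus h + to_torus z) - biot_savart_kernel G (to_torus z)))
      \<le> ennreal (20 * (pole_bound d (norm (h + z)) + pole_bound d (norm z)) + C * d)"
     by (rule ennreal_leI[OF le])
    also have "\<dots> = ennreal 20 * (ennreal (pole_bound d (norm (h + z))) + ennreal (pole_bound d (norm z))) + ennreal (C * d)"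
     using nn by (simp only: ennreal_plus ennreal_mult mult_nonneg_nonneg add_nonneg_nonneg zero_le_numeral)
    also have "\<dots> = ennreal 20 * (g (h + z) + g z) + ennreal (C * d) * s z"
     using S by (simp add: g_def s_def)
    finally show ?thesis using True by simp
   qed simp
  qed
  also have "\<dots> = ennreal 20 * ((\<integral>\<^sup>+z. g (h + z) \<partial>lborel) + (\<integral>\<^sup>+z. g z \<partial>lborel)) + ennreal (C * d) * (\<integral>\<^sup>+z. s z \<partial>lborel)"
   by (simp add: nn_integral_add nn_integral_cmult)
  also have "(\<integral>\<^sup>+z. s z \<partial>lborel) = ennreal 100"
  proof -
   have "(\<integral>\<^sup>+z. 1 * indicator ?S z \<partial>(lborel :: (real \<times> real) measure))
     = (\<integral>\<^sup>+x. (\<integral>\<^sup>+y. 1 * indicator {-5..5 :: real} y \<partial>lborel) * indicator {-5..5 :: real} x \<partial>lborel)"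
    by (rule nn_integral_lborel_Times(1)) auto
   also have "\<dots> = ennreal 10 * ennreal 10" by (simp add: nn_integral_cmult)
   finally show ?thesis by (simp add: s_def ennreal_mult[symmetric] del: ennreal_numeral)
  qed
  also have "ennreal 20 * ((\<integral>\<^sup>+z. g (h + z) \<partial>lborel) + (\<integral>\<^sup>+z. g z \<partial>lborel)) + ennreal (C * d) * ennreal 100
    \<le> ennreal 20 * (ennreal J + ennreal J) + ennreal (C * d) * ennreal 100"
   by (intro add_mono mult_left_mono gJ gJ') auto
  also have "\<dots> = ennreal (20 * (J + J) + C * d * 100)"
  proof -
   have "ln 11 - ln d \<ge> 0" using d by simp
   then have "J \<ge> 0" using d by (simp add: J_def)
   then show ?thesis using C(1) d
    by (simp only: ennreal_plus ennreal_mult mult_nonneg_nonneg add_nonneg_nonneg zero_le_numeral less_imp_le)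
  qed
  also have "\<dots> \<le> ennreal (C' * log_modulus (norm h))"
  proof (rule ennreal_leI)
   \<comment> \<open>For \<open>d \<le> 1\<close> both d and \<open>- d * ln d\<close> are at most
     e, so each term of the estimate is bounded by a multiple of e.\<close>
   define e where "e = d * (1 - ln d)"
   have le: "d \<le> e" "d * (- ln d) \<le> e" using d by (simp_all add: e_def algebra_simps mult_le_0_iff)
   have l11: "ln (11 :: real) \<ge> 0" by simp
   have "J = 32 * d + (4 * pi * ln 11) * d + 4 * pi * (d * (- ln d))" by (simp add: J_def algebra_simps)
   also have "\<dots> \<le> 32 * e + (4 * pi * ln 11) * e + 4 * pi * e"
    using le l11 by (intro add_mono mult_left_mono) auto
   finally have "40 * J \<le> 40 * ((32 + 4 * pi * ln 11 + 4 * pi) * e)" by (simp add: algebra_simps)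
   moreover have "C * d * 100 \<le> 100 * C * e" using mult_left_mono[OF le(1) C(1)] by simp
   moreover have "C' * e = 40 * ((32 + 4 * pi * ln 11 + 4 * pi) * e) + 100 * C * e"
    by (simp add: C'_def algebra_simps)
   moreover have "20 * (J + J) = 40 * J" by simp
   ultimately have "20 * (J + J) + C * d * 100 \<le> C' * e" by (simp only: add_mono)
   also have "\<dots> \<le> C' * log_modulus d"
    using log_modulus_ge_entropy[OF d] C(1) l11 by (intro mult_left_mono) (auto simp: e_def C'_def)
   finally show "20 * (J + J) + C * d * 100 \<le> C' * log_modulus (norm h)" by (simp add: d_def)
  qed
  finally show ?thesis .
 qed
 moreover have "C' \<ge> 0" using C(1) by (simp add: C'_def)
 ultimately show thesis using that by blast
qed

text \<open>The shift is realised by its shortest lift. For lengths above 1 the triangle inequality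
  gives twice the L1 norm of K, and the modulus is at least 1 there.\<close>

lemma kernel_shift:
 assumes G: "green_function G"
 obtains C where "C \<ge> 0" "\<And>x x'.
  (\<integral>\<^sup>+y. ennreal (norm (biot_savart_kernel G (x - y) - biot_savart_kernel G (x' - y))) \<partial>torus_lebesgue)
   \<le> ennreal (C * log_modulus (dist x x'))"
proof -
 let ?K = "biot_savart_kernel G"
 note K = measurable_biot_savart_kernel[OF G]
 note [measurable] = K
 obtain C where C: "C \<ge> 0" "\<And>h. 0 < norm h ==> norm h \<le> 1 ==>
  (\<integral>\<^sup>+p. ennreal (norm (?K (to_torus h + p) - ?K p)) \<partial>torus_lebesgue) \<le> ennreal (C * log_modulus (norm h))"
  by (rule kernel_small_shift[OF G]) blast
 define B where "B = (\<integral>p. norm (?K p) \<partial>torus_lebesgue)"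
 have B: "(\<integral>\<^sup>+p. ennreal (norm (?K p)) \<partial>torus_lebesgue) = ennreal B" "B \<ge> 0"
  unfolding B_def using integrable_biot_savart_kernel[OF G]
  by (auto intro!: nn_integral_eq_integral)
 have "(\<integral>\<^sup>+y. ennreal (norm (?K (x - y) - ?K (x' - y))) \<partial>torus_lebesgue) \<le> ennreal ((C + 2 * B) * log_modulus (dist x x'))" for x x'
 proof -
  obtain h where h: "to_torus h = x - x'" "norm h = dist (x - x') 0" by (rule torus_shortest_rep)
  have nh: "norm h = dist x x'" using h(2) dist_torus_diff by simp
  consider "norm h = 0" | "0 < norm h" "norm h \<le> 1" | "norm h > 1" by fastforce
  then show ?thesis
  proof cases
   case 1
   then have "x = x'" using nh by simp
   then show ?thesis by simp
  next
   case 2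
   have "(\<integral>\<^sup>+y. ennreal (norm (?K (x - y) - ?K (x' - y))) \<partial>torus_lebesgue)
     = (\<integral>\<^sup>+y. ennreal (norm (?K (to_torus h + (x' - y)) - ?K (x' - y))) \<partial>torus_lebesgue)"
    by (simp add: h(1))
   also have "\<dots> = (\<integral>\<^sup>+p. ennreal (norm (?K (to_torus h + p) - ?K p)) \<partial>torus_lebesgue)"
    by (rule nn_integral_torus_reflect) measurable
   also have "\<dots> \<le> ennreal (C * log_modulus (norm h))" by (rule C(2)[OF 2])
   also have "\<dots> \<le> ennreal ((C + 2 * B) * log_modulus (dist x x'))"
    unfolding nh using B(2) log_modulus_nonneg by (intro ennreal_leI mult_right_mono) auto
   finally show ?thesis .
  next
   case 3
   have "(\<integral>\<^sup>+y. ennreal (norm (?K (x - y) - ?K (x' - y))) \<partial>torus_lebesgue)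
     \<le> (\<integral>\<^sup>+y. ennreal (norm (?K (x - y))) + ennreal (norm (?K (x' - y))) \<partial>torus_lebesgue)"
    by (intro nn_integral_mono) (simp add: ennreal_plus[symmetric] norm_triangle_ineq4 del: ennreal_plus)
   also have "\<dots> = (\<integral>\<^sup>+y. ennreal (norm (?K (x - y))) \<partial>torus_lebesgue) + (\<integral>\<^sup>+y. ennreal (norm (?K (x' - y))) \<partial>torus_lebesgue)"
    by (rule nn_integral_add) measurable
   also have "\<dots> = ennreal B + ennreal B"
    using nn_integral_torus_reflect[of "\<lambda>p. ennreal (norm (?K p))"] B(1) by simp
   also have "\<dots> = ennreal (2 * B * 1)" using B(2) by (simp add: ennreal_plus[symmetric] del: ennreal_plus)
   also have "\<dots> \<le> ennreal ((C + 2 * B) * log_modulus (dist x x'))"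
    using 3 nh log_modulus_ge_1[of "dist x x'"] C(1) B(2) by (intro ennreal_leI mult_mono) auto
   finally show ?thesis .
  qed
 qed
 then show thesis using that[of "C + 2 * B"] C(1) B(2) by auto
qed

section \<open>Weak divergence of the kernel\<close>

lemma smooth_pd: assumes "smooth \<theta>" shows "smooth (pd1 \<theta>)" "smooth (pd2 \<theta>)"
proof -
 have "C_class (Suc n) \<theta>" for n using assms by (simp only: smooth_def)
 then show "smooth (pd1 \<theta>)" "smooth (pd2 \<theta>)" by (simp_all add: smooth_def)
qed

lemma smooth_continuous: "smooth \<theta> ==> continuous_on UNIV \<theta>"
 unfolding smooth_def by (metis C_class.simps(1))

lemma smooth_partials:
 assumes "smooth \<theta>"
 shows "((\<lambda>h. \<theta> (p + to_torus (h, 0))) has_real_derivative pd1 \<theta> p) (at 0)"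
  and "((\<lambda>h. \<theta> (p + to_torus (0, h))) has_real_derivative pd2 \<theta> p) (at 0)"
proof -
 have "C_class (Suc 0) \<theta>" using assms by (simp only: smooth_def)
 then show "((\<lambda>h. \<theta> (p + to_torus (h, 0))) has_real_derivative pd1 \<theta> p) (at 0)"
  "((\<lambda>h. \<theta> (p + to_torus (0, h))) has_real_derivative pd2 \<theta> p) (at 0)"
  unfolding pd1_def pd2_def by (simp_all add: DERIV_deriv_iff_field_differentiable)
qed

lemma line_derivative:
 shows "((\<lambda>h. f (to_torus (x, y) + to_torus (h, 0))) has_real_derivative d) (at 0)
  ==> ((\<lambda>x. f (to_torus (x, y))) has_real_derivative d) (at x)"
  and "((\<lambda>h. f (to_torus (x, y) + to_torus (0, h))) has_real_derivative d) (at 0)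
  ==> ((\<lambda>y. f (to_torus (x, y))) has_real_derivative d) (at y)"
 using DERIV_shift[of "\<lambda>x. f (to_torus (x, y))" d 0 x] DERIV_shift[of "\<lambda>y. f (to_torus (x, y))" d 0 y]
 by (simp_all add: to_torus_add[symmetric] add.commute)

lemma smooth_add:
 assumes "smooth \<theta>"
 shows "smooth (\<lambda>p. \<theta> (p + c))" and "pd1 (\<lambda>p. \<theta> (p + c)) = (\<lambda>p. pd1 \<theta> (p + c))"
  and "pd2 (\<lambda>p. \<theta> (p + c)) = (\<lambda>p. pd2 \<theta> (p + c))"
proof -
 have comm: "p + q + c = p + c + q" for p q :: torus by (simp add: ac_simps)
 have pd: "pd1 (\<lambda>p. \<theta> (p + c)) = (\<lambda>p. pd1 \<theta> (p + c))" "pd2 (\<lambda>p. \<theta> (p + c)) = (\<lambda>p. pd2 \<theta> (p + c))" for \<theta>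
  unfolding pd1_def[abs_def] pd2_def[abs_def] by (simp_all only: comm)
 have "C_class n (\<lambda>p. \<theta> (p + c))" if "C_class n \<theta>" for n \<theta>
  using that
 proof (induction n arbitrary: \<theta>)
  case 0
  then show ?case by (auto intro!: continuous_on_compose2[of UNIV \<theta>] continuous_intros)
 next
  case (Suc n)
  have cont: "continuous_on UNIV (\<lambda>p. \<theta> (p + c))"
   using Suc.prems by (auto intro!: continuous_on_compose2[of UNIV \<theta>] continuous_intros)
  show ?case unfolding C_class.simps pd comm using Suc.prems Suc.IH cont by simp
 qed
 then show "smooth (\<lambda>p. \<theta> (p + c))" using assms by (simp add: smooth_def)
 show "pd1 (\<lambda>p. \<theta> (p + c)) = (\<lambda>p. pd1 \<theta> (p + c))" "pd2 (\<lambda>p. \<theta> (p + c)) = (\<lambda>p. pd2 \<theta> (p + c))"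
  by (fact pd)+
qed

text \<open>The mean value theorem, applied to the mixed second difference in either order, yields
  equal values of the two mixed derivatives at two points near the given one. By continuity the
  points may merge.\<close>

lemma mixed_partials:
 assumes th: "smooth \<theta>"
 shows "pd2 (pd1 \<theta>) p = pd1 (pd2 \<theta>) p"
proof -
 obtain x y where p: "p = to_torus (x, y)" by (rule torus_cases)
 note s1 = smooth_pd(1)[OF th] and s2 = smooth_pd(2)[OF th]
 let ?A = "\<lambda>z. pd2 (pd1 \<theta>) (to_torus z)" and ?B = "\<lambda>z. pd1 (pd2 \<theta>) (to_torus z)"
 have cA: "continuous_on UNIV ?A" "continuous_on UNIV ?B"
  using smooth_continuous smooth_pd s1 s2
  by (auto intro!: continuous_on_compose2[OF _ continuous_to_torus])
 have F1: "((\<lambda>s. \<theta> (to_torus (s, t))) has_real_derivative pd1 \<theta> (to_torus (s, t))) (at s)" for s t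
  by (rule line_derivative(1)[OF smooth_partials(1)[OF th]])
 have F2: "((\<lambda>t. \<theta> (to_torus (s, t))) has_real_derivative pd2 \<theta> (to_torus (s, t))) (at t)" for s t
  by (rule line_derivative(2)[OF smooth_partials(2)[OF th]])
 have F12: "((\<lambda>t. pd1 \<theta> (to_torus (s, t))) has_real_derivative ?A (s, t)) (at t)" for s t
  by (rule line_derivative(2)[OF smooth_partials(2)[OF s1]])
 have F21: "((\<lambda>s. pd2 \<theta> (to_torus (s, t))) has_real_derivative ?B (s, t)) (at s)" for s t
  by (rule line_derivative(1)[OF smooth_partials(1)[OF s2]])
 have ex: "\<exists>z w. dist z (x, y) < 2 * h \<and> dist w (x, y) < 2 * h \<and> ?A z = ?B w" if h: "h > 0" for h
 proof -
  let ?S = "\<theta> (to_torus (x + h, y + h)) - \<theta> (to_torus (x + h, y)) - \<theta> (to_torus (x, y + h)) + \<theta> (to_torus (x, y))"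
  have near: "dist (a, b) (x, y) < 2 * h" if "x < a" "a < x + h" "y < b" "b < y + h" for a b
  proof -
   have "dist (a, b) (x, y) \<le> \<bar>a - x\<bar> + \<bar>b - y\<bar>"
    unfolding dist_norm diff_Pair using norm_Pair_le[of "a - x" "b - y"] by simp
   then show ?thesis using that by simp
  qed
  obtain a where a: "x < a" "a < x + h"
   "(\<theta> (to_torus (x + h, y + h)) - \<theta> (to_torus (x + h, y))) - (\<theta> (to_torus (x, y + h)) - \<theta> (to_torus (x, y)))
    = (x + h - x) * (pd1 \<theta> (to_torus (a, y + h)) - pd1 \<theta> (to_torus (a, y)))"
   using MVT2[of x "x + h" "\<lambda>s. \<theta> (to_torus (s, y + h)) - \<theta> (to_torus (s, y))"
     "\<lambda>s. pd1 \<theta> (to_torus (s, y + h)) - pd1 \<theta> (to_torus (s, y))"] h DERIV_diff[OF F1 F1] by auto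
  obtain b where b: "y < b" "b < y + h"
   "pd1 \<theta> (to_torus (a, y + h)) - pd1 \<theta> (to_torus (a, y)) = (y + h - y) * ?A (a, b)"
   using MVT2[of y "y + h" "\<lambda>t. pd1 \<theta> (to_torus (a, t))" "\<lambda>t. ?A (a, t)"] h F12 by auto
  have S1: "?S = h * (h * ?A (a, b))" using a(3) b(3) by simp
  obtain b' where b': "y < b'" "b' < y + h"
   "(\<theta> (to_torus (x + h, y + h)) - \<theta> (to_torus (x, y + h))) - (\<theta> (to_torus (x + h, y)) - \<theta> (to_torus (x, y)))
    = (y + h - y) * (pd2 \<theta> (to_torus (x + h, b')) - pd2 \<theta> (to_torus (x, b')))"
   using MVT2[of y "y + h" "\<lambda>t. \<theta> (to_torus (x + h, t)) - \<theta> (to_torus (x, t))"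
     "\<lambda>t. pd2 \<theta> (to_torus (x + h, t)) - pd2 \<theta> (to_torus (x, t))"] h DERIV_diff[OF F2 F2] by auto
  obtain a' where a': "x < a'" "a' < x + h"
   "pd2 \<theta> (to_torus (x + h, b')) - pd2 \<theta> (to_torus (x, b')) = (x + h - x) * ?B (a', b')"
   using MVT2[of x "x + h" "\<lambda>s. pd2 \<theta> (to_torus (s, b'))" "\<lambda>s. ?B (s, b')"] h F21 by auto
  have S2: "?S = h * (h * ?B (a', b'))" using a'(3) b'(3) by simp
  have "?A (a, b) = ?B (a', b')" using S1 S2 h by simp
  then show ?thesis using near a b a' b' by blast
 qed
 have "\<bar>?A (x, y) - ?B (x, y)\<bar> \<le> 0 + e" if e: "e > 0" for e
 proof -
  have e2: "e / 2 > 0" using e by simp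
  obtain d1 where d1: "d1 > 0" "\<And>z. dist z (x, y) < d1 ==> dist (?A z) (?A (x, y)) < e / 2"
   using cA(1)[unfolded continuous_on_iff, rule_format, OF UNIV_I e2, of "(x, y)"] by auto
  obtain d2 where d2: "d2 > 0" "\<And>z. dist z (x, y) < d2 ==> dist (?B z) (?B (x, y)) < e / 2"
   using cA(2)[unfolded continuous_on_iff, rule_format, OF UNIV_I e2, of "(x, y)"] by auto
  obtain z w where zw: "dist z (x, y) < 2 * (min d1 d2 / 2)" "dist w (x, y) < 2 * (min d1 d2 / 2)" "?A z = ?B w"
   using ex[of "min d1 d2 / 2"] d1(1) d2(1) by auto
  have "dist (?A z) (?A (x, y)) < e / 2" "dist (?B w) (?B (x, y)) < e / 2"
   using d1(2)[of z] d2(2)[of w] zw(1,2) by auto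
  then show ?thesis using zw(3) unfolding dist_real_def by linarith
 qed
 then have "\<bar>?A (x, y) - ?B (x, y)\<bar> \<le> 0" by (rule field_le_epsilon)
 then show ?thesis by (simp add: p)
qed

lemma integrable_torus_mult_continuous:
 fixes g f :: "torus => real"
 assumes g: "integrable torus_lebesgue g" and f: "continuous_on UNIV f"
 shows "integrable torus_lebesgue (\<lambda>p. g p * f p)"
proof -
 have "bounded (range f)" by (rule compact_imp_bounded[OF compact_continuous_image[OF f compact_torus]])
 then obtain B where B: "\<And>p. norm (f p) \<le> B" unfolding bounded_iff by auto
 have "f \<in> borel_measurable borel" by (rule borel_measurable_continuous_onI[OF f])
 then have "f \<in> borel_measurable torus_lebesgue" by (simp cong: measurable_cong_sets)
 then have m: "(\<lambda>p. g p * f p) \<in> borel_measurable torus_lebesgue"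
  by (rule borel_measurable_times[OF borel_measurable_integrable[OF g]])
 have "norm (g p * f p) \<le> norm (B * g p)" for p
 proof -
  have "\<bar>f p\<bar> \<le> \<bar>B\<bar>" using B[of p] by simp
  then have "\<bar>f p\<bar> * \<bar>g p\<bar> \<le> \<bar>B\<bar> * \<bar>g p\<bar>" by (rule mult_right_mono) simp
  then show ?thesis by (simp add: abs_mult mult.commute)
 qed
 then show ?thesis
  by (intro Bochner_Integration.integrable_bound[OF integrable_mult_right[OF g, of B] m] AE_I2)
qed

lemma green_partials_torus:
 assumes G: "green_function G" and p: "p \<noteq> 0"
 shows "((\<lambda>h. G (p + to_torus (h, 0))) has_real_derivative pd1 G p) (at 0)"
  and "((\<lambda>h. G (p + to_torus (0, h))) has_real_derivative pd2 G p) (at 0)"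
proof -
 obtain z where z: "to_torus z = p" "-pi \<le> fst z" "fst z < pi" "-pi \<le> snd z" "snd z < pi"
  by (rule torus_centered_rep)
 have z0: "z \<noteq> 0" using p z(1) to_torus_0 by auto
 have "z \<in> pole_box" using centered_square_pole_box[of z] z by (simp add: mem_Times_iff)
 then have s: "(fst z, snd z) \<in> strip" using pole_box_strip z0 by simp
 show "((\<lambda>h. G (p + to_torus (h, 0))) has_real_derivative pd1 G p) (at 0)"
  "((\<lambda>h. G (p + to_torus (0, h))) has_real_derivative pd2 G p) (at 0)"
  using green_has_partials[OF G s] green_pd[OF G s] by (simp_all add: z(1))
qed

text \<open>Fubini on the period square. Lines strictly inside carry the whole integral, and these
  miss the pole.\<close>

lemma integral_square_lines:
 fixes u :: "torus => real"
 assumes u: "integrable torus_lebesgue u"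
 shows "(\<And>y. 0 < y ==> y < 2 * pi ==> (\<integral>x. indicator {0..2 * pi} x * u (to_torus (x, y)) \<partial>lborel) = 0)
   ==> (\<integral>p. u p \<partial>torus_lebesgue) = 0"
  and "(\<And>x. 0 < x ==> x < 2 * pi ==> (\<integral>y. indicator {0..2 * pi} y * u (to_torus (x, y)) \<partial>lborel) = 0)
   ==> (\<integral>p. u p \<partial>torus_lebesgue) = 0"
proof -
 have um: "u \<in> borel_measurable borel" using borel_measurable_integrable[OF u] by (simp cong: measurable_cong_sets)
 have int: "integrable lborel (\<lambda>z. indicator closed_square z * u (to_torus z))"
  using u integral_torus_closed_square(2)[OF um] by simp
 have feq: "(\<lambda>(x, y). indicator {0..2 * pi} x * (indicator {0..2 * pi} y * u (to_torus (x, y))))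
   = (\<lambda>z. indicator closed_square z * u (to_torus z))"
  by (rule ext, clarify) (simp add: indicator_times)
 have int2: "integrable (lborel \<Otimes>\<^sub>M lborel) (\<lambda>(x, y). indicator {0..2 * pi} x * (indicator {0..2 * pi} y * u (to_torus (x, y))))"
  using int unfolding lborel_prod feq .
 have eq: "(\<integral>p. u p \<partial>torus_lebesgue)
   = (\<integral>(x, y). indicator {0..2 * pi} x * (indicator {0..2 * pi} y * u (to_torus (x, y))) \<partial>(lborel \<Otimes>\<^sub>M lborel))"
  unfolding integral_torus_closed_square(1)[OF um] lborel_prod feq ..
 have ae: "AE y in lborel. y \<noteq> 0 \<and> y \<noteq> 2 * pi"
  using AE_lborel_singleton[of 0] AE_lborel_singleton[of "2 * pi"] by eventually_elim simp
 show "(\<integral>p. u p \<partial>torus_lebesgue) = 0"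
  if h: "\<And>y. 0 < y ==> y < 2 * pi ==> (\<integral>x. indicator {0..2 * pi} x * u (to_torus (x, y)) \<partial>lborel) = 0"
 proof -
  have "(\<integral>p. u p \<partial>torus_lebesgue)
   = (\<integral>y. (\<integral>x. indicator {0..2 * pi} x * (indicator {0..2 * pi} y * u (to_torus (x, y))) \<partial>lborel) \<partial>lborel)"
   unfolding eq by (rule lborel_pair.integral_snd[symmetric]) (use int2 in simp)
  also have "\<dots> = 0"
  proof (rule integral_eq_zero_AE, use ae in eventually_elim)
   fix y assume y: "y \<noteq> 0 \<and> y \<noteq> 2 * pi"
   show "(\<integral>x. indicator {0..2 * pi} x * (indicator {0..2 * pi} y * u (to_torus (x, y))) \<partial>lborel) = 0"
    using h[of y] y by (cases "y \<in> {0..2 * pi}") auto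
  qed
  finally show ?thesis .
 qed
 show "(\<integral>p. u p \<partial>torus_lebesgue) = 0"
  if h: "\<And>x. 0 < x ==> x < 2 * pi ==> (\<integral>y. indicator {0..2 * pi} y * u (to_torus (x, y)) \<partial>lborel) = 0"
 proof -
  have "(\<integral>p. u p \<partial>torus_lebesgue)
   = (\<integral>x. (\<integral>y. indicator {0..2 * pi} x * (indicator {0..2 * pi} y * u (to_torus (x, y))) \<partial>lborel) \<partial>lborel)"
   unfolding eq by (rule lborel_pair.integral_fst[symmetric]) (use int2 in simp)
  also have "\<dots> = 0"
  proof (rule integral_eq_zero_AE, use ae in eventually_elim)
   fix x assume x: "x \<noteq> 0 \<and> x \<noteq> 2 * pi"
   show "(\<integral>y. indicator {0..2 * pi} x * (indicator {0..2 * pi} y * u (to_torus (x, y))) \<partial>lborel) = 0"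
    using h[of x] x by (cases "x \<in> {0..2 * pi}") auto
  qed
  finally show ?thesis .
 qed
qed

lemma not_lattice_fst: "0 < x ==> x < 2 * pi ==> to_torus (x, y) \<noteq> 0"
 and not_lattice_snd: "0 < y ==> y < 2 * pi ==> to_torus (x, y) \<noteq> 0"
proof -
 have no: False if "0 < 2 * pi * of_int m" "2 * pi * of_int m < 2 * pi" for m :: int
 proof -
  have "0 < 2 * pi * of_int m" "2 * pi * of_int m < 2 * pi * 1" using that by simp_all
  then have "0 < m" "m < 1" by (auto simp: zero_less_mult_iff)
  then show False by simp
 qed
 show "to_torus (x, y) \<noteq> 0" if "0 < x" "x < 2 * pi"
  using no that unfolding to_torus_eq_0_iff torus_lattice_iff by auto
 show "to_torus (x, y) \<noteq> 0" if "0 < y" "y < 2 * pi"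
  using no that unfolding to_torus_eq_0_iff torus_lattice_iff by auto
qed

lemma green_pd_continuous:
 assumes G: "green_function G"
 shows "continuous_on (- {0}) (pd1 G)" "continuous_on (- {0}) (pd2 G)"
  and "integrable torus_lebesgue (pd1 G)" "integrable torus_lebesgue (pd2 G)"
proof -
 have e: "pd1 G = (\<lambda>p. - snd (biot_savart_kernel G p))" "pd2 G = (\<lambda>p. fst (biot_savart_kernel G p))"
  by (auto simp: biot_savart_kernel_def)
 show "continuous_on (- {0}) (pd1 G)" "continuous_on (- {0}) (pd2 G)"
  unfolding e by (intro continuous_intros continuous_biot_savart_kernel[OF G])+
 show "integrable torus_lebesgue (pd1 G)"
  unfolding e using integrable_bounded_linear[OF bounded_linear_snd integrable_biot_savart_kernel[OF G]] by simp
 show "integrable torus_lebesgue (pd2 G)"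
  unfolding e by (rule integrable_bounded_linear[OF bounded_linear_fst integrable_biot_savart_kernel[OF G]])
qed

text \<open>On a line strictly inside the period square \<open>G * f\<close> is differentiable and
  takes equal values at both ends, so its derivative integrates to zero. Integrability of the
  gradient of G lets the lines be put together across the pole.\<close>

lemma green_by_parts:
 assumes G: "green_function G" and f: "smooth f"
 shows "(\<integral>p. pd1 G p * f p \<partial>torus_lebesgue) = - (\<integral>p. G p * pd1 f p \<partial>torus_lebesgue)"
  and "(\<integral>p. pd2 G p * f p \<partial>torus_lebesgue) = - (\<integral>p. G p * pd2 f p \<partial>torus_lebesgue)"
proof -
 have Gi: "integrable torus_lebesgue G" and Gc: "continuous_on (- {0}) G"
  using G by (auto simp: green_function_def zero_mean_def)
 have fc: "continuous_on UNIV f" "continuous_on UNIV (pd1 f)" "continuous_on UNIV (pd2 f)"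
  using f smooth_continuous smooth_pd by auto
 note i1 = integrable_torus_mult_continuous[OF green_pd_continuous(3)[OF G] fc(1)] integrable_torus_mult_continuous[OF Gi fc(2)]
 note i2 = integrable_torus_mult_continuous[OF green_pd_continuous(4)[OF G] fc(1)] integrable_torus_mult_continuous[OF Gi fc(3)]
 have path: "continuous_on S (\<lambda>t. g (to_torus (c t)))"
  if "continuous_on (- {0}) g" "continuous_on S c" "\<And>t. t \<in> S ==> to_torus (c t) \<noteq> 0" for g :: "torus => real" and S :: "real set" and c
  using that by (intro continuous_on_compose2[OF that(1) continuous_on_to_torus[OF that(2)]]) auto
 have fc': "continuous_on (- {0}) f" "continuous_on (- {0}) (pd1 f)" "continuous_on (- {0}) (pd2 f)"
  using fc continuous_on_subset by blast+
 have "(\<integral>p. pd1 G p * f p + G p * pd1 f p \<partial>torus_lebesgue) = 0"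
 proof (rule integral_square_lines(1)[OF Bochner_Integration.integrable_add[OF i1]])
  fix y :: real assume y: "0 < y" "y < 2 * pi"
  note n = not_lattice_snd[OF y]
  have c: "continuous_on S (\<lambda>x. (x, y))" for S by (intro continuous_intros)
  let ?F = "\<lambda>x. G (to_torus (x, y)) * f (to_torus (x, y))"
  have "has_bochner_integral lborel (\<lambda>x. indicator {0..2 * pi} x *\<^sub>R
    (pd1 G (to_torus (x, y)) * f (to_torus (x, y)) + G (to_torus (x, y)) * pd1 f (to_torus (x, y)))) (?F (2 * pi) - ?F 0)"
  proof (rule has_bochner_integral_FTC_Icc)
   fix x :: real
   have "(?F has_real_derivative pd1 G (to_torus (x, y)) * f (to_torus (x, y)) + pd1 f (to_torus (x, y)) * G (to_torus (x, y))) (at x)"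
    by (rule DERIV_mult[OF line_derivative(1)[OF green_partials_torus(1)[OF G n]] line_derivative(1)[OF smooth_partials(1)[OF f]]])
   then show "(?F has_vector_derivative pd1 G (to_torus (x, y)) * f (to_torus (x, y)) + G (to_torus (x, y)) * pd1 f (to_torus (x, y))) (at x within {0..2 * pi})"
    unfolding has_real_derivative_iff_has_vector_derivative[symmetric]
    by (subst mult.commute[of "G (to_torus (x, y))"]) (rule has_field_derivative_at_within)
  next
   show "continuous_on {0..2 * pi} (\<lambda>x. pd1 G (to_torus (x, y)) * f (to_torus (x, y)) + G (to_torus (x, y)) * pd1 f (to_torus (x, y)))"
    by (intro continuous_on_add continuous_on_mult path c n green_pd_continuous[OF G] Gc fc')
  qed simp
  moreover have "?F (2 * pi) = ?F 0" using to_torus_periodic[of 0 1 y 0] by simp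
  ultimately show "(\<integral>x. indicator {0..2 * pi} x * (pd1 G (to_torus (x, y)) * f (to_torus (x, y)) + G (to_torus (x, y)) * pd1 f (to_torus (x, y))) \<partial>lborel) = 0"
   by (simp add: has_bochner_integral_iff)
 qed
 then show "(\<integral>p. pd1 G p * f p \<partial>torus_lebesgue) = - (\<integral>p. G p * pd1 f p \<partial>torus_lebesgue)"
  using Bochner_Integration.integral_add[OF i1] by simp
 have "(\<integral>p. pd2 G p * f p + G p * pd2 f p \<partial>torus_lebesgue) = 0"
 proof (rule integral_square_lines(2)[OF Bochner_Integration.integrable_add[OF i2]])
  fix x :: real assume x: "0 < x" "x < 2 * pi"
  note n = not_lattice_fst[OF x]
  have c: "continuous_on S (\<lambda>y. (x, y))" for S by (intro continuous_intros)
  let ?F = "\<lambda>y. G (to_torus (x, y)) * f (to_torus (x, y))"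
  have "has_bochner_integral lborel (\<lambda>y. indicator {0..2 * pi} y *\<^sub>R
    (pd2 G (to_torus (x, y)) * f (to_torus (x, y)) + G (to_torus (x, y)) * pd2 f (to_torus (x, y)))) (?F (2 * pi) - ?F 0)"
  proof (rule has_bochner_integral_FTC_Icc)
   fix y :: real
   have "(?F has_real_derivative pd2 G (to_torus (x, y)) * f (to_torus (x, y)) + pd2 f (to_torus (x, y)) * G (to_torus (x, y))) (at y)"
    by (rule DERIV_mult[OF line_derivative(2)[OF green_partials_torus(2)[OF G n]] line_derivative(2)[OF smooth_partials(2)[OF f]]])
   then show "(?F has_vector_derivative pd2 G (to_torus (x, y)) * f (to_torus (x, y)) + G (to_torus (x, y)) * pd2 f (to_torus (x, y))) (at y within {0..2 * pi})"
    unfolding has_real_derivative_iff_has_vector_derivative[symmetric]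
    by (subst mult.commute[of "G (to_torus (x, y))"]) (rule has_field_derivative_at_within)
  next
   show "continuous_on {0..2 * pi} (\<lambda>y. pd2 G (to_torus (x, y)) * f (to_torus (x, y)) + G (to_torus (x, y)) * pd2 f (to_torus (x, y)))"
    by (intro continuous_on_add continuous_on_mult path c n green_pd_continuous[OF G] Gc fc')
  qed simp
  moreover have "?F (2 * pi) = ?F 0" using to_torus_periodic[of x 0 0 1] by simp
  ultimately show "(\<integral>y. indicator {0..2 * pi} y * (pd2 G (to_torus (x, y)) * f (to_torus (x, y)) + G (to_torus (x, y)) * pd2 f (to_torus (x, y))) \<partial>lborel) = 0"
   by (simp add: has_bochner_integral_iff)
 qed
 then show "(\<integral>p. pd2 G p * f p \<partial>torus_lebesgue) = - (\<integral>p. G p * pd2 f p \<partial>torus_lebesgue)"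
  using Bochner_Integration.integral_add[OF i2] by simp
qed

text \<open>With the pole moved to the origin, integration by parts leaves G against the commutator
  of the two partial derivatives of the test function.\<close>

lemma kernel_divergence:
 assumes G: "green_function G" and th: "smooth \<theta>"
 shows "(\<integral>x. biot_savart_kernel G (x - c) \<bullet> (pd1 \<theta> x, pd2 \<theta> x) \<partial>torus_lebesgue) = 0"
proof -
 note [measurable] = measurable_biot_savart_kernel[OF G]
 define \<eta> where "\<eta> = (\<lambda>p. \<theta> (p + c))"
 have eta: "smooth \<eta>" "pd1 \<eta> = (\<lambda>p. pd1 \<theta> (p + c))" "pd2 \<eta> = (\<lambda>p. pd2 \<theta> (p + c))"
  unfolding \<eta>_def by (rule smooth_add[OF th])+
 note s = smooth_pd[OF eta(1)]
 have m: "(\<lambda>p. biot_savart_kernel G (p - c) \<bullet> (pd1 \<theta> p, pd2 \<theta> p)) \<in> borel_measurable borel"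
 proof -
  have [measurable]: "pd1 \<theta> \<in> borel_measurable borel" "pd2 \<theta> \<in> borel_measurable borel"
   by (intro borel_measurable_continuous_onI smooth_continuous smooth_pd th)+
  show ?thesis by measurable
 qed
 have "(\<integral>x. biot_savart_kernel G (x - c) \<bullet> (pd1 \<theta> x, pd2 \<theta> x) \<partial>torus_lebesgue)
   = (\<integral>x. biot_savart_kernel G (x - c) \<bullet> (pd1 \<theta> x, pd2 \<theta> x) \<partial>distr torus_lebesgue borel (\<lambda>p. p + c))"
  by (simp only: torus_lebesgue_add)
 also have "\<dots> = (\<integral>p. biot_savart_kernel G (p + c - c) \<bullet> (pd1 \<theta> (p + c), pd2 \<theta> (p + c)) \<partial>torus_lebesgue)"
  by (rule integral_distr) (use m in auto)
 also have "\<dots> = (\<integral>p. pd2 G p * pd1 \<eta> p - pd1 G p * pd2 \<eta> p \<partial>torus_lebesgue)"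
  by (intro Bochner_Integration.integral_cong refl) (simp add: biot_savart_kernel_def eta)
 also have "\<dots> = (\<integral>p. pd2 G p * pd1 \<eta> p \<partial>torus_lebesgue) - (\<integral>p. pd1 G p * pd2 \<eta> p \<partial>torus_lebesgue)"
  by (intro Bochner_Integration.integral_diff integrable_torus_mult_continuous green_pd_continuous[OF G] smooth_continuous s)
 also have "\<dots> = 0"
  unfolding green_by_parts[OF G s(1)] green_by_parts[OF G s(2)] mixed_partials[OF eta(1)] by simp
 finally show ?thesis .
qed

section \<open>The kernel through its properties\<close>

text \<open>The properties on which the velocity estimates rest: \<open>K_shift\<close> yields every
  modulus, \<open>K_div\<close> the divergence, and continuity off the pole the continuity in
  time.\<close>

locale log_kernel =
 fixes K :: "torus => real \<times> real" and Ck :: real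
 assumes K_cont: "continuous_on (- {0}) K"
  and K_int: "integrable torus_lebesgue K"
  and Ck: "Ck \<ge> 0"
  and K_shift: "(\<integral>\<^sup>+y. ennreal (norm (K (x - y) - K (x' - y))) \<partial>torus_lebesgue) \<le> ennreal (Ck * log_modulus (dist x x'))"
  and K_div: "smooth \<theta> ==> (\<integral>x. K (x - c) \<bullet> (pd1 \<theta> x, pd2 \<theta> x) \<partial>torus_lebesgue) = 0"

lemma biot_savart_log_kernel:
 assumes "green_function G"
 obtains C where "log_kernel (biot_savart_kernel G) C"
proof -
 obtain C where C: "C \<ge> 0" "\<And>x x'.
  (\<integral>\<^sup>+y. ennreal (norm (biot_savart_kernel G (x - y) - biot_savart_kernel G (x' - y))) \<partial>torus_lebesgue)
   \<le> ennreal (C * log_modulus (dist x x'))"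
  by (rule kernel_shift[OF assms]) blast
 have "log_kernel (biot_savart_kernel G) C"
  by unfold_locales (use C continuous_biot_savart_kernel[OF assms] integrable_biot_savart_kernel[OF assms]
    kernel_divergence[OF assms] in auto)
 then show thesis by (rule that)
qed

section \<open>Measurability and integration\<close>

text \<open>The points are chosen inside S, since they are inserted into functions that are
  controlled on S only.\<close>

lemma countable_dense_subset:
 fixes S :: "'a :: {metric_space, second_countable_topology} set"
 obtains D where "countable D" "D \<subseteq> S" "\<And>x e. x \<in> S ==> e > 0 ==> \<exists>d\<in>D. dist x d < e"
proof -
 obtain B :: "'a set set" where B: "countable B" "topological_basis B" using ex_countable_basis by blast
 define D where "D = (\<lambda>b. SOME x. x \<in> b \<inter> S) ` {b \<in> B. b \<inter> S \<noteq> {}}"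
 have some: "(SOME x. x \<in> b \<inter> S) \<in> b \<inter> S" if "b \<inter> S \<noteq> {}" for b
 proof -
  have "\<exists>x. x \<in> b \<inter> S" using that by blast
  then show ?thesis by (rule someI_ex)
 qed
 have "countable {b \<in> B. b \<inter> S \<noteq> {}}" by (rule countable_subset[OF _ B(1)]) blast
 then have "countable D" unfolding D_def by (rule countable_image)
 moreover have "D \<subseteq> S"
 proof
  fix x assume "x \<in> D"
  then obtain b where "b \<inter> S \<noteq> {}" "x = (SOME x. x \<in> b \<inter> S)" unfolding D_def by blast
  then show "x \<in> S" using some[of b] by blast
 qed
 moreover have "\<exists>d\<in>D. dist x d < e" if x: "x \<in> S" "e > 0" for x e
 proof -
  obtain b where b: "b \<in> B" "x \<in> b" "b \<subseteq> ball x e"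
   using topological_basisE[OF B(2) open_ball, of x x e] x(2) by auto
  then have ne: "b \<inter> S \<noteq> {}" using x by auto
  have "(SOME x. x \<in> b \<inter> S) \<in> D" unfolding D_def using b ne by blast
  moreover have "dist x (SOME x. x \<in> b \<inter> S) < e" using some[OF ne] b(3) by auto
  ultimately show ?thesis by blast
 qed
 ultimately show thesis by (rule that)
qed

text \<open>A point x is replaced by the first member of a dense sequence within
  \<open>1 / (n + 1)\<close> of it. This selection takes countably many values, so the
  approximations are measurable, and they converge by continuity in x.\<close>

lemma caratheodory_measurable:
 fixes f :: "'w => 'a :: {metric_space, second_countable_topology} => 'b :: metric_space"
 assumes meas: "\<And>x. x \<in> S ==> (\<lambda>w. f w x) \<in> borel_measurable M"
  and cont: "\<And>w. w \<in> space M ==> continuous_on S (f w)"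
 shows "(\<lambda>(w, x). f w x) \<in> borel_measurable (M \<Otimes>\<^sub>M restrict_space borel S)"
proof (cases "S = {}")
 case True
 then show ?thesis by (auto simp: measurable_def space_pair_measure space_restrict_space)
next
 case False
 obtain D where D: "countable D" "D \<subseteq> S" "\<And>x e. x \<in> S ==> e > 0 ==> \<exists>d\<in>D. dist x d < e"
  using countable_dense_subset by blast
 have Dne: "D \<noteq> {}" using False D(3)[of _ 1] by fastforce
 define d where "d = from_nat_into D"
 have dS: "d i \<in> S" for i using from_nat_into[OF Dne] D(2) by (auto simp: d_def)
 define idx where "idx n x = (LEAST i. dist x (d i) < inverse (real (Suc n)))" for n x
 have idx: "dist x (d (idx n x)) < inverse (real (Suc n))" if x: "x \<in> S" for n x
 proof -
  have "inverse (real (Suc n)) > 0" by simp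
  then obtain c where c: "c \<in> D" "dist x c < inverse (real (Suc n))" using D(3)[OF x] by blast
  obtain i where i: "d i = c" using from_nat_into_surj[OF D(1) c(1)] unfolding d_def by blast
  show ?thesis unfolding idx_def
   by (rule LeastI[of "\<lambda>i. dist x (d i) < inverse (real (Suc n))" i]) (simp only: i c(2))
 qed
 let ?N = "M \<Otimes>\<^sub>M restrict_space borel S"
 have snd_m[measurable]: "snd \<in> borel_measurable ?N"
 proof -
  have "(\<lambda>x. x) \<in> borel_measurable (restrict_space borel S)" by (rule measurable_restrict_space1) simp
  then have "(\<lambda>p. (\<lambda>x. x) (snd p)) \<in> borel_measurable ?N" by (rule measurable_compose[OF measurable_snd])
  then show ?thesis by simp
 qed
 show ?thesis
 proof (rule borel_measurable_LIMSEQ_metric)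
  fix n
  show "(\<lambda>p. f (fst p) (d (idx n (snd p)))) \<in> borel_measurable ?N"
  proof (rule measurable_compose_countable[where f = "\<lambda>i p. f (fst p) (d i)" and g = "\<lambda>p. idx n (snd p)"])
   show "(\<lambda>p. f (fst p) (d i)) \<in> borel_measurable ?N" for i
    by (rule measurable_compose[OF measurable_fst meas[OF dS]])
   show "(\<lambda>p. idx n (snd p)) \<in> measurable ?N (count_space UNIV)"
    unfolding idx_def by measurable
  qed
 next
  fix p assume "p \<in> space ?N"
  then obtain w x where p: "p = (w, x)" "w \<in> space M" "x \<in> S"
   by (auto simp: space_pair_measure space_restrict_space)
  have "(\<lambda>n. d (idx n x)) \<longlonglongrightarrow> x"
  proof (rule metric_LIMSEQ_I)
   fix r :: real assume r: "r > 0"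
   obtain N where N: "inverse (real (Suc N)) < r" using reals_Archimedean[OF r] by blast
   have "dist (d (idx n x)) x < r" if n: "n \<ge> N" for n
   proof -
    have "inverse (real (Suc n)) \<le> inverse (real (Suc N))" using n by (intro le_imp_inverse_le) auto
    then show ?thesis
     using idx[OF p(3), of n] N unfolding dist_commute[of x "d (idx n x)"] by linarith
   qed
   then show "\<exists>N. \<forall>n\<ge>N. dist (d (idx n x)) x < r" by blast
  qed
  then show "(\<lambda>n. f (fst p) (d (idx n (snd p)))) \<longlonglongrightarrow> (case p of (w, x) => f w x)"
   unfolding p(1) fst_conv snd_conv prod.case
   by (rule continuous_on_tendsto_compose[OF cont[OF p(2)]]) (use dS p(3) in auto)
 qed
qed

text \<open>Off N the map is constant, and the trace on N of an event of P is a null set, which F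
  contains by assumption.\<close>

lemma measurable_null_retract:
 assumes sub: "subalgebra P F" and null: "null_sets P \<subseteq> sets F" and N: "N \<in> null_sets P" and w0: "w0 \<in> space P"
 shows "(\<lambda>w. if w \<in> N then w else w0) \<in> measurable F P"
proof (rule measurableI)
 have sp: "space F = space P" using sub by (simp add: subalgebra_def)
 fix w assume "w \<in> space F"
 then show "(if w \<in> N then w else w0) \<in> space P" using sp w0 by auto
next
 have sp: "space F = space P" using sub by (simp add: subalgebra_def)
 have NF: "N \<in> sets F" using N null by auto
 fix A assume A: "A \<in> sets P"
 have "A \<inter> N \<in> null_sets P" using N A by (rule null_set_Int1)
 then have AF: "A \<inter> N \<in> sets F" using null by auto
 have "(\<lambda>w. if w \<in> N then w else w0) -` A \<inter> space F = (A \<inter> N) \<union> (if w0 \<in> A then space F - N else {})"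
  using sets.sets_into_space[OF A] sp by (auto split: if_splits)
 also have "\<dots> \<in> sets F" using AF NF by auto
 finally show "(\<lambda>w. if w \<in> N then w else w0) -` A \<inter> space F \<in> sets F" .
qed

text \<open>On N the function is f composed with the retraction, elsewhere it is the adapted
  version; both are measurable for F, and N belongs to F.\<close>

lemma measurable_off_null_set:
 fixes f f' :: "'w => 'm => 'b :: topological_space"
 assumes sub: "subalgebra P F" and null: "null_sets P \<subseteq> sets F" and N: "N \<in> null_sets P"
  and f: "(\<lambda>(w, m). f w m) \<in> borel_measurable (P \<Otimes>\<^sub>M M)"
  and f': "(\<lambda>(w, m). f' w m) \<in> borel_measurable (F \<Otimes>\<^sub>M M)"
  and eq: "\<And>w m. w \<in> space P - N ==> m \<in> space M ==> f w m = f' w m"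
 shows "(\<lambda>(w, m). f w m) \<in> borel_measurable (F \<Otimes>\<^sub>M M)"
proof (cases "space P = {}")
 case True
 then show ?thesis using sub by (auto simp: measurable_def space_pair_measure subalgebra_def)
next
 case False
 then obtain w0 where w0: "w0 \<in> space P" by blast
 have sp: "space F = space P" using sub by (simp add: subalgebra_def)
 have NF: "N \<in> sets F" using N null by auto
 define T where "T w = (if w \<in> N then w else w0)" for w
 have T: "T \<in> measurable F P" unfolding T_def[abs_def] by (rule measurable_null_retract[OF sub null N w0])
 have 1: "(\<lambda>p. (T (fst p), snd p)) \<in> measurable (F \<Otimes>\<^sub>M M) (P \<Otimes>\<^sub>M M)"
  by (rule measurable_Pair[OF measurable_compose[OF measurable_fst T] measurable_snd])
 have 2: "(\<lambda>p. f (T (fst p)) (snd p)) \<in> borel_measurable (F \<Otimes>\<^sub>M M)"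
  using measurable_compose[OF 1 f] by simp
 have 3: "(\<lambda>p. if fst p \<in> N then f (T (fst p)) (snd p) else f' (fst p) (snd p)) \<in> borel_measurable (F \<Otimes>\<^sub>M M)"
 proof (rule measurable_If[OF 2])
  show "(\<lambda>p. f' (fst p) (snd p)) \<in> borel_measurable (F \<Otimes>\<^sub>M M)" using f' by (simp add: case_prod_beta')
  have "{p \<in> space (F \<Otimes>\<^sub>M M). fst p \<in> N} = fst -` N \<inter> space (F \<Otimes>\<^sub>M M)" by auto
  then show "{p \<in> space (F \<Otimes>\<^sub>M M). fst p \<in> N} \<in> sets (F \<Otimes>\<^sub>M M)"
   using measurable_sets[OF measurable_fst NF] by simp
 qed
 show ?thesis
  by (rule measurable_cong[THEN iffD1, OF _ 3])
   (use eq sp in \<open>auto simp: space_pair_measure T_def\<close>)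
qed

lemma measurable_off_null_set1:
 fixes f f' :: "'w => 'b :: topological_space"
 assumes sub: "subalgebra P F" and null: "null_sets P \<subseteq> sets F" and N: "N \<in> null_sets P"
  and f: "f \<in> borel_measurable P" and f': "f' \<in> borel_measurable F"
  and eq: "\<And>w. w \<in> space P - N ==> f w = f' w"
 shows "f \<in> borel_measurable F"
proof -
 let ?M = "count_space {()}"
 have "(\<lambda>(w, m). f w) \<in> borel_measurable (F \<Otimes>\<^sub>M ?M)"
 proof (rule measurable_off_null_set[OF sub null N])
  show "(\<lambda>(w, m). f w) \<in> borel_measurable (P \<Otimes>\<^sub>M ?M)"
   using measurable_compose[OF measurable_fst f] by (simp add: case_prod_beta')
  show "(\<lambda>(w, m). f' w) \<in> borel_measurable (F \<Otimes>\<^sub>M ?M)"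
   using measurable_compose[OF measurable_fst f'] by (simp add: case_prod_beta')
 qed (use eq in auto)
 moreover have "(\<lambda>w. (w, ())) \<in> measurable F (F \<Otimes>\<^sub>M ?M)" by measurable
 ultimately show ?thesis by (drule_tac measurable_compose[rotated]) auto
qed

text \<open>The integral over the auxiliary variable is its own conditional expectation:
 both have the same integral over every event \<open>A\<close>, since conditioning may be moved onto the
 indicator of \<open>A\<close> separately for each value of the auxiliary variable.\<close>

lemma integral_adapted:
 fixes f :: "'w => 'v => real"
 assumes P: "prob_space P" and P': "prob_space P'"
  and sub: "subalgebra P F" and null: "null_sets P \<subseteq> sets F"
  and f[measurable]: "(\<lambda>(w, v). f w v) \<in> borel_measurable (P \<Otimes>\<^sub>M P')"
  and bound: "\<And>w v. w \<in> space P ==> v \<in> space P' ==> \<bar>f w v\<bar> \<le> B"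
  and adapted: "\<And>v. v \<in> space P' ==> (\<lambda>w. f w v) \<in> borel_measurable F"
 shows "(\<lambda>w. \<integral>v. f w v \<partial>P') \<in> borel_measurable F"
proof -
 interpret P: prob_space P by (rule P)
 interpret P': prob_space P' by (rule P')
 interpret PP: pair_prob_space P P' ..
 interpret fin: finite_measure_subalgebra P F by unfold_locales (rule sub)
 define g where "g w = (\<integral>v. f w v \<partial>P')" for w
 have [measurable]: "g \<in> borel_measurable P" unfolding g_def[abs_def] by measurable
 have fw: "(\<lambda>v. f w v) \<in> borel_measurable P'" if "w \<in> space P" for w using f that by measurable
 have gb: "\<bar>g w\<bar> \<le> B" if w: "w \<in> space P" for w
 proof -
  have i: "integrable P' (\<lambda>v. f w v)"
   by (rule P'.integrable_const_bound[of _ B]) (use bound[OF w] fw[OF w] in auto)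
  have "\<bar>g w\<bar> \<le> (\<integral>v. \<bar>f w v\<bar> \<partial>P')" unfolding g_def by (rule integral_abs_bound)
  also have "\<dots> \<le> (\<integral>v. B \<partial>P')" by (rule integral_mono) (use i bound[OF w] in auto)
  finally show ?thesis by (simp add: P'.prob_space)
 qed
 have gi: "integrable P g" by (rule P.integrable_const_bound[of _ B]) (use gb in auto)
 define h where "h = real_cond_exp P F g"
 have hF: "h \<in> borel_measurable F" unfolding h_def by simp
 have hi: "integrable P h" unfolding h_def by (rule fin.real_cond_exp_int(1)[OF gi])
 have "AE w in P. g w = h w"
 proof (rule density_unique_real[OF gi hi])
  fix A assume A[measurable]: "A \<in> sets P"
  define e where "e = real_cond_exp P F (indicator A)"
  have eF: "e \<in> borel_measurable F" unfolding e_def by simp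
  have Ai: "integrable P (indicator A :: _ => real)"
   by (rule P.integrable_const_bound[of _ 1]) auto
  have ei: "integrable P e" unfolding e_def by (rule fin.real_cond_exp_int(1)[OF Ai])
  note [measurable] = borel_measurable_integrable[OF ei]
  have e1: "integrable (P \<Otimes>\<^sub>M P') (\<lambda>(w, v). e w * f w v)"
  proof (rule Bochner_Integration.integrable_bound)
   show "integrable (P \<Otimes>\<^sub>M P') (\<lambda>(w, v). B * e w)"
   proof -
    have "integrable (P \<Otimes>\<^sub>M P') (\<lambda>p. e (fst p) * 1)"
    proof (rule PP.Fubini_integrable)
     show "integrable P (\<lambda>x. \<integral>y. norm (e (fst (x, y)) * 1) \<partial>P')" using ei by (simp add: P'.prob_space)
    qed auto
    then show ?thesis by (simp add: case_prod_beta')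
   qed
   show "AE p in P \<Otimes>\<^sub>M P'. norm (case p of (w, v) => e w * f w v) \<le> norm (case p of (w, v) => B * e w)"
   proof (rule AE_I2, clarsimp simp: space_pair_measure abs_mult)
    fix w v assume "w \<in> space P" "v \<in> space P'"
    then have "\<bar>f w v\<bar> \<le> \<bar>B\<bar>" using bound by force
    then show "\<bar>e w\<bar> * \<bar>f w v\<bar> \<le> \<bar>B\<bar> * \<bar>e w\<bar>" by (subst mult.commute) (rule mult_right_mono, auto)
   qed
  qed measurable
  have a1: "integrable (P \<Otimes>\<^sub>M P') (\<lambda>(w, v). indicator A w * f w v)"
  proof (rule PP.integrable_const_bound[of _ "\<bar>B\<bar>"])
   show "AE p in P \<Otimes>\<^sub>M P'. norm (case p of (w, v) => indicator A w * f w v) \<le> \<bar>B\<bar>"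
    using bound by (intro AE_I2) (force simp: space_pair_measure abs_mult split: split_indicator)
  qed measurable
  have "(\<integral>w. indicator A w * g w \<partial>P) = (\<integral>w. (\<integral>v. indicator A w * f w v \<partial>P') \<partial>P)"
   by (simp add: g_def)
  also have "\<dots> = (\<integral>v. (\<integral>w. indicator A w * f w v \<partial>P) \<partial>P')"
   by (rule PP.Fubini_integral[symmetric]) (use a1 in \<open>simp add: case_prod_beta'\<close>)
  also have "\<dots> = (\<integral>v. (\<integral>w. e w * f w v \<partial>P) \<partial>P')"
  proof (rule Bochner_Integration.integral_cong[OF refl])
   fix v assume v: "v \<in> space P'"
   have fv: "(\<lambda>w. f w v) \<in> borel_measurable P" using f v by measurable
   have "integrable P (\<lambda>w. f w v * indicator A w)"
   proof (rule P.integrable_const_bound[of _ "\<bar>B\<bar>"])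
    show "AE w in P. norm (f w v * indicator A w) \<le> \<bar>B\<bar>"
     using bound v by (intro AE_I2) (force simp: abs_mult split: split_indicator)
   qed (use fv in measurable)
   then have "(\<integral>w. f w v * e w \<partial>P) = (\<integral>w. f w v * indicator A w \<partial>P)"
    unfolding e_def by (rule fin.real_cond_exp_intg(2)[OF _ adapted[OF v]]) simp
   then show "(\<integral>w. indicator A w * f w v \<partial>P) = (\<integral>w. e w * f w v \<partial>P)" by (simp add: mult.commute)
  qed
  also have "\<dots> = (\<integral>w. (\<integral>v. e w * f w v \<partial>P') \<partial>P)"
   by (rule PP.Fubini_integral) (use e1 in \<open>simp add: case_prod_beta'\<close>)
  also have "\<dots> = (\<integral>w. e w * g w \<partial>P)" by (simp add: g_def)
  \<comment> \<open>Now e is the F-measurable factor, so g may be replaced by its conditional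
    expectation h; afterwards the conditioning returns from e to the indicator.\<close>
  also have "\<dots> = (\<integral>w. e w * h w \<partial>P)"
  proof -
   have "integrable P (\<lambda>w. e w * g w)"
   proof (rule Bochner_Integration.integrable_bound[OF integrable_mult_right[OF ei, of B]])
    show "AE w in P. norm (e w * g w) \<le> norm (B * e w)"
    proof (rule AE_I2, simp add: abs_mult)
     fix w assume "w \<in> space P"
     then have "\<bar>g w\<bar> \<le> \<bar>B\<bar>" using gb by force
     then show "\<bar>e w\<bar> * \<bar>g w\<bar> \<le> \<bar>B\<bar> * \<bar>e w\<bar>" by (subst mult.commute) (rule mult_right_mono, auto)
    qed
   qed measurable
   then show ?thesis unfolding h_def by (rule fin.real_cond_exp_intg(2)[OF _ eF, symmetric]) simp
  qed
  also have "\<dots> = (\<integral>w. h w * e w \<partial>P)" by (simp add: mult.commute)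
  also have "\<dots> = (\<integral>w. h w * indicator A w \<partial>P)"
  proof -
   have "integrable P (\<lambda>w. h w * indicator A w)"
    using integrable_mult_indicator[OF A hi] by (simp add: mult.commute)
   then show ?thesis unfolding e_def by (rule fin.real_cond_exp_intg(2)[OF _ hF]) simp
  qed
  finally show "(\<integral>w\<in>A. g w \<partial>P) = (\<integral>w\<in>A. h w \<partial>P)"
   by (simp add: set_lebesgue_integral_def mult.commute)
 qed
 then obtain N where N: "N \<in> null_sets P" "{w \<in> space P. g w \<noteq> h w} \<subseteq> N"
  unfolding eventually_ae_filter by auto
 \<comment> \<open>Almost sure equality with h suffices because F contains the null sets of
   P.\<close>
 have "g \<in> borel_measurable F"
  by (rule measurable_off_null_set1[OF sub null N(1) _ hF]) (use N(2) in auto)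
 then show ?thesis by (simp add: g_def[abs_def])
qed

lemma measurable_completion_AE:
 fixes f g :: "'a => 'b :: topological_space"
 assumes g: "g \<in> borel_measurable M" and ae: "AE x in M. f x = g x"
 shows "f \<in> borel_measurable (completion M)"
proof (rule measurableI)
 obtain N where N: "N \<in> null_sets M" "{x \<in> space M. f x \<noteq> g x} \<subseteq> N"
  using ae unfolding eventually_ae_filter by auto
 fix A :: "'b set" assume A: "A \<in> sets borel"
 have Ns: "N \<in> sets M" using N(1) by auto
 have "f -` A \<inter> space (completion M) = ((g -` A \<inter> space M) - N) \<union> (f -` A \<inter> space M \<inter> N)"
  using N(2) by auto
 moreover have a: "(g -` A \<inter> space M) - N \<in> sets (completion M)"
  using measurable_sets[OF g A] Ns by (intro sets_completionI_sets) auto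
 moreover have b: "f -` A \<inter> space M \<inter> N \<in> null_sets (completion M)"
  by (rule null_sets_completion_subset[OF _ null_sets_completionI[OF N(1)]]) auto
 ultimately show "f -` A \<inter> space (completion M) \<in> sets (completion M)"
  using sets.Un[OF a null_setsD2[OF b]] by (simp only:)
qed simp

text \<open>Removes the completion from the definition of the transported vorticity once a
  measurable version of its integrand is known.\<close>

lemma integral_completion_AE:
 fixes f g :: "'a => 'b :: {banach, second_countable_topology}"
 assumes g: "g \<in> borel_measurable M" and ae: "AE x in M. f x = g x"
 shows "(\<integral>x. f x \<partial>completion M) = (\<integral>x. g x \<partial>M)"
proof -
 have "(\<integral>x. f x \<partial>completion M) = (\<integral>x. g x \<partial>completion M)"
  by (rule integral_cong_AE[OF measurable_completion_AE[OF g ae] _ AE_completion[OF ae]])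
   (use g in \<open>rule measurable_completion\<close>)
 then show ?thesis using integral_completion[OF g] by simp
qed

section \<open>Essential bounds\<close>

lemma Linf_norm_AE: "AE x in torus_lebesgue. ennreal \<bar>f x\<bar> \<le> Linf_norm f"
 unfolding Linf_norm_def by (rule esssup_AE)

lemma Linf_norm_less_iff:
 assumes f: "f \<in> borel_measurable borel"
 shows "a < Linf_norm f \<longleftrightarrow> emeasure torus_lebesgue {x. a < ennreal \<bar>f x\<bar>} \<noteq> 0"
proof -
 have m: "(\<lambda>x. ennreal \<bar>f x\<bar>) \<in> borel_measurable torus_lebesgue"
  using f by (simp cong: measurable_cong_sets)
 show ?thesis
 proof
  assume "a < Linf_norm f"
  then show "emeasure torus_lebesgue {x. a < ennreal \<bar>f x\<bar>} \<noteq> 0"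
   using esssup_pos_measure[OF m, of a] unfolding Linf_norm_def by auto
 next
  assume ne: "emeasure torus_lebesgue {x. a < ennreal \<bar>f x\<bar>} \<noteq> 0"
  show "a < Linf_norm f"
  proof (rule ccontr)
   assume "\<not> a < Linf_norm f"
   then have "AE x in torus_lebesgue. \<not> a < ennreal \<bar>f x\<bar>"
    using Linf_norm_AE[of f] by (auto elim!: eventually_mono)
   moreover have "{x \<in> space torus_lebesgue. a < ennreal \<bar>f x\<bar>} \<in> sets torus_lebesgue"
    using m by measurable
   ultimately have "emeasure torus_lebesgue {x \<in> space torus_lebesgue. a < ennreal \<bar>f x\<bar>} = 0"
    by (subst AE_iff_measurable[symmetric, where P = "\<lambda>x. \<not> a < ennreal \<bar>f x\<bar>"]) auto
   then show False using ne by simp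
  qed
 qed
qed

text \<open>The essential supremum exceeds a level iff the set where the function does has positive
  measure, and the measure of sections is measurable by Fubini.\<close>

lemma Linf_norm_measurable:
 assumes q: "(\<lambda>(s, x). q s x) \<in> borel_measurable (M \<Otimes>\<^sub>M borel)"
 shows "(\<lambda>s. Linf_norm (q s)) \<in> borel_measurable M"
proof (rule borel_measurableI_greater)
 fix a :: ennreal
 have q'[measurable]: "(\<lambda>p. q (fst p) (snd p)) \<in> borel_measurable (M \<Otimes>\<^sub>M torus_lebesgue)"
  using q by (simp add: case_prod_beta' cong: measurable_cong_sets)
 have qs: "q s \<in> borel_measurable borel" if "s \<in> space M" for s
  using measurable_compose[OF measurable_Pair1'[OF that, of borel] q] by simp
 have "{p \<in> space (M \<Otimes>\<^sub>M torus_lebesgue). a < ennreal \<bar>q (fst p) (snd p)\<bar>} \<in> sets (M \<Otimes>\<^sub>M torus_lebesgue)"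
  by measurable
 from torus.measurable_emeasure_Pair[OF this]
 have "(\<lambda>s. emeasure torus_lebesgue (Pair s -` {p \<in> space (M \<Otimes>\<^sub>M torus_lebesgue). a < ennreal \<bar>q (fst p) (snd p)\<bar>})) \<in> borel_measurable M" .
 then have "{s \<in> space M. emeasure torus_lebesgue (Pair s -` {p \<in> space (M \<Otimes>\<^sub>M torus_lebesgue). a < ennreal \<bar>q (fst p) (snd p)\<bar>}) \<noteq> 0} \<in> sets M"
  by measurable
 also have "{s \<in> space M. emeasure torus_lebesgue (Pair s -` {p \<in> space (M \<Otimes>\<^sub>M torus_lebesgue). a < ennreal \<bar>q (fst p) (snd p)\<bar>}) \<noteq> 0}
   = {s \<in> space M. a < Linf_norm (q s)}"
 proof (rule Collect_cong, rule conj_cong[OF refl])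
  fix s assume s: "s \<in> space M"
  have "Pair s -` {p \<in> space (M \<Otimes>\<^sub>M torus_lebesgue). a < ennreal \<bar>q (fst p) (snd p)\<bar>} = {x. a < ennreal \<bar>q s x\<bar>}"
   using s by (auto simp: space_pair_measure)
  then show "(emeasure torus_lebesgue (Pair s -` {p \<in> space (M \<Otimes>\<^sub>M torus_lebesgue). a < ennreal \<bar>q (fst p) (snd p)\<bar>}) \<noteq> 0) = (a < Linf_norm (q s))"
   using Linf_norm_less_iff[OF qs[OF s]] by simp
 qed
 finally show "{s \<in> space M. a < Linf_norm (q s)} \<in> sets M" .
qed

text \<open>A planar ball of radius \<open>min r pi\<close> around a lift fits into one period
  square and projects into the given ball.\<close>

lemma emeasure_torus_ball_pos:
 assumes "r > 0" shows "emeasure torus_lebesgue (ball p r) > 0"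
proof -
 obtain x y where p: "p = to_torus (x, y)" by (rule torus_cases)
 define e where "e = min r pi"
 have e: "e > 0" using assms by (simp add: e_def)
 have sub: "indicator (ball (x, y) e) z \<le> (indicator (ball p r) (to_torus z) * indicator (square (x - pi) (y - pi)) z :: ennreal)" for z
 proof (cases "z \<in> ball (x, y) e")
  case True
  then have d: "dist (x, y) z < e" by simp
  have "to_torus z \<in> ball p r"
   using le_less_trans[OF dist_to_torus_le[of "(x, y)" z] d] by (simp add: p e_def)
  moreover have "\<bar>x - fst z\<bar> < pi" "\<bar>y - snd z\<bar> < pi"
   using d dist_fst_le[of "(x, y)" z] dist_snd_le[of "(x, y)" z] by (auto simp: e_def dist_real_def)
  then have "z \<in> square (x - pi) (y - pi)" unfolding mem_Times_iff by auto
  ultimately show ?thesis using True by simp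
 qed simp
 have "\<not> negligible (ball (x, y) e)" using open_not_negligible[OF open_ball, of "(x, y)" e] e by auto
 then have "ball (x, y) e \<notin> null_sets lborel"
  unfolding negligible_iff_null_sets by (meson null_sets_completionI)
 then have "emeasure lborel (ball (x, y) e) \<noteq> 0" by (auto simp: null_sets_def)
 then have "0 < (\<integral>\<^sup>+z. indicator (ball (x, y) e) z \<partial>lborel)" by (simp add: zero_less_iff_neq_zero)
 also have "\<dots> \<le> (\<integral>\<^sup>+z. indicator (ball p r) (to_torus z) * indicator (square (x - pi) (y - pi)) z \<partial>lborel)"
  by (intro nn_integral_mono sub)
 also have "\<dots> = (\<integral>\<^sup>+q. indicator (ball p r) q \<partial>torus_lebesgue)"
  by (rule nn_integral_torus_square[symmetric]) (rule borel_measurable_indicator[OF borel_open[OF open_ball]])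
 also have "\<dots> = emeasure torus_lebesgue (ball p r)" by (rule nn_integral_indicator) simp
 finally show ?thesis .
qed

text \<open>The law of the positions of two particles may be singular on the product of the torus
  with itself, so a bound for almost all pairs says nothing along it. Off a null set of single
  points it holds for all pairs: x and y are compared through a point b close to x at which the
  bounds with x and with y both hold.\<close>

lemma modulus_off_null_set:
 fixes f :: "torus => real"
 assumes "AE (x, y) in torus_lebesgue \<Otimes>\<^sub>M torus_lebesgue. \<bar>f x - f y\<bar> \<le> C * log_modulus (dist x y)"
 obtains N where "N \<in> null_sets torus_lebesgue" "\<And>x y. x \<notin> N ==> y \<notin> N ==> \<bar>f x - f y\<bar> \<le> \<bar>C\<bar> * log_modulus (dist x y)"
proof -
 interpret TT: pair_sigma_finite torus_lebesgue torus_lebesgue ..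
 have "AE x in torus_lebesgue. AE y in torus_lebesgue. \<bar>f x - f y\<bar> \<le> C * log_modulus (dist x y)"
  using TT.AE_pair[OF assms] by simp
 then obtain N where N: "N \<in> null_sets torus_lebesgue"
  "{x \<in> space torus_lebesgue. \<not> (AE y in torus_lebesgue. \<bar>f x - f y\<bar> \<le> C * log_modulus (dist x y))} \<subseteq> N"
  unfolding eventually_ae_filter by auto
 have X: "AE y in torus_lebesgue. \<bar>f x - f y\<bar> \<le> \<bar>C\<bar> * log_modulus (dist x y)" if "x \<notin> N" for x
 proof -
  have "AE y in torus_lebesgue. \<bar>f x - f y\<bar> \<le> C * log_modulus (dist x y)" using N(2) that by auto
  then show ?thesis
   by eventually_elim (meson abs_ge_self log_modulus_nonneg mult_right_mono order_trans)
 qed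
 have "\<bar>f x - f y\<bar> \<le> \<bar>C\<bar> * log_modulus (dist x y)" if xy: "x \<notin> N" "y \<notin> N" for x y
 proof (rule field_le_epsilon)
  fix e :: real assume e: "e > 0"
  \<comment> \<open>The detour through b costs at most \<open>2 * \<bar>C\<bar> * e'\<close>, which
    this choice keeps below e.\<close>
  define e' where "e' = e / (2 * (\<bar>C\<bar> + 1))"
  have e': "e' > 0" using e by (simp add: e'_def)
  obtain d1 where d1: "d1 > 0" "log_modulus (0 + d1) < log_modulus 0 + e'"
   using log_modulus_right_continuous[of 0 e'] e' by auto
  obtain d2 where d2: "d2 > 0" "log_modulus (dist x y + d2) < log_modulus (dist x y) + e'"
   using log_modulus_right_continuous[of "dist x y" e'] e' by auto
  define d where "d = min d1 d2"
  have d: "d > 0" using d1 d2 by (simp add: d_def)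
  have "\<exists>b\<in>ball x d. \<bar>f x - f b\<bar> \<le> \<bar>C\<bar> * log_modulus (dist x b) \<and> \<bar>f y - f b\<bar> \<le> \<bar>C\<bar> * log_modulus (dist y b)"
  proof (rule ccontr)
   assume no: "\<not> ?thesis"
   have "AE b in torus_lebesgue. b \<notin> ball x d"
    using X[OF xy(1)] X[OF xy(2)] by eventually_elim (use no in blast)
   then have "ball x d \<in> null_sets torus_lebesgue" by (subst AE_iff_null_sets) auto
   then show False using emeasure_torus_ball_pos[OF d, of x] by auto
  qed
  then obtain b where b: "dist x b < d" "\<bar>f x - f b\<bar> \<le> \<bar>C\<bar> * log_modulus (dist x b)"
   "\<bar>f y - f b\<bar> \<le> \<bar>C\<bar> * log_modulus (dist y b)" by auto
  have "log_modulus (dist x b) \<le> log_modulus (0 + d1)" using b(1) by (intro log_modulus_mono) (auto simp: d_def)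
  then have l1: "log_modulus (dist x b) \<le> e'" using d1(2) by simp
  have "dist y b \<le> dist x y + d2" using dist_triangle[of y b x] b(1) by (simp add: d_def dist_commute)
  then have "log_modulus (dist y b) \<le> log_modulus (dist x y + d2)" by (intro log_modulus_mono) auto
  then have l2: "log_modulus (dist y b) \<le> log_modulus (dist x y) + e'" using d2(2) by simp
  have "\<bar>f x - f y\<bar> \<le> \<bar>f x - f b\<bar> + \<bar>f y - f b\<bar>" by simp
  also have "\<dots> \<le> \<bar>C\<bar> * e' + \<bar>C\<bar> * (log_modulus (dist x y) + e')"
   by (intro add_mono order_trans[OF b(2)] order_trans[OF b(3)] mult_left_mono l1 l2) auto
  also have "\<dots> = \<bar>C\<bar> * log_modulus (dist x y) + 2 * \<bar>C\<bar> * e'" by (simp add: algebra_simps)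
  also have "2 * \<bar>C\<bar> * e' \<le> e" unfolding e'_def using e by (simp add: divide_simps)
  finally show "\<bar>f x - f y\<bar> \<le> \<bar>C\<bar> * log_modulus (dist x y) + e" by simp
 qed
 then show thesis using N(1) that by blast
qed

text \<open>Each line above the modulus integrates to a line in the mean; the one touching at the
  mean gives the inequality.\<close>

lemma log_modulus_jensen:
 assumes fin: "finite_measure M" and m: "measure M (space M) = m" "m > 0"
  and D: "integrable M D" "\<And>x. x \<in> space M ==> 0 \<le> D x" "\<And>x. x \<in> space M ==> D x \<le> B"
 shows "integrable M (\<lambda>x. log_modulus (D x))"
  and "(\<integral>x. log_modulus (D x) \<partial>M) \<le> m * log_modulus ((\<integral>x. D x \<partial>M) / m)"
proof -
 interpret finite_measure M by (rule fin)
 note [measurable] = borel_measurable_integrable[OF D(1)]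
 show int: "integrable M (\<lambda>x. log_modulus (D x))"
 proof (rule integrable_const_bound[of _ "log_modulus B"])
  show "AE x in M. norm (log_modulus (D x)) \<le> log_modulus B"
   using D(2,3) log_modulus_mono log_modulus_nonneg by (intro AE_I2) simp
 qed measurable
 have line: "(\<integral>x. log_modulus (D x) \<partial>M) \<le> l * (\<integral>x. D x \<partial>M) + m * exp (- l)" if l: "1 \<le> l" for l
 proof -
  have "(\<integral>x. log_modulus (D x) \<partial>M) \<le> (\<integral>x. l * D x + exp (- l) \<partial>M)"
   by (rule integral_mono[OF int]) (use D l log_modulus_le_line in auto)
  also have "\<dots> = l * (\<integral>x. D x \<partial>M) + m * exp (- l)" using D(1) m(1) by simp
  finally show ?thesis .
 qed
 have nn: "0 \<le> (\<integral>x. D x \<partial>M)" by (rule integral_nonneg_AE) (use D(2) in auto)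
 show "(\<integral>x. log_modulus (D x) \<partial>M) \<le> m * log_modulus ((\<integral>x. D x \<partial>M) / m)"
 proof (cases "(\<integral>x. D x \<partial>M) = 0")
  \<comment> \<open>No line touches at 0; letting the slope grow drives the constant term
    \<open>m * exp (- l)\<close> to 0.\<close>
  case True
  have "(\<integral>x. log_modulus (D x) \<partial>M) \<le> 0 + e" if e: "e > 0" for e
  proof -
   define l where "l = max 1 (- ln (e / m))"
   have "exp (- l) \<le> exp (ln (e / m))" unfolding l_def by simp
   then have "exp (- l) \<le> e / m" using e m by simp
   then have "m * exp (- l) \<le> e" using m by (simp add: field_simps)
   then show ?thesis using line[of l] True by (simp add: l_def)
  qed
  then have "(\<integral>x. log_modulus (D x) \<partial>M) \<le> 0" by (rule field_le_epsilon)
  then show ?thesis using True by simp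
 next
  case False
  then have pos: "(\<integral>x. D x \<partial>M) / m > 0" using nn m by simp
  obtain l where l: "1 \<le> l" "log_modulus ((\<integral>x. D x \<partial>M) / m) = l * ((\<integral>x. D x \<partial>M) / m) + exp (- l)"
   by (rule log_modulus_eq_line[OF pos])
  show ?thesis using line[OF l(1)] m unfolding l(2) by (simp add: distrib_left)
 qed
qed

section \<open>Measure-preserving homeomorphisms\<close>

lemma mp_homeoD:
 assumes "mp_homeo f"
 shows "f \<in> borel_measurable borel" "distr torus_lebesgue borel f = torus_lebesgue" "inv f (f x) = x" "f (inv f x) = x"
  "continuous_on UNIV f" "continuous_on UNIV (inv f)"
proof -
 obtain g where g: "homeomorphism UNIV UNIV f g" using assms by (auto simp: mp_homeo_def)
 have c: "continuous_on UNIV f" and fg: "\<And>x. g (f x) = x" "\<And>x. f (g x) = x" and gc: "continuous_on UNIV g"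
  using g by (auto simp: homeomorphism_def)
 have gi: "inv f = g" using fg by (metis inv_unique_comp comp_apply eq_id_iff ext)
 show "f \<in> borel_measurable borel" by (rule borel_measurable_continuous_onI[OF c])
 show "distr torus_lebesgue borel f = torus_lebesgue" using assms by (simp add: mp_homeo_def)
 show "inv f (f x) = x" "f (inv f x) = x" "continuous_on UNIV f" "continuous_on UNIV (inv f)"
  using c fg gc gi by auto
qed

text \<open>The inverse takes y into a closed set C iff y lies in the image of C, which is compact.
  This means that images of a countable dense subset of C come arbitrarily close to y, a countable
  condition. Outside G the value 0 is assigned.\<close>

lemma measurable_inverse_family:
 fixes f :: "'v => torus => torus"
 assumes f: "(\<lambda>(v, x). f v x) \<in> borel_measurable (M \<Otimes>\<^sub>M borel)" and G: "G \<in> sets M"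
  and homeo: "\<And>v. v \<in> G ==> mp_homeo (f v)"
 shows "(\<lambda>(v, y). if v \<in> G then inv (f v) y else 0) \<in> borel_measurable (M \<Otimes>\<^sub>M borel)"
 unfolding borel_eq_closed[where 'a = torus]
proof (rule measurable_measure_of)
 let ?N = "M \<Otimes>\<^sub>M sigma (UNIV :: torus set) (Collect closed)"
 have N: "?N = M \<Otimes>\<^sub>M borel" unfolding borel_eq_closed[where 'a = torus] ..
 fix C :: "torus set" assume "C \<in> Collect closed"
 then have C: "closed C" by simp
 obtain D where D: "countable D" "D \<subseteq> C" "\<And>x e. x \<in> C ==> e > 0 ==> \<exists>d\<in>D. dist x d < e"
  using countable_dense_subset by blast
 let ?A = "{p \<in> space (M \<Otimes>\<^sub>M borel). fst p \<in> G \<and> (\<forall>n. \<exists>d\<in>D. dist (f (fst p) d) (snd p) < inverse (real (Suc n)))}"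
 let ?B = "{p \<in> space (M \<Otimes>\<^sub>M borel). fst p \<notin> G \<and> 0 \<in> C}"
 have eq: "(\<lambda>(v, y). if v \<in> G then inv (f v) y else 0) -` C \<inter> space (M \<Otimes>\<^sub>M borel) = ?A \<union> ?B"
 proof -
  have "inv (f v) y \<in> C \<longleftrightarrow> (\<forall>n. \<exists>d\<in>D. dist (f v d) y < inverse (real (Suc n)))" if v: "v \<in> G" for v y
  proof
   note h = mp_homeoD[OF homeo[OF v]]
   assume y: "inv (f v) y \<in> C"
   show "\<forall>n. \<exists>d\<in>D. dist (f v d) y < inverse (real (Suc n))"
   proof
    fix n
    have "inverse (real (Suc n)) > 0" by simp
    then obtain e where e: "e > 0" "\<And>z. dist z (inv (f v) y) < e ==> dist (f v z) (f v (inv (f v) y)) < inverse (real (Suc n))"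
     using h(5) unfolding continuous_on_iff by (metis UNIV_I)
    obtain d where "d \<in> D" "dist (inv (f v) y) d < e" using D(3)[OF y e(1)] by blast
    then show "\<exists>d\<in>D. dist (f v d) y < inverse (real (Suc n))"
     using e(2)[of d] h(4) by (auto simp: dist_commute)
   qed
  next
   note h = mp_homeoD[OF homeo[OF v]]
   assume a: "\<forall>n. \<exists>d\<in>D. dist (f v d) y < inverse (real (Suc n))"
   have "closed (f v ` C)"
    by (rule compact_imp_closed[OF compact_continuous_image[OF continuous_on_subset[OF h(5)]]])
     (use compact_Int_closed[OF compact_torus C] in auto)
   moreover have "y \<in> closure (f v ` C)"
    unfolding closure_approachable
   proof (intro allI impI)
    fix e :: real assume "e > 0"
    then obtain n where n: "inverse (real (Suc n)) < e" using reals_Archimedean by blast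
    obtain d where "d \<in> D" "dist (f v d) y < inverse (real (Suc n))" using a by blast
    then show "\<exists>z\<in>f v ` C. dist z y < e" using D(2) n by (intro bexI[of _ "f v d"]) auto
   qed
   ultimately obtain c where "c \<in> C" "y = f v c" by (metis closure_closed imageE)
   then show "inv (f v) y \<in> C" using h(3) by simp
  qed
  then show ?thesis by (auto split: if_splits)
 qed
 have As: "?A \<in> sets (M \<Otimes>\<^sub>M borel)"
 proof -
  have fd: "(\<lambda>p. f (fst p) d) \<in> borel_measurable (M \<Otimes>\<^sub>M borel)" for d
   using measurable_compose[OF measurable_Pair[OF measurable_fst measurable_const[of d]] f]
   by simp
  have 1: "{p \<in> space (M \<Otimes>\<^sub>M borel). dist (f (fst p) d) (snd p) < c} \<in> sets (M \<Otimes>\<^sub>M borel)" for d c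
   using borel_measurable_dist[OF fd[of d] measurable_snd] by measurable
  have 2: "{p \<in> space (M \<Otimes>\<^sub>M borel). fst p \<in> G} \<in> sets (M \<Otimes>\<^sub>M (borel :: torus measure))"
   using G by measurable
  have "?A = {p \<in> space (M \<Otimes>\<^sub>M borel). fst p \<in> G} \<inter>
    (\<Inter>n. \<Union>d\<in>D. {p \<in> space (M \<Otimes>\<^sub>M borel). dist (f (fst p) d) (snd p) < inverse (real (Suc n))})"
   by auto
  also have "\<dots> \<in> sets (M \<Otimes>\<^sub>M borel)"
   using 1 2 D(1) by (intro sets.Int sets.countable_INT' sets.countable_UN') auto
  finally show ?thesis .
 qed
 have Bs: "?B \<in> sets (M \<Otimes>\<^sub>M (borel :: torus measure))" using G by measurable
 show "(\<lambda>(v, y). if v \<in> G then inv (f v) y else 0) -` C \<inter> space ?N \<in> sets ?N"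
  unfolding N eq by (rule sets.Un[OF As Bs])
qed auto

section \<open>The velocity field in Lagrangian form\<close>

abbreviation time_space :: "real => real measure" where
 "time_space T \<equiv> restrict_space borel {0..T}"

abbreviation time_lebesgue :: "real => real measure" where
 "time_lebesgue T \<equiv> restrict_space lborel {0..T}"

lemma sets_time_lebesgue[measurable_cong]: "sets (time_lebesgue T) = sets (time_space T)"
 by (simp add: sets_restrict_space)

lemma measurable_time_space: "(\<lambda>s. s) \<in> borel_measurable (time_space T)"
 by (rule measurable_restrict_space1) simp

lemma finite_time_lebesgue: "finite_measure (time_lebesgue T)"
 by (rule finite_measureI) (simp add: emeasure_restrict_space space_restrict_space emeasure_lborel_Icc_eq)

lemma time_lebesgue_integral:
 fixes f :: "real => real"
 assumes "t \<le> T"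
 shows "(LBINT s:{0..t}. f s) = (\<integral>s. indicator {0..t} s * f s \<partial>time_lebesgue T)"
proof -
 have "(\<integral>s. indicator {0..t} s * f s \<partial>time_lebesgue T) = (\<integral>s. indicator {0..T} s *\<^sub>R (indicator {0..t} s * f s) \<partial>lborel)"
  by (rule integral_restrict_space) simp
 also have "\<dots> = (\<integral>s. indicator {0..t} s *\<^sub>R f s \<partial>lborel)"
  by (rule Bochner_Integration.integral_cong[OF refl]) (use assms in \<open>auto split: split_indicator\<close>)
 finally show ?thesis by (simp add: set_lebesgue_integral_def)
qed

context log_kernel
begin

lemma K_meas[measurable]: "K \<in> borel_measurable borel"
 by (rule borel_measurable_continuous_countable_exceptions[OF _ K_cont]) simp

definition "Bk = (\<integral>p. norm (K p) \<partial>torus_lebesgue)"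

lemma Bk_nonneg: "Bk \<ge> 0" unfolding Bk_def by simp

lemma K_reflect: "(\<integral>\<^sup>+y. ennreal (norm (K (x - y))) \<partial>torus_lebesgue) = ennreal Bk"
proof -
 have "(\<integral>\<^sup>+y. ennreal (norm (K (x - y))) \<partial>torus_lebesgue) = (\<integral>\<^sup>+y. ennreal (norm (K y)) \<partial>torus_lebesgue)"
  by (rule nn_integral_torus_reflect) measurable
 also have "\<dots> = ennreal Bk" unfolding Bk_def using K_int by (intro nn_integral_eq_integral) auto
 finally show ?thesis .
qed

end

text \<open>One flow with its initial vorticity and source. The bounds \<open>M0\<close> and
  \<open>M1\<close> are parameters so that the limit and all \<epsilon> can share them, which makes
  the constants uniform.\<close>

locale flow_data = log_kernel K Ck for K Ck +
 fixes P :: "'w measure" and P' :: "'v measure" and T M0 M1 :: real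
  and \<Xi>0 :: "torus => real" and q :: "real => torus => real" and \<phi> :: "('w, 'v) torus_flow"
 assumes P: "prob_space P" and P': "prob_space P'" and T: "T > 0"
  and phi_meas: "(\<lambda>(w, w', t, x). \<phi> w w' t x) \<in> borel_measurable (P \<Otimes>\<^sub>M P' \<Otimes>\<^sub>M time_space T \<Otimes>\<^sub>M borel)"
  and Xi0_meas[measurable]: "\<Xi>0 \<in> borel_measurable borel"
  and Xi0_bound: "AE x in torus_lebesgue. \<bar>\<Xi>0 x\<bar> \<le> M0" and M0: "M0 \<ge> 0"
  and q_meas: "(\<lambda>(t, x). q t x) \<in> borel_measurable (time_space T \<Otimes>\<^sub>M borel)"
  and q_bound: "(\<integral>\<^sup>+s. Linf_norm (q s) \<partial>time_lebesgue T) \<le> ennreal M1" and M1: "M1 \<ge> 0"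
begin

sublocale P': prob_space P' by (rule P')
sublocale P: prob_space P by (rule P)
sublocale LT: finite_measure "time_lebesgue T" by (rule finite_time_lebesgue)
sublocale RR: pair_sigma_finite P' torus_lebesgue ..

definition "R = P' \<Otimes>\<^sub>M torus_lebesgue"

lemma finite_R: "finite_measure R"
proof (rule finite_measureI)
 have "emeasure R (space R) = emeasure P' (space P') * emeasure torus_lebesgue UNIV"
  unfolding R_def space_pair_measure space_torus_lebesgue
  by (rule torus.emeasure_pair_measure_Times) auto
 then show "emeasure R (space R) \<noteq> \<infinity>"
  by (simp add: emeasure_torus P'.emeasure_space_1)
qed

sublocale R: finite_measure R by (rule finite_R)

lemma sets_R[measurable_cong]: "sets R = sets (P' \<Otimes>\<^sub>M borel)"
 unfolding R_def by (intro sets_pair_measure_cong) auto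

lemma space_R: "space R = space P' \<times> UNIV"
 by (simp add: R_def space_pair_measure)

text \<open>The integral runs over the fixed interval with an indicator, so that t enters as a
  parameter and joint measurability follows from Fubini.\<close>

definition \<Theta> :: "'w => 'v => real => torus => real" where
 "\<Theta> w w' t z = \<Xi>0 z + (\<integral>s. indicator {0..t} s * q s (\<phi> w w' s z) \<partial>time_lebesgue T)"

definition V :: "'w => real => torus => real \<times> real" where
 "V w t x = (\<integral>r. \<Theta> w (fst r) t (snd r) *\<^sub>R K (x - \<phi> w (fst r) t (snd r)) \<partial>R)"

definition good :: "'w => bool" where
 "good w \<longleftrightarrow> w \<in> space P \<and> (AE w' in P'. \<forall>t\<in>{0..T}. mp_homeo (\<phi> w w' t))"

lemma phi_comp:
 assumes "a \<in> measurable M P" "b \<in> measurable M P'" "c \<in> measurable M (time_space T)" "d \<in> borel_measurable M"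
 shows "(\<lambda>m. \<phi> (a m) (b m) (c m) (d m)) \<in> borel_measurable M"
 using measurable_compose[OF measurable_Pair[OF assms(1) measurable_Pair[OF assms(2) measurable_Pair[OF assms(3,4)]]] phi_meas]
 by simp

lemma q_comp:
 assumes "c \<in> measurable M (time_space T)" "d \<in> borel_measurable M"
 shows "(\<lambda>m. q (c m) (d m)) \<in> borel_measurable M"
 using measurable_compose[OF measurable_Pair[OF assms] q_meas] by simp

lemma time_real: "c \<in> measurable M (time_space T) ==> c \<in> borel_measurable M"
 using measurable_compose[OF _ measurable_time_space, of c M T] by simp

lemma snd_time: "snd \<in> measurable (M \<Otimes>\<^sub>M time_lebesgue T) (time_space T)"
 using measurable_snd[of M "time_lebesgue T"] by (simp cong: measurable_cong_sets add: sets_time_lebesgue)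

lemma Theta_comp:
 assumes a: "a \<in> measurable M P" and b: "b \<in> measurable M P'" and c: "c \<in> measurable M (time_space T)" and d: "d \<in> borel_measurable M"
 shows "(\<lambda>m. \<Theta> (a m) (b m) (c m) (d m)) \<in> borel_measurable M"
proof -
 let ?N = "M \<Otimes>\<^sub>M time_lebesgue T"
 note f = measurable_compose[OF measurable_fst]
 have 1: "(\<lambda>p. q (snd p) (\<phi> (a (fst p)) (b (fst p)) (snd p) (d (fst p)))) \<in> borel_measurable ?N"
  by (intro q_comp phi_comp snd_time f a b d)
 have [measurable]: "(\<lambda>p. c (fst p)) \<in> borel_measurable ?N" by (rule f[OF time_real[OF c]])
 have [measurable]: "(\<lambda>p. snd p) \<in> borel_measurable ?N" using time_real[OF snd_time[of M]] by simp
 have 2: "(\<lambda>p. indicator {0..c (fst p)} (snd p) :: real) \<in> borel_measurable ?N"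
  unfolding indicator_def atLeastAtMost_iff by measurable
 have "(\<lambda>(m, s). indicator {0..c m} s * q s (\<phi> (a m) (b m) s (d m))) \<in> borel_measurable ?N"
  using borel_measurable_times[OF 2 1] by (simp add: case_prod_beta')
 from LT.borel_measurable_lebesgue_integral[OF this]
 have 3: "(\<lambda>m. \<integral>s. indicator {0..c m} s * q s (\<phi> (a m) (b m) s (d m)) \<partial>time_lebesgue T) \<in> borel_measurable M"
  by simp
 show ?thesis unfolding \<Theta>_def by (rule borel_measurable_add[OF measurable_compose[OF d Xi0_meas] 3])
qed

lemma const_time: "t \<in> {0..T} ==> (\<lambda>m. t) \<in> measurable M (time_space T)"
 by (rule measurable_const) (simp add: space_restrict_space)

lemma phi_R: "w \<in> space P ==> t \<in> {0..T} ==> (\<lambda>r. \<phi> w (fst r) t (snd r)) \<in> borel_measurable R"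
 by (rule phi_comp[OF measurable_const _ const_time]) (auto simp: R_def cong: measurable_cong_sets)

lemma Theta_R: "w \<in> space P ==> t \<in> {0..T} ==> (\<lambda>r. \<Theta> w (fst r) t (snd r)) \<in> borel_measurable R"
 by (rule Theta_comp[OF measurable_const _ const_time]) (auto simp: R_def cong: measurable_cong_sets)

lemma good_space: "good w ==> w \<in> space P" by (simp add: good_def)

lemma mp_nn_integral:
 assumes "mp_homeo f" and g: "g \<in> borel_measurable borel"
 shows "(\<integral>\<^sup>+z. g (f z) \<partial>torus_lebesgue) = (\<integral>\<^sup>+p. g p \<partial>torus_lebesgue)"
proof -
 note h = mp_homeoD[OF assms(1)]
 have "(\<integral>\<^sup>+p. g p \<partial>torus_lebesgue) = (\<integral>\<^sup>+p. g p \<partial>distr torus_lebesgue borel f)" by (simp only: h(2))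
 also have "\<dots> = (\<integral>\<^sup>+z. g (f z) \<partial>torus_lebesgue)"
  by (rule nn_integral_distr) (use h(1) g in \<open>auto cong: measurable_cong_sets\<close>)
 finally show ?thesis by simp
qed

lemma mp_AE:
 assumes "mp_homeo f" "AE p in torus_lebesgue. Q p"
 shows "AE z in torus_lebesgue. Q (f z)"
proof -
 note h = mp_homeoD[OF assms(1)]
 have "f \<in> measurable torus_lebesgue borel" using h(1) by (simp cong: measurable_cong_sets)
 moreover have "AE p in distr torus_lebesgue borel f. Q p" unfolding h(2) by (rule assms(2))
 ultimately show ?thesis by (rule AE_distrD)
qed

text \<open>For almost every auxiliary point the flow preserves Lebesgue measure, so the flow maps R
  to Lebesgue measure.\<close>

lemma push:
 assumes g: "good w" and t: "t \<in> {0..T}" and f: "f \<in> borel_measurable borel"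
 shows "(\<integral>\<^sup>+r. f (\<phi> w (fst r) t (snd r)) \<partial>R) = (\<integral>\<^sup>+p. f p \<partial>torus_lebesgue)"
proof -
 have "(\<integral>\<^sup>+r. f (\<phi> w (fst r) t (snd r)) \<partial>R) = (\<integral>\<^sup>+w'. (\<integral>\<^sup>+z. f (\<phi> w w' t z) \<partial>torus_lebesgue) \<partial>P')"
  using torus.nn_integral_fst[of "\<lambda>r. f (\<phi> w (fst r) t (snd r))" P']
   measurable_compose[OF phi_R[OF good_space[OF g] t] f]
  by (simp add: R_def)
 also have "\<dots> = (\<integral>\<^sup>+w'. (\<integral>\<^sup>+p. f p \<partial>torus_lebesgue) \<partial>P')"
 proof (rule nn_integral_cong_AE)
  have "AE w' in P'. \<forall>t\<in>{0..T}. mp_homeo (\<phi> w w' t)" using g by (simp add: good_def)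
  then show "AE w' in P'. (\<integral>\<^sup>+z. f (\<phi> w w' t z) \<partial>torus_lebesgue) = (\<integral>\<^sup>+p. f p \<partial>torus_lebesgue)"
   by eventually_elim (use mp_nn_integral f t in blast)
 qed
 also have "\<dots> = (\<integral>\<^sup>+p. f p \<partial>torus_lebesgue)" by (simp add: P'.emeasure_space_1)
 finally show ?thesis .
qed

definition "Mt = M0 + M1"

lemma Mt_nonneg: "Mt \<ge> 0" using M0 M1 by (simp add: Mt_def)

lemma q_section: "s \<in> {0..T} ==> q s \<in> borel_measurable borel"
 using q_comp[OF const_time, of s "\<lambda>x. x" borel] by simp

text \<open>At each time the essential bound on the source holds at the position of almost every
  particle, since the flow pulls null sets back to null sets. Fubini exchanges time and particle and
  gives one null set of particles for all t.\<close>

lemma Theta_bound: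
 assumes w: "w \<in> space P" "w' \<in> space P'" and mp: "\<And>t. t \<in> {0..T} ==> mp_homeo (\<phi> w w' t)"
 shows "AE z in torus_lebesgue. integrable (time_lebesgue T) (\<lambda>s. q s (\<phi> w w' s z)) \<and> (\<forall>t. \<bar>\<Theta> w w' t z\<bar> \<le> Mt)"
proof -
 interpret ST: pair_sigma_finite "time_lebesgue T" torus_lebesgue ..
 have spT: "space (time_lebesgue T) = {0..T}" by (simp add: space_restrict_space)
 have fstT: "fst \<in> measurable (time_lebesgue T \<Otimes>\<^sub>M torus_lebesgue) (time_space T)"
  using measurable_fst[of "time_lebesgue T" torus_lebesgue] by (simp cong: measurable_cong_sets add: sets_time_lebesgue)
 have sndT: "snd \<in> borel_measurable (time_lebesgue T \<Otimes>\<^sub>M torus_lebesgue)"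
  using measurable_snd[of "time_lebesgue T" torus_lebesgue] by (simp cong: measurable_cong_sets)
 have qm[measurable]: "(\<lambda>p. q (fst p) (\<phi> w w' (fst p) (snd p))) \<in> borel_measurable (time_lebesgue T \<Otimes>\<^sub>M torus_lebesgue)"
  by (intro q_comp phi_comp measurable_const fstT sndT w)
 have Lm: "(\<lambda>s. Linf_norm (q s)) \<in> borel_measurable (time_space T)" by (rule Linf_norm_measurable[OF q_meas])
 have Lm'[measurable]: "(\<lambda>p. Linf_norm (q (fst p))) \<in> borel_measurable (time_lebesgue T \<Otimes>\<^sub>M torus_lebesgue)"
  by (rule measurable_compose[OF fstT Lm])
 have "AE s in time_lebesgue T. AE z in torus_lebesgue. ennreal \<bar>q s (\<phi> w w' s z)\<bar> \<le> Linf_norm (q s)"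
  by (rule AE_I2) (use mp_AE[OF mp Linf_norm_AE] spT in auto)
 moreover have "{p \<in> space (time_lebesgue T \<Otimes>\<^sub>M torus_lebesgue). ennreal \<bar>q (fst p) (\<phi> w w' (fst p) (snd p))\<bar> \<le> Linf_norm (q (fst p))}
   \<in> sets (time_lebesgue T \<Otimes>\<^sub>M torus_lebesgue)"
  by measurable
 ultimately have "AE z in torus_lebesgue. AE s in time_lebesgue T. ennreal \<bar>q s (\<phi> w w' s z)\<bar> \<le> Linf_norm (q s)"
  using ST.AE_commute[of "\<lambda>s z. ennreal \<bar>q s (\<phi> w w' s z)\<bar> \<le> Linf_norm (q s)"] by simp
 then show ?thesis
  using Xi0_bound
 proof eventually_elim
  case (elim z)
  have m: "(\<lambda>s. q s (\<phi> w w' s z)) \<in> borel_measurable (time_lebesgue T)"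
   by (intro q_comp phi_comp measurable_const w) (auto intro!: measurable_ident_sets simp: sets_time_lebesgue)
  have le: "(\<integral>\<^sup>+s. ennreal (norm (q s (\<phi> w w' s z))) \<partial>time_lebesgue T) \<le> ennreal M1"
  proof -
   have "(\<integral>\<^sup>+s. ennreal (norm (q s (\<phi> w w' s z))) \<partial>time_lebesgue T) \<le> (\<integral>\<^sup>+s. Linf_norm (q s) \<partial>time_lebesgue T)"
    by (rule nn_integral_mono_AE) (use elim(1) in simp)
   then show ?thesis using q_bound by (rule order_trans)
  qed
  have int: "integrable (time_lebesgue T) (\<lambda>s. q s (\<phi> w w' s z))"
   by (rule integrableI_bounded[OF m]) (rule le_less_trans[OF le], simp)
  have "\<bar>\<Theta> w w' t z\<bar> \<le> Mt" for t
  proof -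
   have indm: "(\<lambda>s. indicator {0..t} s :: real) \<in> borel_measurable (time_lebesgue T)"
    by (rule measurable_restrict_space1) simp
   have int': "integrable (time_lebesgue T) (\<lambda>s. indicator {0..t} s * q s (\<phi> w w' s z))"
    by (rule Bochner_Integration.integrable_bound[OF int borel_measurable_times[OF indm m]])
     (auto simp: abs_mult split: split_indicator)
   have "ennreal (norm (\<integral>s. indicator {0..t} s * q s (\<phi> w w' s z) \<partial>time_lebesgue T))
     \<le> (\<integral>\<^sup>+s. ennreal (norm (indicator {0..t} s * q s (\<phi> w w' s z))) \<partial>time_lebesgue T)"
    by (rule integral_norm_bound_ennreal[OF int'])
   also have "\<dots> \<le> (\<integral>\<^sup>+s. ennreal (norm (q s (\<phi> w w' s z))) \<partial>time_lebesgue T)"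
    by (intro nn_integral_mono) (auto split: split_indicator)
   also have "\<dots> \<le> ennreal M1" by (rule le)
   finally have "norm (\<integral>s. indicator {0..t} s * q s (\<phi> w w' s z) \<partial>time_lebesgue T) \<le> M1"
    using M1 by (simp add: ennreal_le_iff)
   then show ?thesis using elim(2) unfolding \<Theta>_def Mt_def by simp
  qed
  then show ?case using int by blast
 qed
qed

lemma Theta_bound_R:
 assumes g: "good w" and t: "t \<in> {0..T}"
 shows "AE r in R. \<bar>\<Theta> w (fst r) t (snd r)\<bar> \<le> Mt"
proof -
 have "AE w' in P'. \<forall>t\<in>{0..T}. mp_homeo (\<phi> w w' t)" using g by (simp add: good_def)
 then have "AE w' in P'. AE z in torus_lebesgue. \<bar>\<Theta> w (fst (w', z)) t (snd (w', z))\<bar> \<le> Mt"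
  using AE_space
 proof eventually_elim
  case (elim w')
  have "AE z in torus_lebesgue. integrable (time_lebesgue T) (\<lambda>s. q s (\<phi> w w' s z)) \<and> (\<forall>t. \<bar>\<Theta> w w' t z\<bar> \<le> Mt)"
   by (rule Theta_bound[OF good_space[OF g]]) (use elim in auto)
  then show ?case by eventually_elim simp
 qed
 moreover have "{r \<in> space (P' \<Otimes>\<^sub>M torus_lebesgue). \<bar>\<Theta> w (fst r) t (snd r)\<bar> \<le> Mt} \<in> sets (P' \<Otimes>\<^sub>M torus_lebesgue)"
  using Theta_R[OF good_space[OF g] t] unfolding R_def by measurable
 ultimately show ?thesis unfolding R_def by (rule RR.AE_pair_measure[rotated])
qed

lemma weighted_bound:
 fixes k :: "torus => 'b :: {banach, second_countable_topology}"
 assumes g: "good w" and t: "t \<in> {0..T}" and k: "k \<in> borel_measurable borel"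
 shows "(\<integral>\<^sup>+r. ennreal (norm (\<Theta> w (fst r) t (snd r) *\<^sub>R k (\<phi> w (fst r) t (snd r)))) \<partial>R)
  \<le> ennreal Mt * (\<integral>\<^sup>+p. ennreal (norm (k p)) \<partial>torus_lebesgue)"
proof -
 have km: "(\<lambda>p. ennreal (norm (k p))) \<in> borel_measurable borel" using k by measurable
 have "(\<integral>\<^sup>+r. ennreal (norm (\<Theta> w (fst r) t (snd r) *\<^sub>R k (\<phi> w (fst r) t (snd r)))) \<partial>R)
   \<le> (\<integral>\<^sup>+r. ennreal Mt * ennreal (norm (k (\<phi> w (fst r) t (snd r)))) \<partial>R)"
 proof (rule nn_integral_mono_AE, use Theta_bound_R[OF g t] in eventually_elim)
  fix r assume "\<bar>\<Theta> w (fst r) t (snd r)\<bar> \<le> Mt"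
  then have "norm (\<Theta> w (fst r) t (snd r) *\<^sub>R k (\<phi> w (fst r) t (snd r))) \<le> Mt * norm (k (\<phi> w (fst r) t (snd r)))"
   by (simp add: mult_right_mono)
  then show "ennreal (norm (\<Theta> w (fst r) t (snd r) *\<^sub>R k (\<phi> w (fst r) t (snd r)))) \<le> ennreal Mt * ennreal (norm (k (\<phi> w (fst r) t (snd r))))"
   using Mt_nonneg by (simp add: ennreal_mult[symmetric] ennreal_leI)
 qed
 also have "\<dots> = ennreal Mt * (\<integral>\<^sup>+r. ennreal (norm (k (\<phi> w (fst r) t (snd r)))) \<partial>R)"
  by (rule nn_integral_cmult) (rule measurable_compose[OF phi_R[OF good_space[OF g] t] km])
 also have "\<dots> = ennreal Mt * (\<integral>\<^sup>+p. ennreal (norm (k p)) \<partial>torus_lebesgue)"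
  by (simp only: push[OF g t km])
 finally show ?thesis .
qed

text \<open>Applied with k a shifted kernel, a difference of two of them, or the error of a cutoff,
  this yields the bound, the modulus and the continuity of V.\<close>

lemma weighted_integrable:
 fixes k :: "torus => 'b :: {banach, second_countable_topology}"
 assumes g: "good w" and t: "t \<in> {0..T}" and k: "k \<in> borel_measurable borel"
  and fin: "(\<integral>\<^sup>+p. ennreal (norm (k p)) \<partial>torus_lebesgue) \<le> ennreal C"
 shows "integrable R (\<lambda>r. \<Theta> w (fst r) t (snd r) *\<^sub>R k (\<phi> w (fst r) t (snd r)))"
  and "C \<ge> 0 ==> norm (\<integral>r. \<Theta> w (fst r) t (snd r) *\<^sub>R k (\<phi> w (fst r) t (snd r)) \<partial>R) \<le> Mt * C"
proof -
 have m: "(\<lambda>r. \<Theta> w (fst r) t (snd r) *\<^sub>R k (\<phi> w (fst r) t (snd r))) \<in> borel_measurable R"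
  by (rule borel_measurable_scaleR[OF Theta_R[OF good_space[OF g] t] measurable_compose[OF phi_R[OF good_space[OF g] t] k]])
 have le: "(\<integral>\<^sup>+r. ennreal (norm (\<Theta> w (fst r) t (snd r) *\<^sub>R k (\<phi> w (fst r) t (snd r)))) \<partial>R) \<le> ennreal Mt * ennreal C"
  by (rule order_trans[OF weighted_bound[OF g t k] mult_left_mono[OF fin]]) simp
 show int: "integrable R (\<lambda>r. \<Theta> w (fst r) t (snd r) *\<^sub>R k (\<phi> w (fst r) t (snd r)))"
  by (rule integrableI_bounded[OF m]) (rule le_less_trans[OF le], simp add: ennreal_mult_less_top)
 assume C: "C \<ge> 0"
 have "ennreal (norm (\<integral>r. \<Theta> w (fst r) t (snd r) *\<^sub>R k (\<phi> w (fst r) t (snd r)) \<partial>R)) \<le> ennreal (Mt * C)"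
  using order_trans[OF integral_norm_bound_ennreal[OF int] le] Mt_nonneg C by (simp add: ennreal_mult)
 then show "norm (\<integral>r. \<Theta> w (fst r) t (snd r) *\<^sub>R k (\<phi> w (fst r) t (snd r)) \<partial>R) \<le> Mt * C"
  using Mt_nonneg C by (simp add: ennreal_le_iff)
qed

lemma K_shifted_meas: "(\<lambda>p. K (x - p)) \<in> borel_measurable borel"
 by measurable

lemma V_integrable:
 assumes "good w" "t \<in> {0..T}"
 shows "integrable R (\<lambda>r. \<Theta> w (fst r) t (snd r) *\<^sub>R K (x - \<phi> w (fst r) t (snd r)))"
 by (rule weighted_integrable(1)[OF assms K_shifted_meas]) (rule eq_refl[OF K_reflect])

lemma V_bound:
 assumes "good w" "t \<in> {0..T}"
 shows "norm (V w t x) \<le> Mt * Bk"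
 unfolding V_def by (rule weighted_integrable(2)[OF assms K_shifted_meas eq_refl[OF K_reflect] Bk_nonneg])

lemma V_modulus:
 assumes g: "good w" and t: "t \<in> {0..T}"
 shows "norm (V w t x - V w t x') \<le> Mt * (Ck * log_modulus (dist x x'))"
proof -
 have "V w t x - V w t x' = (\<integral>r. \<Theta> w (fst r) t (snd r) *\<^sub>R K (x - \<phi> w (fst r) t (snd r))
   - \<Theta> w (fst r) t (snd r) *\<^sub>R K (x' - \<phi> w (fst r) t (snd r)) \<partial>R)"
  unfolding V_def by (rule Bochner_Integration.integral_diff[symmetric]) (rule V_integrable[OF g t])+
 also have "\<dots> = (\<integral>r. \<Theta> w (fst r) t (snd r) *\<^sub>R (K (x - \<phi> w (fst r) t (snd r)) - K (x' - \<phi> w (fst r) t (snd r))) \<partial>R)"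
  by (simp only: scaleR_diff_right)
 also have "norm \<dots> \<le> Mt * (Ck * log_modulus (dist x x'))"
  by (rule weighted_integrable(2)[where k = "\<lambda>p. K (x - p) - K (x' - p)", OF g t _ K_shift])
   (use Ck log_modulus_nonneg in \<open>auto intro!: mult_nonneg_nonneg borel_measurable_diff K_shifted_meas\<close>)
 finally show ?thesis .
qed

lemma V_continuous_space:
 assumes g: "good w" and t: "t \<in> {0..T}"
 shows "continuous_on UNIV (V w t)"
 unfolding continuous_on_iff
proof (intro ballI allI impI)
 fix x :: torus and e :: real assume e: "e > 0"
 define e' where "e' = e / (Mt * Ck + 1)"
 have MC: "Mt * Ck \<ge> 0" using Mt_nonneg Ck by simp
 then have e': "e' > 0" using e by (simp add: e'_def)
 obtain d where d: "d > 0" "log_modulus (0 + d) < log_modulus 0 + e'"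
  using log_modulus_right_continuous[of 0 e'] e' by auto
 have "dist (V w t x') (V w t x) < e" if x': "dist x' x < d" for x'
 proof -
  have "norm (V w t x' - V w t x) \<le> Mt * Ck * log_modulus (dist x' x)" using V_modulus[OF g t] by (simp add: mult.assoc)
  also have "\<dots> \<le> Mt * Ck * log_modulus d" using x' MC by (intro mult_left_mono log_modulus_mono) auto
  also have "\<dots> \<le> Mt * Ck * e'" using d(2) MC by (intro mult_left_mono) auto
  also have "\<dots> < e" using e MC unfolding e'_def by (simp add: divide_simps)
  finally show ?thesis by (simp add: dist_norm)
 qed
 then show "\<exists>d>0. \<forall>x'\<in>UNIV. dist x' x < d \<longrightarrow> dist (V w t x') (V w t x) < e" using d(1) by blast
qed

lemma V_comp:
 assumes a: "a \<in> measurable M P" and c: "c \<in> measurable M (time_space T)" and d: "d \<in> borel_measurable M"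
 shows "(\<lambda>m. V (a m) (c m) (d m)) \<in> borel_measurable M"
proof -
 let ?N = "M \<Otimes>\<^sub>M R"
 note f = measurable_compose[OF measurable_fst]
 have s1: "(\<lambda>p. fst (snd p)) \<in> measurable ?N P'"
  by (rule measurable_compose[OF measurable_snd]) (simp add: R_def)
 have s2: "(\<lambda>p. snd (snd p)) \<in> borel_measurable ?N"
  by (rule measurable_compose[OF measurable_snd]) (simp add: R_def cong: measurable_cong_sets)
 have ph: "(\<lambda>p. \<phi> (a (fst p)) (fst (snd p)) (c (fst p)) (snd (snd p))) \<in> borel_measurable ?N"
  by (intro phi_comp f a c s1 s2)
 have "(\<lambda>p. \<Theta> (a (fst p)) (fst (snd p)) (c (fst p)) (snd (snd p))
   *\<^sub>R K (d (fst p) - \<phi> (a (fst p)) (fst (snd p)) (c (fst p)) (snd (snd p)))) \<in> borel_measurable ?N"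
  by (intro borel_measurable_scaleR Theta_comp f a c s1 s2 measurable_compose[OF _ K_meas] borel_measurable_torus_diff d ph)
 then have "(\<lambda>(m, r). \<Theta> (a m) (fst r) (c m) (snd r) *\<^sub>R K (d m - \<phi> (a m) (fst r) (c m) (snd r))) \<in> borel_measurable ?N"
  by (simp add: case_prod_beta')
 from R.borel_measurable_lebesgue_integral[OF this] show ?thesis unfolding V_def by simp
qed

lemma V_torus: "w \<in> space P ==> t \<in> {0..T} ==> V w t \<in> borel_measurable borel"
 using V_comp[OF measurable_const const_time, of w t "\<lambda>x. x" borel] by simp

text \<open>By Fubini the weak divergence of V is a weighted mean of those of translated kernels,
  each of which vanishes.\<close>

lemma V_div_free:
 assumes g: "good w" and t: "t \<in> {0..T}"
 shows "div_free (V w t)"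
 unfolding div_free_def
proof (intro conjI allI impI)
 note w = good_space[OF g]
 show "integrable torus_lebesgue (V w t)"
  by (rule torus.integrable_const_bound[of _ "Mt * Bk"])
   (use V_bound[OF g t] V_torus[OF w t] in \<open>auto cong: measurable_cong_sets\<close>)
 fix \<theta> :: "torus => real" assume th: "smooth \<theta>"
 interpret XR: pair_sigma_finite torus_lebesgue R ..
 define G where "G x = (pd1 \<theta> x, pd2 \<theta> x)" for x
 have Gc: "continuous_on UNIV G" unfolding G_def[abs_def]
  by (intro continuous_on_Pair smooth_continuous smooth_pd th)
 have Gm: "G \<in> borel_measurable borel" by (rule borel_measurable_continuous_onI[OF Gc])
 have "bounded (range G)" by (rule compact_imp_bounded[OF compact_continuous_image[OF Gc compact_torus]])
 then obtain B0 where B0: "\<And>x. norm (G x) \<le> B0" unfolding bounded_iff by auto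
 have B00: "B0 \<ge> 0" using B0[of 0] norm_ge_zero order_trans by blast
 let ?h = "\<lambda>x r. (\<Theta> w (fst r) t (snd r) *\<^sub>R K (x - \<phi> w (fst r) t (snd r))) \<bullet> G x"
 have hm: "(\<lambda>p. ?h (fst p) (snd p)) \<in> borel_measurable (torus_lebesgue \<Otimes>\<^sub>M R)"
 proof -
  have f: "fst \<in> borel_measurable (torus_lebesgue \<Otimes>\<^sub>M R)"
   using measurable_fst[of torus_lebesgue R] by (simp cong: measurable_cong_sets)
  show ?thesis
   by (intro borel_measurable_inner borel_measurable_scaleR measurable_compose[OF measurable_snd Theta_R[OF w t]]
     measurable_compose[OF _ K_meas] borel_measurable_torus_diff f measurable_compose[OF measurable_snd phi_R[OF w t]]
     measurable_compose[OF f Gm])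
 qed
 have bound: "(\<integral>\<^sup>+r. ennreal (norm (?h x r)) \<partial>R) \<le> ennreal (Mt * Bk * B0)" for x
 proof -
  have "(\<integral>\<^sup>+r. ennreal (norm (?h x r)) \<partial>R)
    \<le> (\<integral>\<^sup>+r. ennreal B0 * ennreal (norm (\<Theta> w (fst r) t (snd r) *\<^sub>R K (x - \<phi> w (fst r) t (snd r)))) \<partial>R)"
  proof (rule nn_integral_mono)
   fix r
   have "norm (?h x r) \<le> norm (\<Theta> w (fst r) t (snd r) *\<^sub>R K (x - \<phi> w (fst r) t (snd r))) * norm (G x)"
    unfolding real_norm_def by (rule Cauchy_Schwarz_ineq2)
   also have "\<dots> \<le> norm (\<Theta> w (fst r) t (snd r) *\<^sub>R K (x - \<phi> w (fst r) t (snd r))) * B0"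
    by (rule mult_left_mono[OF B0 norm_ge_zero])
   finally have "norm (?h x r) \<le> B0 * norm (\<Theta> w (fst r) t (snd r) *\<^sub>R K (x - \<phi> w (fst r) t (snd r)))"
    by (simp only: mult.commute)
   then show "ennreal (norm (?h x r)) \<le> ennreal B0 * ennreal (norm (\<Theta> w (fst r) t (snd r) *\<^sub>R K (x - \<phi> w (fst r) t (snd r))))"
    using B00 by (simp only: ennreal_mult[symmetric] norm_ge_zero ennreal_leI)
  qed
  also have "\<dots> = ennreal B0 * (\<integral>\<^sup>+r. ennreal (norm (\<Theta> w (fst r) t (snd r) *\<^sub>R K (x - \<phi> w (fst r) t (snd r)))) \<partial>R)"
   by (rule nn_integral_cmult) (use borel_measurable_integrable[OF V_integrable[OF g t]] in measurable)
  also have "\<dots> \<le> ennreal B0 * (ennreal Mt * ennreal Bk)"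
   using weighted_bound[OF g t K_shifted_meas, of x] unfolding K_reflect by (rule mult_left_mono) simp
  also have "\<dots> = ennreal (Mt * Bk * B0)" using B00 Mt_nonneg Bk_nonneg by (simp add: ennreal_mult mult_ac)
  finally show ?thesis .
 qed
 have int: "integrable (torus_lebesgue \<Otimes>\<^sub>M R) (\<lambda>p. ?h (fst p) (snd p))"
 proof (rule integrableI_bounded[OF hm])
  have "(\<integral>\<^sup>+p. ennreal (norm (?h (fst p) (snd p))) \<partial>(torus_lebesgue \<Otimes>\<^sub>M R)) = (\<integral>\<^sup>+x. (\<integral>\<^sup>+r. ennreal (norm (?h x r)) \<partial>R) \<partial>torus_lebesgue)"
   using R.nn_integral_fst[of "\<lambda>p. ennreal (norm (?h (fst p) (snd p)))" torus_lebesgue] hm by simp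
  also have "\<dots> \<le> (\<integral>\<^sup>+x. ennreal (Mt * Bk * B0) \<partial>torus_lebesgue)" by (rule nn_integral_mono[OF bound])
  also have "\<dots> < \<infinity>" by (simp add: emeasure_torus ennreal_mult_less_top)
  finally show "(\<integral>\<^sup>+p. ennreal (norm (?h (fst p) (snd p))) \<partial>(torus_lebesgue \<Otimes>\<^sub>M R)) < \<infinity>" .
 qed
 have "(\<integral>x. V w t x \<bullet> G x \<partial>torus_lebesgue) = (\<integral>x. (\<integral>r. ?h x r \<partial>R) \<partial>torus_lebesgue)"
  unfolding V_def
  by (rule Bochner_Integration.integral_cong[OF refl]) (rule integral_inner_left[OF V_integrable[OF g t], symmetric])
 also have "\<dots> = (\<integral>r. (\<integral>x. ?h x r \<partial>torus_lebesgue) \<partial>R)"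
  by (rule XR.Fubini_integral[symmetric]) (use int in \<open>simp add: case_prod_beta'\<close>)
 also have "\<dots> = (\<integral>r. 0 \<partial>R)"
  by (rule Bochner_Integration.integral_cong[OF refl]) (use K_div[OF th] in \<open>simp add: G_def\<close>)
 finally show "(\<integral>x. V w t x \<bullet> (pd1 \<theta> x, pd2 \<theta> x) \<partial>torus_lebesgue) = 0" by (simp add: G_def)
qed

end

section \<open>From the transported vorticity to its Lagrangian form\<close>

context flow_data
begin

lemma AE_inverse:
 assumes mp: "mp_homeo f" and Q: "{y. Q y} \<in> sets borel" and ae: "AE z in torus_lebesgue. Q (f z)"
 shows "AE y in torus_lebesgue. Q y"
proof -
 note h = mp_homeoD[OF mp]
 have "(AE y in distr torus_lebesgue borel f. Q y) \<longleftrightarrow> (AE z in torus_lebesgue. Q (f z))"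
  by (rule AE_distr_iff) (use h(1) Q in \<open>auto cong: measurable_cong_sets\<close>)
 then show ?thesis using ae unfolding h(2) by simp
qed

lemma transported_eq:
 assumes "t \<in> {0..T}"
 shows "transported_vorticity P' \<Xi>0 q \<phi> w t y = (\<integral>w'. \<Theta> w w' t (inv (\<phi> w w' t) y) \<partial>completion P')"
 unfolding transported_vorticity_def \<Theta>_def
 by (subst time_lebesgue_integral[of t T]) (use assms in auto)

text \<open>The substitution \<open>y = \<phi> z\<close> preserves measure and cancels the inverse
  flow, turning \<Theta> at the preimage of y into \<Theta> at z. It is made for each auxiliary
  point off a null set, and Fubini takes the mean inside and outside.\<close>

lemma transported:
 assumes g: "good w" and t: "t \<in> {0..T}"
 shows transported_measurable: "transported_vorticity P' \<Xi>0 q \<phi> w t \<in> borel_measurable borel"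
  and transported_bound: "AE y in torus_lebesgue. \<bar>transported_vorticity P' \<Xi>0 q \<phi> w t y\<bar> \<le> Mt"
  and biot_savart_transported: "(\<integral>y. transported_vorticity P' \<Xi>0 q \<phi> w t y *\<^sub>R K (x - y) \<partial>torus_lebesgue) = V w t x"
proof -
 let ?\<tau> = "transported_vorticity P' \<Xi>0 q \<phi> w t"
 note w = good_space[OF g]
 have "AE w' in P'. \<forall>t\<in>{0..T}. mp_homeo (\<phi> w w' t)" using g by (simp add: good_def)
 then obtain N' where N': "N' \<in> null_sets P'" "{w' \<in> space P'. \<not> (\<forall>t\<in>{0..T}. mp_homeo (\<phi> w w' t))} \<subseteq> N'"
  unfolding eventually_ae_filter by auto
 define G where "G = space P' - N'"
 have Gm: "G \<in> sets P'" using N'(1) unfolding G_def by auto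
 have Gs: "w' \<in> space P'" if "w' \<in> G" for w' using that by (simp add: G_def)
 have AEG: "AE w' in P'. w' \<in> G"
  using AE_not_in[OF N'(1)] AE_space by eventually_elim (simp add: G_def)
 have mp: "mp_homeo (\<phi> w w' s)" if "w' \<in> G" "s \<in> {0..T}" for w' s
  using N'(2) that unfolding G_def by blast
 have phm: "(\<lambda>(w', x). \<phi> w w' t x) \<in> borel_measurable (P' \<Otimes>\<^sub>M borel)"
  using phi_comp[OF measurable_const[OF w] measurable_fst const_time[OF t] measurable_snd]
  by (simp add: case_prod_beta')
 \<comment> \<open>The default 0 on the exceptional set of auxiliary points makes the inverse flow
   jointly measurable.\<close>
 define i where "i w' y = (if w' \<in> G then inv (\<phi> w w' t) y else 0)" for w' y
 have im: "(\<lambda>p. i (fst p) (snd p)) \<in> borel_measurable (P' \<Otimes>\<^sub>M borel)"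
  using measurable_inverse_family[OF phm Gm mp[OF _ t]] unfolding i_def by (simp add: case_prod_beta')
 define h where "h w' y = (if w' \<in> G then \<Theta> w w' t (i w' y) else 0)" for w' y
 have hm: "(\<lambda>p. h (fst p) (snd p)) \<in> borel_measurable (P' \<Otimes>\<^sub>M borel)"
 proof -
  have 1: "(\<lambda>p. \<Theta> w (fst p) t (i (fst p) (snd p))) \<in> borel_measurable (P' \<Otimes>\<^sub>M borel)"
   by (rule Theta_comp[OF measurable_const[OF w] measurable_fst const_time[OF t] im])
  have 2: "{p \<in> space (P' \<Otimes>\<^sub>M borel). fst p \<in> G} \<in> sets (P' \<Otimes>\<^sub>M (borel :: torus measure))"
   using Gm by measurable
  show ?thesis unfolding h_def by (rule measurable_If[OF 1 _ 2]) simp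
 qed
 have hm': "(\<lambda>p. h (fst p) (snd p)) \<in> borel_measurable (P' \<Otimes>\<^sub>M torus_lebesgue)"
  using hm by (simp cong: measurable_cong_sets add: sets_R[unfolded R_def])
 have hy: "(\<lambda>w'. h w' y) \<in> borel_measurable P'" for y
  using measurable_compose[OF measurable_Pair2'[of y borel P'] hm] by simp
 have hw: "h w' \<in> borel_measurable borel" if "w' \<in> space P'" for w'
  using measurable_compose[OF measurable_Pair1'[OF that] hm] by simp
 \<comment> \<open>The completion stands in the definition because the integrand is uncontrolled on
   the exceptional set; h is a measurable version of it.\<close>
 have tau: "?\<tau> y = (\<integral>w'. h w' y \<partial>P')" for y
  unfolding transported_eq[OF t]
  by (rule integral_completion_AE[OF hy]) (use AEG in eventually_elim, simp add: h_def i_def)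
 have hphi: "h w' (\<phi> w w' t z) = \<Theta> w w' t z" if "w' \<in> G" for w' z
  using mp_homeoD(3)[OF mp[OF that t]] that by (simp add: h_def i_def)
 show "?\<tau> \<in> borel_measurable borel"
 proof -
  have "(\<lambda>(y, w'). h w' y) \<in> borel_measurable (borel \<Otimes>\<^sub>M P')"
   using measurable_compose[OF measurable_pair_swap' hm] by (simp add: case_prod_beta')
  from P'.borel_measurable_lebesgue_integral[OF this] show ?thesis
   by (rule subst[where P = "\<lambda>g. g \<in> borel_measurable borel", rotated]) (simp add: fun_eq_iff tau)
 qed
 have hb1: "AE y in torus_lebesgue. \<bar>h w' y\<bar> \<le> Mt" if G: "w' \<in> G" for w'
 proof (rule AE_inverse[OF mp[OF G t]])
  show "{y. \<bar>h w' y\<bar> \<le> Mt} \<in> sets borel" using hw[OF Gs[OF G]] by measurable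
  have "AE z in torus_lebesgue. integrable (time_lebesgue T) (\<lambda>s. q s (\<phi> w w' s z)) \<and> (\<forall>t. \<bar>\<Theta> w w' t z\<bar> \<le> Mt)"
   by (rule Theta_bound[OF w Gs[OF G]]) (rule mp[OF G])
  then show "AE z in torus_lebesgue. \<bar>h w' (\<phi> w w' t z)\<bar> \<le> Mt" by eventually_elim (simp add: hphi[OF G])
 qed
 have "AE w' in P'. AE y in torus_lebesgue. \<bar>h w' y\<bar> \<le> Mt" using AEG by eventually_elim (rule hb1)
 then have "AE y in torus_lebesgue. AE w' in P'. \<bar>h w' y\<bar> \<le> Mt"
  by (subst (asm) RR.AE_commute) (use hm' in measurable)
 then have hb: "AE y in torus_lebesgue. integrable P' (\<lambda>w'. h w' y) \<and> \<bar>?\<tau> y\<bar> \<le> Mt"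
 proof eventually_elim
  case (elim y)
  have int: "integrable P' (\<lambda>w'. h w' y)" by (rule P'.integrable_const_bound[OF _ hy]) (use elim in simp)
  have "norm (\<integral>w'. h w' y \<partial>P') \<le> (\<integral>w'. norm (h w' y) \<partial>P')" by (rule integral_norm_bound)
  also have "\<dots> \<le> (\<integral>w'. Mt \<partial>P')"
   by (rule integral_mono_AE) (use elim int in simp_all)
  finally have "norm (\<integral>w'. h w' y \<partial>P') \<le> (\<integral>w'. Mt \<partial>P')" .
  then show ?case using int by (simp add: tau P'.prob_space)
 qed
 then show "AE y in torus_lebesgue. \<bar>?\<tau> y\<bar> \<le> Mt" by eventually_elim simp
 let ?f = "\<lambda>w' y. h w' y *\<^sub>R K (x - y)"
 have Kx: "(\<lambda>p. K (x - snd p)) \<in> borel_measurable (P' \<Otimes>\<^sub>M torus_lebesgue)"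
  by (rule measurable_compose[OF measurable_snd]) (use K_shifted_meas in \<open>simp cong: measurable_cong_sets\<close>)
 have fm: "(\<lambda>p. ?f (fst p) (snd p)) \<in> borel_measurable (P' \<Otimes>\<^sub>M torus_lebesgue)"
  by (rule borel_measurable_scaleR[OF hm' Kx])
 have fint: "integrable (P' \<Otimes>\<^sub>M torus_lebesgue) (\<lambda>p. ?f (fst p) (snd p))"
 proof (rule integrableI_bounded[OF fm])
  have "(\<integral>\<^sup>+p. ennreal (norm (?f (fst p) (snd p))) \<partial>(P' \<Otimes>\<^sub>M torus_lebesgue))
    = (\<integral>\<^sup>+w'. (\<integral>\<^sup>+y. ennreal (norm (?f w' y)) \<partial>torus_lebesgue) \<partial>P')"
   using torus.nn_integral_fst[of "\<lambda>p. ennreal (norm (?f (fst p) (snd p)))" P']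
    measurable_compose[OF measurable_compose[OF fm borel_measurable_norm] measurable_ennreal] by simp
  also have "\<dots> \<le> (\<integral>\<^sup>+w'. ennreal Mt * ennreal Bk \<partial>P')"
  proof (rule nn_integral_mono_AE, use AEG in eventually_elim)
   fix w' assume G: "w' \<in> G"
   have "(\<integral>\<^sup>+y. ennreal (norm (?f w' y)) \<partial>torus_lebesgue) \<le> (\<integral>\<^sup>+y. ennreal Mt * ennreal (norm (K (x - y))) \<partial>torus_lebesgue)"
   proof (rule nn_integral_mono_AE, use hb1[OF G] in eventually_elim)
    fix y assume "\<bar>h w' y\<bar> \<le> Mt"
    then have "norm (?f w' y) \<le> Mt * norm (K (x - y))" by (simp add: mult_right_mono)
    then show "ennreal (norm (?f w' y)) \<le> ennreal Mt * ennreal (norm (K (x - y)))"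
     using Mt_nonneg by (simp add: ennreal_mult[symmetric] ennreal_leI)
   qed
   also have "\<dots> = ennreal Mt * (\<integral>\<^sup>+y. ennreal (norm (K (x - y))) \<partial>torus_lebesgue)"
    by (rule nn_integral_cmult) (use K_shifted_meas in \<open>auto cong: measurable_cong_sets\<close>)
   finally show "(\<integral>\<^sup>+y. ennreal (norm (?f w' y)) \<partial>torus_lebesgue) \<le> ennreal Mt * ennreal Bk"
    by (simp only: K_reflect)
  qed
  also have "\<dots> < \<infinity>" by (simp add: P'.emeasure_space_1 ennreal_mult_less_top)
  finally show "(\<integral>\<^sup>+p. ennreal (norm (?f (fst p) (snd p))) \<partial>(P' \<Otimes>\<^sub>M torus_lebesgue)) < \<infinity>" .
 qed
 have Kt: "(\<lambda>y. K (x - y)) \<in> borel_measurable torus_lebesgue" using K_shifted_meas by (simp cong: measurable_cong_sets)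
 have "(\<lambda>(y, w'). ?f w' y) \<in> borel_measurable (torus_lebesgue \<Otimes>\<^sub>M P')"
  using measurable_compose[OF measurable_pair_swap' fm] by (simp add: case_prod_beta')
 from P'.borel_measurable_lebesgue_integral[OF this]
 have fym: "(\<lambda>y. \<integral>w'. ?f w' y \<partial>P') \<in> borel_measurable torus_lebesgue" .
 have taum: "?\<tau> \<in> borel_measurable torus_lebesgue"
  using \<open>?\<tau> \<in> borel_measurable borel\<close> by (simp cong: measurable_cong_sets)
 have "(\<integral>y. ?\<tau> y *\<^sub>R K (x - y) \<partial>torus_lebesgue) = (\<integral>y. (\<integral>w'. ?f w' y \<partial>P') \<partial>torus_lebesgue)"
 proof (rule integral_cong_AE[OF borel_measurable_scaleR[OF taum Kt] fym], use hb in eventually_elim)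
  fix y assume "integrable P' (\<lambda>w'. h w' y) \<and> \<bar>?\<tau> y\<bar> \<le> Mt"
  then show "?\<tau> y *\<^sub>R K (x - y) = (\<integral>w'. ?f w' y \<partial>P')" by (simp add: tau)
 qed
 also have "\<dots> = (\<integral>w'. (\<integral>y. ?f w' y \<partial>torus_lebesgue) \<partial>P')"
  by (rule RR.Fubini_integral) (use fint in \<open>simp add: case_prod_beta'\<close>)
 also have "\<dots> = (\<integral>w'. (\<integral>z. \<Theta> w w' t z *\<^sub>R K (x - \<phi> w w' t z) \<partial>torus_lebesgue) \<partial>P')"
 proof (rule integral_cong_AE)
  show "(\<lambda>w'. \<integral>y. ?f w' y \<partial>torus_lebesgue) \<in> borel_measurable P'"
   by (rule torus.borel_measurable_lebesgue_integral) (use fm in \<open>simp add: case_prod_beta'\<close>)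
  show "(\<lambda>w'. \<integral>z. \<Theta> w w' t z *\<^sub>R K (x - \<phi> w w' t z) \<partial>torus_lebesgue) \<in> borel_measurable P'"
   by (rule torus.borel_measurable_lebesgue_integral)
    (use borel_measurable_integrable[OF V_integrable[OF g t]] in \<open>simp add: case_prod_beta' R_def\<close>)
  show "AE w' in P'. (\<integral>y. ?f w' y \<partial>torus_lebesgue) = (\<integral>z. \<Theta> w w' t z *\<^sub>R K (x - \<phi> w w' t z) \<partial>torus_lebesgue)"
   using AEG
  proof eventually_elim
   case (elim w')
   note hh = mp_homeoD[OF mp[OF elim t]]
   have "(\<integral>y. ?f w' y \<partial>torus_lebesgue) = (\<integral>y. ?f w' y \<partial>distr torus_lebesgue borel (\<phi> w w' t))" by (simp only: hh(2))
   also have "\<dots> = (\<integral>z. ?f w' (\<phi> w w' t z) \<partial>torus_lebesgue)"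
   proof (rule integral_distr)
    show "\<phi> w w' t \<in> borel_measurable torus_lebesgue" using hh(1) by (simp cong: measurable_cong_sets)
    show "(\<lambda>y. ?f w' y) \<in> borel_measurable borel"
     by (rule borel_measurable_scaleR[OF hw[OF Gs[OF elim]] K_shifted_meas])
   qed
   finally show ?case by (simp only: hphi[OF elim])
  qed
 qed
 also have "\<dots> = V w t x"
  unfolding V_def R_def
  using RR.integral_fst'[OF V_integrable[OF g t, unfolded R_def, of x]] by simp
 finally show "(\<integral>y. ?\<tau> y *\<^sub>R K (x - y) \<partial>torus_lebesgue) = V w t x" .
qed

end

section \<open>Joint continuity of the velocity in time and space\<close>

lemma AE_torus_nonzero: "AE p in torus_lebesgue. p \<noteq> 0"
proof -
 have c: "countable torus_lattice"
  unfolding torus_lattice_def Ints_def by (intro countable_image countable_SIGMA) auto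
 have "AE z in lborel. z \<notin> torus_lattice"
  by (rule AE_not_in[OF countable_imp_null_set_lborel[OF c]])
 moreover have "to_torus z = 0 \<longleftrightarrow> z \<in> torus_lattice" for z
  using to_torus_eq_iff[of z 0] by (simp add: to_torus_0)
 ultimately have "AE z in restrict_space lborel ({0..<2*pi} \<times> {0..<2*pi}). to_torus z \<noteq> 0"
  by (subst AE_restrict_space_iff) (auto elim: eventually_mono intro: borel_Times)
 then show ?thesis unfolding torus_lebesgue_def
  by (subst AE_distr_iff) (auto intro!: measurable_restrict_space1)
qed

context log_kernel
begin

text \<open>For positive n it vanishes within distance \<open>1 / n\<close> of the pole and is 1
  beyond \<open>2 / n\<close>, so that its product with K is continuous everywhere and, the torus
  being compact, bounded.\<close>

definition cutoff :: "nat => torus => real" where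
 "cutoff n p = max 0 (min 1 (real n * dist p 0 - 1))"

lemma cutoff_bounds: "0 \<le> cutoff n p" "cutoff n p \<le> 1"
 by (auto simp: cutoff_def)

lemma cutoff_kernel_continuous: "continuous_on UNIV (\<lambda>p. cutoff n p *\<^sub>R K p)"
proof -
 let ?B = "{p. real n * dist p 0 < (1 :: real)} :: torus set"
 have op: "open ?B" by (intro open_Collect_less continuous_intros)
 have 1: "continuous_on ?B (\<lambda>p. cutoff n p *\<^sub>R K p)"
  by (rule continuous_on_eq[of _ "\<lambda>_. 0"]) (auto simp: cutoff_def)
 have 2: "continuous_on (- {0}) (\<lambda>p. cutoff n p *\<^sub>R K p)"
  unfolding cutoff_def by (intro continuous_intros K_cont)
 have "continuous_on (?B \<union> - {0}) (\<lambda>p. cutoff n p *\<^sub>R K p)"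
  by (rule continuous_on_open_Un[OF op _ 1 2]) auto
 moreover have "?B \<union> - {0} = UNIV" by auto
 ultimately show ?thesis by simp
qed

lemma cutoff_tendsto: "p \<noteq> 0 ==> (\<lambda>n. cutoff n p) \<longlonglongrightarrow> 1"
proof (rule tendsto_eventually)
 assume p: "p \<noteq> 0"
 obtain N :: nat where N: "real N \<ge> 2 / dist p 0" using real_arch_simple by blast
 show "\<forall>\<^sub>F n in sequentially. cutoff n p = 1"
  using eventually_ge_at_top[of N]
 proof eventually_elim
  case (elim n)
  have d: "dist p 0 > 0" using p by simp
  have "2 / dist p 0 \<le> real n" using N elim by linarith
  then have "2 \<le> real n * dist p 0" using d by (simp add: pos_divide_le_eq)
  then show ?case by (simp add: cutoff_def)
 qed
qed

lemma cutoff_integral_tendsto: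
 "(\<lambda>n. \<integral>p. norm (K p - cutoff n p *\<^sub>R K p) \<partial>torus_lebesgue) \<longlonglongrightarrow> 0"
proof -
 have m: "(\<lambda>p. K p - cutoff n p *\<^sub>R K p) \<in> borel_measurable torus_lebesgue" for n
  using borel_measurable_diff[OF K_meas borel_measurable_continuous_onI[OF cutoff_kernel_continuous]]
  by (simp cong: measurable_cong_sets)
 have "(\<lambda>n. \<integral>p. norm (K p - cutoff n p *\<^sub>R K p) \<partial>torus_lebesgue) \<longlonglongrightarrow> (\<integral>p. 0 \<partial>torus_lebesgue)"
 proof (rule integral_dominated_convergence[where w = "\<lambda>p. norm (K p)"])
  show "AE p in torus_lebesgue. (\<lambda>n. norm (K p - cutoff n p *\<^sub>R K p)) \<longlonglongrightarrow> 0"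
   using AE_torus_nonzero
  proof eventually_elim
   case (elim p)
   have "(\<lambda>n. norm (K p - cutoff n p *\<^sub>R K p)) \<longlonglongrightarrow> norm (K p - 1 *\<^sub>R K p)"
    by (intro tendsto_intros cutoff_tendsto elim)
   then show ?case by simp
  qed
  fix n show "AE p in torus_lebesgue. norm (norm (K p - cutoff n p *\<^sub>R K p)) \<le> norm (K p)"
  proof (rule AE_I2)
   fix p
   have "K p - cutoff n p *\<^sub>R K p = (1 - cutoff n p) *\<^sub>R K p" by (simp add: scaleR_diff_left)
   then show "norm (norm (K p - cutoff n p *\<^sub>R K p)) \<le> norm (K p)"
    using cutoff_bounds[of n p] by (simp add: mult_left_le_one_le)
  qed
  show "(\<lambda>p. norm (K p - cutoff n p *\<^sub>R K p)) \<in> borel_measurable torus_lebesgue"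
   by (rule measurable_compose[OF m borel_measurable_norm])
 qed (use K_int in auto)
 then show ?thesis by simp
qed

end

context flow_data
begin

text \<open>The indicators converge except possibly at the single time \<open>s = t\<close>, and f
  dominates.\<close>

lemma time_integral_tendsto:
 assumes f: "integrable (time_lebesgue T) f" and r: "r \<longlonglongrightarrow> t"
 shows "(\<lambda>j. \<integral>s. indicator {0..r j} s * f s \<partial>time_lebesgue T) \<longlonglongrightarrow> (\<integral>s. indicator {0..t} s * f s \<partial>time_lebesgue T :: real)"
proof (rule integral_dominated_convergence[where w = "\<lambda>s. norm (f s)"])
 have m: "(\<lambda>s. indicator {0..a} s * f s) \<in> borel_measurable (time_lebesgue T)" for a
  by (intro borel_measurable_times borel_measurable_integrable[OF f] measurable_restrict_space1) simp
 then show "(\<lambda>s. indicator {0..t} s * f s) \<in> borel_measurable (time_lebesgue T)"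
  "\<And>j. (\<lambda>s. indicator {0..r j} s * f s) \<in> borel_measurable (time_lebesgue T)" by blast+
 show "integrable (time_lebesgue T) (\<lambda>s. norm (f s))" using f by simp
 show "AE s in time_lebesgue T. norm (indicator {0..r j} s * f s) \<le> norm (f s)" for j
  by (rule AE_I2) (simp split: split_indicator)
 have "AE s in time_lebesgue T. s \<noteq> t"
  by (subst AE_restrict_space_iff) (use AE_lborel_singleton[of t] in \<open>auto elim: eventually_mono\<close>)
 then show "AE s in time_lebesgue T. (\<lambda>j. indicator {0..r j} s * f s) \<longlonglongrightarrow> indicator {0..t} s * f s"
 proof eventually_elim
  case (elim s)
  have "\<forall>\<^sub>F j in sequentially. indicator {0..r j} s = (indicator {0..t} s :: real)"
  proof (cases "s < t")
   case True
   show ?thesis using order_tendstoD(1)[OF r True] by eventually_elim (use True in \<open>auto split: split_indicator\<close>)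
  next
   case False
   then have "t < s" using elim by simp
   from order_tendstoD(2)[OF r this] show ?thesis
    by eventually_elim (use False elim in \<open>auto split: split_indicator\<close>)
  qed
  then show ?case by (intro tendsto_mult tendsto_const tendsto_eventually)
 qed
qed

definition cgood :: "'w => bool" where
 "cgood w \<longleftrightarrow> good w \<and> (AE w' in P'. \<forall>x. continuous_on {0..T} (\<lambda>t. \<phi> w w' t x))"

text \<open>For continuous k dominated convergence applies with a constant majorant. Convergence of
  the integrand uses continuous paths for the kernel and \<open>time_integral_tendsto\<close> for
  the weight.\<close>

lemma weighted_continuous:
 fixes k :: "torus => real \<times> real"
 assumes c: "cgood w" and k: "continuous_on UNIV k"
 shows "continuous_on ({0..T} \<times> UNIV) (\<lambda>(t, x). \<integral>r. \<Theta> w (fst r) t (snd r) *\<^sub>R k (x - \<phi> w (fst r) t (snd r)) \<partial>R)"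
proof (rule continuous_on_sequentiallyI)
 have g: "good w" using c by (simp add: cgood_def)
 note w = good_space[OF g]
 have km: "k \<in> borel_measurable borel" by (rule borel_measurable_continuous_onI[OF k])
 have "bounded (range k)" by (rule compact_imp_bounded[OF compact_continuous_image[OF k compact_torus]])
 then obtain B where B: "\<And>p. norm (k p) \<le> B" unfolding bounded_iff by auto
 have B0: "B \<ge> 0" using B[of 0] norm_ge_zero order_trans by blast
 let ?f = "\<lambda>p r. \<Theta> w (fst r) (fst p) (snd r) *\<^sub>R k (snd p - \<phi> w (fst r) (fst p) (snd r))"
 have fm: "?f p \<in> borel_measurable R" if "fst p \<in> {0..T}" for p
  by (intro borel_measurable_scaleR Theta_R[OF w that] measurable_compose[OF _ km] borel_measurable_torus_diff
    borel_measurable_const phi_R[OF w that])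
 fix u :: "nat => real \<times> torus" and a :: "real \<times> torus"
 assume u: "\<forall>n. u n \<in> {0..T} \<times> UNIV" and a: "a \<in> {0..T} \<times> UNIV" and lim: "u \<longlonglongrightarrow> a"
 have u': "fst (u n) \<in> {0..T}" for n using u by (auto simp: mem_Times_iff)
 have a': "fst a \<in> {0..T}" using a by (auto simp: mem_Times_iff)
 have l1: "(\<lambda>n. fst (u n)) \<longlonglongrightarrow> fst a" and l2: "(\<lambda>n. snd (u n)) \<longlonglongrightarrow> snd a"
  using lim by (auto intro: tendsto_fst tendsto_snd)
 have "(\<lambda>n. \<integral>r. ?f (u n) r \<partial>R) \<longlonglongrightarrow> (\<integral>r. ?f a r \<partial>R)"
 proof (rule integral_dominated_convergence[where w = "\<lambda>_. Mt * B"])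
  show "?f a \<in> borel_measurable R" "\<And>n. ?f (u n) \<in> borel_measurable R" using fm u' a' by blast+
  show "AE r in R. norm (?f (u n) r) \<le> Mt * B" for n
   using Theta_bound_R[OF g u'[of n]]
   by eventually_elim (use B Mt_nonneg in \<open>auto intro!: mult_mono\<close>)
  have "AE w' in P'. \<forall>t\<in>{0..T}. mp_homeo (\<phi> w w' t)" using g by (simp add: good_def)
  moreover have "AE w' in P'. \<forall>x. continuous_on {0..T} (\<lambda>t. \<phi> w w' t x)" using c by (simp add: cgood_def)
  ultimately have "AE w' in P'. AE z in torus_lebesgue. (\<lambda>n. norm (?f (u n) (w', z) - ?f a (w', z))) \<longlonglongrightarrow> 0"
   using AE_space
  proof eventually_elim
   case (elim w')
   have "AE z in torus_lebesgue. integrable (time_lebesgue T) (\<lambda>s. q s (\<phi> w w' s z)) \<and> (\<forall>t. \<bar>\<Theta> w w' t z\<bar> \<le> Mt)"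
    by (rule Theta_bound[OF w]) (use elim in auto)
   then show ?case
   proof eventually_elim
    case z: (elim z)
    have 1: "(\<lambda>n. \<Theta> w w' (fst (u n)) z) \<longlonglongrightarrow> \<Theta> w w' (fst a) z"
     unfolding \<Theta>_def by (intro tendsto_add tendsto_const time_integral_tendsto l1) (use z in blast)
    have 2: "(\<lambda>n. \<phi> w w' (fst (u n)) z) \<longlonglongrightarrow> \<phi> w w' (fst a) z"
     using continuous_on_tendsto_compose[OF _ l1 a', of "\<lambda>t. \<phi> w w' t z"] elim(2) u' by auto
    have 3: "(\<lambda>n. k (snd (u n) - \<phi> w w' (fst (u n)) z)) \<longlonglongrightarrow> k (snd a - \<phi> w w' (fst a) z)"
     by (rule continuous_on_tendsto_compose[OF k tendsto_diff[OF l2 2]]) auto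
    have "(\<lambda>n. norm (?f (u n) (w', z) - ?f a (w', z))) \<longlonglongrightarrow> norm (?f a (w', z) - ?f a (w', z))"
     unfolding fst_conv snd_conv by (intro tendsto_norm tendsto_diff tendsto_scaleR 1 3 tendsto_const)
    then show ?case by simp
   qed
  qed
  moreover have "{r \<in> space (P' \<Otimes>\<^sub>M torus_lebesgue). (\<lambda>n. norm (?f (u n) r - ?f a r)) \<longlonglongrightarrow> 0} \<in> sets (P' \<Otimes>\<^sub>M torus_lebesgue)"
  proof -
   have "(\<lambda>r. norm (?f (u n) r - ?f a r)) \<in> borel_measurable (P' \<Otimes>\<^sub>M torus_lebesgue)" for n
    by (rule measurable_compose[OF borel_measurable_diff[OF fm[OF u'[of n]] fm[OF a']] borel_measurable_norm, unfolded R_def])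
   then have "Measurable.pred (P' \<Otimes>\<^sub>M torus_lebesgue) (\<lambda>r. (\<lambda>n. norm (?f (u n) r - ?f a r)) \<longlonglongrightarrow> 0)"
    by (rule measurable_limit)
   then show ?thesis by (simp add: pred_def)
  qed
  ultimately have "AE r in R. (\<lambda>n. norm (?f (u n) r - ?f a r)) \<longlonglongrightarrow> 0"
   unfolding R_def by (rule RR.AE_pair_measure[rotated])
  then show "AE r in R. (\<lambda>n. ?f (u n) r) \<longlonglongrightarrow> ?f a r"
   by eventually_elim (simp add: tendsto_norm_zero_iff LIM_zero_iff)
 qed auto
 then show "(\<lambda>n. (\<lambda>(t, x). \<integral>r. \<Theta> w (fst r) t (snd r) *\<^sub>R k (x - \<phi> w (fst r) t (snd r)) \<partial>R) (u n))
   \<longlonglongrightarrow> (\<lambda>(t, x). \<integral>r. \<Theta> w (fst r) t (snd r) *\<^sub>R k (x - \<phi> w (fst r) t (snd r)) \<partial>R) a"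
  by (simp add: case_prod_beta')
qed

text \<open>K is unbounded, so dominated convergence is applied to cut-off kernels. The error is at
  most \<open>Mt\<close> times the L1 norm of the removed part, uniformly in t and x because the
  flow preserves measure, and a uniform limit of continuous functions is continuous.\<close>

lemma V_continuous:
 assumes c: "cgood w"
 shows "continuous_on ({0..T} \<times> UNIV) (\<lambda>(t, x). V w t x)"
proof (rule uniform_limit_theorem)
 have g: "good w" using c by (simp add: cgood_def)
 let ?V = "\<lambda>n (t, x). \<integral>r. \<Theta> w (fst r) t (snd r) *\<^sub>R (cutoff n (x - \<phi> w (fst r) t (snd r)) *\<^sub>R K (x - \<phi> w (fst r) t (snd r))) \<partial>R"
 define e where "e n = (\<integral>p. norm (K p - cutoff n p *\<^sub>R K p) \<partial>torus_lebesgue)" for n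
 have e0: "e \<longlonglongrightarrow> 0" unfolding e_def[abs_def] by (rule cutoff_integral_tendsto)
 have en: "e n \<ge> 0" for n by (simp add: e_def)
 show "\<forall>\<^sub>F n in sequentially. continuous_on ({0..T} \<times> UNIV) (?V n)"
  using weighted_continuous[OF c cutoff_kernel_continuous] by auto
 have Cm: "(\<lambda>p. cutoff n p *\<^sub>R K p) \<in> borel_measurable borel" for n
  by (rule borel_measurable_continuous_onI[OF cutoff_kernel_continuous])
 have refl: "(\<integral>\<^sup>+p. ennreal (norm (K (x - p) - cutoff n (x - p) *\<^sub>R K (x - p))) \<partial>torus_lebesgue) = ennreal (e n)" for n x
 proof -
  have "(\<integral>\<^sup>+p. ennreal (norm (K (x - p) - cutoff n (x - p) *\<^sub>R K (x - p))) \<partial>torus_lebesgue)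
    = (\<integral>\<^sup>+p. ennreal (norm (K p - cutoff n p *\<^sub>R K p)) \<partial>torus_lebesgue)"
   by (rule nn_integral_torus_reflect[of "\<lambda>p. ennreal (norm (K p - cutoff n p *\<^sub>R K p))"])
    (rule measurable_compose[OF measurable_compose[OF borel_measurable_diff[OF K_meas Cm] borel_measurable_norm] measurable_ennreal])
  also have "\<dots> = ennreal (e n)"
   unfolding e_def
  proof (rule nn_integral_eq_integral)
   have "integrable torus_lebesgue (\<lambda>p. cutoff n p *\<^sub>R K p)"
    by (rule Bochner_Integration.integrable_bound[OF K_int])
     (use Cm cutoff_bounds[of n] in \<open>auto simp: mult_left_le_one_le cong: measurable_cong_sets\<close>)
   then show "integrable torus_lebesgue (\<lambda>p. norm (K p - cutoff n p *\<^sub>R K p))" using K_int by simp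
  qed simp
  finally show ?thesis .
 qed
 have bound: "dist (?V n (t, x)) (V w t x) \<le> Mt * e n" if t: "t \<in> {0..T}" for n t x
 proof -
  have i: "integrable R (\<lambda>r. \<Theta> w (fst r) t (snd r) *\<^sub>R (cutoff n (x - \<phi> w (fst r) t (snd r)) *\<^sub>R K (x - \<phi> w (fst r) t (snd r))))"
  proof (rule weighted_integrable(1)[where k = "\<lambda>p. cutoff n (x - p) *\<^sub>R K (x - p)", OF g t _ order_trans[OF nn_integral_mono eq_refl[OF K_reflect]]])
   show "(\<lambda>p. cutoff n (x - p) *\<^sub>R K (x - p)) \<in> borel_measurable borel"
    by (rule measurable_compose[OF _ Cm]) (intro borel_measurable_torus_diff borel_measurable_const measurable_ident_sets HOL.refl)
   show "ennreal (norm (cutoff n (x - p) *\<^sub>R K (x - p))) \<le> ennreal (norm (K (x - p)))" for p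
    using cutoff_bounds[of n "x - p"] by (intro ennreal_leI) (simp add: mult_left_le_one_le)
  qed
  have "V w t x - ?V n (t, x) = (\<integral>r. \<Theta> w (fst r) t (snd r) *\<^sub>R
    (K (x - \<phi> w (fst r) t (snd r)) - cutoff n (x - \<phi> w (fst r) t (snd r)) *\<^sub>R K (x - \<phi> w (fst r) t (snd r))) \<partial>R)"
   unfolding V_def scaleR_diff_right using Bochner_Integration.integral_diff[OF V_integrable[OF g t] i] by simp
  also have "norm \<dots> \<le> Mt * e n"
   by (rule weighted_integrable(2)[where k = "\<lambda>p. K (x - p) - cutoff n (x - p) *\<^sub>R K (x - p)", OF g t _ eq_refl[OF refl] en])
    (rule measurable_compose[OF _ borel_measurable_diff[OF K_meas Cm]], intro borel_measurable_torus_diff borel_measurable_const measurable_ident_sets HOL.refl)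
  finally show ?thesis by (simp add: dist_norm norm_minus_commute)
 qed
 show "uniform_limit ({0..T} \<times> UNIV) ?V (\<lambda>(t, x). V w t x) sequentially"
 proof (rule uniform_limitI)
  fix d :: real assume d: "d > 0"
  have "(\<lambda>n. Mt * e n) \<longlonglongrightarrow> Mt * 0" by (intro tendsto_intros e0)
  from order_tendstoD(2)[OF this, of d] d
  have "\<forall>\<^sub>F n in sequentially. Mt * e n < d" by simp
  then show "\<forall>\<^sub>F n in sequentially. \<forall>p\<in>{0..T} \<times> UNIV. dist (?V n p) ((\<lambda>(t, x). V w t x) p) < d"
  proof eventually_elim
   case (elim n)
   show ?case
   proof
    fix p assume "p \<in> {0..T} \<times> (UNIV :: torus set)"
    then have "dist (?V n (fst p, snd p)) (V w (fst p) (snd p)) \<le> Mt * e n" by (intro bound) (simp add: mem_Times_iff)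
    then show "dist (?V n p) ((\<lambda>(t, x). V w t x) p) < d"
     unfolding prod.collapse case_prod_beta by (rule le_less_trans[OF _ elim])
   qed
  qed
 qed
qed simp

end

section \<open>Progressive measurability of the velocity\<close>

context flow_data
begin

text \<open>Unlike \<open>V_bound\<close> this holds before averaging, for each auxiliary point
  where the flow is regular. It supplies the boundedness that \<open>integral_adapted\<close> asks
  for.\<close>

lemma inner_integral_bound:
 assumes w: "w \<in> space P" "w' \<in> space P'" and mp: "\<And>t. t \<in> {0..T} ==> mp_homeo (\<phi> w w' t)" and t: "t \<in> {0..T}"
 shows "norm (\<integral>z. \<Theta> w w' t z *\<^sub>R K (x - \<phi> w w' t z) \<partial>torus_lebesgue) \<le> Mt * Bk"
proof -
 have Th: "\<Theta> w w' t \<in> borel_measurable torus_lebesgue" and ph: "\<phi> w w' t \<in> borel_measurable torus_lebesgue"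
  using Theta_comp[OF measurable_const[OF w(1)] measurable_const[OF w(2)] const_time[OF t], of "\<lambda>x. x" borel]
   phi_comp[OF measurable_const[OF w(1)] measurable_const[OF w(2)] const_time[OF t], of "\<lambda>x. x" borel]
  by (simp_all cong: measurable_cong_sets)
 have m: "(\<lambda>z. \<Theta> w w' t z *\<^sub>R K (x - \<phi> w w' t z)) \<in> borel_measurable torus_lebesgue"
  by (rule borel_measurable_scaleR[OF Th measurable_compose[OF ph K_shifted_meas]])
 have "(\<integral>\<^sup>+z. ennreal (norm (\<Theta> w w' t z *\<^sub>R K (x - \<phi> w w' t z))) \<partial>torus_lebesgue)
   \<le> (\<integral>\<^sup>+z. ennreal Mt * ennreal (norm (K (x - \<phi> w w' t z))) \<partial>torus_lebesgue)"
 proof (rule nn_integral_mono_AE, rule eventually_mono[OF Theta_bound[OF w mp]])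
  fix z assume "integrable (time_lebesgue T) (\<lambda>s. q s (\<phi> w w' s z)) \<and> (\<forall>t. \<bar>\<Theta> w w' t z\<bar> \<le> Mt)"
  then have "norm (\<Theta> w w' t z *\<^sub>R K (x - \<phi> w w' t z)) \<le> Mt * norm (K (x - \<phi> w w' t z))"
   by (simp add: mult_right_mono)
  then show "ennreal (norm (\<Theta> w w' t z *\<^sub>R K (x - \<phi> w w' t z))) \<le> ennreal Mt * ennreal (norm (K (x - \<phi> w w' t z)))"
   using Mt_nonneg by (simp add: ennreal_mult[symmetric] ennreal_leI)
 qed
 also have "\<dots> = ennreal Mt * (\<integral>\<^sup>+z. ennreal (norm (K (x - \<phi> w w' t z))) \<partial>torus_lebesgue)"
  by (rule nn_integral_cmult)
   (rule measurable_compose[OF measurable_compose[OF measurable_compose[OF ph K_shifted_meas] borel_measurable_norm] measurable_ennreal])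
 also have "(\<integral>\<^sup>+z. ennreal (norm (K (x - \<phi> w w' t z))) \<partial>torus_lebesgue) = ennreal Bk"
  using mp_nn_integral[OF mp[OF t], of "\<lambda>p. ennreal (norm (K (x - p)))"]
   measurable_compose[OF measurable_compose[OF K_shifted_meas borel_measurable_norm] measurable_ennreal]
  by (simp add: K_reflect)
 finally have le: "(\<integral>\<^sup>+z. ennreal (norm (\<Theta> w w' t z *\<^sub>R K (x - \<phi> w w' t z))) \<partial>torus_lebesgue) \<le> ennreal Mt * ennreal Bk" .
 have int: "integrable torus_lebesgue (\<lambda>z. \<Theta> w w' t z *\<^sub>R K (x - \<phi> w w' t z))"
  by (rule integrableI_bounded[OF m le_less_trans[OF le]]) (simp add: ennreal_mult_less_top)
 have "ennreal (norm (\<integral>z. \<Theta> w w' t z *\<^sub>R K (x - \<phi> w w' t z) \<partial>torus_lebesgue)) \<le> ennreal (Mt * Bk)"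
  using order_trans[OF integral_norm_bound_ennreal[OF int] le] Mt_nonneg Bk_nonneg by (simp add: ennreal_mult)
 then show ?thesis using Mt_nonneg Bk_nonneg by (simp add: ennreal_le_iff)
qed

lemma V_iterated:
 assumes "good w" "t \<in> {0..T}"
 shows "integrable P' (\<lambda>w'. \<integral>z. \<Theta> w w' t z *\<^sub>R K (x - \<phi> w w' t z) \<partial>torus_lebesgue)"
  and "(\<integral>w'. (\<integral>z. \<Theta> w w' t z *\<^sub>R K (x - \<phi> w w' t z) \<partial>torus_lebesgue) \<partial>P') = V w t x"
 using RR.integral_fst'[OF V_integrable[OF assms, unfolded R_def, of x]]
  RR.integrable_fst'[OF V_integrable[OF assms, unfolded R_def, of x]]
 by (simp_all add: V_def R_def)

text \<open>For a fixed auxiliary point off \<open>N'\<close> the inner integral at time s depends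
  only on the flow up to s and is adapted. \<open>integral_adapted\<close> passes this to the mean,
  and continuity in time and space turns adaptedness into progressive measurability.\<close>

lemma V_progressive:
 assumes F: "filtered_prob_space P F T" and null: "null_sets P \<subseteq> sets (F 0)"
  and N: "N \<in> null_sets P" and N': "N' \<in> null_sets P'"
  and mp: "\<And>w w' t. w \<in> space P - N ==> w' \<in> space P' - N' ==> t \<in> {0..T} ==> mp_homeo (\<phi> w w' t)"
  and cont: "\<And>w w' x. w \<in> space P - N ==> w' \<in> space P' - N' ==> continuous_on {0..T} (\<lambda>t. \<phi> w w' t x)"
  and prog: "\<And>w' x. w' \<in> space P' - N' ==> progressive F T (\<lambda>w t. \<phi> w w' t x)"
 shows "progressive_field F T (\<lambda>w t x. if w \<in> N then 0 else V w t x)"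
proof -
 have sub: "subalgebra P (F t)" if "t \<in> {0..T}" for t using F that by (simp add: filtered_prob_space_def)
 have F_mono: "sets (F s) \<subseteq> sets (F t)" if "s \<in> {0..T}" "t \<in> {0..T}" "s \<le> t" for s t
  using F that by (simp add: filtered_prob_space_def)
 have Fspace: "space (F t) = space P" if "t \<in> {0..T}" for t using sub[OF that] by (simp add: subalgebra_def)
 have FF: "f \<in> borel_measurable (F t)" if "f \<in> borel_measurable (F s)" "s \<in> {0..T}" "t \<in> {0..T}" "s \<le> t"
  for f :: "'w => real \<times> real" and s t
  by (rule measurable_from_subalg[OF _ that(1)]) (use that Fspace F_mono in \<open>auto simp: subalgebra_def\<close>)
 have nullF: "null_sets P \<subseteq> sets (F t)" if "t \<in> {0..T}" for t
  using null F_mono[of 0 t] that T by auto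
 have [measurable]: "N \<in> sets P" "N' \<in> sets P'" using N N' by auto
 have NF: "{w \<in> space (F t). w \<in> N} \<in> sets (F t)" if "t \<in> {0..T}" for t
 proof -
  have "N \<subseteq> space P" using N sets.sets_into_space by blast
  then have "{w \<in> space (F t). w \<in> N} = N" using Fspace[OF that] by auto
  then show ?thesis using nullF[OF that] N by auto
 qed
 have AEN': "AE w' in P'. w' \<in> space P' - N'"
  using AE_not_in[OF N'] AE_space by eventually_elim simp
 have good: "cgood w" if "w \<in> space P - N" for w
 proof -
  have "AE w' in P'. (\<forall>t\<in>{0..T}. mp_homeo (\<phi> w w' t)) \<and> (\<forall>x. continuous_on {0..T} (\<lambda>t. \<phi> w w' t x))"
   using AEN' by eventually_elim (use mp[OF that] cont[OF that] in blast)
  then show ?thesis using that by (simp add: cgood_def good_def)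
 qed
 have adapted: "(\<lambda>w. if w \<in> N then 0 else \<integral>z. \<Theta> w w' s z *\<^sub>R K (x - \<phi> w w' s z) \<partial>torus_lebesgue) \<in> borel_measurable (F s)"
  if s: "s \<in> {0..T}" and w': "w' \<in> space P' - N'" for w' s x
 proof -
  \<comment> \<open>With the value 0 on N the flow is continuous in z for every
    \<open>\<omega>\<close>, as \<open>caratheodory_measurable\<close> demands.\<close>
  define \<phi>' where "\<phi>' w t z = (if w \<in> N then 0 else \<phi> w w' t z)" for w t z
  have s1: "s \<in> space (time_space s)" using s by (simp add: space_restrict_space)
  have sec: "(\<lambda>p. \<phi>' (fst p) (snd p) z) \<in> borel_measurable (F s \<Otimes>\<^sub>M time_space s)" for z
  proof -
   have 1: "(\<lambda>p. \<phi> (fst p) w' (snd p) z) \<in> borel_measurable (F s \<Otimes>\<^sub>M time_space s)"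
    using prog[OF w', of z] s by (simp add: progressive_def case_prod_beta')
   have 2: "{p \<in> space (F s \<Otimes>\<^sub>M time_space s). fst p \<in> N} \<in> sets (F s \<Otimes>\<^sub>M time_space s)"
    by (rule measurable_sets_Collect[OF measurable_fst NF[OF s]])
   show ?thesis unfolding \<phi>'_def by (rule measurable_If[OF borel_measurable_const 1 2])
  qed
  have cts: "continuous_on UNIV (\<phi>' (fst p) (snd p))" if p: "p \<in> space (F s \<Otimes>\<^sub>M time_space s)" for p
  proof -
   have "fst p \<in> space (F s)" "snd p \<in> {0..s}"
    using p unfolding space_pair_measure mem_Times_iff by (simp_all add: space_restrict_space)
   then have p': "fst p \<in> space P" "snd p \<in> {0..T}"
    unfolding Fspace[OF s] using s unfolding atLeastAtMost_iff by (blast, linarith)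
   show ?thesis
   proof (cases "fst p \<in> N")
    case False
    have "mp_homeo (\<phi> (fst p) w' (snd p))" by (rule mp) (use p' w' False in auto)
    then show ?thesis using mp_homeoD(5) False by (simp add: \<phi>'_def)
   qed (simp add: \<phi>'_def)
  qed
  have 1: "(\<lambda>(p, z). \<phi>' (fst p) (snd p) z) \<in> borel_measurable ((F s \<Otimes>\<^sub>M time_space s) \<Otimes>\<^sub>M restrict_space borel UNIV)"
   by (rule caratheodory_measurable[of UNIV "\<lambda>p. \<phi>' (fst p) (snd p)", OF sec cts])
  have ph: "(\<lambda>m. \<phi>' (a m) (c m) (d m)) \<in> borel_measurable M"
   if "a \<in> measurable M (F s)" "c \<in> measurable M (time_space s)" "d \<in> borel_measurable M" for a c d and M :: "'z measure"
  proof -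
   have "d \<in> measurable M (restrict_space borel UNIV)" by (rule measurable_restrict_space2[OF _ that(3)]) simp
   from measurable_compose[OF measurable_Pair[OF measurable_Pair[OF that(1,2)] this] 1] show ?thesis by simp
  qed
  have incl: "c \<in> measurable M (time_space T)" if "c \<in> measurable M (time_space s)" for c and M :: "'z measure"
  proof (rule measurable_restrict_space2)
   show "c \<in> space M \<rightarrow> {0..T}" using measurable_space[OF that] s by (force simp: space_restrict_space)
   show "c \<in> borel_measurable M" using measurable_compose[OF that measurable_time_space] by simp
  qed
  \<comment> \<open>The same vorticity with the time integral taken over \<open>[0, s]\<close> only,
    so that it visibly uses the flow up to time s.\<close>
  define \<Theta>' where "\<Theta>' w z = \<Xi>0 z + (\<integral>t. q t (\<phi>' w t z) \<partial>time_lebesgue s)" for w z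
  interpret Ls: finite_measure "time_lebesgue s" by (rule finite_time_lebesgue)
  have sn: "snd \<in> measurable ((F s \<Otimes>\<^sub>M borel) \<Otimes>\<^sub>M time_lebesgue s) (time_space s)"
   using measurable_snd[of "F s \<Otimes>\<^sub>M borel" "time_lebesgue s"] by (simp cong: measurable_cong_sets add: sets_time_lebesgue)
  have "(\<lambda>p. q (snd p) (\<phi>' (fst (fst p)) (snd p) (snd (fst p)))) \<in> borel_measurable ((F s \<Otimes>\<^sub>M borel) \<Otimes>\<^sub>M time_lebesgue s)"
   by (intro q_comp incl sn ph measurable_compose[OF measurable_fst measurable_fst] measurable_compose[OF measurable_fst measurable_snd])
  then have "(\<lambda>(m, t). q t (\<phi>' (fst m) t (snd m))) \<in> borel_measurable ((F s \<Otimes>\<^sub>M borel) \<Otimes>\<^sub>M time_lebesgue s)"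
   by (simp add: case_prod_beta')
  from Ls.borel_measurable_lebesgue_integral[OF this]
  have Th: "(\<lambda>m. \<Theta>' (fst m) (snd m)) \<in> borel_measurable (F s \<Otimes>\<^sub>M borel)"
   unfolding \<Theta>'_def by (intro borel_measurable_add measurable_compose[OF measurable_snd Xi0_meas]) simp
  have "(\<lambda>m. \<Theta>' (fst m) (snd m) *\<^sub>R K (x - \<phi>' (fst m) s (snd m))) \<in> borel_measurable (F s \<Otimes>\<^sub>M borel)"
   by (intro borel_measurable_scaleR Th measurable_compose[OF _ K_shifted_meas] ph measurable_fst measurable_snd measurable_const s1)
  then have "(\<lambda>(w, z). \<Theta>' w z *\<^sub>R K (x - \<phi>' w s z)) \<in> borel_measurable (F s \<Otimes>\<^sub>M torus_lebesgue)"
   by (simp add: case_prod_beta' cong: measurable_cong_sets sets_pair_measure_cong)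
  from torus.borel_measurable_lebesgue_integral[OF this]
  have "(\<lambda>w. \<integral>z. \<Theta>' w z *\<^sub>R K (x - \<phi>' w s z) \<partial>torus_lebesgue) \<in> borel_measurable (F s)" .
  from measurable_If[OF borel_measurable_const this NF[OF s]]
  have "(\<lambda>w. if w \<in> N then 0 else \<integral>z. \<Theta>' w z *\<^sub>R K (x - \<phi>' w s z) \<partial>torus_lebesgue) \<in> borel_measurable (F s)" .
  moreover have "\<Theta>' w z = \<Theta> w w' s z" if "w \<notin> N" for w z
  proof -
   have "(\<integral>t. q t (\<phi>' w t z) \<partial>time_lebesgue s) = (\<integral>t. indicator {0..s} t * q t (\<phi> w w' t z) \<partial>time_lebesgue s)"
    by (rule Bochner_Integration.integral_cong[OF HOL.refl]) (use that in \<open>simp add: space_restrict_space \<phi>'_def\<close>)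
   also have "\<dots> = (\<integral>t. indicator {0..s} t * q t (\<phi> w w' t z) \<partial>time_lebesgue T)"
    using time_lebesgue_integral[of s s "\<lambda>t. q t (\<phi> w w' t z)"] time_lebesgue_integral[of s T "\<lambda>t. q t (\<phi> w w' t z)"] s by simp
   finally show ?thesis by (simp add: \<Theta>'_def \<Theta>_def)
  qed
  ultimately show ?thesis by (simp add: \<phi>'_def cong: if_cong)
 qed
 \<comment> \<open>Conditional expectations are taken of real functions, so the velocity is treated
   one coordinate at a time.\<close>
 have comp: "(\<lambda>w. if w \<in> N then 0 else c (V w s x)) \<in> borel_measurable (F s)"
  if s: "s \<in> {0..T}" and c: "bounded_linear c" and c1: "\<And>y. \<bar>c y\<bar> \<le> norm y" for c :: "real \<times> real => real" and s x
 proof -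
  \<comment> \<open>Zero on both exceptional sets, hence bounded everywhere and adapted for every
    auxiliary point.\<close>
  define f where "f w w' = (if w \<in> N \<or> w' \<in> N' then 0 else c (\<integral>z. \<Theta> w w' s z *\<^sub>R K (x - \<phi> w w' s z) \<partial>torus_lebesgue))" for w w'
  have cm: "c \<in> borel_measurable borel" by (rule borel_measurable_continuous_onI[OF linear_continuous_on[OF c]])
  have "(\<lambda>w. \<integral>w'. f w w' \<partial>P') \<in> borel_measurable (F s)"
  proof (rule integral_adapted[OF P P' sub[OF s] nullF[OF s]])
   have f: "fst \<in> measurable ((P \<Otimes>\<^sub>M P') \<Otimes>\<^sub>M torus_lebesgue) (P \<Otimes>\<^sub>M P')" by simp
   have sn: "snd \<in> borel_measurable ((P \<Otimes>\<^sub>M P') \<Otimes>\<^sub>M torus_lebesgue)"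
    using measurable_snd[of "P \<Otimes>\<^sub>M P'" torus_lebesgue] by (simp cong: measurable_cong_sets)
   have "(\<lambda>m. \<Theta> (fst (fst m)) (snd (fst m)) s (snd m) *\<^sub>R K (x - \<phi> (fst (fst m)) (snd (fst m)) s (snd m)))
     \<in> borel_measurable ((P \<Otimes>\<^sub>M P') \<Otimes>\<^sub>M torus_lebesgue)"
    by (intro borel_measurable_scaleR Theta_comp measurable_compose[OF _ K_shifted_meas] phi_comp const_time s sn
      measurable_compose[OF f measurable_fst] measurable_compose[OF f measurable_snd])
   then have "(\<lambda>(p, z). \<Theta> (fst p) (snd p) s z *\<^sub>R K (x - \<phi> (fst p) (snd p) s z)) \<in> borel_measurable ((P \<Otimes>\<^sub>M P') \<Otimes>\<^sub>M torus_lebesgue)"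
    by (simp add: case_prod_beta')
   from torus.borel_measurable_lebesgue_integral[OF this]
   have 1: "(\<lambda>p. c (\<integral>z. \<Theta> (fst p) (snd p) s z *\<^sub>R K (x - \<phi> (fst p) (snd p) s z) \<partial>torus_lebesgue)) \<in> borel_measurable (P \<Otimes>\<^sub>M P')"
    by (rule measurable_compose[OF _ cm])
   have 2: "{p \<in> space (P \<Otimes>\<^sub>M P'). fst p \<in> N \<or> snd p \<in> N'} \<in> sets (P \<Otimes>\<^sub>M P')"
    by measurable
   show "(\<lambda>(w, w'). f w w') \<in> borel_measurable (P \<Otimes>\<^sub>M P')"
    using measurable_If[OF borel_measurable_const[of 0] 1 2] by (simp add: f_def case_prod_beta')
  next
   fix w w' assume "w \<in> space P" "w' \<in> space P'"
   then show "\<bar>f w w'\<bar> \<le> Mt * Bk"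
    using order_trans[OF c1 inner_integral_bound[of w w' s x]] mp s Mt_nonneg Bk_nonneg by (auto simp: f_def)
  next
   fix w' assume w': "w' \<in> space P'"
   show "(\<lambda>w. f w w') \<in> borel_measurable (F s)"
   proof (cases "w' \<in> N'")
    case False
    have "f w w' = c (if w \<in> N then 0 else \<integral>z. \<Theta> w w' s z *\<^sub>R K (x - \<phi> w w' s z) \<partial>torus_lebesgue)" for w
     using False bounded_linear.axioms(1)[OF c] by (simp add: f_def linear_0)
    then show ?thesis using measurable_compose[OF adapted[OF s, of w' x] cm] False w' by simp
   qed (simp add: f_def)
  qed
  from measurable_If[OF borel_measurable_const this NF[OF s]]
  have "(\<lambda>w. if w \<in> N then 0 else \<integral>w'. f w w' \<partial>P') \<in> borel_measurable (F s)" .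
  moreover have "(\<integral>w'. f w w' \<partial>P') = c (V w s x)" if w: "w \<in> space P - N" for w
  proof -
   have g: "good w" using good[OF w] by (simp add: cgood_def)
   note it = V_iterated[OF g s, of x]
   have "(\<integral>w'. f w w' \<partial>P') = (\<integral>w'. c (\<integral>z. \<Theta> w w' s z *\<^sub>R K (x - \<phi> w w' s z) \<partial>torus_lebesgue) \<partial>P')"
   proof (rule integral_cong_AE)
    show m: "(\<lambda>w'. c (\<integral>z. \<Theta> w w' s z *\<^sub>R K (x - \<phi> w w' s z) \<partial>torus_lebesgue)) \<in> borel_measurable P'"
     by (rule measurable_compose[OF borel_measurable_integrable[OF it(1)] cm])
    have 2: "{w' \<in> space P'. w \<in> N \<or> w' \<in> N'} \<in> sets P'" by measurable
    show "f w \<in> borel_measurable P'" unfolding f_def[abs_def] by (rule measurable_If[OF borel_measurable_const m 2])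
    show "AE w' in P'. f w w' = c (\<integral>z. \<Theta> w w' s z *\<^sub>R K (x - \<phi> w w' s z) \<partial>torus_lebesgue)"
     using AEN' by eventually_elim (use w in \<open>simp add: f_def\<close>)
   qed
   also have "\<dots> = c (V w s x)" unfolding it(2)[symmetric] by (rule integral_bounded_linear[OF c it(1)])
   finally show ?thesis .
  qed
  ultimately show ?thesis
   by (subst measurable_cong[where g = "\<lambda>w. if w \<in> N then 0 else \<integral>w'. f w w' \<partial>P'"]) (use Fspace[OF s] in auto)
 qed
 have time_slice: "(\<lambda>w. if w \<in> N then 0 else V w s x) \<in> borel_measurable (F s)" if s: "s \<in> {0..T}" for s x
 proof -
  have fst_le: "\<bar>fst y\<bar> \<le> norm y" and snd_le: "\<bar>snd y\<bar> \<le> norm y" for y :: "real \<times> real"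
   using norm_fst_le[of "fst y" "snd y"] norm_snd_le[of "snd y" "fst y"] by simp_all
  have "(\<lambda>w. (if w \<in> N then 0 else fst (V w s x), if w \<in> N then 0 else snd (V w s x))) \<in> borel_measurable (F s)"
   by (intro borel_measurable_Pair comp s bounded_linear_fst bounded_linear_snd fst_le snd_le)
  moreover have "(if w \<in> N then 0 else fst (V w s x), if w \<in> N then 0 else snd (V w s x)) = (if w \<in> N then 0 else V w s x)" for w
   by (simp add: zero_prod_def)
  ultimately show ?thesis by simp
 qed
 show ?thesis
  unfolding progressive_field_def
 proof
  fix t assume t: "t \<in> {0..T}"
  \<comment> \<open>The pair of time and position is one parameter: at each value the field is
    adapted by time t, and it is continuous in the pair.\<close>
  have "(\<lambda>(w, p). if w \<in> N then 0 else V w (fst p) (snd p)) \<in> borel_measurable (F t \<Otimes>\<^sub>M restrict_space borel ({0..t} \<times> UNIV))"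
  proof (rule caratheodory_measurable)
   fix p assume "p \<in> {0..t} \<times> (UNIV :: torus set)"
   then have p: "fst p \<in> {0..T}" "fst p \<le> t" using t by (auto simp: mem_Times_iff)
   show "(\<lambda>w. if w \<in> N then 0 else V w (fst p) (snd p)) \<in> borel_measurable (F t)"
    by (rule FF[OF time_slice[OF p(1)] p(1) t p(2)])
  next
   fix w assume w: "w \<in> space (F t)"
   show "continuous_on ({0..t} \<times> UNIV) (\<lambda>p. if w \<in> N then 0 else V w (fst p) (snd p))"
   proof (cases "w \<in> N")
    case False
    then have "continuous_on ({0..T} \<times> UNIV) (\<lambda>(t, x). V w t x)"
     using w Fspace[OF t] by (intro V_continuous good) simp
    then have "continuous_on ({0..t} \<times> UNIV) (\<lambda>(t, x). V w t x)"
     by (rule continuous_on_subset) (use t in auto)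
    then show ?thesis using False by (simp add: case_prod_beta')
   qed simp
  qed
  moreover have "(\<lambda>p. (fst p, snd p)) \<in> measurable (F t \<Otimes>\<^sub>M time_space t \<Otimes>\<^sub>M borel) (F t \<Otimes>\<^sub>M restrict_space borel ({0..t} \<times> (UNIV :: torus set)))"
  proof (intro measurable_Pair measurable_fst measurable_restrict_space2)
   show "snd \<in> space (F t \<Otimes>\<^sub>M time_space t \<Otimes>\<^sub>M borel) \<rightarrow> {0..t} \<times> (UNIV :: torus set)"
    by (auto simp: space_pair_measure space_restrict_space)
   have "(\<lambda>p. (fst (snd p), snd (snd p))) \<in> borel_measurable (F t \<Otimes>\<^sub>M time_space t \<Otimes>\<^sub>M (borel :: torus measure))"
    by (intro borel_measurable_Pair measurable_compose[OF measurable_snd measurable_snd]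
      measurable_compose[OF measurable_compose[OF measurable_snd measurable_fst] measurable_time_space])
   then show "snd \<in> borel_measurable (F t \<Otimes>\<^sub>M time_space t \<Otimes>\<^sub>M (borel :: torus measure))" by simp
  qed
  ultimately show "(\<lambda>(w, s, x). if w \<in> N then 0 else V w s x) \<in> borel_measurable (F t \<Otimes>\<^sub>M time_space t \<Otimes>\<^sub>M borel)"
   using measurable_compose by (fastforce simp: case_prod_beta')
 qed
qed

end

section \<open>Comparison of two flows\<close>

context log_kernel
begin

lemma K_reflect': "(\<integral>\<^sup>+x. ennreal (norm (K (x - p))) \<partial>torus_lebesgue) = ennreal Bk"
proof -
 have m: "(\<lambda>x. ennreal (norm (K (x - p)))) \<in> borel_measurable borel" by measurable
 show ?thesis using nn_integral_torus_reflect[OF m, of "p + p"] K_reflect[of p] by simp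
qed

text \<open>The reflection of x to \<open>p + p' - x\<close> turns \<open>x - p'\<close> into
  \<open>p - x\<close> and \<open>x - p\<close> into \<open>p' - x\<close>, the form in which
  \<open>K_shift\<close> is stated.\<close>

lemma K_shift': "(\<integral>\<^sup>+x. ennreal (norm (K (x - p') - K (x - p))) \<partial>torus_lebesgue) \<le> ennreal (Ck * log_modulus (dist p' p))"
proof -
 have m: "(\<lambda>x. ennreal (norm (K (x - p') - K (x - p)))) \<in> borel_measurable borel" by measurable
 have "p + p' - x - p' = p - x" "p + p' - x - p = p' - x" for x by (simp_all add: algebra_simps)
 then show ?thesis
  using nn_integral_torus_reflect[OF m, of "p + p'"] K_shift[of p p'] by (simp add: dist_commute)
qed

end

text \<open>The unprimed data are those of the limit, the primed ones those of an \<epsilon>-system.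
  The modulus belongs to the limit source, at which the comparison of the two particles is therefore
  made.\<close>

locale flow_pair = flow_data K Ck P P' T M0 M1 \<Xi>0 q \<phi> + b: flow_data K Ck P P' T M0 M1 \<Xi>0 q' \<phi>'
 for K Ck and P :: "'w measure" and P' :: "'v measure" and T M0 M1 \<Xi>0 q \<phi> q' \<phi>' +
 fixes C :: real
 assumes q_mod: "AE s in time_lebesgue T. AE (x, y) in torus_lebesgue \<Otimes>\<^sub>M torus_lebesgue.
   \<bar>q s x - q s y\<bar> \<le> C * log_modulus (dist x y)"
begin

definition D :: "'w => real => 'v \<times> torus => real" where
 "D w s r = dist (\<phi>' w (fst r) s (snd r)) (\<phi> w (fst r) s (snd r))"

abbreviation "mfd \<equiv> mean_flow_distance P' \<phi>' \<phi>"

lemma fst_time: "fst \<in> measurable (time_lebesgue T \<Otimes>\<^sub>M R) (time_space T)"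
 using measurable_fst[of "time_lebesgue T" R] by (simp cong: measurable_cong_sets add: sets_time_lebesgue)

lemma snd_R1: "(\<lambda>p. fst (snd p)) \<in> measurable (time_lebesgue T \<Otimes>\<^sub>M R) P'"
 by (rule measurable_compose[OF measurable_snd]) (simp add: R_def)

lemma snd_R2: "(\<lambda>p. snd (snd p)) \<in> borel_measurable (time_lebesgue T \<Otimes>\<^sub>M R)"
 by (rule measurable_compose[OF measurable_snd]) (simp add: R_def cong: measurable_cong_sets)

lemma phi_TR:
 assumes "w \<in> space P"
 shows "(\<lambda>p. \<phi> w (fst (snd p)) (fst p) (snd (snd p))) \<in> borel_measurable (time_lebesgue T \<Otimes>\<^sub>M R)"
  and "(\<lambda>p. \<phi>' w (fst (snd p)) (fst p) (snd (snd p))) \<in> borel_measurable (time_lebesgue T \<Otimes>\<^sub>M R)"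
 by (intro phi_comp b.phi_comp measurable_const assms fst_time snd_R1 snd_R2)+

lemma D_TR:
 assumes "w \<in> space P"
 shows "(\<lambda>p. D w (fst p) (snd p)) \<in> borel_measurable (time_lebesgue T \<Otimes>\<^sub>M R)"
 unfolding D_def by (intro borel_measurable_dist phi_TR assms)

lemma D_R:
 assumes "w \<in> space P" "t \<in> {0..T}"
 shows "D w t \<in> borel_measurable R"
 unfolding D_def[abs_def] by (intro borel_measurable_dist phi_R b.phi_R assms)

lemma D_le: "D w s r \<le> diameter (UNIV :: torus set)"
 unfolding D_def by (rule diameter_bounded_bound[OF bounded_torus]) auto

lemma D_integrable: "w \<in> space P ==> t \<in> {0..T} ==> integrable R (D w t)"
 by (rule R.integrable_const_bound[of _ "diameter (UNIV :: torus set)"]) (use D_le D_R in \<open>auto simp: D_def\<close>)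

lemma mfd_eq: "w \<in> space P ==> t \<in> {0..T} ==> mfd w t = (\<integral>r. D w t r \<partial>R)"
 using RR.integral_fst'[OF D_integrable[unfolded R_def]] by (simp add: mean_flow_distance_def R_def D_def[abs_def])

lemma measure_R: "measure R (space R) = 4 * pi\<^sup>2"
proof -
 have "emeasure R (space R) = emeasure P' (space P') * emeasure torus_lebesgue UNIV"
  unfolding R_def space_pair_measure space_torus_lebesgue
  by (rule torus.emeasure_pair_measure_Times) auto
 then show ?thesis by (simp add: measure_def emeasure_torus P'.emeasure_space_1)
qed

text \<open>Jensen on R, whose mass is \<open>4 * pi^2\<close>. The argument comes out divided by
  the mass; as the mass is at least 1, dropping the division only enlarges the modulus.\<close>

lemma log_D:
 assumes w: "w \<in> space P" and t: "t \<in> {0..T}"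
 shows "(\<integral>\<^sup>+r. ennreal (log_modulus (D w t r)) \<partial>R) \<le> ennreal (4 * pi\<^sup>2 * log_modulus (mfd w t))"
proof -
 have pos: "4 * pi\<^sup>2 > 0" by simp
 have "1 \<le> pi\<^sup>2" using pi_ge_two by (simp add: one_le_power)
 then have ge: "1 \<le> 4 * pi\<^sup>2" by simp
 have m0: "mfd w t \<ge> 0" unfolding mfd_eq[OF w t] by (rule Bochner_Integration.integral_nonneg) (simp add: D_def)
 note J = log_modulus_jensen[OF finite_R measure_R pos D_integrable[OF w t], of "diameter (UNIV :: torus set)"]
 have i: "integrable R (\<lambda>r. log_modulus (D w t r))" by (rule J(1)) (use D_le in \<open>simp_all add: D_def\<close>)
 have "(\<integral>r. log_modulus (D w t r) \<partial>R) \<le> 4 * pi\<^sup>2 * log_modulus ((\<integral>r. D w t r \<partial>R) / (4 * pi\<^sup>2))"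
  by (rule J(2)) (use D_le in \<open>simp_all add: D_def\<close>)
 also have "\<dots> \<le> 4 * pi\<^sup>2 * log_modulus (mfd w t)"
  unfolding mfd_eq[OF w t, symmetric] using m0 ge
  by (intro mult_left_mono log_modulus_mono) (simp_all add: divide_le_eq_1 mult_le_cancel_left1 pos_divide_le_eq)
 finally show ?thesis
  using nn_integral_eq_integral[OF i] log_modulus_nonneg by (simp add: ennreal_leI)
qed

lemma mfd_measurable: "w \<in> space P ==> mfd w \<in> borel_measurable (time_lebesgue T)"
proof -
 assume w: "w \<in> space P"
 have "(\<lambda>(s, r). D w s r) \<in> borel_measurable (time_lebesgue T \<Otimes>\<^sub>M R)"
  using D_TR[OF w] by (simp add: case_prod_beta')
 from R.borel_measurable_lebesgue_integral[OF this]
 show ?thesis by (subst measurable_cong[OF mfd_eq[OF w]]) (simp_all add: space_restrict_space)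
qed

lemma mfd_bounds:
 assumes "w \<in> space P" "t \<in> {0..T}"
 shows "0 \<le> mfd w t" "mfd w t \<le> 4 * pi\<^sup>2 * diameter (UNIV :: torus set)"
proof -
 show "0 \<le> mfd w t" unfolding mfd_eq[OF assms] by (rule Bochner_Integration.integral_nonneg) (simp add: D_def)
 have "(\<integral>r. D w t r \<partial>R) \<le> (\<integral>r. diameter (UNIV :: torus set) \<partial>R)"
  by (rule integral_mono[OF D_integrable[OF assms]]) (use D_le in auto)
 then show "mfd w t \<le> 4 * pi\<^sup>2 * diameter (UNIV :: torus set)" by (simp add: mfd_eq[OF assms] measure_R)
qed

text \<open>Under R the position of a particle has Lebesgue measure as its law, hence it gives no
  mass to N.\<close>

lemma off_null:
 assumes g: "good w" and t: "t \<in> {0..T}" and N: "N \<in> null_sets torus_lebesgue"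
 shows "AE r in R. \<phi> w (fst r) t (snd r) \<notin> N"
proof -
 have Nb: "N \<in> sets borel" using N by (auto simp: null_sets_def)
 have "(\<integral>\<^sup>+r. indicator N (\<phi> w (fst r) t (snd r)) \<partial>R) = (\<integral>\<^sup>+p. indicator N p \<partial>torus_lebesgue)"
  by (rule push[OF g t]) (use Nb in simp)
 also have "\<dots> = 0" using N Nb by (simp add: null_sets_def)
 finally have "AE r in R. (indicator N (\<phi> w (fst r) t (snd r)) :: ennreal) = 0"
  by (subst (asm) nn_integral_0_iff_AE)
   (use measurable_compose[OF phi_R[OF good_space[OF g] t] borel_measurable_indicator[OF Nb]] in simp_all)
 then show ?thesis by eventually_elim (simp split: split_indicator_asm)
qed

end

lemma (in flow_pair) off_null':
 assumes g: "b.good w" and t: "t \<in> {0..T}" and N: "N \<in> null_sets torus_lebesgue"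
 shows "AE r in R. \<phi>' w (fst r) t (snd r) \<notin> N"
proof -
 have Nb: "N \<in> sets borel" using N by (auto simp: null_sets_def)
 have "(\<integral>\<^sup>+r. indicator N (\<phi>' w (fst r) t (snd r)) \<partial>R) = (\<integral>\<^sup>+p. indicator N p \<partial>torus_lebesgue)"
  by (rule b.push[OF g t]) (use Nb in simp)
 also have "\<dots> = 0" using N Nb by (simp add: null_sets_def)
 finally have "AE r in R. (indicator N (\<phi>' w (fst r) t (snd r)) :: ennreal) = 0"
  by (subst (asm) nn_integral_0_iff_AE)
   (use measurable_compose[OF b.phi_R[OF b.good_space[OF g] t] borel_measurable_indicator[OF Nb]] in simp_all)
 then show ?thesis by eventually_elim (simp split: split_indicator_asm)
qed

context flow_pair
begin

definition "qdiff = (\<integral>\<^sup>+s. Linf_norm (\<lambda>x. q' s x - q s x) \<partial>time_lebesgue T)"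

text \<open>The difference is split at the limit source in the \<epsilon>-particle. One part is the
  distance of the sources, carried by a measure-preserving flow; the other obeys the modulus, as
  both particles almost surely avoid its exceptional set.\<close>

lemma source_difference:
 assumes g: "good w" and g': "b.good w"
 shows "AE s in time_lebesgue T. (\<integral>\<^sup>+r. ennreal \<bar>q' s (\<phi>' w (fst r) s (snd r)) - q s (\<phi> w (fst r) s (snd r))\<bar> \<partial>R)
  \<le> ennreal (4 * pi\<^sup>2) * Linf_norm (\<lambda>x. q' s x - q s x) + ennreal (\<bar>C\<bar> * (4 * pi\<^sup>2 * log_modulus (mfd w s)))"
 using q_mod AE_space
proof eventually_elim
 case (elim s)
 have s: "s \<in> {0..T}" using elim(2) by (simp add: space_restrict_space)
 note w = good_space[OF g]
 obtain N where N: "N \<in> null_sets torus_lebesgue"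
  and NC: "\<And>x y. x \<notin> N ==> y \<notin> N ==> \<bar>q s x - q s y\<bar> \<le> \<bar>C\<bar> * log_modulus (dist x y)"
  using modulus_off_null_set[OF elim(1)] by blast
 let ?L = "Linf_norm (\<lambda>x. q' s x - q s x)"
 let ?p = "\<lambda>r. \<phi> w (fst r) s (snd r)" and ?p' = "\<lambda>r. \<phi>' w (fst r) s (snd r)"
 have qm: "(\<lambda>x. ennreal \<bar>q' s x - q s x\<bar>) \<in> borel_measurable borel"
  using q_section[OF s] b.q_section[OF s] by measurable
 have m1: "(\<lambda>r. ennreal \<bar>q' s (?p' r) - q s (?p' r)\<bar>) \<in> borel_measurable R"
  by (rule measurable_compose[OF b.phi_R[OF w s] qm])
 have m2: "(\<lambda>r. ennreal (\<bar>C\<bar> * log_modulus (D w s r))) \<in> borel_measurable R"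
  using D_R[OF w s] by measurable
 have "(\<integral>\<^sup>+r. ennreal \<bar>q' s (?p' r) - q s (?p r)\<bar> \<partial>R)
   \<le> (\<integral>\<^sup>+r. ennreal \<bar>q' s (?p' r) - q s (?p' r)\<bar> + ennreal (\<bar>C\<bar> * log_modulus (D w s r)) \<partial>R)"
 proof (rule nn_integral_mono_AE, use off_null[OF g s N] off_null'[OF g' s N] in eventually_elim)
  fix r assume "?p r \<notin> N" "?p' r \<notin> N"
  then have "\<bar>q s (?p' r) - q s (?p r)\<bar> \<le> \<bar>C\<bar> * log_modulus (D w s r)" unfolding D_def by (rule NC[rotated])
  then have "\<bar>q' s (?p' r) - q s (?p r)\<bar> \<le> \<bar>q' s (?p' r) - q s (?p' r)\<bar> + \<bar>C\<bar> * log_modulus (D w s r)" by linarith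
  then show "ennreal \<bar>q' s (?p' r) - q s (?p r)\<bar>
    \<le> ennreal \<bar>q' s (?p' r) - q s (?p' r)\<bar> + ennreal (\<bar>C\<bar> * log_modulus (D w s r))"
   using log_modulus_nonneg by (simp add: ennreal_plus[symmetric] ennreal_leI del: ennreal_plus)
 qed
 also have "\<dots> = (\<integral>\<^sup>+r. ennreal \<bar>q' s (?p' r) - q s (?p' r)\<bar> \<partial>R) + (\<integral>\<^sup>+r. ennreal (\<bar>C\<bar> * log_modulus (D w s r)) \<partial>R)"
  by (rule nn_integral_add[OF m1 m2])
 also have "(\<integral>\<^sup>+r. ennreal \<bar>q' s (?p' r) - q s (?p' r)\<bar> \<partial>R) = (\<integral>\<^sup>+x. ennreal \<bar>q' s x - q s x\<bar> \<partial>torus_lebesgue)"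
  by (rule b.push[OF g' s qm])
 also have "\<dots> \<le> (\<integral>\<^sup>+x. ?L \<partial>torus_lebesgue)" by (rule nn_integral_mono_AE[OF Linf_norm_AE])
 also have "\<dots> = ennreal (4 * pi\<^sup>2) * ?L" by (simp add: emeasure_torus mult.commute)
 also have "(\<integral>\<^sup>+r. ennreal (\<bar>C\<bar> * log_modulus (D w s r)) \<partial>R) = ennreal \<bar>C\<bar> * (\<integral>\<^sup>+r. ennreal (log_modulus (D w s r)) \<partial>R)"
  using D_R[OF w s] log_modulus_nonneg by (subst nn_integral_cmult[symmetric]) (simp_all add: ennreal_mult)
 also have "\<dots> \<le> ennreal \<bar>C\<bar> * ennreal (4 * pi\<^sup>2 * log_modulus (mfd w s))"
  by (rule mult_left_mono[OF log_D[OF w s]]) simp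
 finally show ?case using log_modulus_nonneg by (simp add: ennreal_mult add_mono)
qed

definition "I w t = (LBINT s:{0..t}. log_modulus (mfd w s))"

lemma I_eq:
 assumes w: "w \<in> space P" and t: "t \<in> {0..T}"
 shows "(\<integral>\<^sup>+s. indicator {0..t} s * ennreal (log_modulus (mfd w s)) \<partial>time_lebesgue T) = ennreal (I w t)" and "I w t \<ge> 0"
proof -
 have i: "integrable (time_lebesgue T) (\<lambda>s. indicator {0..t} s * log_modulus (mfd w s))"
 proof (rule LT.integrable_const_bound[of _ "log_modulus (4 * pi\<^sup>2 * diameter (UNIV :: torus set))"])
  show "AE s in time_lebesgue T. norm (indicator {0..t} s * log_modulus (mfd w s)) \<le> log_modulus (4 * pi\<^sup>2 * diameter (UNIV :: torus set))"
   using mfd_bounds[OF w] log_modulus_nonneg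
   by (intro AE_I2) (auto simp: space_restrict_space split: split_indicator intro!: log_modulus_mono)
  show "(\<lambda>s. indicator {0..t} s * log_modulus (mfd w s)) \<in> borel_measurable (time_lebesgue T)"
   by (intro borel_measurable_times measurable_compose[OF mfd_measurable[OF w] log_modulus_measurable] measurable_restrict_space1) simp
 qed
 have eq: "I w t = (\<integral>s. indicator {0..t} s * log_modulus (mfd w s) \<partial>time_lebesgue T)"
  unfolding I_def by (rule time_lebesgue_integral) (use t in simp)
 have "(\<integral>\<^sup>+s. indicator {0..t} s * ennreal (log_modulus (mfd w s)) \<partial>time_lebesgue T)
   = (\<integral>\<^sup>+s. ennreal (indicator {0..t} s * log_modulus (mfd w s)) \<partial>time_lebesgue T)"
  by (rule nn_integral_cong) (simp split: split_indicator)
 also have "\<dots> = ennreal (I w t)" unfolding eq by (rule nn_integral_eq_integral[OF i]) (simp add: log_modulus_nonneg)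
 finally show "(\<integral>\<^sup>+s. indicator {0..t} s * ennreal (log_modulus (mfd w s)) \<partial>time_lebesgue T) = ennreal (I w t)" .
 show "I w t \<ge> 0" unfolding eq by (rule Bochner_Integration.integral_nonneg) (simp add: log_modulus_nonneg)
qed

text \<open>For almost every particle the collected sources differ by at most the time integral of
  the pointwise difference. With the time integral moved outside by Fubini,
  \<open>source_difference\<close> applies at almost every time.\<close>

lemma Theta_difference:
 assumes g: "good w" and g': "b.good w" and t: "t \<in> {0..T}"
 shows "(\<integral>\<^sup>+r. ennreal \<bar>b.\<Theta> w (fst r) t (snd r) - \<Theta> w (fst r) t (snd r)\<bar> \<partial>R)
  \<le> ennreal (4 * pi\<^sup>2) * qdiff + ennreal (\<bar>C\<bar> * (4 * pi\<^sup>2) * I w t)"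
proof -
 note w = good_space[OF g]
 interpret TR: pair_sigma_finite "time_lebesgue T" R ..
 let ?h = "\<lambda>s r. indicator {0..t} s * ennreal \<bar>q' s (\<phi>' w (fst r) s (snd r)) - q s (\<phi> w (fst r) s (snd r))\<bar>"
 have ind: "(\<lambda>s. indicator {0..t} s :: ennreal) \<in> borel_measurable (time_lebesgue T)"
  by (rule measurable_restrict_space1) simp
 have qm: "(\<lambda>p. ennreal \<bar>q' (fst p) (\<phi>' w (fst (snd p)) (fst p) (snd (snd p))) - q (fst p) (\<phi> w (fst (snd p)) (fst p) (snd (snd p)))\<bar>)
   \<in> borel_measurable (time_lebesgue T \<Otimes>\<^sub>M R)"
  by (intro measurable_compose[OF _ measurable_ennreal] borel_measurable_abs borel_measurable_diff
    q_comp b.q_comp fst_time phi_TR w)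
 have hm: "(\<lambda>(s, r). ?h s r) \<in> borel_measurable (time_lebesgue T \<Otimes>\<^sub>M R)"
  using borel_measurable_times_ennreal[OF measurable_compose[OF measurable_fst ind] qm] by (simp add: case_prod_beta')
 have mp: "AE w' in P'. \<forall>t\<in>{0..T}. mp_homeo (\<phi> w w' t)" "AE w' in P'. \<forall>t\<in>{0..T}. mp_homeo (\<phi>' w w' t)"
  using g g' by (simp_all add: good_def b.good_def)
 have Dm: "(\<lambda>r. ennreal \<bar>b.\<Theta> w (fst r) t (snd r) - \<Theta> w (fst r) t (snd r)\<bar>) \<in> borel_measurable R"
  using Theta_R[OF w t] b.Theta_R[OF w t] by measurable
 have Hm: "(\<lambda>r. \<integral>\<^sup>+s. ?h s r \<partial>time_lebesgue T) \<in> borel_measurable R"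
  by (rule LT.borel_measurable_nn_integral) (use measurable_compose[OF measurable_pair_swap' hm] in \<open>simp add: case_prod_beta'\<close>)
 have "AE w' in P'. AE z in torus_lebesgue. ennreal \<bar>b.\<Theta> w (fst (w', z)) t (snd (w', z)) - \<Theta> w (fst (w', z)) t (snd (w', z))\<bar>
   \<le> (\<integral>\<^sup>+s. ?h s (w', z) \<partial>time_lebesgue T)"
  using mp AE_space
 proof eventually_elim
  case (elim w')
  have a: "AE z in torus_lebesgue. integrable (time_lebesgue T) (\<lambda>s. q s (\<phi> w w' s z)) \<and> (\<forall>t. \<bar>\<Theta> w w' t z\<bar> \<le> Mt)"
   by (rule Theta_bound[OF w]) (use elim in auto)
  have b: "AE z in torus_lebesgue. integrable (time_lebesgue T) (\<lambda>s. q' s (\<phi>' w w' s z)) \<and> (\<forall>t. \<bar>b.\<Theta> w w' t z\<bar> \<le> b.Mt)"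
   by (rule b.Theta_bound[OF w]) (use elim in auto)
  from a b show ?case
  proof eventually_elim
   case z: (elim z)
   have i: "integrable (time_lebesgue T) (\<lambda>s. indicator {0..t} s * f s)" if "integrable (time_lebesgue T) f" for f :: "real => real"
   proof (rule Bochner_Integration.integrable_bound[OF that])
    have "(\<lambda>s. indicator {0..t} s :: real) \<in> borel_measurable (time_lebesgue T)" by (rule measurable_restrict_space1) simp
    then show "(\<lambda>s. indicator {0..t} s * f s) \<in> borel_measurable (time_lebesgue T)"
     by (rule borel_measurable_times[OF _ borel_measurable_integrable[OF that]])
   qed (auto split: split_indicator)
   let ?f = "\<lambda>s. q s (\<phi> w w' s z)" and ?f' = "\<lambda>s. q' s (\<phi>' w w' s z)"
   have fi: "integrable (time_lebesgue T) (\<lambda>s. indicator {0..t} s * ?f s)" "integrable (time_lebesgue T) (\<lambda>s. indicator {0..t} s * ?f' s)"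
    using i[of ?f] i[of ?f'] z by auto
   have eq: "b.\<Theta> w w' t z - \<Theta> w w' t z = (\<integral>s. indicator {0..t} s * ?f' s - indicator {0..t} s * ?f s \<partial>time_lebesgue T)"
    unfolding \<Theta>_def b.\<Theta>_def using Bochner_Integration.integral_diff[OF fi(2,1)] by simp
   have "ennreal \<bar>b.\<Theta> w w' t z - \<Theta> w w' t z\<bar>
     \<le> (\<integral>\<^sup>+s. ennreal (norm (indicator {0..t} s * ?f' s - indicator {0..t} s * ?f s)) \<partial>time_lebesgue T)"
    unfolding eq real_norm_def[symmetric] by (rule integral_norm_bound_ennreal[OF Bochner_Integration.integrable_diff[OF fi(2,1)]])
   also have "\<dots> = (\<integral>\<^sup>+s. ?h s (w', z) \<partial>time_lebesgue T)"
    by (rule nn_integral_cong) (simp split: split_indicator)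
   finally show ?case by (simp only: fst_conv snd_conv)
  qed
 qed
 moreover have "{r \<in> space (P' \<Otimes>\<^sub>M torus_lebesgue). ennreal \<bar>b.\<Theta> w (fst r) t (snd r) - \<Theta> w (fst r) t (snd r)\<bar>
   \<le> (\<integral>\<^sup>+s. ?h s r \<partial>time_lebesgue T)} \<in> sets (P' \<Otimes>\<^sub>M torus_lebesgue)"
  using borel_measurable_le[OF Dm Hm] unfolding R_def .
 ultimately have "AE r in R. ennreal \<bar>b.\<Theta> w (fst r) t (snd r) - \<Theta> w (fst r) t (snd r)\<bar> \<le> (\<integral>\<^sup>+s. ?h s r \<partial>time_lebesgue T)"
  unfolding R_def by (rule RR.AE_pair_measure[rotated])
 then have "(\<integral>\<^sup>+r. ennreal \<bar>b.\<Theta> w (fst r) t (snd r) - \<Theta> w (fst r) t (snd r)\<bar> \<partial>R)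
   \<le> (\<integral>\<^sup>+r. (\<integral>\<^sup>+s. ?h s r \<partial>time_lebesgue T) \<partial>R)" by (rule nn_integral_mono_AE)
 also have "\<dots> = (\<integral>\<^sup>+s. (\<integral>\<^sup>+r. ?h s r \<partial>R) \<partial>time_lebesgue T)" by (rule TR.Fubini'[OF hm])
 also have "\<dots> \<le> (\<integral>\<^sup>+s. ennreal (4 * pi\<^sup>2) * Linf_norm (\<lambda>x. q' s x - q s x)
   + ennreal (\<bar>C\<bar> * (4 * pi\<^sup>2)) * (indicator {0..t} s * ennreal (log_modulus (mfd w s))) \<partial>time_lebesgue T)"
 proof (rule nn_integral_mono_AE, rule eventually_mono[OF source_difference[OF g g']])
  fix s assume le: "(\<integral>\<^sup>+r. ennreal \<bar>q' s (\<phi>' w (fst r) s (snd r)) - q s (\<phi> w (fst r) s (snd r))\<bar> \<partial>R)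
   \<le> ennreal (4 * pi\<^sup>2) * Linf_norm (\<lambda>x. q' s x - q s x) + ennreal (\<bar>C\<bar> * (4 * pi\<^sup>2 * log_modulus (mfd w s)))"
  have e: "ennreal (\<bar>C\<bar> * (4 * pi\<^sup>2 * log_modulus (mfd w s))) = ennreal (\<bar>C\<bar> * (4 * pi\<^sup>2)) * ennreal (log_modulus (mfd w s))"
   using log_modulus_nonneg by (simp add: ennreal_mult[symmetric] mult.assoc)
  show "(\<integral>\<^sup>+r. ?h s r \<partial>R) \<le> ennreal (4 * pi\<^sup>2) * Linf_norm (\<lambda>x. q' s x - q s x)
    + ennreal (\<bar>C\<bar> * (4 * pi\<^sup>2)) * (indicator {0..t} s * ennreal (log_modulus (mfd w s)))"
   using le unfolding e by (cases "s \<in> {0..t}") simp_all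
 qed
 also have "\<dots> = ennreal (4 * pi\<^sup>2) * qdiff
   + ennreal (\<bar>C\<bar> * (4 * pi\<^sup>2)) * (\<integral>\<^sup>+s. indicator {0..t} s * ennreal (log_modulus (mfd w s)) \<partial>time_lebesgue T)"
 proof -
  have "(\<lambda>(s, x). q' s x - q s x) \<in> borel_measurable (time_space T \<Otimes>\<^sub>M borel)"
   using borel_measurable_diff[OF b.q_meas q_meas] by (simp add: case_prod_beta')
  from Linf_norm_measurable[OF this]
  have m1: "(\<lambda>s. Linf_norm (\<lambda>x. q' s x - q s x)) \<in> borel_measurable (time_lebesgue T)"
   by (simp cong: measurable_cong_sets add: sets_time_lebesgue)
  have m2: "(\<lambda>s. indicator {0..t} s * ennreal (log_modulus (mfd w s))) \<in> borel_measurable (time_lebesgue T)"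
   by (intro borel_measurable_times_ennreal ind measurable_compose[OF measurable_compose[OF mfd_measurable[OF w] log_modulus_measurable] measurable_ennreal])
  show ?thesis unfolding qdiff_def
   using m1 m2 by (subst nn_integral_add) (simp_all add: nn_integral_cmult)
 qed
 also have "\<dots> = ennreal (4 * pi\<^sup>2) * qdiff + ennreal (\<bar>C\<bar> * (4 * pi\<^sup>2) * I w t)"
  unfolding I_eq(1)[OF w t] using I_eq(2)[OF w t] by (simp add: ennreal_mult)
 finally show ?thesis .
qed

text \<open>The integrands differ by a difference of weights times the limit kernel, plus an
  \<epsilon>-weight times a difference of kernels. Integrating over x first gives \<open>Bk\<close>
  for the one and, by \<open>K_shift'\<close>, the modulus of the particle distance for the
  other.\<close>

lemma V_difference:
 assumes g: "good w" and g': "b.good w" and t: "t \<in> {0..T}" and fin: "qdiff < \<infinity>"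
 shows "(\<integral>x. norm (b.V w t x - V w t x) \<partial>torus_lebesgue)
  \<le> Mt * Ck * (4 * pi\<^sup>2) * log_modulus (mfd w t) + Bk * (\<bar>C\<bar> * (4 * pi\<^sup>2)) * I w t + Bk * (4 * pi\<^sup>2) * enn2real qdiff"
proof -
 note w = good_space[OF g]
 interpret XR: pair_sigma_finite torus_lebesgue R ..
 let ?p = "\<lambda>r. \<phi> w (fst r) t (snd r)" and ?p' = "\<lambda>r. \<phi>' w (fst r) t (snd r)"
 let ?th = "\<lambda>r. \<Theta> w (fst r) t (snd r)" and ?th' = "\<lambda>r. b.\<Theta> w (fst r) t (snd r)"
 let ?h1 = "\<lambda>x r. ennreal \<bar>?th' r - ?th r\<bar> * ennreal (norm (K (x - ?p r)))"
 let ?h2 = "\<lambda>x r. ennreal \<bar>?th' r\<bar> * ennreal (norm (K (x - ?p' r) - K (x - ?p r)))"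
 have fX: "fst \<in> borel_measurable (torus_lebesgue \<Otimes>\<^sub>M R)"
  using measurable_fst[of torus_lebesgue R] by (simp cong: measurable_cong_sets)
 have Km: "(\<lambda>p. K (fst p - ?p (snd p))) \<in> borel_measurable (torus_lebesgue \<Otimes>\<^sub>M R)"
  "(\<lambda>p. K (fst p - ?p' (snd p))) \<in> borel_measurable (torus_lebesgue \<Otimes>\<^sub>M R)"
  by (intro measurable_compose[OF _ K_meas] borel_measurable_torus_diff fX measurable_compose[OF measurable_snd phi_R[OF w t]]
     measurable_compose[OF measurable_snd b.phi_R[OF w t]])+
 have d1: "(\<lambda>r. ennreal \<bar>?th' r - ?th r\<bar>) \<in> borel_measurable R" and d2: "(\<lambda>r. ennreal \<bar>?th' r\<bar>) \<in> borel_measurable R"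
  using Theta_R[OF w t] b.Theta_R[OF w t] by measurable
 have k1: "(\<lambda>p. ennreal (norm (K (fst p - ?p (snd p))))) \<in> borel_measurable (torus_lebesgue \<Otimes>\<^sub>M R)"
  by (rule measurable_compose[OF measurable_compose[OF Km(1) borel_measurable_norm] measurable_ennreal])
 have k2: "(\<lambda>p. ennreal (norm (K (fst p - ?p' (snd p)) - K (fst p - ?p (snd p))))) \<in> borel_measurable (torus_lebesgue \<Otimes>\<^sub>M R)"
  by (rule measurable_compose[OF measurable_compose[OF borel_measurable_diff[OF Km(2,1)] borel_measurable_norm] measurable_ennreal])
 have h1m: "(\<lambda>(x, r). ?h1 x r) \<in> borel_measurable (torus_lebesgue \<Otimes>\<^sub>M R)"
  using borel_measurable_times_ennreal[OF measurable_compose[OF measurable_snd d1] k1] by (simp add: case_prod_beta')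
 have h2m: "(\<lambda>(x, r). ?h2 x r) \<in> borel_measurable (torus_lebesgue \<Otimes>\<^sub>M R)"
  using borel_measurable_times_ennreal[OF measurable_compose[OF measurable_snd d2] k2] by (simp add: case_prod_beta')
 have pw: "ennreal (norm (b.V w t x - V w t x)) \<le> (\<integral>\<^sup>+r. ?h1 x r \<partial>R) + (\<integral>\<^sup>+r. ?h2 x r \<partial>R)" for x
 proof -
  note i = V_integrable[OF g t, of x] b.V_integrable[OF g' t, of x]
  have eq: "b.V w t x - V w t x = (\<integral>r. ?th' r *\<^sub>R K (x - ?p' r) - ?th r *\<^sub>R K (x - ?p r) \<partial>R)"
   unfolding V_def b.V_def by (rule Bochner_Integration.integral_diff[OF i(2,1), symmetric])
  have "ennreal (norm (b.V w t x - V w t x)) \<le> (\<integral>\<^sup>+r. ennreal (norm (?th' r *\<^sub>R K (x - ?p' r) - ?th r *\<^sub>R K (x - ?p r))) \<partial>R)"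
   unfolding eq by (rule integral_norm_bound_ennreal[OF Bochner_Integration.integrable_diff[OF i(2,1)]])
  also have "\<dots> \<le> (\<integral>\<^sup>+r. ?h1 x r + ?h2 x r \<partial>R)"
  proof (rule nn_integral_mono)
   fix r
   have "?th' r *\<^sub>R K (x - ?p' r) - ?th r *\<^sub>R K (x - ?p r)
     = (?th' r - ?th r) *\<^sub>R K (x - ?p r) + ?th' r *\<^sub>R (K (x - ?p' r) - K (x - ?p r))"
    by (simp add: algebra_simps)
   then have "norm (?th' r *\<^sub>R K (x - ?p' r) - ?th r *\<^sub>R K (x - ?p r))
     \<le> \<bar>?th' r - ?th r\<bar> * norm (K (x - ?p r)) + \<bar>?th' r\<bar> * norm (K (x - ?p' r) - K (x - ?p r))"
    by (metis norm_triangle_ineq norm_scaleR)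
   then show "ennreal (norm (?th' r *\<^sub>R K (x - ?p' r) - ?th r *\<^sub>R K (x - ?p r))) \<le> ?h1 x r + ?h2 x r"
    by (simp add: ennreal_mult[symmetric] ennreal_plus[symmetric] ennreal_leI del: ennreal_plus)
  qed
  also have "\<dots> = (\<integral>\<^sup>+r. ?h1 x r \<partial>R) + (\<integral>\<^sup>+r. ?h2 x r \<partial>R)"
   by (rule nn_integral_add) (use measurable_Pair2[OF h1m, of x] measurable_Pair2[OF h2m, of x] in simp_all)
  finally show ?thesis .
 qed
 have Am: "(\<lambda>x. \<integral>\<^sup>+r. ?h1 x r \<partial>R) \<in> borel_measurable torus_lebesgue" by (rule R.borel_measurable_nn_integral[OF h1m])
 have Bm: "(\<lambda>x. \<integral>\<^sup>+r. ?h2 x r \<partial>R) \<in> borel_measurable torus_lebesgue" by (rule R.borel_measurable_nn_integral[OF h2m])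
 have kx1: "(\<lambda>x. ennreal (norm (K (x - p)))) \<in> borel_measurable torus_lebesgue" for p
  by (simp cong: measurable_cong_sets)
 have kx2: "(\<lambda>x. ennreal (norm (K (x - p') - K (x - p)))) \<in> borel_measurable torus_lebesgue" for p p'
  by (simp cong: measurable_cong_sets)
 have "(\<integral>\<^sup>+x. ennreal (norm (b.V w t x - V w t x)) \<partial>torus_lebesgue)
   \<le> (\<integral>\<^sup>+x. (\<integral>\<^sup>+r. ?h1 x r \<partial>R) + (\<integral>\<^sup>+r. ?h2 x r \<partial>R) \<partial>torus_lebesgue)"
  by (rule nn_integral_mono[OF pw])
 also have "\<dots> = (\<integral>\<^sup>+x. (\<integral>\<^sup>+r. ?h1 x r \<partial>R) \<partial>torus_lebesgue) + (\<integral>\<^sup>+x. (\<integral>\<^sup>+r. ?h2 x r \<partial>R) \<partial>torus_lebesgue)"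
  by (rule nn_integral_add[OF Am Bm])
 also have "(\<integral>\<^sup>+x. (\<integral>\<^sup>+r. ?h1 x r \<partial>R) \<partial>torus_lebesgue) = (\<integral>\<^sup>+r. (\<integral>\<^sup>+x. ?h1 x r \<partial>torus_lebesgue) \<partial>R)"
  by (rule XR.Fubini'[OF h1m, symmetric])
 also have "\<dots> = (\<integral>\<^sup>+r. ennreal Bk * ennreal \<bar>?th' r - ?th r\<bar> \<partial>R)"
  by (rule nn_integral_cong) (subst nn_integral_cmult[OF kx1], simp only: K_reflect' mult.commute)
 also have "\<dots> = ennreal Bk * (\<integral>\<^sup>+r. ennreal \<bar>?th' r - ?th r\<bar> \<partial>R)" by (rule nn_integral_cmult[OF d1])
 also have "\<dots> \<le> ennreal Bk * (ennreal (4 * pi\<^sup>2) * qdiff + ennreal (\<bar>C\<bar> * (4 * pi\<^sup>2) * I w t))"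
  by (rule mult_left_mono[OF Theta_difference[OF g g' t]]) simp
 also have "(\<integral>\<^sup>+x. (\<integral>\<^sup>+r. ?h2 x r \<partial>R) \<partial>torus_lebesgue) = (\<integral>\<^sup>+r. (\<integral>\<^sup>+x. ?h2 x r \<partial>torus_lebesgue) \<partial>R)"
  by (rule XR.Fubini'[OF h2m, symmetric])
 also have "\<dots> \<le> (\<integral>\<^sup>+r. ennreal (Mt * Ck) * ennreal (log_modulus (D w t r)) \<partial>R)"
 proof (rule nn_integral_mono_AE, use b.Theta_bound_R[OF g' t] in eventually_elim)
  fix r assume th: "\<bar>?th' r\<bar> \<le> Mt"
  have "(\<integral>\<^sup>+x. ?h2 x r \<partial>torus_lebesgue) = ennreal \<bar>?th' r\<bar> * (\<integral>\<^sup>+x. ennreal (norm (K (x - ?p' r) - K (x - ?p r))) \<partial>torus_lebesgue)"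
   by (rule nn_integral_cmult[OF kx2])
  also have "\<dots> \<le> ennreal Mt * ennreal (Ck * log_modulus (D w t r))"
   unfolding D_def by (intro mult_mono K_shift' ennreal_leI th) auto
  finally show "(\<integral>\<^sup>+x. ?h2 x r \<partial>torus_lebesgue) \<le> ennreal (Mt * Ck) * ennreal (log_modulus (D w t r))"
   using Mt_nonneg Ck log_modulus_nonneg by (simp add: ennreal_mult mult.assoc)
 qed
 also have "\<dots> = ennreal (Mt * Ck) * (\<integral>\<^sup>+r. ennreal (log_modulus (D w t r)) \<partial>R)"
  by (rule nn_integral_cmult) (use D_R[OF w t] in measurable)
 also have "\<dots> \<le> ennreal (Mt * Ck) * ennreal (4 * pi\<^sup>2 * log_modulus (mfd w t))"
  by (rule mult_left_mono[OF log_D[OF w t]]) simp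
 finally have total: "(\<integral>\<^sup>+x. ennreal (norm (b.V w t x - V w t x)) \<partial>torus_lebesgue)
   \<le> ennreal Bk * (ennreal (4 * pi\<^sup>2) * qdiff + ennreal (\<bar>C\<bar> * (4 * pi\<^sup>2) * I w t))
    + ennreal (Mt * Ck) * ennreal (4 * pi\<^sup>2 * log_modulus (mfd w t))"
  by (simp add: add_mono)
 define e where "e = enn2real qdiff"
 have e: "qdiff = ennreal e" "e \<ge> 0" using fin by (simp_all add: e_def)
 note nn = e(2) Bk_nonneg Mt_nonneg Ck I_eq(2)[OF w t] log_modulus_nonneg[of "mfd w t"]
 have combine: "ennreal a * (ennreal b * ennreal c + ennreal d) + ennreal f * ennreal h = ennreal (a * (b * c + d) + f * h)"
  if "a \<ge> 0" "b \<ge> 0" "c \<ge> 0" "d \<ge> 0" "f \<ge> 0" "h \<ge> 0" for a b c d f h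
  using that by (simp add: ennreal_mult)
 have "ennreal Bk * (ennreal (4 * pi\<^sup>2) * qdiff + ennreal (\<bar>C\<bar> * (4 * pi\<^sup>2) * I w t))
    + ennreal (Mt * Ck) * ennreal (4 * pi\<^sup>2 * log_modulus (mfd w t))
   = ennreal (Bk * ((4 * pi\<^sup>2) * e + \<bar>C\<bar> * (4 * pi\<^sup>2) * I w t) + Mt * Ck * (4 * pi\<^sup>2 * log_modulus (mfd w t)))"
  unfolding e(1) by (rule combine) (use nn in \<open>auto intro!: mult_nonneg_nonneg\<close>)
 note total = total[unfolded this]
 have Vi: "integrable torus_lebesgue (\<lambda>x. norm (b.V w t x - V w t x))"
  using V_div_free[OF g t] b.V_div_free[OF g' t] by (simp add: div_free_def)
 have "ennreal (\<integral>x. norm (b.V w t x - V w t x) \<partial>torus_lebesgue)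
   \<le> ennreal (Bk * ((4 * pi\<^sup>2) * e + \<bar>C\<bar> * (4 * pi\<^sup>2) * I w t) + Mt * Ck * (4 * pi\<^sup>2 * log_modulus (mfd w t)))"
  using total nn_integral_eq_integral[OF Vi] by simp
 then have "(\<integral>x. norm (b.V w t x - V w t x) \<partial>torus_lebesgue)
   \<le> Bk * ((4 * pi\<^sup>2) * e + \<bar>C\<bar> * (4 * pi\<^sup>2) * I w t) + Mt * Ck * (4 * pi\<^sup>2 * log_modulus (mfd w t))"
  using nn by (subst (asm) ennreal_le_iff) simp_all
 then show ?thesis by (simp add: e_def algebra_simps)
qed

end

section \<open>Velocity fields of generalised solutions\<close>

lemma nn_integral_time_lebesgue: "(\<integral>\<^sup>+s\<in>{0..T}. f s \<partial>lborel) = (\<integral>\<^sup>+s. f s \<partial>time_lebesgue T)"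
 by (simp add: nn_integral_restrict_space)

lemma AE_time_lebesgue: "(AE s in time_lebesgue T. Q s) \<longleftrightarrow> (AE s\<in>{0..T} in lborel. Q s)"
 by (rule AE_restrict_space_iff) simp

lemma Linf_norm_le_iff:
 assumes "f \<in> borel_measurable borel"
 shows "Linf_norm f \<le> c \<longleftrightarrow> (AE x in torus_lebesgue. ennreal \<bar>f x\<bar> \<le> c)"
proof
 assume "Linf_norm f \<le> c"
 then show "AE x in torus_lebesgue. ennreal \<bar>f x\<bar> \<le> c"
  using Linf_norm_AE[of f] by (auto elim!: eventually_mono intro: order_trans)
next
 have m: "(\<lambda>x. ennreal \<bar>f x\<bar>) \<in> borel_measurable torus_lebesgue"
  using assms by (simp cong: measurable_cong_sets)
 show "AE x in torus_lebesgue. ennreal \<bar>f x\<bar> \<le> c ==> Linf_norm f \<le> c"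
  unfolding Linf_norm_def by (rule esssup_I[OF m])
qed

lemma Linf_norm_diff:
 assumes f: "f \<in> borel_measurable borel" and g: "g \<in> borel_measurable borel"
 shows "Linf_norm (\<lambda>x. f x - g x) \<le> Linf_norm f + Linf_norm g"
proof -
 have m: "(\<lambda>x. f x - g x) \<in> borel_measurable borel" using f g by measurable
 show ?thesis
  unfolding Linf_norm_le_iff[OF m] using Linf_norm_AE[of f] Linf_norm_AE[of g]
 proof eventually_elim
  case (elim x)
  have "ennreal \<bar>f x - g x\<bar> \<le> ennreal (\<bar>f x\<bar> + \<bar>g x\<bar>)" by (rule ennreal_leI) simp
  also have "\<dots> = ennreal \<bar>f x\<bar> + ennreal \<bar>g x\<bar>" by simp
  finally show ?case using add_mono[OF elim] by (rule order_trans)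
 qed
qed

lemma continuous_on_log_modulus:
 fixes f :: "'a :: metric_space => 'b :: real_normed_vector"
 assumes C: "C \<ge> 0" and f: "\<And>x x'. norm (f x - f x') \<le> C * log_modulus (dist x x')"
 shows "continuous_on UNIV f"
 unfolding continuous_on_iff
proof (intro ballI allI impI)
 fix x :: 'a and e :: real assume e: "e > 0"
 obtain d where d: "d > 0" "log_modulus (0 + d) < log_modulus 0 + e / (C + 1)"
  using log_modulus_right_continuous[of 0 "e / (C + 1)"] e C by auto
 have "dist (f x') (f x) < e" if x': "dist x' x < d" for x'
 proof -
  have "norm (f x' - f x) \<le> C * log_modulus (dist x' x)" by (rule f)
  also have "\<dots> \<le> C * log_modulus d" using x' C by (intro mult_left_mono log_modulus_mono) auto
  also have "\<dots> \<le> C * (e / (C + 1))" using d(2) C by (intro mult_left_mono) auto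
  also have "\<dots> < e" using e C by (simp add: divide_simps)
  finally show ?thesis by (simp add: dist_norm)
 qed
 then show "\<exists>d>0. \<forall>x'\<in>UNIV. dist x' x < d \<longrightarrow> dist (f x') (f x) < e" using d(1) by blast
qed

text \<open>Serves to extend an identity between velocities from a countable dense set of points to
  all points.\<close>

lemma (in log_kernel) convolution_continuous:
 assumes f: "f \<in> borel_measurable borel" and M: "M \<ge> 0" "AE y in torus_lebesgue. \<bar>f y\<bar> \<le> M"
 shows "continuous_on UNIV (\<lambda>x. \<integral>y. f y *\<^sub>R K (x - y) \<partial>torus_lebesgue)"
proof (rule continuous_on_log_modulus)
 show "M * Ck \<ge> 0" using M(1) Ck by simp
 fix x x' :: torus
 have fm: "(\<lambda>y. f y *\<^sub>R k y) \<in> borel_measurable torus_lebesgue" if "k \<in> borel_measurable borel" for k :: "torus => real \<times> real"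
  using borel_measurable_scaleR[OF f that] by (simp cong: measurable_cong_sets)
 have bound: "(\<integral>\<^sup>+y. ennreal (norm (f y *\<^sub>R k y)) \<partial>torus_lebesgue) \<le> ennreal M * (\<integral>\<^sup>+y. ennreal (norm (k y)) \<partial>torus_lebesgue)"
  if k: "k \<in> borel_measurable borel" for k :: "torus => real \<times> real"
 proof -
  have "(\<integral>\<^sup>+y. ennreal (norm (f y *\<^sub>R k y)) \<partial>torus_lebesgue) \<le> (\<integral>\<^sup>+y. ennreal M * ennreal (norm (k y)) \<partial>torus_lebesgue)"
   by (rule nn_integral_mono_AE, use M(2) in eventually_elim)
    (use M(1) in \<open>simp add: ennreal_mult[symmetric] ennreal_leI mult_right_mono\<close>)
  also have "\<dots> = ennreal M * (\<integral>\<^sup>+y. ennreal (norm (k y)) \<partial>torus_lebesgue)"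
   by (rule nn_integral_cmult) (use k in \<open>simp cong: measurable_cong_sets\<close>)
  finally show ?thesis .
 qed
 have Km: "(\<lambda>y. K (x - y)) \<in> borel_measurable borel" for x by measurable
 have i: "integrable torus_lebesgue (\<lambda>y. f y *\<^sub>R K (x - y))" for x
  by (rule integrableI_bounded[OF fm[OF Km] le_less_trans[OF bound[OF Km]]])
   (simp add: K_reflect ennreal_mult_less_top)
 let ?d = "\<lambda>y. K (x - y) - K (x' - y)"
 have dm: "?d \<in> borel_measurable borel" by measurable
 have di: "integrable torus_lebesgue (\<lambda>y. f y *\<^sub>R ?d y)"
  unfolding scaleR_diff_right by (rule Bochner_Integration.integrable_diff[OF i i])
 have eq: "(\<integral>y. f y *\<^sub>R K (x - y) \<partial>torus_lebesgue) - (\<integral>y. f y *\<^sub>R K (x' - y) \<partial>torus_lebesgue) = (\<integral>y. f y *\<^sub>R ?d y \<partial>torus_lebesgue)"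
  unfolding scaleR_diff_right by (rule Bochner_Integration.integral_diff[OF i i, symmetric])
 have "ennreal (norm (\<integral>y. f y *\<^sub>R ?d y \<partial>torus_lebesgue)) \<le> (\<integral>\<^sup>+y. ennreal (norm (f y *\<^sub>R ?d y)) \<partial>torus_lebesgue)"
  by (rule integral_norm_bound_ennreal[OF di])
 also have "\<dots> \<le> ennreal M * ennreal (Ck * log_modulus (dist x x'))"
  by (rule order_trans[OF bound[OF dm] mult_left_mono[OF K_shift]]) simp
 also have "\<dots> = ennreal (M * Ck * log_modulus (dist x x'))"
  using M(1) Ck log_modulus_nonneg by (simp add: ennreal_mult mult.assoc)
 finally show "norm ((\<integral>y. f y *\<^sub>R K (x - y) \<partial>torus_lebesgue) - (\<integral>y. f y *\<^sub>R K (x' - y) \<partial>torus_lebesgue)) \<le> M * Ck * log_modulus (dist x x')"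
  unfolding eq using M(1) Ck log_modulus_nonneg by (subst (asm) ennreal_le_iff) simp_all
qed

lemma time_integral_continuous:
 fixes f :: "real => real \<times> real"
 assumes "set_integrable lborel {0..T} f"
 shows "continuous_on {0..T} (\<lambda>t. LBINT s:{0..t}. f s)"
proof -
 have "continuous_on {0..T} (\<lambda>t. integral {0..t} f)"
  by (rule indefinite_integral_continuous_1[OF set_borel_integral_eq_integral(1)[OF assms]])
 then show ?thesis
  by (rule continuous_on_eq) (rule set_borel_integral_eq_integral(2)[symmetric], rule set_integrable_subset[OF assms], auto)
qed

lemma set_integral_time_cong:
 fixes f g :: "real => real \<times> real"
 assumes ae: "AE s in time_lebesgue T. f s = g s" and f: "set_integrable lborel {0..T} f" and g: "g \<in> borel_measurable (time_space T)"
 shows "set_integrable lborel {0..T} g" and "t \<in> {0..T} ==> (LBINT s:{0..t}. g s) = (LBINT s:{0..t}. f s)"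
proof -
 have gm: "(\<lambda>s. indicator {0..T} s *\<^sub>R g s) \<in> borel_measurable lborel"
  using g by (subst (asm) borel_measurable_restrict_space_iff) simp_all
 have fm: "(\<lambda>s. indicator {0..T} s *\<^sub>R f s) \<in> borel_measurable lborel"
  using f unfolding set_integrable_def by (rule borel_measurable_integrable)
 have eq: "AE s in lborel. s \<in> {0..T} \<longrightarrow> f s = g s" using ae by (simp add: AE_time_lebesgue)
 show "set_integrable lborel {0..T} g"
  unfolding set_integrable_def
  by (rule integrable_cong_AE_imp[OF f[unfolded set_integrable_def] gm], use eq in eventually_elim)
   (simp split: split_indicator)
 assume t: "t \<in> {0..T}"
 have r: "indicator {0..t} s *\<^sub>R h s = indicator {0..t} s *\<^sub>R (indicator {0..T} s *\<^sub>R h s)" for h :: "real => real \<times> real" and s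
  using t by (simp split: split_indicator)
 have im: "(indicator {0..t} :: real => real) \<in> borel_measurable lborel" by simp
 show "(LBINT s:{0..t}. g s) = (LBINT s:{0..t}. f s)"
  unfolding set_lebesgue_integral_def
  by (subst r[of _ g], subst r[of _ f], rule integral_cong_AE[OF borel_measurable_scaleR[OF im gm] borel_measurable_scaleR[OF im fm]],
    use eq in eventually_elim) (simp split: split_indicator)
qed

text \<open>Transfers progressive measurability to the given velocities, which are jointly
  measurable for P and agree with an adapted field off a null set.\<close>

lemma progressive_field_cong_off:
 assumes F: "filtered_prob_space P F T" and null: "null_sets P \<subseteq> sets (F 0)" and T: "T > 0" and N: "N \<in> null_sets P"
  and f: "(\<lambda>(w, s, x). f w s x) \<in> borel_measurable (P \<Otimes>\<^sub>M time_space T \<Otimes>\<^sub>M borel)"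
  and f': "progressive_field F T f'"
  and eq: "\<And>w s x. w \<in> space P - N ==> s \<in> {0..T} ==> f w s x = f' w s x"
 shows "progressive_field F T f"
 unfolding progressive_field_def
proof
 fix t assume t: "t \<in> {0..T}"
 have sub: "subalgebra P (F t)" using F t by (simp add: filtered_prob_space_def)
 have "sets (F 0) \<subseteq> sets (F t)" using F t T by (simp add: filtered_prob_space_def)
 then have nullt: "null_sets P \<subseteq> sets (F t)" using null by blast
 let ?M = "time_space t \<Otimes>\<^sub>M (borel :: torus measure)"
 have incl: "(\<lambda>p. (fst p, fst (snd p), snd (snd p))) \<in> measurable (P \<Otimes>\<^sub>M ?M) (P \<Otimes>\<^sub>M time_space T \<Otimes>\<^sub>M borel)"
 proof (intro measurable_Pair measurable_fst measurable_restrict_space2)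
  show "(\<lambda>p. fst (snd p)) \<in> space (P \<Otimes>\<^sub>M ?M) \<rightarrow> {0..T}"
   using t by (auto simp: space_pair_measure space_restrict_space)
  show "(\<lambda>p. fst (snd p)) \<in> borel_measurable (P \<Otimes>\<^sub>M ?M)"
   by (rule measurable_compose[OF measurable_compose[OF measurable_snd measurable_fst] measurable_time_space])
  show "(\<lambda>p. snd (snd p)) \<in> borel_measurable (P \<Otimes>\<^sub>M ?M)"
   by (rule measurable_compose[OF measurable_snd measurable_snd])
 qed
 have 1: "(\<lambda>(w, m). f w (fst m) (snd m)) \<in> borel_measurable (P \<Otimes>\<^sub>M ?M)"
  using measurable_compose[OF incl f] by (simp add: case_prod_beta')
 have 2: "(\<lambda>(w, m). f' w (fst m) (snd m)) \<in> borel_measurable (F t \<Otimes>\<^sub>M ?M)"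
  using f' t by (simp add: progressive_field_def case_prod_beta')
 have "(\<lambda>(w, m). f w (fst m) (snd m)) \<in> borel_measurable (F t \<Otimes>\<^sub>M ?M)"
 proof (rule measurable_off_null_set[OF sub nullt N 1 2])
  fix w m assume "w \<in> space P - N" "m \<in> space ?M"
  then show "f w (fst m) (snd m) = f' w (fst m) (snd m)"
   using t by (intro eq) (auto simp: space_pair_measure space_restrict_space)
 qed
 then show "(\<lambda>(w, s, x). f w s x) \<in> borel_measurable (F t \<Otimes>\<^sub>M ?M)" by (simp add: case_prod_beta')
qed

lemma progressive_field_if:
 assumes F: "filtered_prob_space P F T" and null: "null_sets P \<subseteq> sets (F 0)" and T: "T > 0" and N: "N \<in> null_sets P"
  and u: "progressive_field F T u" and v: "progressive_field F T v"
 shows "progressive_field F T (\<lambda>w. if w \<in> N then u w else v w)"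
 unfolding progressive_field_def
proof
 fix t assume t: "t \<in> {0..T}"
 have "sets (F 0) \<subseteq> sets (F t)" using F t T by (simp add: filtered_prob_space_def)
 then have Ft: "N \<in> sets (F t)" using null N by blast
 let ?M = "F t \<Otimes>\<^sub>M time_space t \<Otimes>\<^sub>M (borel :: torus measure)"
 have "{w \<in> space (F t). w \<in> N} = N" using sets.sets_into_space[OF Ft] by auto
 then have A: "{p \<in> space ?M. fst p \<in> N} \<in> sets ?M"
  using measurable_sets_Collect[OF measurable_fst, of "F t" "\<lambda>w. w \<in> N"] Ft by simp
 have uv: "(\<lambda>p. u (fst p) (fst (snd p)) (snd (snd p))) \<in> borel_measurable ?M"
  "(\<lambda>p. v (fst p) (fst (snd p)) (snd (snd p))) \<in> borel_measurable ?M"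
  using u v t by (simp_all add: progressive_field_def case_prod_beta')
 have "(\<lambda>p. if fst p \<in> N then u (fst p) (fst (snd p)) (snd (snd p)) else v (fst p) (fst (snd p)) (snd (snd p))) \<in> borel_measurable ?M"
  by (rule measurable_If[OF uv A])
 then show "(\<lambda>(w, s, x). (if w \<in> N then u w else v w) s x) \<in> borel_measurable ?M"
  by (simp add: case_prod_beta' if_distrib cong: if_cong) (simp add: if_distribR cong: if_cong)
qed

section \<open>The given velocities compared with the Lagrangian one\<close>

context flow_data
begin

lemma vorticity_section:
 assumes sol: "generalized_solution P P' T \<Xi>0 q \<phi> \<Xi>" and "w \<in> space P" "t \<in> {0..T}"
 shows "\<Xi> w t \<in> borel_measurable borel"
proof -
 have "(\<lambda>(w, t, x). \<Xi> w t x) \<in> borel_measurable (P \<Otimes>\<^sub>M time_space T \<Otimes>\<^sub>M borel)" using sol by (simp add: generalized_solution_def)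
 from measurable_compose[OF measurable_Pair[OF measurable_const[OF assms(2)] measurable_Pair[OF const_time[OF assms(3)] measurable_ident]] this]
 show ?thesis by simp
qed

text \<open>Convolution ignores null sets of points, so the transported vorticity may be inserted,
  and equality holds at every x.\<close>

lemma velocity_eq_V:
 assumes K: "K = biot_savart_kernel G" and sol: "generalized_solution P P' T \<Xi>0 q \<phi> \<Xi>"
  and g: "good w" and t: "t \<in> {0..T}"
  and ae: "AE x in torus_lebesgue. \<Xi> w t x = transported_vorticity P' \<Xi>0 q \<phi> w t x"
 shows "velocity G \<Xi> w t x = V w t x"
proof -
 have Kx: "(\<lambda>y. K (x - y)) \<in> borel_measurable torus_lebesgue"
  using K_shifted_meas by (simp cong: measurable_cong_sets)
 have "velocity G \<Xi> w t x = (\<integral>y. transported_vorticity P' \<Xi>0 q \<phi> w t y *\<^sub>R K (x - y) \<partial>torus_lebesgue)"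
  unfolding velocity_def biot_savart_def K[symmetric]
 proof (rule integral_cong_AE)
  show "(\<lambda>y. \<Xi> w t y *\<^sub>R K (x - y)) \<in> borel_measurable torus_lebesgue"
   by (intro borel_measurable_scaleR Kx) (use vorticity_section[OF sol good_space[OF g] t] in \<open>simp cong: measurable_cong_sets\<close>)
  show "(\<lambda>y. transported_vorticity P' \<Xi>0 q \<phi> w t y *\<^sub>R K (x - y)) \<in> borel_measurable torus_lebesgue"
   by (intro borel_measurable_scaleR Kx) (use transported_measurable[OF g t] in \<open>simp cong: measurable_cong_sets\<close>)
  show "AE y in torus_lebesgue. \<Xi> w t y *\<^sub>R K (x - y) = transported_vorticity P' \<Xi>0 q \<phi> w t y *\<^sub>R K (x - y)"
   using ae by eventually_elim simp
 qed
 then show ?thesis by (simp add: biot_savart_transported[OF g t])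
qed

lemma velocity_measurable:
 assumes K: "K = biot_savart_kernel G" and sol: "generalized_solution P P' T \<Xi>0 q \<phi> \<Xi>"
 shows "(\<lambda>(w, t, x). velocity G \<Xi> w t x) \<in> borel_measurable (P \<Otimes>\<^sub>M time_space T \<Otimes>\<^sub>M borel)"
proof -
 let ?M = "P \<Otimes>\<^sub>M time_space T \<Otimes>\<^sub>M (borel :: torus measure)"
 have X: "(\<lambda>(w, t, x). \<Xi> w t x) \<in> borel_measurable ?M" using sol by (simp add: generalized_solution_def)
 have y: "snd \<in> borel_measurable (?M \<Otimes>\<^sub>M torus_lebesgue)"
  using measurable_snd[of ?M torus_lebesgue] by (simp cong: measurable_cong_sets)
 have xm: "(\<lambda>p. snd (snd (fst p))) \<in> borel_measurable (?M \<Otimes>\<^sub>M torus_lebesgue)"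
  by (rule measurable_compose[OF measurable_compose[OF measurable_fst measurable_snd] measurable_snd])
 have 1: "(\<lambda>p. \<Xi> (fst (fst p)) (fst (snd (fst p))) (snd p)) \<in> borel_measurable (?M \<Otimes>\<^sub>M torus_lebesgue)"
  using measurable_compose[OF measurable_Pair[OF measurable_compose[OF measurable_fst measurable_fst]
    measurable_Pair[OF measurable_compose[OF measurable_compose[OF measurable_fst measurable_snd] measurable_fst] y]] X]
  by simp
 have "(\<lambda>(m, y). \<Xi> (fst m) (fst (snd m)) y *\<^sub>R K (snd (snd m) - y)) \<in> borel_measurable (?M \<Otimes>\<^sub>M torus_lebesgue)"
  using borel_measurable_scaleR[OF 1 measurable_compose[OF borel_measurable_torus_diff[OF xm y] K_meas]]
  by (simp add: case_prod_beta')
 from torus.borel_measurable_lebesgue_integral[OF this]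
 show ?thesis unfolding velocity_def biot_savart_def K[symmetric] by (simp add: case_prod_beta')
qed

lemma vorticity_AE:
 assumes sol: "generalized_solution P P' T \<Xi>0 q \<phi> \<Xi>" and t: "t \<in> {0..T}"
 shows "AE w in P. AE x in torus_lebesgue. \<Xi> w t x = transported_vorticity P' \<Xi>0 q \<phi> w t x"
proof -
 interpret PT: pair_sigma_finite P torus_lebesgue ..
 have "AE p in P \<Otimes>\<^sub>M torus_lebesgue. \<Xi> (fst p) t (snd p) = transported_vorticity P' \<Xi>0 q \<phi> (fst p) t (snd p)"
  using sol t by (simp add: generalized_solution_def case_prod_beta')
 from PT.AE_pair[OF this] show ?thesis by simp
qed

lemma velocity_modification:
 assumes K: "K = biot_savart_kernel G" and sol: "generalized_solution P P' T \<Xi>0 q \<phi> \<Xi>"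
  and g: "AE w in P. good w" and t: "t \<in> {0..T}"
 shows "AE w in P. \<forall>x. velocity G \<Xi> w t x = V w t x"
 using vorticity_AE[OF sol t] g by eventually_elim (use velocity_eq_V[OF K sol _ t] in blast)

text \<open>The vorticity identity holds at each time off a null set that depends on the time,
  whereas characteristics need, for almost every \<open>\<omega>\<close>, almost every time. Fubini
  makes the exchange but requires a measurable event.\<close>

lemma velocity_AE_time:
 assumes K: "K = biot_savart_kernel G" and sol: "generalized_solution P P' T \<Xi>0 q \<phi> \<Xi>"
  and g: "AE w in P. good w"
 shows "AE w in P. AE s in time_lebesgue T. \<forall>x. velocity G \<Xi> w s x = V w s x"
proof -
 interpret PL: pair_sigma_finite P "time_lebesgue T" ..
 obtain E :: "torus set" where E: "countable E" "\<And>x e. x \<in> UNIV ==> e > 0 ==> \<exists>d\<in>E. dist x d < e"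
  using countable_dense_subset[of "UNIV :: torus set"] by metis
 let ?M = "P \<Otimes>\<^sub>M time_lebesgue T"
 \<comment> \<open>Equality at all x is replaced by equality on the countable set E and a bound on
   the vorticity. Both are measurable conditions, and the bound makes the velocity continuous, which
   recovers all x.\<close>
 let ?Q = "\<lambda>w s. Linf_norm (\<Xi> w s) \<le> ennreal Mt \<and> (\<forall>x\<in>E. velocity G \<Xi> w s x = V w s x)"
 have X: "(\<lambda>(w, t, x). \<Xi> w t x) \<in> borel_measurable (P \<Otimes>\<^sub>M time_space T \<Otimes>\<^sub>M borel)" using sol by (simp add: generalized_solution_def)
 have Xm: "(\<lambda>(m, x). \<Xi> (fst m) (snd m) x) \<in> borel_measurable (?M \<Otimes>\<^sub>M borel)"
  using measurable_compose[OF measurable_Pair[OF measurable_compose[OF measurable_fst measurable_fst]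
    measurable_Pair[OF measurable_compose[OF measurable_fst snd_time] measurable_snd]] X]
  by (simp add: case_prod_beta')
 have Lm: "(\<lambda>m. Linf_norm (\<Xi> (fst m) (snd m))) \<in> borel_measurable ?M" by (rule Linf_norm_measurable[OF Xm])
 have vm: "(\<lambda>m. velocity G \<Xi> (fst m) (snd m) x) \<in> borel_measurable ?M" for x
  using measurable_compose[OF measurable_Pair[OF measurable_fst measurable_Pair[OF snd_time borel_measurable_const]] velocity_measurable[OF K sol]]
  by simp
 have Vm: "(\<lambda>m. V (fst m) (snd m) x) \<in> borel_measurable ?M" for x
  by (rule V_comp[OF measurable_fst snd_time]) simp
 have "{m \<in> space ?M. velocity G \<Xi> (fst m) (snd m) x = V (fst m) (snd m) x} \<in> sets ?M" for x
  using vm[of x] Vm[of x] by measurable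
 then have "{m \<in> space ?M. \<forall>x\<in>E. velocity G \<Xi> (fst m) (snd m) x = V (fst m) (snd m) x} \<in> sets ?M"
  by (intro sets.sets_Collect_countable_All' E(1))
 moreover have "{m \<in> space ?M. Linf_norm (\<Xi> (fst m) (snd m)) \<le> ennreal Mt} \<in> sets ?M" using Lm by measurable
 ultimately have Qm: "{m \<in> space ?M. ?Q (fst m) (snd m)} \<in> sets ?M" by (rule sets.sets_Collect_conj)
 have "AE s in time_lebesgue T. AE w in P. ?Q w s"
 proof (rule AE_I2)
  fix s assume "s \<in> space (time_lebesgue T)"
  then have s: "s \<in> {0..T}" by (simp add: space_restrict_space)
  show "AE w in P. ?Q w s"
   using vorticity_AE[OF sol s] g
  proof eventually_elim
   case (elim w)
   have "AE x in torus_lebesgue. ennreal \<bar>\<Xi> w s x\<bar> \<le> ennreal Mt"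
    using elim(1) transported_bound[OF elim(2) s] by eventually_elim (simp add: ennreal_leI)
   then show ?case
    using velocity_eq_V[OF K sol elim(2) s elim(1)] vorticity_section[OF sol good_space[OF elim(2)] s]
    by (simp add: Linf_norm_le_iff)
  qed
 qed
 then have "AE w in P. AE s in time_lebesgue T. ?Q w s"
  using PL.AE_commute[of ?Q] Qm by simp
 then show ?thesis using g
 proof eventually_elim
  case w: (elim w)
  show ?case using w(1) AE_space
  proof eventually_elim
   case (elim s)
   have s: "s \<in> {0..T}" using elim(2) by (simp add: space_restrict_space)
   note sec = vorticity_section[OF sol good_space[OF w(2)] s]
   have "AE y in torus_lebesgue. \<bar>\<Xi> w s y\<bar> \<le> Mt"
    using elim(1) Mt_nonneg by (simp add: Linf_norm_le_iff[OF sec] ennreal_le_iff)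
   from convolution_continuous[OF sec Mt_nonneg this]
   have c1: "continuous_on UNIV (velocity G \<Xi> w s)"
    by (simp add: velocity_def[abs_def] biot_savart_def[abs_def] K)
   have c: "continuous_on UNIV (\<lambda>x. velocity G \<Xi> w s x - V w s x)"
    by (intro continuous_on_diff c1 V_continuous_space[OF w(2) s])
   show ?case
   proof
    fix x
    have "x \<in> closure E" unfolding closure_approachable using E(2)[of x] by (auto simp: dist_commute)
    moreover have "closure E \<subseteq> {x. velocity G \<Xi> w s x - V w s x = 0}"
    proof (rule closure_minimal[OF _ closed_Collect_eq[OF c continuous_on_const]])
     show "E \<subseteq> {x. velocity G \<Xi> w s x - V w s x = 0}" using elim(1) by auto
    qed
    ultimately show "velocity G \<Xi> w s x = V w s x" by auto
   qed
  qed
 qed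
qed

lemma V_along_flow_measurable:
 assumes "w \<in> space P" "w' \<in> space P'"
 shows "(\<lambda>s. V w s (\<phi> w w' s x)) \<in> borel_measurable (time_space T)"
 by (intro V_comp phi_comp measurable_const assms measurable_ident_sets[OF HOL.refl]) simp

text \<open>\<open>Nc\<close> is an input so that further null sets can be absorbed while the
  modification stays progressive.\<close>

lemma exceptional_sets:
 assumes F: "filtered_prob_space P F T" and null: "null_sets P \<subseteq> sets (F 0)"
  and flow: "stochastic_flow P F P' T \<phi>"
  and Nc: "Nc \<in> null_sets P" "Nc' \<in> null_sets P'"
  and cont: "\<And>w w' x. w \<in> space P - Nc ==> w' \<in> space P' - Nc' ==> continuous_on {0..T} (\<lambda>t. \<phi> w w' t x)"
 obtains N where "N \<in> null_sets P" "Nc \<subseteq> N" "\<And>w. w \<in> space P - N ==> good w"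
  "progressive_field F T (\<lambda>w t x. if w \<in> N then 0 else V w t x)"
proof -
 obtain Nf Nf' where Nf: "Nf \<in> null_sets P" "Nf' \<in> null_sets P'"
  and mp: "\<forall>w\<in>space P - Nf. \<forall>w'\<in>space P' - Nf'. \<forall>t\<in>{0..T}. mp_homeo (\<phi> w w' t)"
  and prog: "\<forall>w'\<in>space P' - Nf'. \<forall>x. progressive F T (\<lambda>w t. \<phi> w w' t x)"
  using flow unfolding stochastic_flow_def by blast
 show thesis
 proof
  show N: "Nf \<union> Nc \<in> null_sets P" using Nf Nc by auto
  show "Nc \<subseteq> Nf \<union> Nc" by blast
  have N': "Nf' \<union> Nc' \<in> null_sets P'" using Nf Nc by auto
  show "good w" if "w \<in> space P - (Nf \<union> Nc)" for w
  proof -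
   have "AE w' in P'. \<forall>t\<in>{0..T}. mp_homeo (\<phi> w w' t)"
    using AE_not_in[OF Nf(2)] AE_space by eventually_elim (use mp that in blast)
   then show ?thesis using that by (simp add: good_def)
  qed
  show "progressive_field F T (\<lambda>w t x. if w \<in> Nf \<union> Nc then 0 else V w t x)"
   by (rule V_progressive[OF F null N N']) (use mp prog cont in blast)+
 qed
qed

end

lemma (in flow_data) V_log_lipschitz:
 assumes "good w" "t \<in> {0..T}" "Mt * Bk \<le> B" "Mt * Ck \<le> B"
 shows "log_lipschitz_bounded B (V w t)"
 unfolding log_lipschitz_bounded_def
proof (intro conjI allI)
 show "norm (V w t x) \<le> B" for x using V_bound[OF assms(1,2), of x] assms(3) by linarith
 show "norm (V w t x - V w t y) \<le> B * log_modulus (dist x y)" for x y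
  using V_modulus[OF assms(1,2), of x y] mult_right_mono[OF assms(4) log_modulus_nonneg[of "dist x y"]]
  by (simp add: mult.assoc)
qed

section \<open>Families of flows indexed by \<epsilon>\<close>

locale velocity_family = flow_data K Ck P P' T M0 M1 \<Xi>0 q \<phi>
 for K Ck and P :: "'w measure" and P' :: "'v measure" and T M0 M1 \<Xi>0 q \<phi> +
 fixes qe :: "real => real => torus => real" and \<phi>e :: "real => ('w, 'v) torus_flow" and C :: real
 assumes fam: "\<epsilon> > 0 ==> flow_pair K Ck P P' T M0 M1 \<Xi>0 q \<phi> (qe \<epsilon>) (\<phi>e \<epsilon>) C"
  and conv: "((\<lambda>\<epsilon>. \<integral>\<^sup>+s. Linf_norm (\<lambda>x. qe \<epsilon> s x - q s x) \<partial>time_lebesgue T) \<longlongrightarrow> 0) (at_right 0)"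
begin

abbreviation "Ve \<epsilon> \<equiv> flow_data.V K P' T \<Xi>0 (qe \<epsilon>) (\<phi>e \<epsilon>)"
abbreviation "good_e \<epsilon> \<equiv> flow_data.good P P' T (\<phi>e \<epsilon>)"

lemma fam_data: "\<epsilon> > 0 ==> flow_data K Ck P P' T M0 M1 \<Xi>0 (qe \<epsilon>) (\<phi>e \<epsilon>)"
 using fam[of \<epsilon>] by (simp add: flow_pair_def)

text \<open>Convergence to 0 gives finiteness for small \<epsilon> only; the uniform bounds on the
  sources give it for every \<epsilon>.\<close>

lemma qdiff_finite:
 assumes e: "\<epsilon> > 0"
 shows "(\<integral>\<^sup>+s. Linf_norm (\<lambda>x. qe \<epsilon> s x - q s x) \<partial>time_lebesgue T) < \<infinity>"
proof -
 interpret e: flow_data K Ck P P' T M0 M1 \<Xi>0 "qe \<epsilon>" "\<phi>e \<epsilon>" by (rule fam_data[OF e])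
 have L: "(\<lambda>s. Linf_norm (q s)) \<in> borel_measurable (time_lebesgue T)" "(\<lambda>s. Linf_norm (qe \<epsilon> s)) \<in> borel_measurable (time_lebesgue T)"
  using Linf_norm_measurable[OF q_meas] Linf_norm_measurable[OF e.q_meas]
  by (simp_all cong: measurable_cong_sets add: sets_time_lebesgue)
 have "(\<integral>\<^sup>+s. Linf_norm (\<lambda>x. qe \<epsilon> s x - q s x) \<partial>time_lebesgue T) \<le> (\<integral>\<^sup>+s. Linf_norm (qe \<epsilon> s) + Linf_norm (q s) \<partial>time_lebesgue T)"
  by (rule nn_integral_mono) (rule Linf_norm_diff; simp add: space_restrict_space q_section e.q_section)
 also have "\<dots> = (\<integral>\<^sup>+s. Linf_norm (qe \<epsilon> s) \<partial>time_lebesgue T) + (\<integral>\<^sup>+s. Linf_norm (q s) \<partial>time_lebesgue T)"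
  by (rule nn_integral_add[OF L(2,1)])
 also have "\<dots> \<le> ennreal M1 + ennreal M1" by (rule add_mono[OF e.q_bound q_bound])
 also have "\<dots> < \<infinity>" by simp
 finally show ?thesis .
qed

text \<open>For each \<epsilon> and \<open>\<omega>\<close> either the velocity coincides with the
  limit, which inherits all bounds with zero difference, or it is the Lagrangian velocity of a good
  flow. This alternative is what permits one N for all \<epsilon>.\<close>

lemma properties:
 assumes N: "N \<in> null_sets P" and good: "\<And>w. w \<in> space P - N ==> good w"
  and u: "\<And>w t. w \<in> space P - N ==> t \<in> {0..T} ==> u w t = V w t"
  and ue: "\<And>\<epsilon> w. \<epsilon> > 0 ==> w \<in> space P - N ==>
   (\<forall>t\<in>{0..T}. ue \<epsilon> w t = u w t) \<or> good_e \<epsilon> w \<and> (\<forall>t\<in>{0..T}. ue \<epsilon> w t = Ve \<epsilon> w t)"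
  and prog: "progressive_field F T u" "\<And>\<epsilon>. \<epsilon> > 0 ==> progressive_field F T (ue \<epsilon>)"
 shows "velocity_properties P F P' T \<phi>e \<phi> ue u"
 unfolding velocity_properties_def
proof (intro conjI)
 show "\<forall>\<epsilon>>0. progressive_field F T (ue \<epsilon>)" "progressive_field F T u" using prog by auto
 define B where "B = max (Mt * Bk) (Mt * Ck)"
 have B: "Mt * Bk \<le> B" "Mt * Ck \<le> B" by (simp_all add: B_def)
 show "\<exists>C. \<exists>N\<in>null_sets P. \<forall>w\<in>space P - N. \<forall>\<epsilon>>0. \<forall>t\<in>{0..T}.
    div_free (ue \<epsilon> w t) \<and> div_free (u w t) \<and>
    log_lipschitz_bounded C (ue \<epsilon> w t) \<and> log_lipschitz_bounded C (u w t)"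
 proof (intro exI[of _ B] bexI[OF _ N] ballI allI impI)
  fix w \<epsilon> t assume w: "w \<in> space P - N" and e: "\<epsilon> > (0 :: real)" and t: "t \<in> {0..T}"
  interpret e: flow_data K Ck P P' T M0 M1 \<Xi>0 "qe \<epsilon>" "\<phi>e \<epsilon>" by (rule fam_data[OF e])
  have uw: "div_free (u w t)" "log_lipschitz_bounded B (u w t)"
   using V_div_free[OF good[OF w] t] V_log_lipschitz[OF good[OF w] t B] by (simp_all add: u[OF w t])
  have "div_free (ue \<epsilon> w t) \<and> log_lipschitz_bounded B (ue \<epsilon> w t)"
   using ue[OF e w]
  proof
   assume "\<forall>t\<in>{0..T}. ue \<epsilon> w t = u w t"
   then show ?thesis using uw t by simp
  next
   assume a: "good_e \<epsilon> w \<and> (\<forall>t\<in>{0..T}. ue \<epsilon> w t = Ve \<epsilon> w t)"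
   then have "ue \<epsilon> w t = Ve \<epsilon> w t" using t by blast
   then show ?thesis using a e.V_div_free[of w t] e.V_log_lipschitz[of w t B] B t by simp
  qed
  then show "div_free (ue \<epsilon> w t) \<and> div_free (u w t) \<and>
    log_lipschitz_bounded B (ue \<epsilon> w t) \<and> log_lipschitz_bounded B (u w t)" using uw by blast
 qed
 \<comment> \<open>A single constant has to multiply both the modulus at time t and its time
   integral.\<close>
 define L where "L = max (Mt * Ck * (4 * pi\<^sup>2)) (Bk * (\<bar>C\<bar> * (4 * pi\<^sup>2)))"
 have L: "Mt * Ck * (4 * pi\<^sup>2) \<le> L" "Bk * (\<bar>C\<bar> * (4 * pi\<^sup>2)) \<le> L" by (simp_all add: L_def)
 have "0 \<le> Mt * Ck * (4 * pi\<^sup>2)" using Mt_nonneg Ck by simp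
 then have L0: "L \<ge> 0" using L(1) by linarith
 \<comment> \<open>The error is the distance of the sources up to a constant, so it depends neither
   on \<open>\<omega>\<close> nor on t.\<close>
 define c where "c \<epsilon> = Bk * (4 * pi\<^sup>2) * enn2real (\<integral>\<^sup>+s. Linf_norm (\<lambda>x. qe \<epsilon> s x - q s x) \<partial>time_lebesgue T)" for \<epsilon>
 have c0: "c \<epsilon> \<ge> 0" for \<epsilon> using Bk_nonneg by (simp add: c_def)
 have "((\<lambda>\<epsilon>. enn2real (\<integral>\<^sup>+s. Linf_norm (\<lambda>x. qe \<epsilon> s x - q s x) \<partial>time_lebesgue T)) \<longlongrightarrow> 0) (at_right 0)"
  by (rule tendsto_enn2real) (use conv in simp_all)
 then have c: "(c \<longlongrightarrow> 0) (at_right 0)"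
  unfolding c_def[abs_def] by (rule tendsto_mult_right_zero)
 show "\<exists>C. \<exists>N\<in>null_sets P. \<exists>c :: real => real. (c \<longlongrightarrow> 0) (at_right 0) \<and>
    (\<forall>w\<in>space P - N. \<forall>\<epsilon>>0. \<forall>t\<in>{0..T}.
     (\<integral>x. norm (ue \<epsilon> w t x - u w t x) \<partial>torus_lebesgue)
      \<le> C * log_modulus (mean_flow_distance P' (\<phi>e \<epsilon>) \<phi> w t)
       + C * (LBINT s:{0..t}. log_modulus (mean_flow_distance P' (\<phi>e \<epsilon>) \<phi> w s))
       + c \<epsilon>)"
 proof (intro exI[of _ L] bexI[OF _ N] exI[of _ c] conjI c ballI allI impI)
  fix w \<epsilon> t assume w: "w \<in> space P - N" and e: "\<epsilon> > (0 :: real)" and t: "t \<in> {0..T}"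
  interpret e: flow_pair K Ck P P' T M0 M1 \<Xi>0 q \<phi> "qe \<epsilon>" "\<phi>e \<epsilon>" C by (rule fam[OF e])
  let ?m = "mean_flow_distance P' (\<phi>e \<epsilon>) \<phi> w"
  have I0: "e.I w t \<ge> 0" by (rule e.I_eq(2)) (use w t in auto)
  have I: "e.I w t = (LBINT s:{0..t}. log_modulus (?m s))" by (rule e.I_def)
  have m0: "log_modulus (?m t) \<ge> 0" by (rule log_modulus_nonneg)
  show "(\<integral>x. norm (ue \<epsilon> w t x - u w t x) \<partial>torus_lebesgue)
    \<le> L * log_modulus (?m t) + L * (LBINT s:{0..t}. log_modulus (?m s)) + c \<epsilon>"
   using ue[OF e w]
  proof
   assume "\<forall>t\<in>{0..T}. ue \<epsilon> w t = u w t"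
   then have "ue \<epsilon> w t = u w t" using t by blast
   moreover have "0 \<le> L * log_modulus (?m t) + L * e.I w t + c \<epsilon>" using L0 m0 I0 c0[of \<epsilon>] by simp
   ultimately show ?thesis by (simp add: I)
  next
   assume a: "good_e \<epsilon> w \<and> (\<forall>t\<in>{0..T}. ue \<epsilon> w t = Ve \<epsilon> w t)"
   then have eq: "ue \<epsilon> w t = Ve \<epsilon> w t" using t by blast
   have "(\<integral>x. norm (Ve \<epsilon> w t x - V w t x) \<partial>torus_lebesgue)
     \<le> Mt * Ck * (4 * pi\<^sup>2) * log_modulus (?m t) + Bk * (\<bar>C\<bar> * (4 * pi\<^sup>2)) * e.I w t + c \<epsilon>"
    unfolding c_def e.qdiff_def[symmetric]
    by (rule e.V_difference[OF good[OF w] _ t]) (use a qdiff_finite[OF e] in \<open>simp_all add: e.qdiff_def\<close>)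
   then show ?thesis
    unfolding eq u[OF w t] I[symmetric]
    using mult_right_mono[OF L(1) m0] mult_right_mono[OF L(2) I0] by linarith
  qed
 qed
qed

end

section \<open>Characteristics: continuity in time and change of drift\<close>

text \<open>Continuity of paths is read off the equation: drift integrals are continuous in their
  end point, and the noise is continuous for almost every auxiliary point.\<close>

lemma random_characteristics_continuous:
 assumes ch: "random_characteristics P P' T v u z \<phi>" and z: "AE w' in P'. continuous_on {0..T} (z w')"
 obtains N N' where "N \<in> null_sets P" "N' \<in> null_sets P'"
  "\<And>w w' x. w \<in> space P - N ==> w' \<in> space P' - N' ==> continuous_on {0..T} (\<lambda>t. \<phi> w w' t x)"
proof -
 obtain N N' where N: "N \<in> null_sets P" "N' \<in> null_sets P'" and eq: "\<forall>w\<in>space P - N. \<forall>w'\<in>space P' - N'. \<forall>x.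
   set_integrable lborel {0..T} (\<lambda>s. v w s (\<phi> w w' s x)) \<and>
   set_integrable lborel {0..T} (\<lambda>s. u w s (\<phi> w w' s x)) \<and>
   (\<forall>t\<in>{0..T}. \<phi> w w' t x = x + to_torus
     ((LBINT s:{0..t}. v w s (\<phi> w w' s x)) + (LBINT s:{0..t}. u w s (\<phi> w w' s x)) + z w' t))"
  using ch unfolding random_characteristics_def by blast
 obtain N'' where N'': "N'' \<in> null_sets P'" "{w' \<in> space P'. \<not> continuous_on {0..T} (z w')} \<subseteq> N''"
  using z unfolding eventually_ae_filter by blast
 show thesis
 proof
  show "N \<in> null_sets P" "N' \<union> N'' \<in> null_sets P'" using N N'' by auto
  fix w w' x assume w: "w \<in> space P - N" "w' \<in> space P' - (N' \<union> N'')"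
  then have e: "set_integrable lborel {0..T} (\<lambda>s. v w s (\<phi> w w' s x))"
   "set_integrable lborel {0..T} (\<lambda>s. u w s (\<phi> w w' s x))"
   "\<And>t. t \<in> {0..T} ==> \<phi> w w' t x = x + to_torus
     ((LBINT s:{0..t}. v w s (\<phi> w w' s x)) + (LBINT s:{0..t}. u w s (\<phi> w w' s x)) + z w' t)"
   using eq by blast+
  have zc: "continuous_on {0..T} (z w')" using w N'' by blast
  have "continuous_on {0..T} (\<lambda>t. x + to_torus
     ((LBINT s:{0..t}. v w s (\<phi> w w' s x)) + (LBINT s:{0..t}. u w s (\<phi> w w' s x)) + z w' t))"
   by (intro continuous_on_add continuous_on_const continuous_on_compose2[OF continuous_on_to_torus] time_integral_continuous e zc) auto
  then show "continuous_on {0..T} (\<lambda>t. \<phi> w w' t x)" by (rule continuous_on_eq) (simp add: e(3))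
 qed
qed

lemma stratonovich_characteristics_continuous:
 assumes ch: "stratonovich_characteristics P F P' T W v \<sigma> z \<phi>" and z: "AE w' in P'. continuous_on {0..T} (z w')"
 obtains N N' where "N \<in> null_sets P" "N' \<in> null_sets P'"
  "\<And>w w' x. w \<in> space P - N ==> w' \<in> space P' - N' ==> continuous_on {0..T} (\<lambda>t. \<phi> w w' t x)"
proof -
 obtain N N' S where N: "N \<in> null_sets P" "N' \<in> null_sets P'" and eq: "\<forall>w\<in>space P - N. \<forall>w'\<in>space P' - N'. \<forall>x.
   continuous_on {0..T} (\<lambda>t. S w w' t x) \<and>
   set_integrable lborel {0..T} (\<lambda>s. v w s (\<phi> w w' s x)) \<and>
   (\<forall>t\<in>{0..T}. \<phi> w w' t x = x + to_torus ((LBINT s:{0..t}. v w s (\<phi> w w' s x)) + S w w' t x + z w' t))"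
  using ch unfolding stratonovich_characteristics_def by blast
 obtain N'' where N'': "N'' \<in> null_sets P'" "{w' \<in> space P'. \<not> continuous_on {0..T} (z w')} \<subseteq> N''"
  using z unfolding eventually_ae_filter by blast
 show thesis
 proof
  show "N \<in> null_sets P" "N' \<union> N'' \<in> null_sets P'" using N N'' by auto
  fix w w' x assume w: "w \<in> space P - N" "w' \<in> space P' - (N' \<union> N'')"
  then have e: "continuous_on {0..T} (\<lambda>t. S w w' t x)"
   "set_integrable lborel {0..T} (\<lambda>s. v w s (\<phi> w w' s x))"
   "\<And>t. t \<in> {0..T} ==> \<phi> w w' t x = x + to_torus ((LBINT s:{0..t}. v w s (\<phi> w w' s x)) + S w w' t x + z w' t)"
   using eq by blast+
  have zc: "continuous_on {0..T} (z w')" using w N'' by blast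
  have "continuous_on {0..T} (\<lambda>t. x + to_torus ((LBINT s:{0..t}. v w s (\<phi> w w' s x)) + S w w' t x + z w' t))"
   by (intro continuous_on_add continuous_on_const continuous_on_compose2[OF continuous_on_to_torus] time_integral_continuous e zc) auto
  then show "continuous_on {0..T} (\<lambda>t. \<phi> w w' t x)" by (rule continuous_on_eq) (simp add: e(3))
 qed
qed

text \<open>The drift enters through time integrals along the flow, so a change on a null set of
  times is invisible. Hence the modified velocities still drive the same flow.\<close>

lemma random_characteristics_cong:
 assumes ch: "random_characteristics P P' T v u z \<phi>" and N0: "N0 \<in> null_sets P"
  and ae: "\<And>w. w \<in> space P - N0 ==> AE s in time_lebesgue T. \<forall>x. v w s x = v' w s x"
  and m: "\<And>w w' x. w \<in> space P - N0 ==> w' \<in> space P' ==> (\<lambda>s. v' w s (\<phi> w w' s x)) \<in> borel_measurable (time_space T)"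
 shows "random_characteristics P P' T v' u z \<phi>"
proof -
 obtain N N' where N: "N \<in> null_sets P" "N' \<in> null_sets P'" and eq: "\<forall>w\<in>space P - N. \<forall>w'\<in>space P' - N'. \<forall>x.
   set_integrable lborel {0..T} (\<lambda>s. v w s (\<phi> w w' s x)) \<and>
   set_integrable lborel {0..T} (\<lambda>s. u w s (\<phi> w w' s x)) \<and>
   (\<forall>t\<in>{0..T}. \<phi> w w' t x = x + to_torus
     ((LBINT s:{0..t}. v w s (\<phi> w w' s x)) + (LBINT s:{0..t}. u w s (\<phi> w w' s x)) + z w' t))"
  using ch unfolding random_characteristics_def by blast
 show ?thesis
  unfolding random_characteristics_def
 proof (intro bexI[of _ "N \<union> N0"] bexI[OF _ N(2)] ballI allI)
  show "N \<union> N0 \<in> null_sets P" using N N0 by auto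
  fix w w' x assume w: "w \<in> space P - (N \<union> N0)" and w': "w' \<in> space P' - N'"
  have e: "set_integrable lborel {0..T} (\<lambda>s. v w s (\<phi> w w' s x))"
   "set_integrable lborel {0..T} (\<lambda>s. u w s (\<phi> w w' s x))"
   "\<And>t. t \<in> {0..T} ==> \<phi> w w' t x = x + to_torus
     ((LBINT s:{0..t}. v w s (\<phi> w w' s x)) + (LBINT s:{0..t}. u w s (\<phi> w w' s x)) + z w' t)"
   using eq w w' by blast+
  have ae': "AE s in time_lebesgue T. v w s (\<phi> w w' s x) = v' w s (\<phi> w w' s x)"
   using ae[of w] w by (auto elim: eventually_mono)
  have m': "(\<lambda>s. v' w s (\<phi> w w' s x)) \<in> borel_measurable (time_space T)" using m w w' by blast
  note c = set_integral_time_cong[OF ae' e(1) m']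
  show "set_integrable lborel {0..T} (\<lambda>s. v' w s (\<phi> w w' s x)) \<and>
   set_integrable lborel {0..T} (\<lambda>s. u w s (\<phi> w w' s x)) \<and>
   (\<forall>t\<in>{0..T}. \<phi> w w' t x = x + to_torus
     ((LBINT s:{0..t}. v' w s (\<phi> w w' s x)) + (LBINT s:{0..t}. u w s (\<phi> w w' s x)) + z w' t))"
   using c(1) e(2) by (intro conjI ballI) (simp_all only: c(2) e(3)[symmetric])
 qed
qed

lemma stratonovich_characteristics_cong:
 assumes ch: "stratonovich_characteristics P F P' T W v \<sigma> z \<phi>" and N0: "N0 \<in> null_sets P"
  and ae: "\<And>w. w \<in> space P - N0 ==> AE s in time_lebesgue T. \<forall>x. v w s x = v' w s x"
  and m: "\<And>w w' x. w \<in> space P - N0 ==> w' \<in> space P' ==> (\<lambda>s. v' w s (\<phi> w w' s x)) \<in> borel_measurable (time_space T)"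
 shows "stratonovich_characteristics P F P' T W v' \<sigma> z \<phi>"
proof -
 obtain N N' S where N: "N \<in> null_sets P" "N' \<in> null_sets P'"
  and S: "\<forall>w'\<in>space P' - N'. \<forall>x. stratonovich_series P F T W (\<lambda>k w s. \<sigma> k (\<phi> w w' s x)) (\<lambda>w t. S w w' t x)"
  and eq: "\<forall>w\<in>space P - N. \<forall>w'\<in>space P' - N'. \<forall>x.
   continuous_on {0..T} (\<lambda>t. S w w' t x) \<and>
   set_integrable lborel {0..T} (\<lambda>s. v w s (\<phi> w w' s x)) \<and>
   (\<forall>t\<in>{0..T}. \<phi> w w' t x = x + to_torus ((LBINT s:{0..t}. v w s (\<phi> w w' s x)) + S w w' t x + z w' t))"
  using ch unfolding stratonovich_characteristics_def by blast
 show ?thesis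
  unfolding stratonovich_characteristics_def
 proof (intro bexI[of _ "N \<union> N0"] bexI[OF _ N(2)] exI[of _ S] conjI S)
  show "N \<union> N0 \<in> null_sets P" using N N0 by auto
  show "\<forall>w\<in>space P - (N \<union> N0). \<forall>w'\<in>space P' - N'. \<forall>x.
   continuous_on {0..T} (\<lambda>t. S w w' t x) \<and>
   set_integrable lborel {0..T} (\<lambda>s. v' w s (\<phi> w w' s x)) \<and>
   (\<forall>t\<in>{0..T}. \<phi> w w' t x = x + to_torus ((LBINT s:{0..t}. v' w s (\<phi> w w' s x)) + S w w' t x + z w' t))"
  proof (intro ballI allI)
   fix w w' x assume w: "w \<in> space P - (N \<union> N0)" and w': "w' \<in> space P' - N'"
   have e: "continuous_on {0..T} (\<lambda>t. S w w' t x)"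
    "set_integrable lborel {0..T} (\<lambda>s. v w s (\<phi> w w' s x))"
    "\<And>t. t \<in> {0..T} ==> \<phi> w w' t x = x + to_torus ((LBINT s:{0..t}. v w s (\<phi> w w' s x)) + S w w' t x + z w' t)"
    using eq w w' by blast+
   have ae': "AE s in time_lebesgue T. v w s (\<phi> w w' s x) = v' w s (\<phi> w w' s x)"
    using ae[of w] w by (auto elim: eventually_mono)
   have m': "(\<lambda>s. v' w s (\<phi> w w' s x)) \<in> borel_measurable (time_space T)" using m w w' by blast
   note c = set_integral_time_cong[OF ae' e(2) m']
   show "continuous_on {0..T} (\<lambda>t. S w w' t x) \<and>
    set_integrable lborel {0..T} (\<lambda>s. v' w s (\<phi> w w' s x)) \<and>
    (\<forall>t\<in>{0..T}. \<phi> w w' t x = x + to_torus ((LBINT s:{0..t}. v' w s (\<phi> w w' s x)) + S w w' t x + z w' t))"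
    using c(1) e(1) by (intro conjI ballI) (simp_all only: c(2) e(3)[symmetric])
  qed
 qed
qed

lemma (in flow_data) solution_exceptional_set:
 assumes K: "K = biot_savart_kernel G" and sol: "generalized_solution P P' T \<Xi>0 q \<phi> \<Xi>"
  and F: "filtered_prob_space P F T" and null: "null_sets P \<subseteq> sets (F 0)"
  and flow: "stochastic_flow P F P' T \<phi>"
  and Nc: "Nc \<in> null_sets P" "Nc' \<in> null_sets P'"
  and cont: "\<And>w w' x. w \<in> space P - Nc ==> w' \<in> space P' - Nc' ==> continuous_on {0..T} (\<lambda>t. \<phi> w w' t x)"
 obtains N where "N \<in> null_sets P" "\<And>w. w \<in> space P - N ==> good w"
  "progressive_field F T (\<lambda>w t x. if w \<in> N then 0 else V w t x)"
  "\<And>w. w \<in> space P - N ==> AE s in time_lebesgue T. \<forall>x. velocity G \<Xi> w s x = V w s x"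
proof -
 have AEg: "AE w in P. good w"
 proof (rule exceptional_sets[OF F null flow Nc cont])
  fix N assume N: "N \<in> null_sets P" "\<And>w. w \<in> space P - N ==> good w"
  show ?thesis using AE_not_in[OF N(1)] AE_space by eventually_elim (rule N(2), simp)
 qed
 obtain N2 where N2: "\<And>w. w \<in> space P - N2 ==> AE s in time_lebesgue T. \<forall>x. velocity G \<Xi> w s x = V w s x"
  "N2 \<in> null_sets P"
 proof (rule AE_E3[OF velocity_AE_time[OF K sol AEg]])
  fix N assume a: "\<And>w. w \<in> space P - N ==> AE s in time_lebesgue T. \<forall>x. velocity G \<Xi> w s x = V w s x" "N \<in> null_sets P"
  show thesis by (rule that[OF a(1) a(2)])
 qed
 \<comment> \<open>The set where the velocities disagree on too many times is fed back as part of
   the exceptional set, so that the final N contains it.\<close>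
 have Nc2: "Nc \<union> N2 \<in> null_sets P" using Nc N2 by auto
 show thesis
 proof (rule exceptional_sets[OF F null flow Nc2 Nc(2)])
  fix N assume N: "N \<in> null_sets P" "Nc \<union> N2 \<subseteq> N" "\<And>w. w \<in> space P - N ==> good w"
   "progressive_field F T (\<lambda>w t x. if w \<in> N then 0 else V w t x)"
  show thesis by (rule that[OF N(1,3,4) N2(1)]) (use N(2) in auto)
 qed (use cont in blast)
qed

theorem proposition6p1:
  fixes P :: "'w measure" and F :: "real \<Rightarrow> 'w measure" and W :: "nat \<Rightarrow> 'w \<Rightarrow> real \<Rightarrow> real"
    and P' :: "'v measure" and F' :: "real \<Rightarrow> 'v measure" and w :: "'v \<Rightarrow> real \<Rightarrow> real \<times> real"
    and T \<nu> :: real and l :: nat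
    and G :: "torus \<Rightarrow> real" and \<zeta> :: "nat \<Rightarrow> torus \<Rightarrow> real" and \<Xi>0 :: "torus \<Rightarrow> real"
    and qe :: "real \<Rightarrow> real \<Rightarrow> torus \<Rightarrow> real" and q :: "real \<Rightarrow> torus \<Rightarrow> real"
    and \<Xi>e \<xi>e :: "real \<Rightarrow> 'w \<Rightarrow> real \<Rightarrow> torus \<Rightarrow> real" and \<Xi> :: "'w \<Rightarrow> real \<Rightarrow> torus \<Rightarrow> real"
    and \<psi>e \<phi>e :: "real \<Rightarrow> ('w, 'v) torus_flow" and \<phi> :: "('w, 'v) torus_flow"
  assumes "T > 0" and "\<nu> \<ge> 0"
    and "filtered_prob_space P F T" and "null_sets P \<subseteq> sets (F 0)"
    and "wiener_family P F T W"
    and "filtered_prob_space P' F' T" and "wiener_process P' F' T w"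
    and "green_function G"
    and "\<Xi>0 \<in> Linf" and "zero_mean \<Xi>0"
    \<comment> \<open>(i), with the continuous representatives\<close>
    and "l \<ge> 1"
    and "\<And>k. \<zeta> k \<in> sobolev_inf l \<and> continuous_on UNIV (\<zeta> k) \<and> zero_mean (\<zeta> k)"
    and "(\<Sum>k. sobolev_inf_norm l (\<zeta> k)) < \<infinity>"
    \<comment> \<open>(ii), for suitable representatives of the weak gradients\<close>
    and "\<exists>d1 d2. (\<forall>k. d1 k \<in> Linf \<and> has_weak_deriv (\<zeta> k) 1 0 (d1 k) \<and>
                    d2 k \<in> Linf \<and> has_weak_deriv (\<zeta> k) 0 1 (d2 k)) \<and>
           (\<forall>x. (\<lambda>k. biot_savart G (\<zeta> k) x \<bullet> (d1 k x, d2 k x)) sums 0)"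
    \<comment> \<open>(iii)\<close>
    and "\<And>\<epsilon>. \<epsilon> > 0 \<Longrightarrow> (\<lambda>(t, x). qe \<epsilon> t x) \<in> borel_measurable (restrict_space borel {0..T} \<Otimes>\<^sub>M borel)"
    and "(\<lambda>(t, x). q t x) \<in> borel_measurable (restrict_space borel {0..T} \<Otimes>\<^sub>M borel)"
    and "\<exists>C :: real. (\<forall>\<epsilon>>0. (\<integral>\<^sup>+s\<in>{0..T}. Linf_norm (qe \<epsilon> s) \<partial>lborel) \<le> ennreal C) \<and>
           (\<integral>\<^sup>+s\<in>{0..T}. Linf_norm (q s) \<partial>lborel) \<le> ennreal C"
    \<comment> \<open>(iv)\<close>
    and "((\<lambda>\<epsilon>. \<integral>\<^sup>+s\<in>{0..T}. Linf_norm (\<lambda>x. qe \<epsilon> s x - q s x) \<partial>lborel) \<longlongrightarrow> 0) (at_right 0)"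
    \<comment> \<open>(v)\<close>
    and "\<exists>C. AE t\<in>{0..T} in lborel. AE (x, y) in torus_lebesgue \<Otimes>\<^sub>M torus_lebesgue.
           \<bar>q t x - q t y\<bar> \<le> C * log_modulus (dist x y)"
    \<comment> \<open>(vi)\<close>
    and "\<And>\<epsilon>. \<epsilon> > 0 \<Longrightarrow> AE t\<in>{0..T} in lborel. zero_mean (qe \<epsilon> t)"
    and "AE t\<in>{0..T} in lborel. zero_mean (q t)"
    \<comment> \<open>the given solutions\<close>
    and "\<And>\<epsilon>. \<epsilon> > 0 \<Longrightarrow>
           small_scale_solution P F P' T W G \<zeta> \<epsilon> (velocity G (\<Xi>e \<epsilon>)) (\<xi>e \<epsilon>) (\<psi>e \<epsilon>)"
    and "\<And>\<epsilon>. \<epsilon> > 0 \<Longrightarrow> stochastic_flow P F P' T (\<phi>e \<epsilon>) \<and>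
           random_characteristics P P' T (velocity G (\<Xi>e \<epsilon>)) (velocity G (\<xi>e \<epsilon>))
             (\<lambda>\<omega>' t. sqrt (2 * \<nu>) *\<^sub>R w \<omega>' t) (\<phi>e \<epsilon>) \<and>
           generalized_solution P P' T \<Xi>0 (qe \<epsilon>) (\<phi>e \<epsilon>) (\<Xi>e \<epsilon>)"
    and "stochastic_flow P F P' T \<phi> \<and>
         stratonovich_characteristics P F P' T W (velocity G \<Xi>) (\<lambda>k. biot_savart G (\<zeta> k))
           (\<lambda>\<omega>' t. sqrt (2 * \<nu>) *\<^sub>R w \<omega>' t) \<phi> \<and>
         generalized_solution P P' T \<Xi>0 q \<phi> \<Xi>"
  shows
    \<comment> \<open>\<open>v\<^sup>\<epsilon>\<close> and \<open>v\<close>, which the hypotheses determine at each time only almost surely, have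
      modifications with the asserted properties, still driving the same characteristics\<close>
    "(\<exists>ve v.
        (\<forall>\<epsilon>>0. modification P T (ve \<epsilon>) (velocity G (\<Xi>e \<epsilon>)) \<and>
           random_characteristics P P' T (ve \<epsilon>) (velocity G (\<xi>e \<epsilon>))
             (\<lambda>\<omega>' t. sqrt (2 * \<nu>) *\<^sub>R w \<omega>' t) (\<phi>e \<epsilon>)) \<and>
        modification P T v (velocity G \<Xi>) \<and>
        stratonovich_characteristics P F P' T W v (\<lambda>k. biot_savart G (\<zeta> k))
          (\<lambda>\<omega>' t. sqrt (2 * \<nu>) *\<^sub>R w \<omega>' t) \<phi> \<and>
        velocity_properties P F P' T \<phi>e \<phi> ve v) \<and>
    \<comment> \<open>no modification is needed if the exceptional null sets can be chosen uniformly\<close>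
     (common_null_set P P' T \<Xi>0 qe q \<phi>e \<phi> \<Xi>e \<Xi> \<longrightarrow>
        velocity_properties P F P' T \<phi>e \<phi> (\<lambda>\<epsilon>. velocity G (\<Xi>e \<epsilon>)) (velocity G \<Xi>))"
proof -
 note T = assms(1) and F = assms(3) and null = assms(4) and flows = assms(23) and flow = assms(24)
 have Pp: "prob_space P" "prob_space P'" using assms(3,6) by (auto simp: filtered_prob_space_def)
 let ?K = "biot_savart_kernel G"
 let ?z = "\<lambda>\<omega>' t. sqrt (2 * \<nu>) *\<^sub>R w \<omega>' t"
 obtain Ck where Ck: "log_kernel ?K Ck" using biot_savart_log_kernel[OF assms(8)] by blast
 have Xi0: "\<Xi>0 \<in> borel_measurable borel" "Linf_norm \<Xi>0 < \<infinity>" using assms(9) by (auto simp: Linf_def)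
 define M0 where "M0 = enn2real (Linf_norm \<Xi>0)"
 have M0: "Linf_norm \<Xi>0 = ennreal M0" "M0 \<ge> 0" using Xi0(2) by (simp_all add: M0_def)
 have Xi0_bound: "AE x in torus_lebesgue. \<bar>\<Xi>0 x\<bar> \<le> M0"
  using Linf_norm_AE[of \<Xi>0] unfolding M0(1) by eventually_elim (use M0(2) in simp)
 obtain C1 :: real where C1: "\<forall>\<epsilon>>0. (\<integral>\<^sup>+s\<in>{0..T}. Linf_norm (qe \<epsilon> s) \<partial>lborel) \<le> ennreal C1"
  "(\<integral>\<^sup>+s\<in>{0..T}. Linf_norm (q s) \<partial>lborel) \<le> ennreal C1" using assms(17) by blast
 \<comment> \<open>The constant of the hypothesis may be negative, where \<open>ennreal\<close>
   truncates it to 0; the locale asks for a nonnegative real.\<close>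
 define M1 where "M1 = max 0 C1"
 have C1M: "ennreal C1 \<le> ennreal M1" by (rule ennreal_leI) (simp add: M1_def)
 have q_bound: "(\<integral>\<^sup>+s. Linf_norm (q s) \<partial>time_lebesgue T) \<le> ennreal M1"
  using order_trans[OF C1(2) C1M] unfolding nn_integral_time_lebesgue .
 have qe_bound: "(\<integral>\<^sup>+s. Linf_norm (qe \<epsilon> s) \<partial>time_lebesgue T) \<le> ennreal M1" if "\<epsilon> > 0" for \<epsilon>
  using order_trans[OF C1(1)[rule_format, OF that] C1M] unfolding nn_integral_time_lebesgue .
 obtain C2 where C2: "AE t\<in>{0..T} in lborel. AE (x, y) in torus_lebesgue \<Otimes>\<^sub>M torus_lebesgue.
   \<bar>q t x - q t y\<bar> \<le> C2 * log_modulus (dist x y)" using assms(19) by blast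
 have flow_data: "flow_data ?K Ck P P' T M0 M1 \<Xi>0 q \<phi>"
  using flow assms(16) Pp T Xi0 Xi0_bound M0(2) q_bound
  by (intro flow_data.intro Ck flow_data_axioms.intro) (auto simp: stochastic_flow_def M1_def)
 have flow_data_e: "flow_data ?K Ck P P' T M0 M1 \<Xi>0 (qe \<epsilon>) (\<phi>e \<epsilon>)" if e: "\<epsilon> > 0" for \<epsilon>
  using flows[OF e] assms(15)[OF e] Pp T Xi0 Xi0_bound M0(2) qe_bound[OF e]
  by (intro flow_data.intro Ck flow_data_axioms.intro) (auto simp: stochastic_flow_def M1_def)
 interpret velocity_family ?K Ck P P' T M0 M1 \<Xi>0 q \<phi> qe \<phi>e C2
 proof (rule velocity_family.intro[OF flow_data velocity_family_axioms.intro])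
  show "flow_pair ?K Ck P P' T M0 M1 \<Xi>0 q \<phi> (qe \<epsilon>) (\<phi>e \<epsilon>) C2" if "\<epsilon> > 0" for \<epsilon>
   by (rule flow_pair.intro[OF flow_data flow_data_e[OF that] flow_pair_axioms.intro])
    (use C2 in \<open>simp only: AE_time_lebesgue\<close>)
  show "((\<lambda>\<epsilon>. \<integral>\<^sup>+s. Linf_norm (\<lambda>x. qe \<epsilon> s x - q s x) \<partial>time_lebesgue T) \<longlongrightarrow> 0) (at_right 0)"
   using assms(18) unfolding nn_integral_time_lebesgue .
 qed
 have z: "AE \<omega>' in P'. continuous_on {0..T} (?z \<omega>')"
 proof -
  have "AE \<omega>' in P'. w \<omega>' 0 = 0 \<and> continuous_on {0..T} (w \<omega>')" using assms(7) by (simp add: wiener_process_def)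
  then show ?thesis by eventually_elim (auto intro!: continuous_intros)
 qed
 have sol: "generalized_solution P P' T \<Xi>0 q \<phi> \<Xi>" and flow': "stochastic_flow P F P' T \<phi>"
  and char: "stratonovich_characteristics P F P' T W (velocity G \<Xi>) (\<lambda>k. biot_savart G (\<zeta> k)) ?z \<phi>"
  using flow by auto
 obtain N where N: "N \<in> null_sets P" "\<And>\<omega>. \<omega> \<in> space P - N ==> good \<omega>"
  "progressive_field F T (\<lambda>\<omega> t x. if \<omega> \<in> N then 0 else V \<omega> t x)"
  "\<And>\<omega>. \<omega> \<in> space P - N ==> AE s in time_lebesgue T. \<forall>x. velocity G \<Xi> \<omega> s x = V \<omega> s x"
 proof -
  obtain Nc Nc' where Nc: "Nc \<in> null_sets P" "Nc' \<in> null_sets P'"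
   "\<And>\<omega> \<omega>' x. \<omega> \<in> space P - Nc ==> \<omega>' \<in> space P' - Nc' ==> continuous_on {0..T} (\<lambda>t. \<phi> \<omega> \<omega>' t x)"
   using stratonovich_characteristics_continuous[OF char z] by blast
  show thesis by (rule solution_exceptional_set[OF HOL.refl sol F null flow' Nc that])
 qed
 define Q where "Q \<epsilon> N \<longleftrightarrow> N \<in> null_sets P \<and> (\<forall>\<omega>\<in>space P - N. good_e \<epsilon> \<omega>) \<and>
   progressive_field F T (\<lambda>\<omega> t x. if \<omega> \<in> N then 0 else Ve \<epsilon> \<omega> t x) \<and>
   (\<forall>\<omega>\<in>space P - N. AE s in time_lebesgue T. \<forall>x. velocity G (\<Xi>e \<epsilon>) \<omega> s x = Ve \<epsilon> \<omega> s x)" for \<epsilon> N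
 \<comment> \<open>One exceptional set is chosen for every \<epsilon>; its properties are available
   for positive \<epsilon>.\<close>
 define Ne where "Ne \<epsilon> = (SOME N. Q \<epsilon> N)" for \<epsilon>
 have Ex_Q: "\<exists>N. Q \<epsilon> N" if e: "\<epsilon> > 0" for \<epsilon>
 proof -
  interpret e: flow_data ?K Ck P P' T M0 M1 \<Xi>0 "qe \<epsilon>" "\<phi>e \<epsilon>" by (rule flow_data_e[OF e])
  have sol: "generalized_solution P P' T \<Xi>0 (qe \<epsilon>) (\<phi>e \<epsilon>) (\<Xi>e \<epsilon>)" and flow': "stochastic_flow P F P' T (\<phi>e \<epsilon>)"
   and char: "random_characteristics P P' T (velocity G (\<Xi>e \<epsilon>)) (velocity G (\<xi>e \<epsilon>)) ?z (\<phi>e \<epsilon>)"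
   using flows[OF e] by auto
  obtain Nc Nc' where Nc: "Nc \<in> null_sets P" "Nc' \<in> null_sets P'"
   "\<And>\<omega> \<omega>' x. \<omega> \<in> space P - Nc ==> \<omega>' \<in> space P' - Nc' ==> continuous_on {0..T} (\<lambda>t. \<phi>e \<epsilon> \<omega> \<omega>' t x)"
   using random_characteristics_continuous[OF char z] by blast
  show ?thesis
  proof (rule e.solution_exceptional_set[OF HOL.refl sol F null flow' Nc])
   fix N assume "N \<in> null_sets P" "\<And>\<omega>. \<omega> \<in> space P - N ==> good_e \<epsilon> \<omega>"
    "progressive_field F T (\<lambda>\<omega> t x. if \<omega> \<in> N then 0 else Ve \<epsilon> \<omega> t x)"
    "\<And>\<omega>. \<omega> \<in> space P - N ==> AE s in time_lebesgue T. \<forall>x. velocity G (\<Xi>e \<epsilon>) \<omega> s x = Ve \<epsilon> \<omega> s x"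
   note N = this
   show ?thesis unfolding Q_def by (intro exI[of _ N] conjI ballI N)
  qed
 qed
 have Ne': "Q \<epsilon> (Ne \<epsilon>)" if "\<epsilon> > 0" for \<epsilon>
  unfolding Ne_def by (rule someI_ex[OF Ex_Q[OF that]])
 have Ne: "Ne \<epsilon> \<in> null_sets P" "\<And>\<omega>. \<omega> \<in> space P - Ne \<epsilon> ==> good_e \<epsilon> \<omega>"
  "progressive_field F T (\<lambda>\<omega> t x. if \<omega> \<in> Ne \<epsilon> then 0 else Ve \<epsilon> \<omega> t x)"
  "\<And>\<omega>. \<omega> \<in> space P - Ne \<epsilon> ==> AE s in time_lebesgue T. \<forall>x. velocity G (\<Xi>e \<epsilon>) \<omega> s x = Ve \<epsilon> \<omega> s x"
  if "\<epsilon> > 0" for \<epsilon> using Ne'[OF that] unfolding Q_def by simp_all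
 have AE_good: "AE \<omega> in P. good \<omega>"
  using AE_not_in[OF N(1)] AE_space by eventually_elim (use N(2) in blast)
 have AE_good_e: "AE \<omega> in P. good_e \<epsilon> \<omega>" if "\<epsilon> > 0" for \<epsilon>
  using AE_not_in[OF Ne(1)[OF that]] AE_space by eventually_elim (use Ne(2)[OF that] in blast)
 define v where "v = (\<lambda>\<omega> t x. if \<omega> \<in> N then 0 else V \<omega> t x)"
 \<comment> \<open>On the exceptional set of \<epsilon> the limit velocity is substituted, which is
   progressive and obeys all bounds. The null set N of the limit thus serves every \<epsilon>,
   although the union of the sets \<open>Ne \<epsilon>\<close> need not be null.\<close>
 define ve where "ve \<epsilon> = (\<lambda>\<omega>. if \<omega> \<in> Ne \<epsilon> then v \<omega> else (\<lambda>t x. if \<omega> \<in> Ne \<epsilon> then 0 else Ve \<epsilon> \<omega> t x))" for \<epsilon>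
 have v_eq: "v \<omega> = V \<omega>" if "\<omega> \<in> space P - N" for \<omega> using that by (simp add: v_def)
 have ve_eq: "ve \<epsilon> \<omega> = Ve \<epsilon> \<omega>" if "\<omega> \<in> space P - Ne \<epsilon>" for \<omega> \<epsilon> using that by (simp add: ve_def)
 have prog_v: "progressive_field F T v" unfolding v_def by (rule N(3))
 have prog_ve: "progressive_field F T (ve \<epsilon>)" if e: "\<epsilon> > 0" for \<epsilon>
  unfolding ve_def by (rule progressive_field_if[OF F null T Ne(1)[OF e] prog_v Ne(3)[OF e]])
 have mod_v: "modification P T v (velocity G \<Xi>)"
  unfolding modification_def
 proof
  fix t assume t: "t \<in> {0..T}"
  show "AE \<omega> in P. \<forall>x. v \<omega> t x = velocity G \<Xi> \<omega> t x"
   using velocity_modification[OF HOL.refl sol AE_good t] AE_not_in[OF N(1)] AE_space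
   by eventually_elim (simp add: v_eq)
 qed
 have char_v: "stratonovich_characteristics P F P' T W v (\<lambda>k. biot_savart G (\<zeta> k)) ?z \<phi>"
  by (rule stratonovich_characteristics_cong[OF char N(1)])
   (use N(4) v_eq V_along_flow_measurable in auto)
 have mod_ve: "modification P T (ve \<epsilon>) (velocity G (\<Xi>e \<epsilon>)) \<and>
   random_characteristics P P' T (ve \<epsilon>) (velocity G (\<xi>e \<epsilon>)) ?z (\<phi>e \<epsilon>)" if e: "\<epsilon> > 0" for \<epsilon>
 proof
  interpret e: flow_data ?K Ck P P' T M0 M1 \<Xi>0 "qe \<epsilon>" "\<phi>e \<epsilon>" by (rule flow_data_e[OF e])
  have sol: "generalized_solution P P' T \<Xi>0 (qe \<epsilon>) (\<phi>e \<epsilon>) (\<Xi>e \<epsilon>)"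
   and char: "random_characteristics P P' T (velocity G (\<Xi>e \<epsilon>)) (velocity G (\<xi>e \<epsilon>)) ?z (\<phi>e \<epsilon>)"
   using flows[OF e] by auto
  show "modification P T (ve \<epsilon>) (velocity G (\<Xi>e \<epsilon>))"
   unfolding modification_def
  proof
   fix t assume t: "t \<in> {0..T}"
   show "AE \<omega> in P. \<forall>x. ve \<epsilon> \<omega> t x = velocity G (\<Xi>e \<epsilon>) \<omega> t x"
    using e.velocity_modification[OF HOL.refl sol AE_good_e[OF e] t] AE_not_in[OF Ne(1)[OF e]] AE_space
    by eventually_elim (simp add: ve_eq)
  qed
  show "random_characteristics P P' T (ve \<epsilon>) (velocity G (\<xi>e \<epsilon>)) ?z (\<phi>e \<epsilon>)"
   by (rule random_characteristics_cong[OF char Ne(1)[OF e]])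
    (use Ne(4)[OF e] ve_eq e.V_along_flow_measurable in auto)
 qed
 have "velocity_properties P F P' T \<phi>e \<phi> ve v"
 proof (rule properties[OF N(1,2)])
  fix \<epsilon> :: real and \<omega> assume e: "\<epsilon> > 0" and w: "\<omega> \<in> space P - N"
  show "(\<forall>t\<in>{0..T}. ve \<epsilon> \<omega> t = v \<omega> t) \<or> good_e \<epsilon> \<omega> \<and> (\<forall>t\<in>{0..T}. ve \<epsilon> \<omega> t = Ve \<epsilon> \<omega> t)"
   using Ne(2)[OF e, of \<omega>] w by (cases "\<omega> \<in> Ne \<epsilon>") (simp_all add: ve_def)
 qed (use v_eq prog_v prog_ve in auto)
 moreover have "velocity_properties P F P' T \<phi>e \<phi> (\<lambda>\<epsilon>. velocity G (\<Xi>e \<epsilon>)) (velocity G \<Xi>)"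
  if common: "common_null_set P P' T \<Xi>0 qe q \<phi>e \<phi> \<Xi>e \<Xi>"
 proof -
  obtain Nb where Nb: "Nb \<in> null_sets P"
   and cm: "(\<forall>\<epsilon>>0. \<exists>N'\<in>null_sets P'. \<forall>\<omega>\<in>space P - Nb. \<forall>\<omega>'\<in>space P' - N'. \<forall>t\<in>{0..T}. mp_homeo (\<phi>e \<epsilon> \<omega> \<omega>' t)) \<and>
    (\<forall>\<omega>\<in>space P - Nb. \<forall>t\<in>{0..T}.
     (\<forall>\<epsilon>>0. AE x in torus_lebesgue. \<Xi>e \<epsilon> \<omega> t x = transported_vorticity P' \<Xi>0 (qe \<epsilon>) (\<phi>e \<epsilon>) \<omega> t x) \<and>
     (AE x in torus_lebesgue. \<Xi> \<omega> t x = transported_vorticity P' \<Xi>0 q \<phi> \<omega> t x))"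
   using common unfolding common_null_set_def by (elim bexE)
  note mp = conjunct1[OF cm, rule_format]
  note Xe = conjunct1[OF bspec[OF bspec[OF conjunct2[OF cm]]], rule_format]
  note X = conjunct2[OF bspec[OF bspec[OF conjunct2[OF cm]]]]
  have gd: "good_e \<epsilon> \<omega>" if e: "\<epsilon> > 0" and w: "\<omega> \<in> space P - Nb" for \<epsilon> \<omega>
  proof -
   interpret e: flow_data ?K Ck P P' T M0 M1 \<Xi>0 "qe \<epsilon>" "\<phi>e \<epsilon>" by (rule flow_data_e[OF e])
   obtain N' where N': "N' \<in> null_sets P'" "\<forall>\<omega>\<in>space P - Nb. \<forall>\<omega>'\<in>space P' - N'. \<forall>t\<in>{0..T}. mp_homeo (\<phi>e \<epsilon> \<omega> \<omega>' t)"
    using mp[OF e] by blast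
   have "AE \<omega>' in P'. \<forall>t\<in>{0..T}. mp_homeo (\<phi>e \<epsilon> \<omega> \<omega>' t)"
    using AE_not_in[OF N'(1)] AE_space by eventually_elim (use N'(2) w in blast)
   then show ?thesis using w by (simp add: e.good_def)
  qed
  have eqe: "velocity G (\<Xi>e \<epsilon>) \<omega> t = Ve \<epsilon> \<omega> t" if e: "\<epsilon> > 0" and w: "\<omega> \<in> space P - Nb" and t: "t \<in> {0..T}" for \<epsilon> \<omega> t
  proof
   interpret e: flow_data ?K Ck P P' T M0 M1 \<Xi>0 "qe \<epsilon>" "\<phi>e \<epsilon>" by (rule flow_data_e[OF e])
   have sol: "generalized_solution P P' T \<Xi>0 (qe \<epsilon>) (\<phi>e \<epsilon>) (\<Xi>e \<epsilon>)" using flows[OF e] by simp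
   show "velocity G (\<Xi>e \<epsilon>) \<omega> t x = Ve \<epsilon> \<omega> t x" for x
    by (rule e.velocity_eq_V[OF HOL.refl sol gd[OF e w] t Xe[OF w t e]])
  qed
  \<comment> \<open>N is joined because the common null set controls the homeomorphisms of the
    \<epsilon>-flows; the limit flow is known to be good off N.\<close>
  have eq: "velocity G \<Xi> \<omega> t = V \<omega> t" if w: "\<omega> \<in> space P - (N \<union> Nb)" and t: "t \<in> {0..T}" for \<omega> t
  proof
   have w': "\<omega> \<in> space P - N" "\<omega> \<in> space P - Nb" using w by auto
   show "velocity G \<Xi> \<omega> t x = V \<omega> t x" for x
    by (rule velocity_eq_V[OF HOL.refl sol N(2)[OF w'(1)] t X[OF w'(2) t]])
  qed
  show ?thesis
  proof (rule properties)
   show NNb: "N \<union> Nb \<in> null_sets P" using N(1) Nb by auto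
   show "good \<omega>" if "\<omega> \<in> space P - (N \<union> Nb)" for \<omega> using N(2) that by blast
   show "velocity G \<Xi> \<omega> t = V \<omega> t" if "\<omega> \<in> space P - (N \<union> Nb)" "t \<in> {0..T}" for \<omega> t by (rule eq[OF that])
   show "(\<forall>t\<in>{0..T}. velocity G (\<Xi>e \<epsilon>) \<omega> t = velocity G \<Xi> \<omega> t) \<or>
     good_e \<epsilon> \<omega> \<and> (\<forall>t\<in>{0..T}. velocity G (\<Xi>e \<epsilon>) \<omega> t = Ve \<epsilon> \<omega> t)"
    if "\<epsilon> > 0" "\<omega> \<in> space P - (N \<union> Nb)" for \<epsilon> \<omega>
    using gd[OF that(1), of \<omega>] eqe[OF that(1), of \<omega>] that(2) by blast
   show "progressive_field F T (velocity G \<Xi>)"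
    by (rule progressive_field_cong_off[OF F null T NNb velocity_measurable[OF HOL.refl sol] N(3)])
     (use eq in auto)
   show "progressive_field F T (velocity G (\<Xi>e \<epsilon>))" if e: "\<epsilon> > 0" for \<epsilon>
   \<comment> \<open>Progressive measurability is asserted for each \<epsilon> separately, so here
     the exceptional set may depend on \<epsilon>.\<close>
   proof (rule progressive_field_cong_off[OF F null T _ _ Ne(3)[OF e]])
    interpret e: flow_data ?K Ck P P' T M0 M1 \<Xi>0 "qe \<epsilon>" "\<phi>e \<epsilon>" by (rule flow_data_e[OF e])
    show "Ne \<epsilon> \<union> Nb \<in> null_sets P" using Ne(1)[OF e] Nb by auto
    show "(\<lambda>(\<omega>, s, x). velocity G (\<Xi>e \<epsilon>) \<omega> s x) \<in> borel_measurable (P \<Otimes>\<^sub>M time_space T \<Otimes>\<^sub>M borel)"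
    proof (rule e.velocity_measurable[OF HOL.refl])
     show "generalized_solution P P' T \<Xi>0 (qe \<epsilon>) (\<phi>e \<epsilon>) (\<Xi>e \<epsilon>)" using flows[OF e] by simp
    qed
    show "velocity G (\<Xi>e \<epsilon>) \<omega> s x = (if \<omega> \<in> Ne \<epsilon> then 0 else Ve \<epsilon> \<omega> s x)"
     if "\<omega> \<in> space P - (Ne \<epsilon> \<union> Nb)" "s \<in> {0..T}" for \<omega> s x
     using eqe[OF e, of \<omega> s] that by simp
   qed
  qed
 qed
 ultimately show ?thesis using mod_v mod_ve char_v by blast
qed

end
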